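(* Let $0<\beta<1$ and $0<\gamma_Y\le\dfrac{(1-\beta)^4}{4(1+2\beta^2)^2}$ be fixed, and let $A\sim\mathsf{GOE}(n)$. There is a universal constant $C>0$ and an $n_0(\beta,\gamma_Y)$ such that for all $n\ge n_0(\beta,\gamma_Y)$, with probability at least $1-4e^{-n/4}$ over $A$, the bound $$\left\|E_{\mathcal D_n}\!\Big[D\big(\beta^2\mathrm{tr}_n(D^{-1})I_n-\beta A+D\big)^{-2}D\Big]-\frac{I_n}{1-\beta^2\mathrm{tr}_n(D^{-2})}\right\|_{L^2}\le\frac{C\beta}{\gamma_Y^2\sqrt n}\qquad(\ast)$$ holds simultaneously for all $D\in\mathcal D_n([1,\infty))$ satisfying $$D^{-1}\big(a I_n-\beta A+D\big)^2D^{-1}\succeq\gamma_Y I_n,\qquad a=\beta^2\mathrm{tr}_n(D^{-1}).$$ In particular, on the same event, $(\ast)$ holds uniformly for $D=D(m)$ with $m\in\mathcal S_A(c)$, for any fixed $c>0$ such that $$\gamma_Y\le\Big(1+\frac{1+3\beta}{c}\Big)^{-2}.$$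
   Context: $\mathsf{GOE}(n)$: symmetric Gaussian matrix with independent (up to symmetry) centered entries of variance $1/n$ off the diagonal and $2/n$ on the diagonal. $\mathcal D_n(K)$ is the set of diagonal $n\times n$ matrices with diagonal entries in $K\subseteq\mathbb R$; $E_{\mathcal D_n}$ maps a matrix to its diagonal part; $\mathrm{tr}_n=\frac1n\mathrm{Tr}$; $\|X\|_{L^2}=\big(\mathrm{tr}_n(X^*X)\big)^{1/2}$ is the normalized Schatten $2$-norm. For $m\in(-1,1)^n$: $D(m)=\mathrm{diag}\big(\frac1{1-m_i^2}\big)$, $$\nabla^2\mathcal F_{\mathrm{TAP}}(m)=-\beta A+D(m)+\beta^2\Big(1-\frac{\|m\|_2^2}n\Big)I_n-\frac{2\beta^2}n mm^{\mathsf T},$$ and $\mathcal S_A(c)=\{m\in(-1,1)^n:\ c\,D(m)\prec\nabla^2\mathcal F_{\mathrm{TAP}}(m)\}$. *)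

theory Defs
  imports "HOL-Probability.Probability" "Jordan_Normal_Form.Gauss_Jordan_Elimination"
begin

unbundle no vec_syntax
unbundle no inner_syntax
hide_const (open) Finite_Cartesian_Product.mat Finite_Cartesian_Product.vec Determinants.trace

definition sym_mats :: "nat \<Rightarrow> real mat set" where
  "sym_mats n = {A \<in> carrier_mat n n. transpose_mat A = A}"

definition upper_idx :: "nat \<Rightarrow> (nat \<times> nat) set" where
  "upper_idx n = {(i, j). i \<le> j \<and> j < n}"

definition upper_entries :: "nat \<Rightarrow> real mat \<Rightarrow> nat \<times> nat \<Rightarrow> real" where
  "upper_entries n A = (\<lambda>ij\<in>upper_idx n. A $$ ij)"

definition sym_mat_of :: "nat \<Rightarrow> (nat \<times> nat \<Rightarrow> real) \<Rightarrow> real mat" where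
  "sym_mat_of n g = mat n n (\<lambda>(i, j). g (min i j, max i j))"

text \<open>The \<sigma>-algebra generated by the entries; it is the Borel \<sigma>-algebra of the
  finite-dimensional space of symmetric matrices.\<close>

definition sym_mat_space :: "nat \<Rightarrow> real mat measure" where
  "sym_mat_space n =
     vimage_algebra (sym_mats n) (upper_entries n) (Pi\<^sub>M (upper_idx n) (\<lambda>_. borel))"

text \<open>Note that the second parameter of \<^const>\<open>normal_density\<close> is the standard deviation,
  not the variance.\<close>

definition GOE_entry :: "nat \<Rightarrow> nat \<times> nat \<Rightarrow> real measure" where
  "GOE_entry n = (\<lambda>(i, j). density lborel
     (normal_density 0 (sqrt (if i = j then 2 / real n else 1 / real n))))"

text \<open>The law of the random matrix, as a measure on the symmetric matrices of size \<open>n\<close>.\<close>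

definition GOE :: "nat \<Rightarrow> real mat measure" where
  "GOE n = distr (Pi\<^sub>M (upper_idx n) (GOE_entry n)) (sym_mat_space n) (sym_mat_of n)"

lemma prob_space_GOE_entry:
  assumes "n > 0"
  shows "prob_space (GOE_entry n ij)"
  using assms by (cases ij) (auto simp: GOE_entry_def intro!: prob_space_normal_density)

lemma sets_GOE_entry [simp]: "sets (GOE_entry n ij) = sets borel"
  by (cases ij) (simp add: GOE_entry_def)

lemma space_GOE [simp]: "space (GOE n) = sym_mats n"
  by (simp add: GOE_def sym_mat_space_def)

lemma sym_mat_of_in: "sym_mat_of n g \<in> sym_mats n"
  by (auto simp: sym_mats_def sym_mat_of_def min.commute max.commute)

lemma sets_PiM_GOE_entry:
  "sets (Pi\<^sub>M (upper_idx n) (GOE_entry n)) = sets (Pi\<^sub>M (upper_idx n) (\<lambda>_. borel))"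
  by (intro sets_PiM_cong) auto

lemma upper_entries_sym_mat_of:
  "upper_entries n (sym_mat_of n g) = restrict g (upper_idx n)"
  by (auto simp: upper_entries_def sym_mat_of_def upper_idx_def fun_eq_iff min_absorb1 max_absorb2)

lemma measurable_sym_mat_of:
  "sym_mat_of n \<in> Pi\<^sub>M (upper_idx n) (GOE_entry n) \<rightarrow>\<^sub>M sym_mat_space n"
  unfolding sym_mat_space_def
proof (rule measurable_vimage_algebra2)
  show "sym_mat_of n \<in> space (Pi\<^sub>M (upper_idx n) (GOE_entry n)) \<rightarrow> sym_mats n"
    using sym_mat_of_in by auto
  have "(\<lambda>g. restrict g (upper_idx n))
      \<in> Pi\<^sub>M (upper_idx n) (GOE_entry n) \<rightarrow>\<^sub>M Pi\<^sub>M (upper_idx n) (\<lambda>_. borel)"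
    by (subst measurable_cong_sets[OF sets_PiM_GOE_entry refl]) (rule measurable_restrict_subset, simp)
  then show "(\<lambda>x. upper_entries n (sym_mat_of n x))
      \<in> Pi\<^sub>M (upper_idx n) (GOE_entry n) \<rightarrow>\<^sub>M Pi\<^sub>M (upper_idx n) (\<lambda>_. borel)"
    by (simp add: upper_entries_sym_mat_of)
qed

lemma measurable_upper_entries:
  "upper_entries n \<in> GOE n \<rightarrow>\<^sub>M Pi\<^sub>M (upper_idx n) (\<lambda>_. borel)"
proof -
  have "upper_entries n \<in> sym_mats n \<rightarrow> space (Pi\<^sub>M (upper_idx n) (\<lambda>_. borel))"
    by (auto simp: upper_entries_def space_PiM)
  then show ?thesis
    using measurable_vimage_algebra1 by (simp add: GOE_def sym_mat_space_def)
qed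

lemma prob_space_GOE:
  assumes "n > 0"
  shows "prob_space (GOE n)"
  unfolding GOE_def
  using assms by (intro prob_space.prob_space_distr prob_space_PiM prob_space_GOE_entry measurable_sym_mat_of)

lemma measurable_GOE_entry:
  assumes "ij \<in> upper_idx n"
  shows "(\<lambda>A. A $$ ij) \<in> borel_measurable (GOE n)"
proof -
  have "(\<lambda>A. upper_entries n A ij) \<in> borel_measurable (GOE n)"
    by (rule measurable_compose[OF measurable_upper_entries]) (rule measurable_component_singleton[OF assms])
  then show ?thesis using assms by (simp add: upper_entries_def)
qed

lemma distr_upper_entries:
  "distr (GOE n) (Pi\<^sub>M (upper_idx n) (\<lambda>_. borel)) (upper_entries n)
     = Pi\<^sub>M (upper_idx n) (GOE_entry n)"
proof -
  have "distr (GOE n) (Pi\<^sub>M (upper_idx n) (\<lambda>_. borel)) (upper_entries n) =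
    distr (Pi\<^sub>M (upper_idx n) (GOE_entry n)) (Pi\<^sub>M (upper_idx n) (\<lambda>_. borel))
      (upper_entries n \<circ> sym_mat_of n)"
    using measurable_upper_entries[of n] measurable_sym_mat_of[of n]
    unfolding GOE_def by (subst distr_distr) (auto simp: comp_def)
  also have "\<dots> = distr (Pi\<^sub>M (upper_idx n) (GOE_entry n)) (Pi\<^sub>M (upper_idx n) (GOE_entry n)) (\<lambda>g. g)"
    by (intro distr_cong)
      (auto simp: upper_entries_sym_mat_of space_PiM PiE_restrict sets_PiM_GOE_entry)
  finally show ?thesis by (simp add: distr_id)
qed

lemma distr_GOE_entry:
  assumes "n > 0" "ij \<in> upper_idx n"
  shows "distr (GOE n) borel (\<lambda>A. A $$ ij) = GOE_entry n ij"
proof -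
  have "distr (GOE n) borel (\<lambda>A. A $$ ij) = distr (GOE n) borel ((\<lambda>g. g ij) \<circ> upper_entries n)"
    using assms by (intro distr_cong) (auto simp: upper_entries_def)
  also have "\<dots> = distr (distr (GOE n) (Pi\<^sub>M (upper_idx n) (\<lambda>_. borel)) (upper_entries n)) borel (\<lambda>g. g ij)"
    using assms measurable_upper_entries by (subst distr_distr) auto
  also have "\<dots> = distr (Pi\<^sub>M (upper_idx n) (GOE_entry n)) (GOE_entry n ij) (\<lambda>g. g ij)"
    unfolding distr_upper_entries by (intro distr_cong) auto
  also have "\<dots> = GOE_entry n ij"
    using assms by (intro distr_PiM_component prob_space_GOE_entry)
  finally show ?thesis .
qed

lemma indep_vars_GOE:
  assumes "n > 0"
  shows "prob_space.indep_vars (GOE n) (\<lambda>_. borel) (\<lambda>ij A. A $$ ij) (upper_idx n)"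
proof -
  interpret prob_space "GOE n" using assms by (rule prob_space_GOE)
  have "(0, 0) \<in> upper_idx n" using assms by (simp add: upper_idx_def)
  moreover have "distr (GOE n) (Pi\<^sub>M (upper_idx n) (\<lambda>_. borel)) (\<lambda>A. \<lambda>ij\<in>upper_idx n. A $$ ij)
      = Pi\<^sub>M (upper_idx n) (\<lambda>ij. distr (GOE n) borel (\<lambda>A. A $$ ij))"
    using distr_upper_entries[of n] assms
    by (simp add: upper_entries_def[abs_def] distr_GOE_entry cong: PiM_cong)
  ultimately show ?thesis
    by (subst indep_vars_iff_distr_eq_PiM') (auto intro: measurable_GOE_entry)
qed

text \<open>Unspecified for singular matrices. In the uses below invertibility follows: from
  \<open>D \<in> diag_mats n {1..}\<close>, from \<open>\<gamma> > 0\<close> in \<open>D\<^sup>-\<^sup>1 B\<^sup>2 D\<^sup>-\<^sup>1 \<succeq> \<gamma> I\<close>, or from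
  \<open>B \<succ> c D\<close> on \<open>S_set\<close>.\<close>

definition matinv :: "real mat \<Rightarrow> real mat" where
  "matinv X = the (mat_inverse X)"

lemma matinv:
  assumes "X \<in> carrier_mat n n" "invertible_mat X"
  shows "matinv X \<in> carrier_mat n n" "X * matinv X = 1\<^sub>m n" "matinv X * X = 1\<^sub>m n"
proof -
  obtain Y where Y: "X * Y = 1\<^sub>m n" "Y * X = 1\<^sub>m (dim_row Y)"
    using assms by (auto simp: invertible_mat_def inverts_mat_def)
  then have "Y \<in> carrier_mat n n"
    using assms(1) by (metis carrier_matD(2) carrier_matI index_mult_mat(3) index_one_mat(3))
  then have "X \<in> Units (ring_mat TYPE(real) n b)" for b
    using assms(1) Y by (auto simp: Units_def ring_mat_def)
  then obtain Z where "mat_inverse X = Some Z"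
    using mat_inverse(1)[OF assms(1)] by fastforce
  then show "matinv X \<in> carrier_mat n n" "X * matinv X = 1\<^sub>m n" "matinv X * X = 1\<^sub>m n"
    using mat_inverse(2)[OF assms(1)] by (auto simp: matinv_def)
qed

definition ntr :: "real mat \<Rightarrow> real" where
  "ntr X = (\<Sum>i<dim_row X. X $$ (i, i)) / real (dim_row X)"

definition norm_L2 :: "real mat \<Rightarrow> real" where
  "norm_L2 X = sqrt (ntr (transpose_mat X * X))"

definition diag_part :: "real mat \<Rightarrow> real mat" where
  "diag_part X = mat_diag (dim_row X) (\<lambda>i. X $$ (i, i))"

definition diag_mats :: "nat \<Rightarrow> real set \<Rightarrow> real mat set" where
  "diag_mats n K = {D \<in> carrier_mat n n. diagonal_mat D \<and> (\<forall>i<n. D $$ (i, i) \<in> K)}"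

text \<open>The Loewner order; symmetry of both sides is part of the relation.\<close>

definition pos_semidef :: "nat \<Rightarrow> real mat \<Rightarrow> bool" where
  "pos_semidef n X \<longleftrightarrow> X \<in> sym_mats n \<and> (\<forall>v\<in>carrier_vec n. 0 \<le> v \<bullet> (X *\<^sub>v v))"

definition pos_def :: "nat \<Rightarrow> real mat \<Rightarrow> bool" where
  "pos_def n X \<longleftrightarrow> X \<in> sym_mats n \<and> (\<forall>v\<in>carrier_vec n. v \<noteq> 0\<^sub>v n \<longrightarrow> 0 < v \<bullet> (X *\<^sub>v v))"

definition loewner_le :: "nat \<Rightarrow> real mat \<Rightarrow> real mat \<Rightarrow> bool" where
  "loewner_le n X Y \<longleftrightarrow> X \<in> sym_mats n \<and> Y \<in> sym_mats n \<and> pos_semidef n (Y - X)"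

definition loewner_less :: "nat \<Rightarrow> real mat \<Rightarrow> real mat \<Rightarrow> bool" where
  "loewner_less n X Y \<longleftrightarrow> X \<in> sym_mats n \<and> Y \<in> sym_mats n \<and> pos_def n (Y - X)"

definition open_cube :: "nat \<Rightarrow> real vec set" where
  "open_cube n = {m \<in> carrier_vec n. \<forall>i<n. -1 < m $ i \<and> m $ i < 1}"

definition D_of :: "real vec \<Rightarrow> real mat" where
  "D_of m = mat_diag (dim_vec m) (\<lambda>i. 1 / (1 - (m $ i)\<^sup>2))"

definition outer_square :: "real vec \<Rightarrow> real mat" where
  "outer_square m = mat (dim_vec m) (dim_vec m) (\<lambda>(i, j). m $ i * m $ j)"

definition hess_TAP :: "nat \<Rightarrow> real \<Rightarrow> real mat \<Rightarrow> real vec \<Rightarrow> real mat" where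
  "hess_TAP n \<beta> A m =
     (- \<beta>) \<cdot>\<^sub>m A + D_of m + (\<beta>\<^sup>2 * (1 - (m \<bullet> m) / real n)) \<cdot>\<^sub>m 1\<^sub>m n
       - (2 * \<beta>\<^sup>2 / real n) \<cdot>\<^sub>m outer_square m"

definition S_set :: "nat \<Rightarrow> real \<Rightarrow> real mat \<Rightarrow> real \<Rightarrow> real vec set" where
  "S_set n \<beta> A c = {m \<in> open_cube n. loewner_less n (c \<cdot>\<^sub>m D_of m) (hess_TAP n \<beta> A m)}"

definition shifted_mat :: "nat \<Rightarrow> real \<Rightarrow> real mat \<Rightarrow> real mat \<Rightarrow> real mat" where
  "shifted_mat n \<beta> A D = (\<beta>\<^sup>2 * ntr (matinv D)) \<cdot>\<^sub>m 1\<^sub>m n - \<beta> \<cdot>\<^sub>m A + D"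

definition diag_bound :: "nat \<Rightarrow> real \<Rightarrow> real \<Rightarrow> real \<Rightarrow> real mat \<Rightarrow> real mat \<Rightarrow> bool" where
  "diag_bound n C \<beta> \<gamma> A D \<longleftrightarrow>
     norm_L2 (diag_part (D * (matinv (shifted_mat n \<beta> A D) ^\<^sub>m 2) * D)
              - (1 / (1 - \<beta>\<^sup>2 * ntr (matinv D ^\<^sub>m 2))) \<cdot>\<^sub>m 1\<^sub>m n)
       \<le> C * \<beta> / (\<gamma>\<^sup>2 * sqrt (real n))"

end

theory Submission
  imports Defs "HOL-Real_Asymp.Real_Asymp" "Jordan_Normal_Form.Determinant"
begin

text \<open>
  Put \<open>X = D\<^sup>-\<^sup>1\<close> with diagonal \<open>x\<close>, and \<open>B = \<beta>\<^sup>2 tr(X) I - \<beta> A + D\<close>. Then \<open>B X = I + \<beta>\<^sup>2 tr(X) X - \<beta> A X\<close>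
  depends smoothly on \<open>x\<close> up to \<open>x = 0\<close>, and the diagonal of \<open>D B\<^sup>-\<^sup>2 D\<close> is the vector \<open>Z(x)\<close> of the squared
  row norms of \<open>(B X)\<^sup>-\<^sup>1\<close>.

  For a single \<open>x\<close>, the Sudakov--Fernique comparison gives \<open>B \<succeq> c D\<close> with \<open>c = (1 - \<beta>)\<^sup>2 / 2\<close>, except on an event of
  small probability. The cavity (Schur complement) equations for the diagonals of \<open>B\<^sup>-\<^sup>1\<close> and \<open>B\<^sup>-\<^sup>2\<close>, with quadratic
  forms replaced by their means, form a self-consistent system whose solution makes \<open>Z(x)\<close> equal to the constant
  \<open>1 / (1 - \<beta>\<^sup>2 tr(X\<^sup>2))\<close>, up to an error that is bounded in \<open>\<ell>\<^sup>2\<close> independently of \<open>n\<close>.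

  Uniformity in \<open>x\<close> comes from chaining over the dyadic grids. A step of size \<open>2\<^sup>-\<^sup>k\<close> in \<open>x\<close> changes
  \<open>Z\<close> by a function of \<open>A\<close> with Lipschitz constant of order \<open>2\<^sup>-\<^sup>k\<close> on the event of well-conditioned \<open>B X\<close>. Such
  partially defined functions are controlled by the Gaussian enlargement inequality, which follows from
  Maurey's property (tau). The centres of the increments are differences of approximate medians and telescope,
  so that the fixed-\<open>x\<close> estimate enters only at both ends of the chain and no logarithm is lost.
\<close>

section \<open>Property (tau) and Gaussian enlargement\<close>

text \<open>The obstacle is uniformity over profiles filling a cube of dimension \<open>n\<close>: a
  union bound over the finest grid alone, of mesh about \<open>1 / sqrt n\<close>, faces entropy of
  order \<open>n * ln n\<close> and would lose a factor \<open>sqrt (ln n)\<close>. Enlargement by a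
  Frobenius radius \<rho> fails with probability about
  \<open>exp (- n * \<rho>\<^sup>2 / 8)\<close>, while level \<open>k\<close> of the grids has
  entropy of order \<open>n * (k + 1)\<close>. So a radius of order \<open>k + 2\<close> is
  affordable, the increments are of order \<open>(k + 2) / 2 ^ k\<close>, and their sum stays
  bounded. The resolvent estimates ask for good conditioning at two endpoints, not on the segment
  between them. This is what lets enlargement act on functions controlled only on an arbitrary set
  of matrices, and why approximate medians replace expectations. With
  \<open>s = sqrt \<gamma>\<close> and \<open>\<kappa> = 8 / s\<close>, second differences of
  squared row norms cost \<open>\<kappa> ^ 4\<close>, whence the power of \<gamma> in the final
  bound; the factor \<beta> appears because the randomness enters through \<beta> times
  \<open>A\<close>.\<close>

lemma nn_integral_layer_cake:
  fixes f :: "real \<Rightarrow> real"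
  assumes [measurable]: "f \<in> borel_measurable borel" and "\<And>x. 0 \<le> f x"
  shows "(\<integral>\<^sup>+x. ennreal (f x) \<partial>lborel) = (\<integral>\<^sup>+t. indicator {0<..} t * emeasure lborel {x. t < f x} \<partial>lborel)"
proof -
  have "(\<integral>\<^sup>+x. ennreal (f x) \<partial>lborel) = (\<integral>\<^sup>+x. (\<integral>\<^sup>+t. indicator {0<..<f x} t \<partial>lborel) \<partial>lborel)"
    using assms(2) by (intro nn_integral_cong) simp
  also have "\<dots> = (\<integral>\<^sup>+x. (\<integral>\<^sup>+t. indicator {(x,t). 0 < t \<and> t < f x} (x,t) \<partial>lborel) \<partial>lborel)"
    by (intro nn_integral_cong) (auto simp: indicator_def)
  also have "\<dots> = (\<integral>\<^sup>+t. (\<integral>\<^sup>+x. indicator {(x,t). 0 < t \<and> t < f x} (x,t) \<partial>lborel) \<partial>lborel)"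
    by (rule lborel_pair.Fubini'[symmetric]) measurable
  also have "\<dots> = (\<integral>\<^sup>+t. indicator {0<..} t * emeasure lborel {x. t < f x} \<partial>lborel)"
  proof (intro nn_integral_cong)
    fix t :: real
    have "(\<integral>\<^sup>+x. indicator {(x,t). 0 < t \<and> t < f x} (x,t) \<partial>lborel)
        = (\<integral>\<^sup>+x. indicator {0<..} t * indicator {x. t < f x} x \<partial>lborel)"
      by (intro nn_integral_cong) (auto simp: indicator_def)
    then show "(\<integral>\<^sup>+x. indicator {(x,t). 0 < t \<and> t < f x} (x,t) \<partial>lborel)
        = indicator {0<..} t * emeasure lborel {x. t < f x}"
      by (simp add: nn_integral_cmult)
  qed
  finally show ?thesis .
qed

text \<open>Only the convex hulls matter. The bound on midpoints passes to
  \<open>Sup A + Sup B\<close> and to \<open>Inf A + Inf B\<close>, so the two enclosing intervals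
  have total length at most \<open>4 * \<rho>\<close>. This is Brunn-Minkowski for a target that is
  a symmetric interval.\<close>

lemma emeasure_lborel_le_diam:
  fixes A B :: "real set" and \<rho> :: real
  assumes A: "A \<in> sets borel" "A \<noteq> {}" and B: "B \<in> sets borel" "B \<noteq> {}"
    and le: "\<And>x y. x \<in> A \<Longrightarrow> y \<in> B \<Longrightarrow> \<bar>(x + y) / 2\<bar> \<le> \<rho>"
  shows "emeasure lborel A + emeasure lborel B \<le> ennreal (4 * \<rho>)"
proof -
  obtain a0 b0 where ab: "a0 \<in> A" "b0 \<in> B" using A B by auto
  have bA: "x \<in> A \<Longrightarrow> \<bar>x + y\<bar> \<le> 2 * \<rho>" if "y \<in> B" for x y using le[of x y] that by simp
  have bddA: "bdd_above A" "bdd_below A"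
    using bA[OF ab(2)] by (auto intro!: bdd_aboveI[of _ "2*\<rho> + \<bar>b0\<bar>"] bdd_belowI[of _ "- 2*\<rho> - \<bar>b0\<bar>"])
      (smt (verit))+
  have bddB: "bdd_above B" "bdd_below B"
    using bA[OF _ ab(1)] by (auto intro!: bdd_aboveI[of _ "2*\<rho> + \<bar>a0\<bar>"] bdd_belowI[of _ "- 2*\<rho> - \<bar>a0\<bar>"])
      (smt (verit))+
  have 1: "Sup A \<le> 2 * \<rho> - y" if "y \<in> B" for y
    using A(2) bA[OF that] by (intro cSup_least) (auto simp: abs_le_iff, smt (verit))
  have "Sup B \<le> 2 * \<rho> - Sup A"
    using B(2) 1 by (intro cSup_least) (auto, smt (verit))
  moreover have 2: "- 2 * \<rho> - y \<le> Inf A" if "y \<in> B" for y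
    using A(2) bA[OF that] by (intro cInf_greatest) (auto simp: abs_le_iff, smt (verit))
  have "- 2 * \<rho> - Inf A \<le> Inf B"
    using B(2) 2 by (intro cInf_greatest) (auto, smt (verit))
  ultimately have sum: "(Sup A - Inf A) + (Sup B - Inf B) \<le> 4 * \<rho>" by linarith
  have "Inf A \<le> Sup A" "Inf B \<le> Sup B" using bddA bddB A B by (auto intro: cInf_le_cSup)
  have "emeasure lborel A \<le> emeasure lborel {Inf A..Sup A}"
    using bddA by (intro emeasure_mono) (auto intro: cInf_lower cSup_upper)
  also have "\<dots> = ennreal (Sup A - Inf A)" using \<open>Inf A \<le> Sup A\<close> by simp
  finally have eA: "emeasure lborel A \<le> ennreal (Sup A - Inf A)" .
  have "emeasure lborel B \<le> emeasure lborel {Inf B..Sup B}"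
    using bddB by (intro emeasure_mono) (auto intro: cInf_lower cSup_upper)
  also have "\<dots> = ennreal (Sup B - Inf B)" using \<open>Inf B \<le> Sup B\<close> by simp
  finally have eB: "emeasure lborel B \<le> ennreal (Sup B - Inf B)" .
  have "emeasure lborel A + emeasure lborel B \<le> ennreal (Sup A - Inf A) + ennreal (Sup B - Inf B)"
    using eA eB by (rule add_mono)
  also have "\<dots> = ennreal ((Sup A - Inf A) + (Sup B - Inf B))"
    using \<open>Inf A \<le> Sup A\<close> \<open>Inf B \<le> Sup B\<close> by (simp add: ennreal_plus)
  also have "\<dots> \<le> ennreal (4 * \<rho>)" using sum by (rule ennreal_leI)
  finally show ?thesis .
qed

text \<open>Superlevel sets of the normal density are symmetric intervals, so the Brunn--Minkowski step
  only needs the diameters of the superlevel sets of \<open>f\<close> and \<open>g\<close>.\<close>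

lemma prekopa_leindler_gauss:
  fixes f g :: "real \<Rightarrow> real" and \<sigma> :: real
  assumes \<sigma>: "\<sigma> > 0" and [measurable]: "f \<in> borel_measurable borel" "g \<in> borel_measurable borel"
    and f0: "\<And>x. 0 \<le> f x" and g0: "\<And>x. 0 \<le> g x"
    and le: "\<And>x y. f x * g y \<le> (normal_density 0 \<sigma> ((x + y) / 2))\<^sup>2"
  shows "(\<integral>\<^sup>+x. ennreal (f x) \<partial>lborel) * (\<integral>\<^sup>+x. ennreal (g x) \<partial>lborel) \<le> 1"
proof (cases "(\<forall>x. f x = 0) \<or> (\<forall>y. g y = 0)")
  case True then show ?thesis by auto
next
  case False
  then obtain x0 y0 where x0: "f x0 > 0" and y0: "g y0 > 0" using f0 g0 by (metis less_eq_real_def)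
  define \<phi> where "\<phi> = normal_density 0 \<sigma>"
  have [measurable]: "\<phi> \<in> borel_measurable borel" by (simp add: \<phi>_def)
  have \<phi>pos: "\<phi> z > 0" for z using \<sigma> by (simp add: \<phi>_def normal_density_pos)
  have \<phi>le: "\<phi> z \<le> \<phi> 0" for z
    using \<sigma> by (auto simp: \<phi>_def normal_density_def divide_right_mono)
  have fle: "f x \<le> (\<phi> 0)\<^sup>2 / g y0" for x
    using order_trans[OF le[of x y0, folded \<phi>_def] power_mono[OF \<phi>le[of "(x+y0)/2"], of 2]] y0 \<phi>pos[of "(x+y0)/2"]
    by (simp add: pos_le_divide_eq less_imp_le)
  have gle: "g y \<le> (\<phi> 0)\<^sup>2 / f x0" for y
    using order_trans[OF le[of x0 y, folded \<phi>_def] power_mono[OF \<phi>le[of "(x0+y)/2"], of 2]] x0 \<phi>pos[of "(x0+y)/2"]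
    by (simp add: pos_le_divide_eq less_imp_le mult.commute)
  \<comment> \<open>Levels are measured as fractions of the suprema, so that for every
    \<open>t < 1\<close> both superlevel sets are nonempty, as the diameter bound requires.\<close>
  define a where "a = (SUP x. f x)"
  define b where "b = (SUP x. g x)"
  have bdd: "bdd_above (range f)" "bdd_above (range g)" using fle gle by (auto intro!: bdd_aboveI2)
  have a: "f x \<le> a" for x unfolding a_def by (rule cSUP_upper[OF _ bdd(1)]) simp
  have b: "g x \<le> b" for x unfolding b_def by (rule cSUP_upper[OF _ bdd(2)]) simp
  have ab: "a > 0" "b > 0" using a[of x0] b[of y0] x0 y0 by auto
  define m where "m = sqrt (a * b)"
  have m: "m > 0" using ab by (simp add: m_def)
  have level: "emeasure lborel {x. a * t < f x} + emeasure lborel {x. b * t < g x} \<le> 2 * emeasure lborel {x. m * t < \<phi> x}"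
    if t: "0 < t" "t < 1" for t
  proof -
    have "a * t < a" "b * t < b" using ab t by auto
    then obtain x1 y1 where x1: "a * t < f x1" and y1: "b * t < g y1"
      using less_cSUP_iff[OF UNIV_not_empty bdd(1), of "a * t"] less_cSUP_iff[OF UNIV_not_empty bdd(2), of "b * t"]
      unfolding a_def[symmetric] b_def[symmetric] by auto
    \<comment> \<open>The square of \<open>m * t\<close> is the product of the two levels, so
      midpoints land in the superlevel set of the density at the geometric mean.\<close>
    have key: "m * t < \<phi> ((x + y) / 2)" if "a * t < f x" "b * t < g y" for x y
    proof -
      have "(m * t)\<^sup>2 = (a * t) * (b * t)" using ab by (simp add: m_def power_mult_distrib power2_eq_square)
      also have "\<dots> < f x * g y" using that ab t less_trans[OF mult_pos_pos[OF ab(1) t(1)] that(1)]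
        by (intro mult_strict_mono) (auto simp: less_imp_le)
      also have "\<dots> \<le> (\<phi> ((x + y) / 2))\<^sup>2" using le by (simp add: \<phi>_def)
      finally show ?thesis by (rule power2_less_imp_less) (simp add: \<phi>pos less_imp_le)
    qed
    define q where "q = - 2 * \<sigma>\<^sup>2 * ln (m * t * sqrt (2 * pi * \<sigma>\<^sup>2))"
    have mt: "m * t * sqrt (2 * pi * \<sigma>\<^sup>2) > 0" using m t \<sigma> by simp
    have iff: "m * t < \<phi> z \<longleftrightarrow> z\<^sup>2 < q" for z
    proof -
      have "m * t < \<phi> z \<longleftrightarrow> m * t * sqrt (2 * pi * \<sigma>\<^sup>2) < exp (- z\<^sup>2 / (2 * \<sigma>\<^sup>2))"
        using \<sigma> by (simp add: \<phi>_def normal_density_def field_simps)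
      also have "\<dots> \<longleftrightarrow> ln (m * t * sqrt (2 * pi * \<sigma>\<^sup>2)) < - z\<^sup>2 / (2 * \<sigma>\<^sup>2)"
        using mt by (metis exp_less_cancel_iff exp_ln)
      also have "\<dots> \<longleftrightarrow> z\<^sup>2 < q" using \<sigma> unfolding q_def by (auto simp: field_simps)
      finally show ?thesis .
    qed
    have q: "q > 0" using key[OF x1 y1] iff by (smt (verit) zero_le_power2)
    have set: "{x. m * t < \<phi> x} = {- sqrt q <..< sqrt q}"
    proof -
      have sq: "z\<^sup>2 < q \<longleftrightarrow> \<bar>z\<bar> < sqrt q" for z by (metis real_sqrt_abs real_sqrt_less_iff)
      show ?thesis
        unfolding set_eq_iff mem_Collect_eq greaterThanLessThan_iff iff sq abs_less_iff by auto
    qed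
    have e\<phi>: "emeasure lborel {x. m * t < \<phi> x} = ennreal (2 * sqrt q)" unfolding set using q by simp
    have "emeasure lborel {x. a * t < f x} + emeasure lborel {x. b * t < g x} \<le> ennreal (4 * sqrt q)"
    proof (rule emeasure_lborel_le_diam)
      fix x y assume "x \<in> {x. a * t < f x}" "y \<in> {x. b * t < g x}"
      then have "((x + y) / 2) \<in> {x. m * t < \<phi> x}" using key by auto
      then show "\<bar>(x + y) / 2\<bar> \<le> sqrt q" unfolding set by auto
    qed (use x1 y1 in auto)
    also have "ennreal (4 * sqrt q) = ennreal 2 * ennreal (2 * sqrt q)"
      by (subst ennreal_mult[symmetric]) (use q in auto)
    finally show ?thesis by (simp add: e\<phi>)
  qed
  have scale: "(\<integral>\<^sup>+x. ennreal (h x) \<partial>lborel) = ennreal s * (\<integral>\<^sup>+t. indicator {0<..} t * emeasure lborel {x. s * t < h x} \<partial>lborel)"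
    if s: "s > 0" and [measurable]: "h \<in> borel_measurable borel" and h: "\<And>x. 0 \<le> h x" for h :: "real \<Rightarrow> real" and s :: real
  proof -
    have "(\<integral>\<^sup>+x. ennreal (h x) \<partial>lborel) = (\<integral>\<^sup>+x. ennreal s * ennreal (h x / s) \<partial>lborel)"
      using s h by (intro nn_integral_cong) (simp flip: ennreal_mult)
    also have "\<dots> = ennreal s * (\<integral>\<^sup>+x. ennreal (h x / s) \<partial>lborel)" by (rule nn_integral_cmult) simp
    also have "(\<integral>\<^sup>+x. ennreal (h x / s) \<partial>lborel) = (\<integral>\<^sup>+t. indicator {0<..} t * emeasure lborel {x. t < h x / s} \<partial>lborel)"
      by (intro nn_integral_layer_cake) (use h s in auto)
    finally show ?thesis using s by (simp add: field_simps)
  qed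
  define I where "I h s = (\<integral>\<^sup>+t. indicator {0<..} t * emeasure lborel {x. s * t < h x} \<partial>lborel)" for h :: "real \<Rightarrow> real" and s
  have meas: "(\<lambda>t. emeasure lborel {x. s * t < h x}) \<in> borel_measurable borel" if [measurable]: "h \<in> borel_measurable borel" for h :: "real \<Rightarrow> real" and s
  proof -
    have "(\<lambda>t. emeasure lborel (Pair t -` {(t, x). s * t < h x})) \<in> borel_measurable borel"
      using lborel.measurable_emeasure_Pair[of "{(t::real, x). s * t < h x}" borel] 
      by (simp add: borel_prod) measurable
    then show ?thesis by (simp add: vimage_def)
  qed
  have If: "(\<integral>\<^sup>+x. ennreal (f x) \<partial>lborel) = ennreal a * I f a" and Ig: "(\<integral>\<^sup>+x. ennreal (g x) \<partial>lborel) = ennreal b * I g b"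
    and I\<phi>: "(\<integral>\<^sup>+x. ennreal (\<phi> x) \<partial>lborel) = ennreal m * I \<phi> m"
    unfolding I_def using ab m \<phi>pos f0 g0 by (auto intro!: scale simp: less_imp_le)
  have one: "(\<integral>\<^sup>+x. ennreal (\<phi> x) \<partial>lborel) = 1"
    using prob_space.emeasure_space_1[OF prob_space_normal_density[of \<sigma> 0, OF \<sigma>]]
    by (simp add: emeasure_density \<phi>_def)
  have ge1: "{x. s * t < h x} = {}" if "\<not> t < 1" "\<And>x. h x \<le> s" "s > 0" for s t and h :: "real \<Rightarrow> real"
  proof -
    have "s * 1 \<le> s * t" using that(1,3) by (intro mult_left_mono) auto
    then have "h x \<le> s * t" for x using that(2)[of x] by simp
    then show ?thesis by (auto simp: not_less)
  qed
  \<comment> \<open>Integration over \<open>t\<close> gives an additive bound. Since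
    \<open>m\<^sup>2 = a * b\<close> and \<open>m * I \<phi> m = 1\<close>, the inequality of
    arithmetic and geometric means turns it into the product bound.\<close>
  have "I f a + I g b \<le> 2 * I \<phi> m"
    unfolding I_def using meas
    apply (simp add: nn_integral_add[symmetric] nn_integral_cmult[symmetric])
    apply (intro nn_integral_mono)
    subgoal for t
      using level[of t] ge1[of t f a, OF _ a ab(1)] ge1[of t g b, OF _ b ab(2)]
      by (cases "0 < t"; cases "t < 1") (simp_all add: indicator_def)
    done
  moreover obtain p where p: "ennreal m * I \<phi> m = ennreal 1" "I \<phi> m = ennreal p" "p \<ge> 0"
    using I\<phi> one m by (cases "I \<phi> m") (auto simp: ennreal_mult_top)
  ultimately have le2: "I f a + I g b \<le> ennreal (2 * p)" by (simp add: ennreal_mult)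
  have mp: "m * p = 1" using p m by (simp flip: ennreal_mult) 
  obtain u v where uv: "I f a = ennreal u" "I g b = ennreal v" "u \<ge> 0" "v \<ge> 0"
    using le2 by (cases "I f a"; cases "I g b") (auto simp: top_unique)
  have "u + v \<le> 2 * p" using le2 uv p by (simp flip: ennreal_plus)
  then have "(u + v)\<^sup>2 \<le> (2 * p)\<^sup>2" using uv by (intro power_mono) auto
  moreover have "4 * (u * v) \<le> (u + v)\<^sup>2" using zero_le_power2[of "u - v"] by (simp add: power2_eq_square algebra_simps)
  ultimately have "u * v \<le> p\<^sup>2" by (simp add: power_mult_distrib)
  then have "a * b * (u * v) \<le> a * b * p\<^sup>2" using ab by (intro mult_left_mono) auto
  also have "\<dots> = (m * p)\<^sup>2" using ab by (simp add: m_def power_mult_distrib)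
  finally have "a * b * (u * v) \<le> 1" by (simp add: mp)
  then show ?thesis unfolding If Ig uv using ab uv
    by (simp flip: ennreal_mult add: ac_simps)
qed

text \<open>Maurey's inequality in dimension one. It is Prekopa-Leindler for \<phi> times
  \<open>F\<close> and \<phi> times \<open>G\<close>, because the parallelogram law gives
  \<open>\<phi> x * \<phi> y * exp (((x - y) / \<sigma>)\<^sup>2 / 4) = (\<phi> ((x + y) /
  2))\<^sup>2\<close>.\<close>

lemma normal_tau:
  fixes F G :: "real \<Rightarrow> ennreal"
  assumes \<sigma>: "\<sigma> > 0" and [measurable]: "F \<in> borel_measurable borel" "G \<in> borel_measurable borel"
    and le: "\<And>x y. F x * G y \<le> ennreal (exp (((x - y) / \<sigma>)\<^sup>2 / 4))"
  shows "(\<integral>\<^sup>+x. F x \<partial>density lborel (normal_density 0 \<sigma>)) * (\<integral>\<^sup>+x. G x \<partial>density lborel (normal_density 0 \<sigma>)) \<le> 1"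
proof (cases "(\<forall>x. F x = 0) \<or> (\<forall>y. G y = 0)")
  case True then show ?thesis by auto
next
  case False
  then obtain x0 y0 where x0: "F x0 \<noteq> 0" and y0: "G y0 \<noteq> 0" by auto
  \<comment> \<open>One nonzero value of the other function excludes the value \<top>, so both
    functions can be made real-valued.\<close>
  have Ff: "F x < \<top>" for x
    using le[of x y0] y0 by (cases "F x = \<top>") (auto simp: ennreal_top_mult top_unique less_top)
  have Gf: "G x < \<top>" for x
    using le[of x0 x] x0 by (cases "G x = \<top>") (auto simp: ennreal_mult_top top_unique less_top)
  define \<phi> where "\<phi> = normal_density 0 \<sigma>"
  have [measurable]: "\<phi> \<in> borel_measurable borel" by (simp add: \<phi>_def)
  have \<phi>0: "\<phi> z \<ge> 0" for z by (simp add: \<phi>_def)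
  define f where "f x = \<phi> x * enn2real (F x)" for x
  define g where "g x = \<phi> x * enn2real (G x)" for x
  have [measurable]: "f \<in> borel_measurable borel" "g \<in> borel_measurable borel" unfolding f_def g_def by measurable
  have "(\<integral>\<^sup>+x. F x \<partial>density lborel \<phi>) = (\<integral>\<^sup>+x. ennreal (f x) \<partial>lborel)"
    using Ff \<phi>0 by (subst nn_integral_density) (auto intro!: nn_integral_cong simp: f_def ennreal_mult)
  moreover have "(\<integral>\<^sup>+x. G x \<partial>density lborel \<phi>) = (\<integral>\<^sup>+x. ennreal (g x) \<partial>lborel)"
    using Gf \<phi>0 by (subst nn_integral_density) (auto intro!: nn_integral_cong simp: g_def ennreal_mult)
  moreover have "(\<integral>\<^sup>+x. ennreal (f x) \<partial>lborel) * (\<integral>\<^sup>+x. ennreal (g x) \<partial>lborel) \<le> 1"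
  proof (rule prekopa_leindler_gauss[OF \<sigma>])
    fix x y
    have "ennreal (enn2real (F x) * enn2real (G y)) = F x * G y" using Ff Gf by (simp add: ennreal_mult)
    then have h: "enn2real (F x) * enn2real (G y) \<le> exp (((x - y) / \<sigma>)\<^sup>2 / 4)"
      using le[of x y] by (metis ennreal_le_iff exp_ge_zero)
    have "f x * g y \<le> \<phi> x * \<phi> y * exp (((x - y) / \<sigma>)\<^sup>2 / 4)"
      using mult_left_mono[OF h, of "\<phi> x * \<phi> y"] \<phi>0[of x] \<phi>0[of y]
      by (simp add: f_def g_def ac_simps)
    also have "\<dots> = (\<phi> ((x + y) / 2))\<^sup>2"
    proof -
      have "- x\<^sup>2 / (2 * \<sigma>\<^sup>2) + (- y\<^sup>2 / (2 * \<sigma>\<^sup>2) + ((x - y) / \<sigma>)\<^sup>2 / 4) = 2 * (- ((x + y) / 2)\<^sup>2 / (2 * \<sigma>\<^sup>2))"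
        using \<sigma> by (simp add: field_simps power2_eq_square)
      then show ?thesis using \<sigma>
        by (simp add: \<phi>_def normal_density_def power_divide flip: exp_add exp_double)
    qed
    finally show "f x * g y \<le> (normal_density 0 \<sigma> ((x + y) / 2))\<^sup>2" by (simp add: \<phi>_def)
  qed (auto simp: f_def g_def \<phi>0)
  ultimately show ?thesis by (simp add: \<phi>_def)
qed

lemma ennreal_le_one_of_mult:
  fixes x y :: ennreal
  assumes "x * y \<le> 1" "1 \<le> y"
  shows "x \<le> 1"
proof -
  have "x * 1 \<le> x * y" by (rule mult_left_mono[OF assms(2)]) simp
  then show ?thesis using assms(1) by (simp add: order_trans)
qed

section \<open>Products of centred normal laws: tensorisation, enlargement and tails\<close>

locale gaussian_family =
  fixes I :: "'k::countable set" and \<sigma> :: "'k \<Rightarrow> real"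
  assumes fin: "finite I" and sd_pos: "\<And>k. \<sigma> k > 0"
begin

definition N :: "'k \<Rightarrow> real measure" where "N k = density lborel (normal_density 0 (\<sigma> k))"

text \<open>Distance after standardising each coordinate, so that the constants below depend neither
  on the variances nor on the dimension.\<close>

definition wdist :: "('k \<Rightarrow> real) \<Rightarrow> ('k \<Rightarrow> real) \<Rightarrow> real" where
  "wdist x y = L2_set (\<lambda>k. (x k - y k) / \<sigma> k) I"

lemma sets_N [simp, measurable_cong]: "sets (N k) = sets borel" by (simp add: N_def)
lemma space_N [simp]: "space (N k) = UNIV" by (simp add: N_def)

lemma prob_N: "prob_space (N k)" using sd_pos by (simp add: N_def prob_space_normal_density)

sublocale P: product_prob_space N I
  using prob_N by (simp add: product_prob_space_def product_sigma_finite_def product_prob_space_axioms_def prob_space_imp_sigma_finite)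

sublocale finite_product_prob_space N I
  using fin by unfold_locales

lemma sets_PiM_N: "sets (Pi\<^sub>M J N) = sets (Pi\<^sub>M J (\<lambda>_. borel))" by (intro sets_PiM_cong) auto
lemma space_PiM_N: "space (Pi\<^sub>M J N) = extensional J" by (auto simp: space_PiM PiE_def)

lemma wdist_sym: "wdist x y = wdist y x"
  unfolding wdist_def L2_set_def by (simp add: power_divide power2_commute)
lemma wdist_nonneg: "0 \<le> wdist x y" by (simp add: wdist_def L2_set_nonneg)
lemma wdist_triangle: "wdist x z \<le> wdist x y + wdist y z"
proof -
  have "wdist x z = L2_set (\<lambda>k. (x k - y k) / \<sigma> k + (y k - z k) / \<sigma> k) I"
    by (simp add: wdist_def flip: add_divide_distrib)
  also have "\<dots> \<le> wdist x y + wdist y z" unfolding wdist_def by (rule L2_set_triangle_ineq)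
  finally show ?thesis .
qed

lemma wdist_sq: "(wdist x y)\<^sup>2 = (\<Sum>k\<in>I. ((x k - y k) / \<sigma> k)\<^sup>2)"
  by (simp add: wdist_def L2_set_def sum_nonneg)

text \<open>Tensorisation: the fibre integrals \<open>F1\<close> and \<open>G1\<close> over the new
  coordinate satisfy the hypothesis for \<open>J\<close>, by the one-dimensional case applied to
  each pair of fibres.\<close>

lemma tau_aux:
  assumes "finite J" "F \<in> borel_measurable (Pi\<^sub>M J N)" "G \<in> borel_measurable (Pi\<^sub>M J N)"
    and "\<And>x y. x \<in> space (Pi\<^sub>M J N) \<Longrightarrow> y \<in> space (Pi\<^sub>M J N) \<Longrightarrow>
      F x * G y \<le> ennreal (exp ((\<Sum>k\<in>J. ((x k - y k) / \<sigma> k)\<^sup>2) / 4))"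
  shows "(\<integral>\<^sup>+x. F x \<partial>Pi\<^sub>M J N) * (\<integral>\<^sup>+x. G x \<partial>Pi\<^sub>M J N) \<le> 1"
  using assms
proof (induction J arbitrary: F G rule: finite_induct)
  case empty
  then show ?case by (auto simp: P.nn_integral_empty PiM_empty nn_integral_count_space_finite)
next
  case (insert i J)
  note [measurable] = insert.prems(1,2)
  have upd: "(\<lambda>(x, y). x(i := y)) \<in> Pi\<^sub>M J N \<Otimes>\<^sub>M N i \<rightarrow>\<^sub>M Pi\<^sub>M (insert i J) N"
    by (rule measurable_add_dim)
  define F1 where "F1 x = (\<integral>\<^sup>+y. F (x(i := y)) \<partial>N i)" for x
  define G1 where "G1 x = (\<integral>\<^sup>+y. G (x(i := y)) \<partial>N i)" for x
  have mF: "(\<lambda>(x, y). F (x(i := y))) \<in> borel_measurable (Pi\<^sub>M J N \<Otimes>\<^sub>M N i)"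
    using measurable_compose[OF upd insert.prems(1)] by (simp add: case_prod_unfold)
  have mG: "(\<lambda>(x, y). G (x(i := y))) \<in> borel_measurable (Pi\<^sub>M J N \<Otimes>\<^sub>M N i)"
    using measurable_compose[OF upd insert.prems(2)] by (simp add: case_prod_unfold)
  have "(\<integral>\<^sup>+x. F1 x \<partial>Pi\<^sub>M J N) * (\<integral>\<^sup>+x. G1 x \<partial>Pi\<^sub>M J N) \<le> 1"
  proof (rule insert.IH)
    show "F1 \<in> borel_measurable (Pi\<^sub>M J N)" unfolding F1_def
      using P.M.borel_measurable_nn_integral[OF mF] by simp
    show "G1 \<in> borel_measurable (Pi\<^sub>M J N)" unfolding G1_def
      using P.M.borel_measurable_nn_integral[OF mG] by simp
    fix x y assume x: "x \<in> space (Pi\<^sub>M J N)" and y: "y \<in> space (Pi\<^sub>M J N)"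
    define s where "s = (\<Sum>k\<in>J. ((x k - y k) / \<sigma> k)\<^sup>2)"
    have [measurable]: "(\<lambda>u. F (x(i := u))) \<in> borel_measurable borel" "(\<lambda>u. G (y(i := u))) \<in> borel_measurable borel"
      using measurable_Pair2[OF mF x] measurable_Pair2[OF mG y] by (simp_all cong: measurable_cong_sets)
    have xy: "x(i := u) \<in> space (Pi\<^sub>M (insert i J) N)" "y(i := u) \<in> space (Pi\<^sub>M (insert i J) N)" for u
      using x y by (auto simp: space_PiM PiE_def extensional_def)
    \<comment> \<open>The cost \<open>s\<close> of the old coordinates is constant on the two
      fibres; moving it into the second function restores the exact one-dimensional
      hypothesis.\<close>
    have "(\<integral>\<^sup>+u. F (x(i := u)) \<partial>N i) * (\<integral>\<^sup>+u. ennreal (exp (- s / 4)) * G (y(i := u)) \<partial>N i) \<le> 1"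
      unfolding N_def
    proof (rule normal_tau[OF sd_pos])
      fix u v
      have "(\<Sum>k\<in>J. (((x(i := u)) k - (y(i := v)) k) / \<sigma> k)\<^sup>2) = s"
        unfolding s_def using insert.hyps by (intro sum.cong) auto
      then have sumeq: "(\<Sum>k\<in>insert i J. (((x(i := u)) k - (y(i := v)) k) / \<sigma> k)\<^sup>2) = ((u - v) / \<sigma> i)\<^sup>2 + s"
        using insert.hyps by simp
      have "F (x(i := u)) * G (y(i := v)) \<le> ennreal (exp ((((u - v) / \<sigma> i)\<^sup>2 + s) / 4))"
        using insert.prems(3)[OF xy, of u v] unfolding sumeq .
      then have "ennreal (exp (- s / 4)) * (F (x(i := u)) * G (y(i := v))) \<le> ennreal (exp (- s / 4)) * ennreal (exp ((((u - v) / \<sigma> i)\<^sup>2 + s) / 4))"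
        by (rule mult_left_mono) simp
      also have "\<dots> = ennreal (exp (((u - v) / \<sigma> i)\<^sup>2 / 4))"
        by (simp add: add_divide_distrib flip: ennreal_mult exp_add)
      finally show "F (x(i := u)) * (ennreal (exp (- s / 4)) * G (y(i := v))) \<le> ennreal (exp (((u - v) / \<sigma> i)\<^sup>2 / 4))"
        by (simp add: ac_simps)
    qed measurable
    also have "(\<integral>\<^sup>+u. ennreal (exp (- s / 4)) * G (y(i := u)) \<partial>N i) = ennreal (exp (- s / 4)) * G1 y"
      unfolding G1_def by (rule nn_integral_cmult) measurable
    finally have k1: "ennreal (exp (s / 4)) * (F1 x * (ennreal (exp (- s / 4)) * G1 y)) \<le> ennreal (exp (s / 4)) * 1"
      unfolding F1_def by (rule mult_left_mono) simp
    have e1: "ennreal (exp (s / 4)) * ennreal (exp (- s / 4)) = 1"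
      by (simp flip: ennreal_mult exp_add)
    have "F1 x * G1 y = (ennreal (exp (s / 4)) * ennreal (exp (- s / 4))) * (F1 x * G1 y)" unfolding e1 by simp
    also have "\<dots> = ennreal (exp (s / 4)) * (F1 x * (ennreal (exp (- s / 4)) * G1 y))" by (simp only: ac_simps)
    finally have "F1 x * G1 y = ennreal (exp (s / 4)) * (F1 x * (ennreal (exp (- s / 4)) * G1 y))" .
    then show "F1 x * G1 y \<le> ennreal (exp ((\<Sum>k\<in>J. ((x k - y k) / \<sigma> k)\<^sup>2) / 4))"
      unfolding s_def[symmetric] using k1 by simp
  qed
  then show ?case
    using insert.hyps insert.prems by (simp add: P.product_nn_integral_insert F1_def G1_def)
qed

lemma tau:
  assumes "F \<in> borel_measurable (Pi\<^sub>M I N)" "G \<in> borel_measurable (Pi\<^sub>M I N)"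
    and "\<And>x y. x \<in> space (Pi\<^sub>M I N) \<Longrightarrow> y \<in> space (Pi\<^sub>M I N) \<Longrightarrow> F x * G y \<le> ennreal (exp ((wdist x y)\<^sup>2 / 4))"
  shows "(\<integral>\<^sup>+x. F x \<partial>Pi\<^sub>M I N) * (\<integral>\<^sup>+x. G x \<partial>Pi\<^sub>M I N) \<le> 1"
  using tau_aux[OF fin assms(1,2)] assms(3) by (simp add: wdist_sq)

text \<open>Serves the distance to a set, an infimum over a possibly uncountable family. After
  composition with \<open>restrict\<close> the function is continuous on the full product space,
  whose Borel sets are the product sets because the index type is countable.\<close>

lemma lipschitz_measurable:
  fixes f :: "('k \<Rightarrow> real) \<Rightarrow> real"
  assumes "\<And>x y. x \<in> extensional I \<Longrightarrow> y \<in> extensional I \<Longrightarrow> \<bar>f x - f y\<bar> \<le> L * wdist x y"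
  shows "f \<in> borel_measurable (Pi\<^sub>M I N)"
proof -
  define g where "g y = f (restrict y I)" for y
  have lip: "\<bar>g x - g y\<bar> \<le> L * wdist x y" for x y
  proof -
    have "wdist (restrict x I) (restrict y I) = wdist x y"
      unfolding wdist_def by (rule L2_set_cong) auto
    then show ?thesis using assms[of "restrict x I" "restrict y I"] by (simp add: g_def)
  qed
  have cont: "continuous_on UNIV (\<lambda>z. L * wdist z y)" for y
    unfolding wdist_def L2_set_def using sd_pos
    by (intro continuous_intros continuous_on_product_coordinates) (metis less_numeral_extra(3))
  have "continuous_on UNIV g"
  proof (rule continuous_at_imp_continuous_on, rule ballI)
    fix y :: "'k \<Rightarrow> real"
    have "((\<lambda>z. L * wdist z y) \<longlongrightarrow> L * wdist y y) (at y)"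
      using cont[of y] by (auto simp: continuous_on_def)
    then have "((\<lambda>z. L * wdist z y) \<longlongrightarrow> 0) (at y)" by (simp add: wdist_def L2_set_def)
    then have "((\<lambda>z. g z - g y) \<longlongrightarrow> 0) (at y)"
      by (rule Lim_null_comparison[rotated]) (use lip in auto)
    then show "isCont g y" unfolding isCont_def using LIM_zero_cancel by blast
  qed
  then have g: "g \<in> borel_measurable (Pi\<^sub>M UNIV (\<lambda>_. borel))"
    using borel_measurable_continuous_onI measurable_cong_sets[OF sets_PiM_equal_borel refl] by blast
  have e: "(\<lambda>x k. if k \<in> I then x k else 0) \<in> Pi\<^sub>M I N \<rightarrow>\<^sub>M Pi\<^sub>M UNIV (\<lambda>_. borel)"
  proof (rule measurable_PiM_single')
    fix k show "(\<lambda>x. if k \<in> I then x k else 0) \<in> borel_measurable (Pi\<^sub>M I N)"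
      by (cases "k \<in> I") auto
  qed auto
  have "(\<lambda>x. g (\<lambda>k. if k \<in> I then x k else 0)) \<in> borel_measurable (Pi\<^sub>M I N)"
    by (rule measurable_compose[OF e g])
  moreover have "g (\<lambda>k. if k \<in> I then x k else 0) = f x" if "x \<in> space (Pi\<^sub>M I N)" for x
  proof -
    have "restrict (\<lambda>k. if k \<in> I then x k else 0) I = x"
      using that by (auto simp: space_PiM_N extensional_def restrict_def fun_eq_iff)
    then show ?thesis by (simp add: g_def)
  qed
  ultimately show ?thesis by (simp cong: measurable_cong)
qed

text \<open>Property (tau) for \<open>exp (r\<^sup>2 / 4)\<close> times the indicator of the points
  at distance at least \<open>r\<close>, against the indicator of \<open>S\<close>: the transport
  cost of any such pair is at least \<open>r\<^sup>2 / 4\<close>.\<close>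

lemma enlargement:
  assumes S: "S \<in> sets (Pi\<^sub>M I N)" and p: "0 < p" "p \<le> measure (Pi\<^sub>M I N) S" and r: "0 < r"
  obtains B where "B \<in> sets (Pi\<^sub>M I N)" "measure (Pi\<^sub>M I N) B \<le> exp (- r\<^sup>2 / 4) / p"
    "\<And>x. x \<in> space (Pi\<^sub>M I N) \<Longrightarrow> x \<notin> B \<Longrightarrow> \<exists>y\<in>S. wdist x y \<le> r"
proof -
  have "S \<noteq> {}" using p by auto
  define d where "d x = (INF y\<in>S. wdist x y)" for x
  have bdd: "bdd_below ((\<lambda>y. wdist x y) ` S)" for x using wdist_nonneg by (auto intro!: bdd_belowI2)
  have d_le: "d x \<le> wdist x y" if "y \<in> S" for x y unfolding d_def using bdd that by (rule cINF_lower)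
  have d0: "0 \<le> d x" for x unfolding d_def using \<open>S \<noteq> {}\<close> wdist_nonneg by (intro cINF_greatest)
  have lip1: "d x \<le> d y + wdist x y" for x y
  proof -
    have "d x - wdist x y \<le> d y" unfolding d_def[of y]
    proof (rule cINF_greatest[OF \<open>S \<noteq> {}\<close>])
      fix z assume "z \<in> S"
      then show "d x - wdist x y \<le> wdist y z" using d_le[of z x] wdist_triangle[of x z y] by simp
    qed
    then show ?thesis by simp
  qed
  have [measurable]: "d \<in> borel_measurable (Pi\<^sub>M I N)"
  proof (rule lipschitz_measurable[where L=1])
    fix x y show "\<bar>d x - d y\<bar> \<le> 1 * wdist x y" using lip1[of x y] lip1[of y x] wdist_sym[of x y] by simp
  qed
  define B where "B = {x \<in> space (Pi\<^sub>M I N). r \<le> d x}"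
  have B: "B \<in> sets (Pi\<^sub>M I N)" unfolding B_def by measurable
  note [measurable] = B S
  have "(\<integral>\<^sup>+x. ennreal (exp (r\<^sup>2 / 4)) * indicator B x \<partial>Pi\<^sub>M I N) * (\<integral>\<^sup>+x. indicator S x \<partial>Pi\<^sub>M I N) \<le> 1"
  proof (rule tau)
    fix x y assume "x \<in> space (Pi\<^sub>M I N)" "y \<in> space (Pi\<^sub>M I N)"
    have "r\<^sup>2 \<le> (wdist x y)\<^sup>2" if "x \<in> B" "y \<in> S"
      using that d_le[of y x] r by (intro power_mono) (auto simp: B_def)
    then show "ennreal (exp (r\<^sup>2 / 4)) * indicator B x * indicator S y \<le> ennreal (exp ((wdist x y)\<^sup>2 / 4))"
      by (auto simp: indicator_def intro!: ennreal_leI)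
  qed measurable
  then have "ennreal (exp (r\<^sup>2 / 4)) * emeasure (Pi\<^sub>M I N) B * emeasure (Pi\<^sub>M I N) S \<le> 1"
    by (simp add: nn_integral_cmult)
  then have "exp (r\<^sup>2 / 4) * measure (Pi\<^sub>M I N) B * measure (Pi\<^sub>M I N) S \<le> 1"
    by (simp add: P.emeasure_eq_measure flip: ennreal_mult ennreal_1)
  moreover have "exp (r\<^sup>2 / 4) * measure (Pi\<^sub>M I N) B * p \<le> exp (r\<^sup>2 / 4) * measure (Pi\<^sub>M I N) B * measure (Pi\<^sub>M I N) S"
    using p by (intro mult_left_mono) auto
  ultimately have "exp (r\<^sup>2 / 4) * measure (Pi\<^sub>M I N) B * p \<le> 1" by linarith
  then have "measure (Pi\<^sub>M I N) B \<le> exp (- r\<^sup>2 / 4) / p"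
    using p by (simp add: exp_minus field_simps)
  moreover have "\<exists>y\<in>S. wdist x y \<le> r" if "x \<in> space (Pi\<^sub>M I N)" "x \<notin> B" for x
  proof -
    have "d x < r" using that by (simp add: B_def)
    then show ?thesis unfolding d_def using cINF_less_iff[OF \<open>S \<noteq> {}\<close> bdd] by (metis less_imp_le)
  qed
  ultimately show thesis using B that by blast
qed

text \<open>Property (tau) for an exponential weight on the tail event, against
  \<open>exp (l * (E - f x))\<close>. The second integral is at least 1 by Jensen, so the first is
  at most 1.\<close>

lemma lipschitz_tail:
  assumes lip: "\<And>x y. x \<in> extensional I \<Longrightarrow> y \<in> extensional I \<Longrightarrow> \<bar>f x - f y\<bar> \<le> L * wdist x y"
    and int: "integrable (Pi\<^sub>M I N) f" and L: "L > 0" and t: "t > 0"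
  shows "measure (Pi\<^sub>M I N) {x \<in> space (Pi\<^sub>M I N). (\<integral>x. f x \<partial>Pi\<^sub>M I N) + t \<le> f x} \<le> exp (- t\<^sup>2 / (4 * L\<^sup>2))"
proof -
  define E where "E = (\<integral>x. f x \<partial>Pi\<^sub>M I N)"
  \<comment> \<open>The maximiser of \<open>l * t - l\<^sup>2 * L\<^sup>2\<close>.\<close>
  define l where "l = t / (2 * L\<^sup>2)"
  have l: "l > 0" using L t by (simp add: l_def)
  have [measurable]: "f \<in> borel_measurable (Pi\<^sub>M I N)" using int by auto
  define A where "A = {x \<in> space (Pi\<^sub>M I N). E + t \<le> f x}"
  have A: "A \<in> sets (Pi\<^sub>M I N)" unfolding A_def by measurable
  note [measurable] = A
  have "(\<integral>\<^sup>+x. ennreal (exp (l * t - l\<^sup>2 * L\<^sup>2)) * indicator A x \<partial>Pi\<^sub>M I N) * (\<integral>\<^sup>+x. ennreal (exp (l * (E - f x))) \<partial>Pi\<^sub>M I N) \<le> 1"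
  proof (rule tau)
    fix x y assume "x \<in> space (Pi\<^sub>M I N)" "y \<in> space (Pi\<^sub>M I N)"
    then have xy: "f x - f y \<le> L * wdist x y" using lip[of x y] by (auto simp: space_PiM_N)
    have "l * t - l\<^sup>2 * L\<^sup>2 + l * (E - f y) \<le> (wdist x y)\<^sup>2 / 4" if "x \<in> A"
    proof -
      have "l * t + l * (E - f y) \<le> l * (L * wdist x y)"
        using that xy l unfolding distrib_left[symmetric] by (intro mult_left_mono) (auto simp: A_def)
      moreover have "l * (L * wdist x y) \<le> l\<^sup>2 * L\<^sup>2 + (wdist x y)\<^sup>2 / 4"
        using zero_le_power2[of "l * L - wdist x y / 2"] by (simp add: power2_eq_square algebra_simps)
      ultimately show ?thesis by linarith
    qed
    then show "ennreal (exp (l * t - l\<^sup>2 * L\<^sup>2)) * indicator A x * ennreal (exp (l * (E - f y))) \<le> ennreal (exp ((wdist x y)\<^sup>2 / 4))"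
      by (auto simp: indicator_def simp flip: ennreal_mult exp_add)
  qed measurable
  \<comment> \<open>Jensen through \<open>1 + u \<le> exp u\<close>. If the exponential is not
    integrable its integral is infinite, which serves equally well.\<close>
  moreover have ge1: "1 \<le> (\<integral>\<^sup>+x. ennreal (exp (l * (E - f x))) \<partial>Pi\<^sub>M I N)"
  proof (cases "integrable (Pi\<^sub>M I N) (\<lambda>x. exp (l * (E - f x)))")
    case True
    have "1 = (\<integral>x. 1 + l * (E - f x) \<partial>Pi\<^sub>M I N)"
      using int by (simp add: E_def P.P.prob_space)
    also have "\<dots> \<le> (\<integral>x. exp (l * (E - f x)) \<partial>Pi\<^sub>M I N)"
      using True int by (intro integral_mono) auto
    finally have "ennreal 1 \<le> ennreal (\<integral>x. exp (l * (E - f x)) \<partial>Pi\<^sub>M I N)" by (rule ennreal_leI)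
    then show ?thesis using nn_integral_eq_integral[OF True] by simp
  next
    case False
    have "\<not> (\<integral>\<^sup>+x. ennreal (exp (l * (E - f x))) \<partial>Pi\<^sub>M I N) < \<infinity>"
    proof
      assume fin: "(\<integral>\<^sup>+x. ennreal (exp (l * (E - f x))) \<partial>Pi\<^sub>M I N) < \<infinity>"
      have "integrable (Pi\<^sub>M I N) (\<lambda>x. exp (l * (E - f x)))"
        by (rule integrableI_nonneg[OF _ _ fin]) simp_all
      then show False using False by contradiction
    qed
    then show ?thesis unfolding not_less by (rule order_trans[rotated]) simp
  qed
  ultimately have "(\<integral>\<^sup>+x. ennreal (exp (l * t - l\<^sup>2 * L\<^sup>2)) * indicator A x \<partial>Pi\<^sub>M I N) \<le> 1"
    by (rule ennreal_le_one_of_mult)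
  then have "exp (l * t - l\<^sup>2 * L\<^sup>2) * measure (Pi\<^sub>M I N) A \<le> 1"
    by (simp add: nn_integral_cmult P.emeasure_eq_measure flip: ennreal_mult ennreal_1)
  then have "measure (Pi\<^sub>M I N) A \<le> exp (- (l * t - l\<^sup>2 * L\<^sup>2))"
    unfolding exp_minus by (simp add: inverse_eq_divide pos_le_divide_eq mult.commute del: exp_diff)
  also have "l * t - l\<^sup>2 * L\<^sup>2 = t\<^sup>2 / (4 * L\<^sup>2)"
    using L by (simp add: l_def power2_eq_square field_simps)
  finally show ?thesis by (simp add: A_def E_def)
qed

end

section \<open>Gaussian comparison\<close>

lemma normal_density_tendsto_0:
  assumes "\<sigma> > 0"
  shows "(normal_density 0 \<sigma> \<longlongrightarrow> 0) at_top" "(normal_density 0 \<sigma> \<longlongrightarrow> 0) at_bot"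
proof -
  have *: "((\<lambda>x::real. 1 / K * exp (- x\<^sup>2 / c)) \<longlongrightarrow> 0) at_top" "((\<lambda>x::real. 1 / K * exp (- x\<^sup>2 / c)) \<longlongrightarrow> 0) at_bot"
    if "c > 0" for K c :: real
    using that by real_asymp+
  show "(normal_density 0 \<sigma> \<longlongrightarrow> 0) at_top" "(normal_density 0 \<sigma> \<longlongrightarrow> 0) at_bot"
    using *[of "2 * \<sigma>\<^sup>2" "sqrt (2 * pi * \<sigma>\<^sup>2)"] assms by (auto simp: normal_density_def[abs_def])
qed

text \<open>Stein's identity. The derivative of \<open>g x * \<phi> x\<close> is
  \<open>\<phi> x * g' x - \<phi> x * (x * g x) / \<sigma>\<^sup>2\<close>, and its integral
  vanishes because \<open>g\<close> is bounded and the density tends to 0 at both ends.\<close>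

lemma normal_integration_by_parts:
  fixes g g' :: "real \<Rightarrow> real"
  assumes \<sigma>: "\<sigma> > 0"
    and der: "\<And>x. (g has_real_derivative g' x) (at x)"
    and bd: "\<And>x. \<bar>g x\<bar> \<le> C" "\<And>x. \<bar>g' x\<bar> \<le> C"
    and cont: "\<And>x. isCont g' x"
  shows "(\<integral>x. x * g x \<partial>density lborel (normal_density 0 \<sigma>)) = \<sigma>\<^sup>2 * (\<integral>x. g' x \<partial>density lborel (normal_density 0 \<sigma>))"
proof -
  define \<phi> where "\<phi> = normal_density 0 \<sigma>"
  have [measurable]: "\<phi> \<in> borel_measurable borel" by (simp add: \<phi>_def)
  have contg: "isCont g x" for x using der DERIV_isCont by blast
  have [measurable]: "g \<in> borel_measurable borel" "g' \<in> borel_measurable borel"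
    using contg cont by (auto intro!: borel_measurable_continuous_onI continuous_at_imp_continuous_on)
  have der\<phi>: "(\<phi> has_real_derivative - (x / \<sigma>\<^sup>2) * \<phi> x) (at x)" for x
    unfolding \<phi>_def normal_density_def using \<sigma>
    by (auto intro!: derivative_eq_intros simp: field_simps power2_eq_square)
  have \<phi>0: "\<phi> x \<ge> 0" for x by (simp add: \<phi>_def)
  have C0: "C \<ge> 0" using bd(1)[of 0] by linarith
  have i0: "integrable lborel \<phi>" using integrable_normal_moment[OF \<sigma>, of 0 0] by (simp add: \<phi>_def)
  have i1: "integrable lborel (\<lambda>x. \<bar>x\<bar> * \<phi> x)"
    using integrable_abs[OF integrable_normal_moment[OF \<sigma>, of 0 1]] by (simp add: \<phi>_def abs_mult mult.commute)
  have i2: "integrable lborel (\<lambda>x. \<phi> x * g' x)"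
  proof (rule Bochner_Integration.integrable_bound[OF integrable_mult_right[OF i0, of C]])
    have "norm (\<phi> x * g' x) \<le> norm (C * \<phi> x)" for x
      using mult_right_mono[OF bd(2)[of x] \<phi>0[of x]] \<phi>0[of x] C0 by (simp add: abs_mult mult.commute)
    then show "AE x in lborel. norm (\<phi> x * g' x) \<le> norm (C * \<phi> x)" by simp
  qed simp
  have i3: "integrable lborel (\<lambda>x. \<phi> x * (x * g x))"
  proof (rule Bochner_Integration.integrable_bound[OF integrable_mult_right[OF i1, of C]])
    have "norm (\<phi> x * (x * g x)) \<le> norm (C * (\<bar>x\<bar> * \<phi> x))" for x
      using mult_right_mono[OF bd(1)[of x], of "\<bar>x\<bar> * \<phi> x"] \<phi>0[of x] C0 by (simp add: abs_mult ac_simps)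
    then show "AE x in lborel. norm (\<phi> x * (x * g x)) \<le> norm (C * (\<bar>x\<bar> * \<phi> x))" by simp
  qed simp
  define f where "f x = \<phi> x * g' x - (\<phi> x * (x * g x)) / \<sigma>\<^sup>2" for x
  have intf: "integrable lborel f" unfolding f_def using i2 i3 by auto
  have "(LBINT x=-\<infinity>..\<infinity>. f x) = 0 - 0"
  proof (rule interval_integral_FTC_integrable[where F = "\<lambda>x. g x * \<phi> x"])
    fix x :: real
    show "((\<lambda>x. g x * \<phi> x) has_vector_derivative f x) (at x)"
      unfolding has_real_derivative_iff_has_vector_derivative[symmetric] f_def
      by (rule derivative_eq_intros der der\<phi> refl)+ (simp add: field_simps)
    have "isCont \<phi> x" for x using der\<phi> DERIV_isCont by blast
    then show "isCont f x" unfolding f_def using cont contg by (intro continuous_intros) (use \<sigma> in auto)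
    show "set_integrable lborel (einterval (- \<infinity>) \<infinity>) f" using intf by (simp add: set_integrable_def)
    have lim: "((\<lambda>x. g x * \<phi> x) \<longlongrightarrow> 0) F" if "(\<phi> \<longlongrightarrow> 0) F" for F
    proof (rule Lim_null_comparison)
      show "((\<lambda>x. C * \<phi> x) \<longlongrightarrow> 0) F" using tendsto_mult_left[OF that, of C] by simp
      show "\<forall>\<^sub>F x in F. norm (g x * \<phi> x) \<le> C * \<phi> x" using bd \<phi>0 by (intro always_eventually) (auto simp: abs_mult intro!: mult_right_mono)
    qed
    show "(((\<lambda>x. g x * \<phi> x) \<circ> real_of_ereal) \<longlongrightarrow> 0) (at_right (- \<infinity>))"
      "(((\<lambda>x. g x * \<phi> x) \<circ> real_of_ereal) \<longlongrightarrow> 0) (at_left \<infinity>)"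
      using lim[OF normal_density_tendsto_0(1)[OF \<sigma>, folded \<phi>_def]] lim[OF normal_density_tendsto_0(2)[OF \<sigma>, folded \<phi>_def]]
      by (auto simp: ereal_tendsto_simps)
  qed simp
  then have "(\<integral>x. f x \<partial>lborel) = 0" by (simp add: interval_lebesgue_integral_def set_lebesgue_integral_def)
  then have "(\<integral>x. \<phi> x * g' x \<partial>lborel) = (\<integral>x. \<phi> x * (x * g x) \<partial>lborel) / \<sigma>\<^sup>2"
    unfolding f_def using i2 i3 by simp
  then show ?thesis using \<sigma> \<phi>0 by (simp add: integral_density \<phi>_def[symmetric] field_simps)
qed

lemma integral_nonpos:
  fixes f :: "'a \<Rightarrow> real"
  assumes "\<And>x. f x \<le> 0"
  shows "(\<integral>x. f x \<partial>M) \<le> 0"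
  using integral_nonneg_AE[where M = M and f = "\<lambda>x. - f x"] assms by simp

text \<open>A smooth maximum over \<open>V\<close>, too large by at most \<open>ln (card V)\<close>.
  Smoothness is what integration by parts requires; the logarithmic loss is made harmless later by
  scaling the argument.\<close>

definition lse :: "'v set \<Rightarrow> ('v \<Rightarrow> real) \<Rightarrow> real" where
  "lse V h = ln (\<Sum>v\<in>V. exp (h v))"

lemma lse_mono_shift:
  assumes V: "finite V" "V \<noteq> {}" and le: "\<And>v. v \<in> V \<Longrightarrow> h v \<le> h' v + d"
  shows "lse V h \<le> lse V h' + d"
proof -
  have "(\<Sum>v\<in>V. exp (h v)) \<le> (\<Sum>v\<in>V. exp (h' v) * exp d)"
    using le by (intro sum_mono) (simp flip: exp_add)
  also have "\<dots> = (\<Sum>v\<in>V. exp (h' v)) * exp d" by (simp add: sum_distrib_right)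
  finally have "ln (\<Sum>v\<in>V. exp (h v)) \<le> ln ((\<Sum>v\<in>V. exp (h' v)) * exp d)"
    using V by (intro ln_mono) (auto intro!: sum_pos)
  also have "\<dots> = ln (\<Sum>v\<in>V. exp (h' v)) + d"
  proof -
    have "(\<Sum>v\<in>V. exp (h' v)) > 0" using V by (intro sum_pos) auto
    then show ?thesis by (simp add: ln_mult)
  qed
  finally show ?thesis by (simp add: lse_def)
qed

lemma lse_lipschitz:
  assumes "finite V" "V \<noteq> {}" "\<And>v. v \<in> V \<Longrightarrow> \<bar>h v - h' v\<bar> \<le> d"
  shows "\<bar>lse V h - lse V h'\<bar> \<le> d"
  using lse_mono_shift[OF assms(1,2), of h h' d] lse_mono_shift[OF assms(1,2), of h' h d] assms(3)
  by (smt (verit))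

lemma lse_upper:
  assumes V: "finite V" "V \<noteq> {}" and le: "\<And>v. v \<in> V \<Longrightarrow> h v \<le> d"
  shows "lse V h \<le> ln (card V) + d"
  using lse_mono_shift[OF V, of h "\<lambda>_. 0" d] le by (simp add: lse_def)

lemma le_lse:
  assumes V: "finite V" "v \<in> V"
  shows "h v \<le> lse V h"
proof -
  have "exp (h v) \<le> (\<Sum>v\<in>V. exp (h v))" using V by (intro member_le_sum) auto
  then have "ln (exp (h v)) \<le> ln (\<Sum>v\<in>V. exp (h v))"
    using V by (intro ln_mono) (auto intro!: sum_pos)
  then show ?thesis by (simp add: lse_def)
qed

context gaussian_family
begin

lemma integrable_component: "k \<in> I \<Longrightarrow> integrable (Pi\<^sub>M I N) (\<lambda>x. x k)"
proof -
  assume k: "k \<in> I"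
  have "integrable (N k) (\<lambda>x. x)"
    unfolding N_def using integrable_normal_moment[OF sd_pos, of 0 k 1] 
    by (subst integrable_density) auto
  then have "integrable (distr (Pi\<^sub>M I N) (N k) (\<lambda>x. x k)) (\<lambda>x. x)" using P.PiM_component[OF k] by simp
  then show ?thesis using k by (subst (asm) integrable_distr_eq) auto
qed

text \<open>Fubini isolates coordinate \<open>k\<close>; the other coordinates are parameters of the
  one-dimensional identity.\<close>

lemma integration_by_parts:
  assumes k: "k \<in> I"
    and m: "g \<in> borel_measurable (Pi\<^sub>M I N)" "g' \<in> borel_measurable (Pi\<^sub>M I N)"
    and bd: "\<And>x. \<bar>g x\<bar> \<le> C" "\<And>x. \<bar>g' x\<bar> \<le> C"
    and der: "\<And>x y. ((\<lambda>y. g (x(k := y))) has_real_derivative g' (x(k := y))) (at y)"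
    and cont: "\<And>x y. isCont (\<lambda>y. g' (x(k := y))) y"
  shows "(\<integral>x. x k * g x \<partial>Pi\<^sub>M I N) = (\<sigma> k)\<^sup>2 * (\<integral>x. g' x \<partial>Pi\<^sub>M I N)"
proof -
  define J where "J = I - {k}"
  have I: "I = insert k J" "k \<notin> J" "finite J" using k fin by (auto simp: J_def)
  have C0: "C \<ge> 0" using bd(1)[of undefined] by linarith
  have i1: "integrable (Pi\<^sub>M I N) (\<lambda>x. x k * g x)"
  proof (rule Bochner_Integration.integrable_bound[OF integrable_mult_right[OF integrable_abs[OF integrable_component[OF k]], of C]])
    have "norm (x k * g x) \<le> norm (C * \<bar>x k\<bar>)" for x
      using mult_right_mono[OF bd(1)[of x], of "\<bar>x k\<bar>"] C0 by (simp add: abs_mult mult.commute)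
    then show "AE x in Pi\<^sub>M I N. norm (x k * g x) \<le> norm (C * \<bar>x k\<bar>)" by simp
  qed (use m k in simp)
  have i2: "integrable (Pi\<^sub>M I N) g'"
    by (rule P.P.integrable_const_bound[where B=C]) (use bd m in auto)
  have "(\<integral>x. x k * g x \<partial>Pi\<^sub>M I N) = (\<integral>x. (\<integral>y. y * g (x(k := y)) \<partial>N k) \<partial>Pi\<^sub>M J N)"
    using P.product_integral_insert[OF I(3,2), of "\<lambda>x. x k * g x"] i1 by (simp add: I(1)[symmetric])
  also have "\<dots> = (\<integral>x. (\<sigma> k)\<^sup>2 * (\<integral>y. g' (x(k := y)) \<partial>N k) \<partial>Pi\<^sub>M J N)"
    unfolding N_def[of k]
    by (intro Bochner_Integration.integral_cong refl normal_integration_by_parts[OF sd_pos _ bd]) (use der cont in auto)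
  also have "\<dots> = (\<sigma> k)\<^sup>2 * (\<integral>x. g' x \<partial>Pi\<^sub>M I N)"
    using P.product_integral_insert[OF I(3,2), of g'] i2 by (simp add: I(1)[symmetric])
  finally show ?thesis .
qed

text \<open>Interpolation along \<open>sin \<theta> * a + cos \<theta> * b\<close>, from
  \<open>b\<close> at 0 to \<open>a\<close> at \<open>pi / 2\<close>. Integration by parts turns the
  derivative of the expectation into a sum over pairs with nonnegative weights, whose sign is fixed
  by \<open>inc\<close>. Both processes are linear in one Gaussian vector, and \<open>orth\<close>
  makes them uncorrelated.\<close>

lemma sudakov_fernique:
  fixes a b :: "'v \<Rightarrow> 'k \<Rightarrow> real" and w :: "'v \<Rightarrow> real"
  assumes V: "finite V" "V \<noteq> {}"
    and orth: "\<And>u v. u \<in> V \<Longrightarrow> v \<in> V \<Longrightarrow> (\<Sum>k\<in>I. (\<sigma> k)\<^sup>2 * (a u k * b v k)) = 0"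
    and inc: "\<And>u v. u \<in> V \<Longrightarrow> v \<in> V \<Longrightarrow>
       (\<Sum>k\<in>I. (\<sigma> k)\<^sup>2 * (a v k * a v k - b v k * b v k)) \<le> (\<Sum>k\<in>I. (\<sigma> k)\<^sup>2 * (a v k * a u k - b v k * b u k))"
  shows "(\<integral>x. lse V (\<lambda>v. w v + (\<Sum>k\<in>I. a v k * x k)) \<partial>Pi\<^sub>M I N) \<le> (\<integral>x. lse V (\<lambda>v. w v + (\<Sum>k\<in>I. b v k * x k)) \<partial>Pi\<^sub>M I N)"
proof -
  define c where "c \<theta> v k = sin \<theta> * a v k + cos \<theta> * b v k" for \<theta> v k
  define c' where "c' \<theta> v k = cos \<theta> * a v k - sin \<theta> * b v k" for \<theta> v k
  define H where "H \<theta> v x = w v + (\<Sum>k\<in>I. c \<theta> v k * x k)" for \<theta> v x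
  define H' where "H' \<theta> v x = (\<Sum>k\<in>I. c' \<theta> v k * x k)" for \<theta> v x
  define Z where "Z \<theta> x = (\<Sum>v\<in>V. exp (H \<theta> v x))" for \<theta> x
  \<comment> \<open>The Gibbs weights, which are the partial derivatives of the smooth
    maximum.\<close>
  define p where "p \<theta> v x = exp (H \<theta> v x) / Z \<theta> x" for \<theta> v x
  define G where "G \<theta> x = (\<Sum>v\<in>V. p \<theta> v x * H' \<theta> v x)" for \<theta> x
  define B where "B x = (\<Sum>v\<in>V. \<Sum>k\<in>I. (\<bar>a v k\<bar> + \<bar>b v k\<bar>) * \<bar>x k\<bar>)" for x
  have Zpos: "Z \<theta> x > 0" for \<theta> x unfolding Z_def using V by (intro sum_pos) auto
  have p0: "0 \<le> p \<theta> v x" for \<theta> v x using Zpos[of \<theta> x] by (simp add: p_def)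
  have psum: "(\<Sum>v\<in>V. p \<theta> v x) = 1" for \<theta> x
    using Zpos[of \<theta> x] by (simp add: p_def flip: sum_divide_distrib Z_def)
  have p1: "p \<theta> v x \<le> 1" if "v \<in> V" for \<theta> v x
    using member_le_sum[of v V "\<lambda>v. p \<theta> v x"] that V p0 by (simp add: psum)
  have c'le: "\<bar>c' \<theta> v k\<bar> \<le> \<bar>a v k\<bar> + \<bar>b v k\<bar>" for \<theta> v k
  proof -
    have "\<bar>c' \<theta> v k\<bar> \<le> \<bar>cos \<theta>\<bar> * \<bar>a v k\<bar> + \<bar>sin \<theta>\<bar> * \<bar>b v k\<bar>"
      unfolding c'_def by (metis abs_mult abs_triangle_ineq4)
    also have "\<dots> \<le> 1 * \<bar>a v k\<bar> + 1 * \<bar>b v k\<bar>" by (intro add_mono mult_right_mono) auto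
    finally show ?thesis by simp
  qed
  have GB: "\<bar>G \<theta> x\<bar> \<le> B x" for \<theta> x
  proof -
    have "\<bar>G \<theta> x\<bar> \<le> (\<Sum>v\<in>V. \<bar>p \<theta> v x * H' \<theta> v x\<bar>)" unfolding G_def by (rule sum_abs)
    also have "\<dots> \<le> (\<Sum>v\<in>V. 1 * \<bar>H' \<theta> v x\<bar>)"
      using p0 p1 by (intro sum_mono) (simp add: abs_mult mult_left_le_one_le)
    also have "\<dots> \<le> B x" unfolding B_def H'_def mult_1
      using c'le by (intro sum_mono order_trans[OF sum_abs]) (simp add: abs_mult mult_right_mono)
    finally show ?thesis .
  qed
  have intB: "integrable (Pi\<^sub>M I N) B"
    unfolding B_def using integrable_component by (intro Bochner_Integration.integrable_sum integrable_mult_right integrable_abs) auto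
  have mp [measurable]: "(\<lambda>x. x k) \<in> borel_measurable (Pi\<^sub>M I N)" if "k \<in> I" for k
    using integrable_component[OF that] by auto
  have lseint: "integrable (Pi\<^sub>M I N) (\<lambda>x. ln (Z \<theta> x))" for \<theta>
  proof (rule Bochner_Integration.integrable_bound)
    show "integrable (Pi\<^sub>M I N) (\<lambda>x. ln (card V) + (\<Sum>v\<in>V. \<bar>w v\<bar> + (\<Sum>k\<in>I. \<bar>c \<theta> v k\<bar> * \<bar>x k\<bar>)))"
      using integrable_component
      by (intro Bochner_Integration.integrable_add Bochner_Integration.integrable_sum integrable_mult_right integrable_abs P.P.integrable_const) auto
    show "(\<lambda>x. ln (Z \<theta> x)) \<in> borel_measurable (Pi\<^sub>M I N)" unfolding Z_def H_def by measurable
    have "norm (ln (Z \<theta> x)) \<le> norm (ln (card V) + (\<Sum>v\<in>V. \<bar>w v\<bar> + (\<Sum>k\<in>I. \<bar>c \<theta> v k\<bar> * \<bar>x k\<bar>)))" for x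
    proof -
      define S where "S = (\<Sum>v\<in>V. \<bar>w v\<bar> + (\<Sum>k\<in>I. \<bar>c \<theta> v k\<bar> * \<bar>x k\<bar>))"
      have Hs: "\<bar>H \<theta> v x\<bar> \<le> S" if "v \<in> V" for v
      proof -
        have "\<bar>H \<theta> v x\<bar> \<le> \<bar>w v\<bar> + (\<Sum>k\<in>I. \<bar>c \<theta> v k * x k\<bar>)" unfolding H_def
          by (intro order_trans[OF abs_triangle_ineq] add_left_mono sum_abs)
        also have "\<dots> = \<bar>w v\<bar> + (\<Sum>k\<in>I. \<bar>c \<theta> v k\<bar> * \<bar>x k\<bar>)" by (simp add: abs_mult)
        also have "\<dots> \<le> S" unfolding S_def using that V
          by (intro member_le_sum) (auto intro!: add_nonneg_nonneg sum_nonneg)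
        finally show ?thesis .
      qed
      obtain v0 where v0: "v0 \<in> V" using V by auto
      have "ln (Z \<theta> x) \<le> ln (card V) + S"
        using lse_upper[OF V, of "\<lambda>v. H \<theta> v x" S] Hs by (auto simp: lse_def Z_def abs_le_iff)
      moreover have "- S \<le> ln (Z \<theta> x)"
        using le_lse[OF V(1) v0, of "\<lambda>v. H \<theta> v x"] Hs[OF v0] by (auto simp: lse_def Z_def abs_le_iff)
      moreover have "0 \<le> ln (card V)" using V by (simp add: Suc_le_eq card_gt_0_iff)
      ultimately show ?thesis unfolding S_def[symmetric] by (simp add: abs_le_iff)
    qed
    then show "AE x in Pi\<^sub>M I N. norm (ln (Z \<theta> x)) \<le> norm (ln (card V) + (\<Sum>v\<in>V. \<bar>w v\<bar> + (\<Sum>k\<in>I. \<bar>c \<theta> v k\<bar> * \<bar>x k\<bar>)))"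
      by simp
  qed
  have derc: "((\<lambda>\<theta>. c \<theta> v k) has_real_derivative c' \<theta> v k) (at \<theta>)" for v k \<theta>
    unfolding c_def c'_def by (auto intro!: derivative_eq_intros)
  have derH: "((\<lambda>\<theta>. H \<theta> v x) has_real_derivative H' \<theta> v x) (at \<theta>)" for v x \<theta>
    unfolding H_def H'_def by (rule derivative_eq_intros derc refl DERIV_sum)+ simp
  have derZ: "((\<lambda>\<theta>. ln (Z \<theta> x)) has_real_derivative G \<theta> x) (at \<theta>)" for x \<theta>
  proof -
    have "((\<lambda>\<theta>. Z \<theta> x) has_real_derivative (\<Sum>v\<in>V. exp (H \<theta> v x) * H' \<theta> v x)) (at \<theta>)"
      unfolding Z_def by (intro DERIV_sum DERIV_fun_exp derH)
    from DERIV_chain2[OF DERIV_ln_divide[OF Zpos] this]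
    show ?thesis by (simp add: G_def p_def sum_divide_distrib)
  qed
  have contG: "isCont (\<lambda>\<theta>. G \<theta> x) \<theta>" for x \<theta>
  proof -
    have "isCont (\<lambda>\<theta>. Z \<theta> x) \<theta>" unfolding Z_def H_def c_def by (intro continuous_intros)
    then show ?thesis unfolding G_def p_def H'_def c'_def H_def c_def
      using less_imp_neq[OF Zpos[of \<theta> x]] by (intro continuous_intros) auto
  qed
  \<comment> \<open>The indicator makes the integral over \<theta> a Lebesgue integral on the whole
    line, ready for Fubini.\<close>
  define ind where "ind = (indicator {0..pi/2} :: real \<Rightarrow> real)"
  have ftc: "(\<integral>\<theta>. G \<theta> x * ind \<theta> \<partial>lborel) = ln (Z (pi/2) x) - ln (Z 0 x)" for x
    unfolding ind_def by (rule integral_FTC_Icc_real) (use derZ contG in auto)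
  interpret Q: pair_sigma_finite "Pi\<^sub>M I N" lborel ..
  have [measurable]: "ind \<in> borel_measurable borel" by (simp add: ind_def)
  have measG: "(\<lambda>(x, \<theta>). G \<theta> x * ind \<theta>) \<in> borel_measurable (Pi\<^sub>M I N \<Otimes>\<^sub>M lborel)"
    unfolding G_def p_def Z_def H'_def H_def c'_def c_def by measurable
  have dom: "integrable (Pi\<^sub>M I N \<Otimes>\<^sub>M lborel) (\<lambda>(x, \<theta>). B x * ind \<theta>)"
  proof (rule Q.Fubini_integrable)
    have [measurable]: "B \<in> borel_measurable (Pi\<^sub>M I N)" using intB by auto
    show "(\<lambda>(x, \<theta>). B x * ind \<theta>) \<in> borel_measurable (Pi\<^sub>M I N \<Otimes>\<^sub>M lborel)" by measurable
    have i: "integrable lborel ind" unfolding ind_def by (simp add: integrable_indicator_iff emeasure_lborel_Icc_eq)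
    have "(\<lambda>x. \<integral>\<theta>. norm (case (x, \<theta>) of (x, \<theta>) \<Rightarrow> B x * ind \<theta>) \<partial>lborel) = (\<lambda>x. \<bar>B x\<bar> * (\<integral>\<theta>. ind \<theta> \<partial>lborel))"
      by (auto simp: abs_mult ind_def)
    then show "integrable (Pi\<^sub>M I N) (\<lambda>x. \<integral>\<theta>. norm (case (x, \<theta>) of (x, \<theta>) \<Rightarrow> B x * ind \<theta>) \<partial>lborel)"
      using intB by simp
    show "AE x in Pi\<^sub>M I N. integrable lborel (\<lambda>\<theta>. case (x, \<theta>) of (x, \<theta>) \<Rightarrow> B x * ind \<theta>)"
      using i by simp
  qed
  have intG: "integrable (Pi\<^sub>M I N \<Otimes>\<^sub>M lborel) (\<lambda>(x, \<theta>). G \<theta> x * ind \<theta>)"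
  proof (rule Bochner_Integration.integrable_bound[OF dom measG])
    show "AE z in Pi\<^sub>M I N \<Otimes>\<^sub>M lborel. norm (case z of (x, \<theta>) \<Rightarrow> G \<theta> x * ind \<theta>) \<le> norm (case z of (x, \<theta>) \<Rightarrow> B x * ind \<theta>)"
    proof (rule AE_I2, clarsimp simp: abs_mult ind_def)
      fix x \<theta> show "\<bar>G \<theta> x\<bar> * indicator {0..pi/2} \<theta> \<le> \<bar>B x\<bar> * indicator {0..pi/2} \<theta>"
        using GB[of \<theta> x] by (intro mult_right_mono) auto
    qed
  qed
  have neg: "(\<integral>x. G \<theta> x \<partial>Pi\<^sub>M I N) \<le> 0" if \<theta>: "\<theta> \<in> {0..pi/2}" for \<theta>
  proof -
    \<comment> \<open>The derivative of the Gibbs weight of \<open>v\<close> in coordinate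
      \<open>k\<close>.\<close>
    define d where "d v k x = p \<theta> v x * (c \<theta> v k - (\<Sum>u\<in>V. p \<theta> u x * c \<theta> u k))" for v k x
    define K where "K v k = \<bar>c \<theta> v k\<bar> + (\<Sum>u\<in>V. \<bar>c \<theta> u k\<bar>)" for v k
    have mpv [measurable]: "p \<theta> v \<in> borel_measurable (Pi\<^sub>M I N)" for v
      unfolding p_def Z_def H_def by measurable
    have md [measurable]: "d v k \<in> borel_measurable (Pi\<^sub>M I N)" for v k unfolding d_def by measurable
    have dK: "\<bar>d v k x\<bar> \<le> K v k" if "v \<in> V" for v k x
    proof -
      have "\<bar>\<Sum>u\<in>V. p \<theta> u x * c \<theta> u k\<bar> \<le> (\<Sum>u\<in>V. \<bar>c \<theta> u k\<bar>)"
        using p0 p1 by (intro order_trans[OF sum_abs] sum_mono) (simp add: abs_mult mult_left_le_one_le)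
      then have "\<bar>c \<theta> v k - (\<Sum>u\<in>V. p \<theta> u x * c \<theta> u k)\<bar> \<le> K v k" unfolding K_def by linarith
      moreover have "\<bar>d v k x\<bar> \<le> \<bar>c \<theta> v k - (\<Sum>u\<in>V. p \<theta> u x * c \<theta> u k)\<bar>"
        unfolding d_def using p0 p1[OF that] by (simp add: abs_mult mult_left_le_one_le)
      ultimately show ?thesis by linarith
    qed
    have intd: "integrable (Pi\<^sub>M I N) (d v k)" if "v \<in> V" for v k
      by (rule P.P.integrable_const_bound[where B="K v k"]) (use dK[OF that] in auto)
    have intxp: "integrable (Pi\<^sub>M I N) (\<lambda>x. x k * p \<theta> v x)" if "k \<in> I" "v \<in> V" for k v
      by (rule Bochner_Integration.integrable_bound[OF integrable_component[OF that(1)]])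
        (use p0 p1[OF that(2)] that in \<open>auto simp: abs_mult mult_right_le_one_le\<close>)
    have ibp: "(\<integral>x. x k * p \<theta> v x \<partial>Pi\<^sub>M I N) = (\<sigma> k)\<^sup>2 * (\<integral>x. d v k x \<partial>Pi\<^sub>M I N)" if k: "k \<in> I" and v: "v \<in> V" for k v
    proof (rule integration_by_parts[OF k mpv md, where C = "1 + K v k"])
      show "\<bar>p \<theta> v x\<bar> \<le> 1 + K v k" for x
      proof -
        have "0 \<le> K v k" unfolding K_def by (intro add_nonneg_nonneg sum_nonneg) auto
        then show ?thesis using p0[of \<theta> v x] p1[OF v, of \<theta> x] by simp
      qed
      show "\<bar>d v k x\<bar> \<le> 1 + K v k" for x using dK[OF v, of k x] by simp
      have Hupd: "H \<theta> u (x(k := y)) = (w u + (\<Sum>j\<in>I - {k}. c \<theta> u j * x j)) + c \<theta> u k * y" for u x y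
        unfolding H_def using fin k by (subst sum.remove[OF fin k]) (auto intro!: sum.cong)
      have dH: "((\<lambda>y. H \<theta> u (x(k := y))) has_real_derivative c \<theta> u k) (at y)" for u x y
        unfolding Hupd by (auto intro!: derivative_eq_intros)
      have dZ: "((\<lambda>y. Z \<theta> (x(k := y))) has_real_derivative (\<Sum>u\<in>V. exp (H \<theta> u (x(k := y))) * c \<theta> u k)) (at y)" for x y
        unfolding Z_def by (intro DERIV_sum DERIV_fun_exp dH)
      show dp: "((\<lambda>y. p \<theta> v (x(k := y))) has_real_derivative d v k (x(k := y))) (at y)" for x y
      proof -
        define Zy where "Zy = Z \<theta> (x(k := y))"
        have Zy: "Zy > 0" "Zy \<noteq> 0" using Zpos[of \<theta> "x(k := y)"] by (auto simp: Zy_def)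
        define s where "s = (\<Sum>u\<in>V. exp (H \<theta> u (x(k := y))) * c \<theta> u k)"
        have s: "(\<Sum>u\<in>V. p \<theta> u (x(k := y)) * c \<theta> u k) = s / Zy"
          by (simp add: p_def s_def Zy_def sum_divide_distrib)
        define e where "e = exp (H \<theta> v (x(k := y)))"
        have "((\<lambda>y. p \<theta> v (x(k := y))) has_real_derivative (e * c \<theta> v k * Zy - e * s) / (Zy * Zy)) (at y)"
          unfolding p_def e_def Zy_def s_def
          by (rule DERIV_divide[OF DERIV_fun_exp[OF dH] dZ]) (use Zpos[of \<theta> "x(k := y)"] in auto)
        moreover have "(e * c \<theta> v k * Zy - e * s) / (Zy * Zy) = d v k (x(k := y))"
          unfolding d_def s using Zy by (simp add: p_def e_def[symmetric] Zy_def[symmetric] field_simps)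
        ultimately show ?thesis by simp
      qed
      have cp: "isCont (\<lambda>y. p \<theta> u (x(k := y))) y" for u x y
      proof -
        have "isCont (\<lambda>y. H \<theta> u (x(k := y))) y" using dH DERIV_isCont by blast
        moreover have "isCont (\<lambda>y. Z \<theta> (x(k := y))) y" using dZ DERIV_isCont by blast
        ultimately show ?thesis unfolding p_def using less_imp_neq[OF Zpos[of \<theta> "x(k := y)"]] by (intro continuous_intros) auto
      qed
      show "isCont (\<lambda>y. d v k (x(k := y))) y" for x y
        unfolding d_def by (intro continuous_intros cp)
    qed
    have Gx: "G \<theta> x = (\<Sum>v\<in>V. \<Sum>k\<in>I. c' \<theta> v k * (x k * p \<theta> v x))" for x
      unfolding G_def H'_def by (simp add: sum_distrib_left ac_simps)
    have "(\<integral>x. G \<theta> x \<partial>Pi\<^sub>M I N) = (\<Sum>v\<in>V. \<Sum>k\<in>I. c' \<theta> v k * ((\<sigma> k)\<^sup>2 * (\<integral>x. d v k x \<partial>Pi\<^sub>M I N)))"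
      unfolding Gx using intxp by (simp add: Bochner_Integration.integral_sum ibp)
    also have "\<dots> = (\<integral>x. (\<Sum>v\<in>V. \<Sum>k\<in>I. c' \<theta> v k * ((\<sigma> k)\<^sup>2 * d v k x)) \<partial>Pi\<^sub>M I N)"
      using intd by (simp add: Bochner_Integration.integral_sum)
    also have "\<dots> \<le> 0"
    proof -
      have "(\<Sum>v\<in>V. \<Sum>k\<in>I. c' \<theta> v k * ((\<sigma> k)\<^sup>2 * d v k x)) \<le> 0" for x
      proof -
        define D where "D v u = (\<Sum>k\<in>I. (\<sigma> k)\<^sup>2 * (a v k * a u k - b v k * b u k))" for v u
        \<comment> \<open>The covariance of one process with the derivative of the other: the mixed
          terms vanish by \<open>orth\<close>, and only the difference of the two covariances
          remains.\<close>
        have cc: "(\<Sum>k\<in>I. (\<sigma> k)\<^sup>2 * (c' \<theta> v k * c \<theta> u k)) = sin \<theta> * cos \<theta> * D v u" if "v \<in> V" "u \<in> V" for v u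
        proof -
          have "(\<Sum>k\<in>I. (\<sigma> k)\<^sup>2 * (c' \<theta> v k * c \<theta> u k)) = (\<Sum>k\<in>I. sin \<theta> * cos \<theta> * ((\<sigma> k)\<^sup>2 * (a v k * a u k - b v k * b u k))
             + (cos \<theta>)\<^sup>2 * ((\<sigma> k)\<^sup>2 * (a v k * b u k)) - (sin \<theta>)\<^sup>2 * ((\<sigma> k)\<^sup>2 * (a u k * b v k)))"
            by (intro sum.cong refl) (simp add: c_def c'_def power2_eq_square algebra_simps)
          also have "\<dots> = sin \<theta> * cos \<theta> * D v u + (cos \<theta>)\<^sup>2 * (\<Sum>k\<in>I. (\<sigma> k)\<^sup>2 * (a v k * b u k)) - (sin \<theta>)\<^sup>2 * (\<Sum>k\<in>I. (\<sigma> k)\<^sup>2 * (a u k * b v k))"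
            by (simp add: D_def sum.distrib sum_subtractf sum_distrib_left)
          finally show ?thesis using orth[of v u] orth[of u v] that by simp
        qed
        \<comment> \<open>Since the weights sum to 1, centring at the Gibbs mean is a weighted sum
          of pairwise differences.\<close>
        have dd: "d v k x = (\<Sum>u\<in>V. p \<theta> v x * p \<theta> u x * (c \<theta> v k - c \<theta> u k))" for v k
        proof -
          have "(\<Sum>u\<in>V. p \<theta> v x * p \<theta> u x * (c \<theta> v k - c \<theta> u k)) = p \<theta> v x * ((\<Sum>u\<in>V. p \<theta> u x) * c \<theta> v k - (\<Sum>u\<in>V. p \<theta> u x * c \<theta> u k))"
            by (simp add: sum_distrib_left sum_distrib_right sum_subtractf algebra_simps)
          then show ?thesis by (simp add: d_def psum)
        qed
        have "(\<Sum>v\<in>V. \<Sum>k\<in>I. c' \<theta> v k * ((\<sigma> k)\<^sup>2 * d v k x)) = (\<Sum>v\<in>V. \<Sum>k\<in>I. \<Sum>u\<in>V. p \<theta> v x * p \<theta> u x * ((\<sigma> k)\<^sup>2 * (c' \<theta> v k * c \<theta> v k) - (\<sigma> k)\<^sup>2 * (c' \<theta> v k * c \<theta> u k)))"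
          unfolding dd by (simp add: sum_distrib_left algebra_simps)
        also have "\<dots> = (\<Sum>v\<in>V. \<Sum>u\<in>V. \<Sum>k\<in>I. p \<theta> v x * p \<theta> u x * ((\<sigma> k)\<^sup>2 * (c' \<theta> v k * c \<theta> v k) - (\<sigma> k)\<^sup>2 * (c' \<theta> v k * c \<theta> u k)))"
          by (intro sum.cong refl sum.swap)
        also have "\<dots> = (\<Sum>v\<in>V. \<Sum>u\<in>V. p \<theta> v x * p \<theta> u x * (sin \<theta> * cos \<theta> * (D v v - D v u)))"
          by (intro sum.cong refl) (simp add: sum_subtractf cc right_diff_distrib flip: sum_distrib_left)
        also have "\<dots> \<le> 0"
        proof (intro sum_nonpos)
          fix v u assume "v \<in> V" "u \<in> V"
          then have "D v v - D v u \<le> 0" using inc[of u v] by (simp add: D_def)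
          moreover have "0 \<le> sin \<theta> * cos \<theta>" using \<theta> by (intro mult_nonneg_nonneg sin_ge_zero cos_ge_zero) auto
          ultimately have "sin \<theta> * cos \<theta> * (D v v - D v u) \<le> 0" by (simp add: mult_nonneg_nonpos)
          then show "p \<theta> v x * p \<theta> u x * (sin \<theta> * cos \<theta> * (D v v - D v u)) \<le> 0"
            by (rule mult_nonneg_nonpos[OF mult_nonneg_nonneg[OF p0 p0]])
        qed
        finally show ?thesis .
      qed
      then show ?thesis by (rule integral_nonpos)
    qed
    finally show ?thesis .
  qed
  have "(\<integral>x. ln (Z (pi/2) x) \<partial>Pi\<^sub>M I N) - (\<integral>x. ln (Z 0 x) \<partial>Pi\<^sub>M I N) = (\<integral>x. (\<integral>\<theta>. G \<theta> x * ind \<theta> \<partial>lborel) \<partial>Pi\<^sub>M I N)"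
    unfolding ftc using lseint by simp
  also have "\<dots> = (\<integral>\<theta>. (\<integral>x. G \<theta> x * ind \<theta> \<partial>Pi\<^sub>M I N) \<partial>lborel)"
    by (rule Q.Fubini_integral[symmetric]) (rule intG)
  also have "\<dots> \<le> 0"
  proof (rule integral_nonpos)
    fix \<theta> show "(\<integral>x. G \<theta> x * ind \<theta> \<partial>Pi\<^sub>M I N) \<le> 0"
      using neg[of \<theta>] by (cases "\<theta> \<in> {0..pi/2}") (simp_all add: ind_def)
  qed
  finally have "(\<integral>x. ln (Z (pi/2) x) \<partial>Pi\<^sub>M I N) \<le> (\<integral>x. ln (Z 0 x) \<partial>Pi\<^sub>M I N)" by simp
  then show ?thesis by (simp add: lse_def Z_def H_def c_def)
qed

end

section \<open>Quadratic forms of Gaussian vectors\<close>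

context gaussian_family
begin

definition mom :: "'k \<Rightarrow> nat \<Rightarrow> real" where "mom k m = (\<integral>x. x ^ m \<partial>N k)"

lemma integrable_power_N: "integrable (N k) (\<lambda>x. x ^ m)"
  unfolding N_def using integrable_normal_moment[OF sd_pos, of 0 k m]
  by (subst integrable_density) auto

lemma mom_eq: "mom k m = (\<integral>x. normal_density 0 (\<sigma> k) x * x ^ m \<partial>lborel)"
  unfolding mom_def N_def by (subst integral_density) auto

lemma mom_odd: "odd m \<Longrightarrow> mom k m = 0"
  using integral_normal_moment_odd[OF sd_pos, of 0 k "m div 2"] by (auto simp: mom_eq elim!: oddE)

lemma mom_values: "mom k 0 = 1" "mom k 2 = (\<sigma> k)\<^sup>2" "mom k 4 = 3 * (\<sigma> k) ^ 4"
proof -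
  show "mom k 0 = 1" using integral_normal_moment_even[OF sd_pos, of 0 k 0] by (simp add: mom_eq)
  show "mom k 2 = (\<sigma> k)\<^sup>2" using integral_normal_moment_even[OF sd_pos, of 0 k 1] sd_pos[of k]
    by (simp add: mom_eq)
  show "mom k 4 = 3 * (\<sigma> k) ^ 4" using integral_normal_moment_even[OF sd_pos, of 0 k 2] sd_pos[of k]
    by (simp add: mom_eq fact_numeral power_divide field_simps)
qed

lemma
  assumes J: "finite J"
  shows integrable_monomial: "integrable (Pi\<^sub>M J N) (\<lambda>y. \<Prod>k\<in>J. (y k) ^ e k)"
    and integral_monomial: "(\<integral>y. (\<Prod>k\<in>J. (y k) ^ e k) \<partial>Pi\<^sub>M J N) = (\<Prod>k\<in>J. mom k (e k))"
  using P.product_integrable_prod[OF J, of "\<lambda>k x. x ^ e k"] P.product_integral_prod[OF J, of "\<lambda>k x. x ^ e k"]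
    integrable_power_N by (auto simp: mom_def)

lemma prod_power_of_bool:
  fixes y :: "'k \<Rightarrow> real"
  assumes "finite J" "p \<in> J"
  shows "(\<Prod>k\<in>J. (y k) ^ of_bool (k = p)) = y p"
proof -
  have "(\<Prod>k\<in>J. (y k) ^ of_bool (k = p)) = (\<Prod>k\<in>J. if k = p then y k else 1)"
    by (intro prod.cong) auto
  also have "\<dots> = y p" using assms by (simp add: prod.delta)
  finally show ?thesis .
qed

lemma integral_two:
  assumes J: "finite J" and pq: "p \<in> J" "q \<in> J"
  shows "integrable (Pi\<^sub>M J N) (\<lambda>y. y p * y q)"
    and "(\<integral>y. y p * y q \<partial>Pi\<^sub>M J N) = (if p = q then (\<sigma> p)\<^sup>2 else 0)"
proof -
  define e :: "'k \<Rightarrow> nat" where "e k = of_bool (k = p) + of_bool (k = q)" for k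
  have eq: "(\<lambda>y. y p * y q) = (\<lambda>y. \<Prod>k\<in>J. (y k :: real) ^ e k)"
    using pq J by (simp add: e_def power_add prod.distrib prod_power_of_bool)
  show "integrable (Pi\<^sub>M J N) (\<lambda>y. y p * y q)" unfolding eq by (rule integrable_monomial[OF J])
  have "(\<integral>y. y p * y q \<partial>Pi\<^sub>M J N) = (\<Prod>k\<in>J. mom k (e k))" unfolding eq by (rule integral_monomial[OF J])
  also have "\<dots> = (if p = q then (\<sigma> p)\<^sup>2 else 0)"
  proof (cases "p = q")
    case True
    have "(\<Prod>k\<in>J. mom k (e k)) = (\<Prod>k\<in>{p}. mom k (e k))"
      using J pq True by (intro prod.mono_neutral_right) (auto simp: e_def mom_values)
    then show ?thesis using True by (simp add: e_def mom_values numeral_2_eq_2[symmetric])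
  next
    case False
    have "\<exists>k\<in>J. mom k (e k) = 0" using False pq by (intro bexI[of _ p]) (auto simp: e_def mom_odd)
    then show ?thesis using J False by (simp add: prod_zero)
  qed
  finally show "(\<integral>y. y p * y q \<partial>Pi\<^sub>M J N) = (if p = q then (\<sigma> p)\<^sup>2 else 0)" .
qed

text \<open>Wick's formula as a sum over the three pairings. When the four indices coincide, all
  three indicators equal 1 and reproduce the fourth moment \<open>3 * s ^ 4\<close>. The exponents
  \<open>e\<close> count how often each coordinate occurs, and an odd count kills the
  integral.\<close>

lemma integral_four:
  assumes J: "finite J" and pq: "p \<in> J" "q \<in> J" "r \<in> J" "t \<in> J" and s: "\<And>k. k \<in> J \<Longrightarrow> \<sigma> k = s"
  shows "integrable (Pi\<^sub>M J N) (\<lambda>y. y p * y q * y r * y t)"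
    and "(\<integral>y. y p * y q * y r * y t \<partial>Pi\<^sub>M J N)
      = s ^ 4 * (of_bool (p = q \<and> r = t) + of_bool (p = r \<and> q = t) + of_bool (p = t \<and> q = r))"
proof -
  define e :: "'k \<Rightarrow> nat" where "e k = of_bool (k = p) + of_bool (k = q) + of_bool (k = r) + of_bool (k = t)" for k
  have eq: "(\<lambda>y. y p * y q * y r * y t) = (\<lambda>y. \<Prod>k\<in>J. (y k :: real) ^ e k)"
    using pq J by (simp add: e_def power_add prod.distrib prod_power_of_bool)
  show "integrable (Pi\<^sub>M J N) (\<lambda>y. y p * y q * y r * y t)" unfolding eq by (rule integrable_monomial[OF J])
  have zero: "(\<Prod>k\<in>J. mom k (e k)) = 0" if "k0 \<in> J" "odd (e k0)" for k0
    using J that mom_odd by (intro prod_zero) auto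
  have two: "(\<Prod>k\<in>J. mom k (e k)) = s ^ 4" if ab: "a \<in> J" "b \<in> J" "a \<noteq> b" "e a = 2" "e b = 2" and oth: "\<And>k. k \<noteq> a \<Longrightarrow> k \<noteq> b \<Longrightarrow> e k = 0" for a b
  proof -
    have "(\<Prod>k\<in>J. mom k (e k)) = (\<Prod>k\<in>{a, b}. mom k (e k))"
      using J ab oth by (intro prod.mono_neutral_right) (auto simp: mom_values)
    then show ?thesis using ab s by (simp add: mom_values power2_eq_square power4_eq_xxxx)
  qed
  have "(\<integral>y. y p * y q * y r * y t \<partial>Pi\<^sub>M J N) = (\<Prod>k\<in>J. mom k (e k))" unfolding eq by (rule integral_monomial[OF J])
  also have "\<dots> = s ^ 4 * (of_bool (p = q \<and> r = t) + of_bool (p = r \<and> q = t) + of_bool (p = t \<and> q = r))"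
  proof (cases "p = q")
    case pq': True
    show ?thesis
    proof (cases "r = t")
      case rt: True
      show ?thesis
      proof (cases "p = r")
        case True
        have "(\<Prod>k\<in>J. mom k (e k)) = (\<Prod>k\<in>{p}. mom k (e k))"
          using J pq pq' rt True by (intro prod.mono_neutral_right) (auto simp: e_def mom_values)
        moreover have "e p = 4" using pq' rt True by (simp add: e_def)
        ultimately show ?thesis using pq' rt True pq s by (simp add: mom_values)
      next
        case False
        have "(\<Prod>k\<in>J. mom k (e k)) = s ^ 4"
          by (rule two[of p r]) (use pq' rt False pq in \<open>auto simp: e_def\<close>)
        then show ?thesis using pq' rt False by simp
      qed
    next
      case False
      then have "odd (e r)" using pq' by (auto simp: e_def)
      then have "(\<Prod>k\<in>J. mom k (e k)) = 0" by (rule zero[OF pq(3)])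
      then show ?thesis using pq' False by auto
    qed
  next
    case npq: False
    show ?thesis
    proof (cases "(p = r \<and> q = t) \<or> (p = t \<and> q = r)")
      case True
      have "(\<Prod>k\<in>J. mom k (e k)) = s ^ 4"
        by (rule two[of p q]) (use npq True pq in \<open>auto simp: e_def\<close>)
      then show ?thesis using npq True by auto
    next
      case False
      then have "odd (e p) \<or> odd (e q)" using npq by (auto simp: e_def)
      then have "(\<Prod>k\<in>J. mom k (e k)) = 0" by (elim disjE) (rule zero[OF pq(1)], assumption, rule zero[OF pq(2)], assumption)
      moreover have "\<not> (p = r \<and> q = t)" "\<not> (p = t \<and> q = r)" using False by auto
      ultimately show ?thesis using npq by (simp only: of_bool_eq simp_thms) simp
    qed
  qed
  finally show "(\<integral>y. y p * y q * y r * y t \<partial>Pi\<^sub>M J N)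
      = s ^ 4 * (of_bool (p = q \<and> r = t) + of_bool (p = r \<and> q = t) + of_bool (p = t \<and> q = r))" .
qed

text \<open>In Wick's formula the pairing \<open>p = q\<close>, \<open>r = t\<close> is the squared
  mean and cancels. Each of the other two pairings contributes the squared Frobenius norm, the
  crossed one by symmetry of \<open>R\<close>.\<close>

lemma quadratic_form_variance:
  assumes J: "finite J" and s: "\<And>k. k \<in> J \<Longrightarrow> \<sigma> k = s" and sym: "\<And>p q. p \<in> J \<Longrightarrow> q \<in> J \<Longrightarrow> R p q = R q p"
  shows "integrable (Pi\<^sub>M J N) (\<lambda>y. ((\<Sum>p\<in>J. \<Sum>q\<in>J. R p q * (y p * y q)) - s\<^sup>2 * (\<Sum>p\<in>J. R p p))\<^sup>2)" (is ?A)
    and "(\<integral>y. ((\<Sum>p\<in>J. \<Sum>q\<in>J. R p q * (y p * y q)) - s\<^sup>2 * (\<Sum>p\<in>J. R p p))\<^sup>2 \<partial>Pi\<^sub>M J N) = 2 * s ^ 4 * (\<Sum>p\<in>J. \<Sum>q\<in>J. (R p q)\<^sup>2)" (is ?B)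
proof -
  define T where "T = (\<Sum>p\<in>J. R p p)"
  have expand: "((\<Sum>p\<in>J. \<Sum>q\<in>J. R p q * (y p * y q)) - s\<^sup>2 * T)\<^sup>2
     = (\<Sum>p\<in>J. \<Sum>q\<in>J. \<Sum>r\<in>J. \<Sum>t\<in>J. R p q * R r t * (y p * y q * y r * y t))
       - 2 * s\<^sup>2 * T * (\<Sum>p\<in>J. \<Sum>q\<in>J. R p q * (y p * y q)) + (s\<^sup>2 * T)\<^sup>2" for y
  proof -
    have "(\<Sum>p\<in>J. \<Sum>q\<in>J. R p q * (y p * y q)) * (\<Sum>r\<in>J. \<Sum>t\<in>J. R r t * (y r * y t))
      = (\<Sum>p\<in>J. \<Sum>q\<in>J. \<Sum>r\<in>J. \<Sum>t\<in>J. R p q * R r t * (y p * y q * y r * y t))"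
      by (simp only: sum_distrib_right, simp only: sum_distrib_left, intro sum.cong refl, simp only: ac_simps)
    then show ?thesis by (simp add: power2_diff power2_eq_square[of "\<Sum>p\<in>J. \<Sum>q\<in>J. R p q * (y p * y q)"])
  qed
  note int = integral_two(1)[OF J] integral_four(1)[OF J _ _ _ _ s]
  have pJ: "prob_space (Pi\<^sub>M J N)" by (intro prob_space_PiM prob_N)
  interpret J: prob_space "Pi\<^sub>M J N" by (rule pJ)
  show ?A unfolding T_def[symmetric] expand
    by (intro Bochner_Integration.integrable_add Bochner_Integration.integrable_diff Bochner_Integration.integrable_sum integrable_mult_right int) auto
  have "(\<integral>y. ((\<Sum>p\<in>J. \<Sum>q\<in>J. R p q * (y p * y q)) - s\<^sup>2 * T)\<^sup>2 \<partial>Pi\<^sub>M J N)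
    = (\<Sum>p\<in>J. \<Sum>q\<in>J. \<Sum>r\<in>J. \<Sum>t\<in>J. R p q * R r t * (s ^ 4 * (of_bool (p = q \<and> r = t) + of_bool (p = r \<and> q = t) + of_bool (p = t \<and> q = r))))
       - 2 * s\<^sup>2 * T * (\<Sum>p\<in>J. \<Sum>q\<in>J. R p q * (if p = q then (\<sigma> p)\<^sup>2 else 0)) + (s\<^sup>2 * T)\<^sup>2"
  proof -
    have i1: "integrable (Pi\<^sub>M J N) (\<lambda>y. \<Sum>p\<in>J. \<Sum>q\<in>J. \<Sum>r\<in>J. \<Sum>t\<in>J. R p q * R r t * (y p * y q * y r * y t))"
      by (intro Bochner_Integration.integrable_sum integrable_mult_right int)
    have i2: "integrable (Pi\<^sub>M J N) (\<lambda>y. 2 * s\<^sup>2 * T * (\<Sum>p\<in>J. \<Sum>q\<in>J. R p q * (y p * y q)))"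
      by (intro Bochner_Integration.integrable_sum integrable_mult_right int)
    have e1: "(\<integral>y. (\<Sum>p\<in>J. \<Sum>q\<in>J. \<Sum>r\<in>J. \<Sum>t\<in>J. R p q * R r t * (y p * y q * y r * y t)) \<partial>Pi\<^sub>M J N)
      = (\<Sum>p\<in>J. \<Sum>q\<in>J. \<Sum>r\<in>J. \<Sum>t\<in>J. R p q * R r t * (s ^ 4 * (of_bool (p = q \<and> r = t) + of_bool (p = r \<and> q = t) + of_bool (p = t \<and> q = r))))"
      using integral_four[OF J _ _ _ _ s]
      by (simp add: Bochner_Integration.integral_sum Bochner_Integration.integrable_sum)
    have e2: "(\<integral>y. (\<Sum>p\<in>J. \<Sum>q\<in>J. R p q * (y p * y q)) \<partial>Pi\<^sub>M J N) = (\<Sum>p\<in>J. \<Sum>q\<in>J. R p q * (if p = q then (\<sigma> p)\<^sup>2 else 0))"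
      using integral_two[OF J]
      by (simp add: Bochner_Integration.integral_sum Bochner_Integration.integrable_sum)
    show ?thesis unfolding expand
      using i1 i2 by (simp only: Bochner_Integration.integral_add Bochner_Integration.integral_diff Bochner_Integration.integrable_diff
          J.integrable_const e1 e2 integral_mult_right_zero) (simp add: J.prob_space)
  qed
  also have "(\<Sum>p\<in>J. \<Sum>q\<in>J. R p q * (if p = q then (\<sigma> p)\<^sup>2 else 0)) = s\<^sup>2 * T"
    using s J by (simp add: T_def sum_distrib_left if_distrib[of "\<lambda>x. _ * x"] sum.delta mult.commute cong: if_cong sum.cong)
  also have "(\<Sum>p\<in>J. \<Sum>q\<in>J. \<Sum>r\<in>J. \<Sum>t\<in>J. R p q * R r t * (s ^ 4 * (of_bool (p = q \<and> r = t) + of_bool (p = r \<and> q = t) + of_bool (p = t \<and> q = r))))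
     = (s\<^sup>2 * T)\<^sup>2 + 2 * s ^ 4 * (\<Sum>p\<in>J. \<Sum>q\<in>J. (R p q)\<^sup>2)"
  proof -
    have d: "(\<Sum>t\<in>J. f t * of_bool (P \<and> a = t)) = (if P then f a else 0)" if "a \<in> J" for f :: "'k \<Rightarrow> real" and P a
      using J that by (cases P) (simp_all add: of_bool_def if_distrib[of "\<lambda>x. _ * x"] sum.delta' cong: if_cong)
    have d': "(\<Sum>r\<in>J. if a = r then f r else 0) = f a" if "a \<in> J" for f :: "'k \<Rightarrow> real" and a
      using J that by simp
    have s1: "(\<Sum>p\<in>J. \<Sum>q\<in>J. \<Sum>r\<in>J. \<Sum>t\<in>J. R p q * R r t * of_bool (p = q \<and> r = t)) = T * T"
    proof -
      have "(\<Sum>p\<in>J. \<Sum>q\<in>J. \<Sum>r\<in>J. \<Sum>t\<in>J. R p q * R r t * of_bool (p = q \<and> r = t)) = (\<Sum>p\<in>J. \<Sum>q\<in>J. \<Sum>r\<in>J. if p = q then R p q * R r r else 0)"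
        by (intro sum.cong refl d)
      also have "\<dots> = (\<Sum>p\<in>J. \<Sum>q\<in>J. if p = q then R p q * T else 0)"
        by (intro sum.cong refl) (simp add: T_def sum_distrib_left)
      also have "\<dots> = T * T" by (simp add: d' sum_distrib_right[symmetric] T_def cong: sum.cong)
      finally show ?thesis .
    qed
    have s2: "(\<Sum>p\<in>J. \<Sum>q\<in>J. \<Sum>r\<in>J. \<Sum>t\<in>J. R p q * R r t * of_bool (p = r \<and> q = t)) = (\<Sum>p\<in>J. \<Sum>q\<in>J. (R p q)\<^sup>2)"
      by (intro sum.cong refl) (simp add: d d' power2_eq_square cong: sum.cong)
    have s3: "(\<Sum>p\<in>J. \<Sum>q\<in>J. \<Sum>r\<in>J. \<Sum>t\<in>J. R p q * R r t * of_bool (p = t \<and> q = r)) = (\<Sum>p\<in>J. \<Sum>q\<in>J. (R p q)\<^sup>2)"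
    proof (intro sum.cong refl)
      fix p q assume pq: "p \<in> J" "q \<in> J"
      have "(\<Sum>r\<in>J. \<Sum>t\<in>J. R p q * R r t * of_bool (p = t \<and> q = r)) = (\<Sum>r\<in>J. if q = r then R p q * R r p else 0)"
      proof (intro sum.cong refl)
        fix r
        have "of_bool (p = t \<and> q = r) = (of_bool (q = r \<and> p = t) :: real)" for t by auto
        then show "(\<Sum>t\<in>J. R p q * R r t * of_bool (p = t \<and> q = r)) = (if q = r then R p q * R r p else 0)"
          by (simp only: d[OF pq(1)])
      qed
      also have "\<dots> = (R p q)\<^sup>2" using pq sym[of q p] by (simp add: d' power2_eq_square)
      finally show "(\<Sum>r\<in>J. \<Sum>t\<in>J. R p q * R r t * of_bool (p = t \<and> q = r)) = (R p q)\<^sup>2" .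
    qed
    have "(\<Sum>p\<in>J. \<Sum>q\<in>J. \<Sum>r\<in>J. \<Sum>t\<in>J. R p q * R r t * (s ^ 4 * (of_bool (p = q \<and> r = t) + of_bool (p = r \<and> q = t) + of_bool (p = t \<and> q = r))))
      = s ^ 4 * (\<Sum>p\<in>J. \<Sum>q\<in>J. \<Sum>r\<in>J. \<Sum>t\<in>J. R p q * R r t * of_bool (p = q \<and> r = t)) + s ^ 4 * (\<Sum>p\<in>J. \<Sum>q\<in>J. \<Sum>r\<in>J. \<Sum>t\<in>J. R p q * R r t * of_bool (p = r \<and> q = t))
       + s ^ 4 * (\<Sum>p\<in>J. \<Sum>q\<in>J. \<Sum>r\<in>J. \<Sum>t\<in>J. R p q * R r t * of_bool (p = t \<and> q = r))"
      unfolding sum_distrib_left sum.distrib[symmetric] by (intro sum.cong refl) (simp only: distrib_left ac_simps)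
    then show ?thesis unfolding s1 s2 s3 by (simp add: power2_eq_square power4_eq_xxxx algebra_simps)
  qed
  finally show ?B unfolding T_def[symmetric] by (simp add: power2_eq_square)
qed

end

section \<open>The GOE in independent coordinates\<close>

definition goe_sd :: "nat \<Rightarrow> nat \<times> nat \<Rightarrow> real" where
  "goe_sd n = (\<lambda>(i, j). sqrt (if i = j then 2 / real n else 1 / real n))"

definition ent :: "(nat \<times> nat \<Rightarrow> real) \<Rightarrow> nat \<Rightarrow> nat \<Rightarrow> real" where
  "ent \<xi> i j = \<xi> (min i j, max i j)"

definition qform :: "nat \<Rightarrow> (nat \<times> nat \<Rightarrow> real) \<Rightarrow> (nat \<Rightarrow> real) \<Rightarrow> real" where
  "qform n \<xi> v = (\<Sum>i<n. \<Sum>j<n. v i * v j * ent \<xi> i j)"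

lemma finite_upper_idx [simp]: "finite (upper_idx n)"
  by (rule finite_subset[of _ "{..<n} \<times> {..<n}"]) (auto simp: upper_idx_def)

lemma sum_upper_idx:
  fixes f :: "nat \<Rightarrow> nat \<Rightarrow> real"
  assumes "\<And>i j. f i j = f j i"
  shows "(\<Sum>k\<in>upper_idx n. if fst k = snd k then f (fst k) (snd k) else 2 * f (fst k) (snd k)) = (\<Sum>i<n. \<Sum>j<n. f i j)"
proof (induction n)
  case 0
  then show ?case by (simp add: upper_idx_def)
next
  case (Suc n)
  have eq: "upper_idx (Suc n) = upper_idx n \<union> (\<lambda>i. (i, n)) ` {..n}" by (auto simp: upper_idx_def less_Suc_eq)
  have "(\<Sum>k\<in>(\<lambda>i. (i, n)) ` {..n}. if fst k = snd k then f (fst k) (snd k) else 2 * f (fst k) (snd k))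
    = (\<Sum>i\<le>n. if i = n then f i n else 2 * f i n)"
    by (subst sum.reindex) (auto simp: inj_on_def cong: if_cong)
  also have "\<dots> = (\<Sum>i<n. 2 * f i n) + f n n"
    by (simp add: lessThan_Suc_atMost[symmetric])
  finally have new: "(\<Sum>k\<in>(\<lambda>i. (i, n)) ` {..n}. if fst k = snd k then f (fst k) (snd k) else 2 * f (fst k) (snd k)) = (\<Sum>i<n. 2 * f i n) + f n n" .
  have "(\<Sum>k\<in>upper_idx (Suc n). if fst k = snd k then f (fst k) (snd k) else 2 * f (fst k) (snd k))
    = (\<Sum>i<n. \<Sum>j<n. f i j) + ((\<Sum>i<n. 2 * f i n) + f n n)"
    unfolding eq by (subst sum.union_disjoint) (auto simp: new Suc.IH, auto simp: upper_idx_def)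
  also have "\<dots> = (\<Sum>i<Suc n. \<Sum>j<Suc n. f i j)"
  proof -
    have "(\<Sum>j<n. f n j) = (\<Sum>i<n. f i n)" by (intro sum.cong refl assms)
    then show ?thesis by (simp add: sum.distrib flip: sum_distrib_left)
  qed
  finally show ?case .
qed

text \<open>Coefficients of the quadratic form as a linear function of the independent entries; an
  entry off the diagonal occurs twice.\<close>

definition qcoef :: "(nat \<Rightarrow> real) \<Rightarrow> nat \<times> nat \<Rightarrow> real" where
  "qcoef v k = (if fst k = snd k then (v (fst k))\<^sup>2 else 2 * (v (fst k) * v (snd k)))"

lemma qform_eq: "qform n \<xi> v = (\<Sum>k\<in>upper_idx n. qcoef v k * \<xi> k)"
proof -
  have "(\<Sum>k\<in>upper_idx n. qcoef v k * \<xi> k) = (\<Sum>k\<in>upper_idx n. if fst k = snd k then v (fst k) * v (snd k) * ent \<xi> (fst k) (snd k) else 2 * (v (fst k) * v (snd k) * ent \<xi> (fst k) (snd k)))"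
    by (intro sum.cong refl) (auto simp: qcoef_def upper_idx_def ent_def power2_eq_square)
  also have "\<dots> = qform n \<xi> v" unfolding qform_def
    by (rule sum_upper_idx) (simp add: ent_def min.commute max.commute mult.commute)
  finally show ?thesis by simp
qed

lemma goe_sd_sq: "(goe_sd n k)\<^sup>2 = (if fst k = snd k then 2 / real n else 1 / real n)"
  by (cases k) (simp add: goe_sd_def)

text \<open>The doubled variance on the diagonal lets diagonal and off-diagonal entries join in one
  symmetric double sum, which factorises.\<close>

lemma qcoef_covariance:
  "(\<Sum>k\<in>upper_idx n. (goe_sd n k)\<^sup>2 * (qcoef u k * qcoef v k)) = 2 / real n * (\<Sum>i<n. u i * v i)\<^sup>2"
proof -
  have "(\<Sum>k\<in>upper_idx n. (goe_sd n k)\<^sup>2 * (qcoef u k * qcoef v k))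
    = (\<Sum>k\<in>upper_idx n. if fst k = snd k then 2 / real n * ((u (fst k) * v (fst k)) * (u (snd k) * v (snd k))) else 2 * (2 / real n * ((u (fst k) * v (fst k)) * (u (snd k) * v (snd k)))))"
    by (intro sum.cong refl, unfold goe_sd_sq) (auto simp: qcoef_def power2_eq_square)
  also have "\<dots> = (\<Sum>i<n. \<Sum>j<n. 2 / real n * ((u i * v i) * (u j * v j)))"
    by (rule sum_upper_idx) (simp add: mult.commute)
  also have "\<dots> = 2 / real n * (\<Sum>i<n. u i * v i)\<^sup>2"
    by (subst power2_eq_square, subst sum_product, simp only: sum_distrib_left)
  finally show ?thesis .
qed

locale goe =
  fixes n :: nat
  assumes n_pos: "n > 0"
begin

lemma goe_sd_pos: "goe_sd n k > 0" using n_pos by (cases k) (simp add: goe_sd_def)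

sublocale gaussian_family "upper_idx n" "goe_sd n"
  using goe_sd_pos by unfold_locales auto

abbreviation PG :: "(nat \<times> nat \<Rightarrow> real) measure" where "PG \<equiv> Pi\<^sub>M (upper_idx n) N"

lemma GOE_entry_eq_N: "GOE_entry n = N"
proof (rule ext)
  fix k show "GOE_entry n k = N k"
    unfolding GOE_entry_def N_def by (cases k) (simp add: goe_sd_def)
qed

text \<open>Entries off the diagonal have half the variance of diagonal ones but are counted twice
  in the Frobenius norm, so standardised and Frobenius distances are proportional.\<close>

lemma wdist_ent: "(wdist x y)\<^sup>2 = real n / 2 * (\<Sum>i<n. \<Sum>j<n. (ent x i j - ent y i j)\<^sup>2)"
proof -
  have "(wdist x y)\<^sup>2 = (\<Sum>k\<in>upper_idx n. if fst k = snd k then real n / 2 * (ent x (fst k) (snd k) - ent y (fst k) (snd k))\<^sup>2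
     else 2 * (real n / 2 * (ent x (fst k) (snd k) - ent y (fst k) (snd k))\<^sup>2))"
    unfolding wdist_sq by (intro sum.cong refl) (auto simp: power_divide goe_sd_sq upper_idx_def ent_def)
  also have "\<dots> = (\<Sum>i<n. \<Sum>j<n. real n / 2 * (ent x i j - ent y i j)\<^sup>2)"
    by (rule sum_upper_idx) (simp add: ent_def min.commute max.commute)
  finally show ?thesis by (simp add: sum_distrib_left)
qed

lemma qform_lipschitz:
  assumes "(\<Sum>i<n. (v i)\<^sup>2) = 1"
  shows "\<bar>qform n x v - qform n y v\<bar> \<le> sqrt (2 / real n) * wdist x y"
proof -
  have "qform n x v - qform n y v = (\<Sum>k\<in>upper_idx n. (goe_sd n k * qcoef v k) * ((x k - y k) / goe_sd n k))"
    unfolding qform_eq sum_subtractf[symmetric]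
  proof (intro sum.cong refl)
    fix k
    have "goe_sd n k \<noteq> 0" using goe_sd_pos[of k] by simp
    then show "qcoef v k * x k - qcoef v k * y k = (goe_sd n k * qcoef v k) * ((x k - y k) / goe_sd n k)"
      by (simp add: field_simps)
  qed
  also have "\<bar>\<dots>\<bar> \<le> (\<Sum>k\<in>upper_idx n. \<bar>goe_sd n k * qcoef v k\<bar> * \<bar>(x k - y k) / goe_sd n k\<bar>)"
    by (rule order_trans[OF sum_abs]) (simp only: abs_mult order_refl)
  also have "\<dots> \<le> L2_set (\<lambda>k. goe_sd n k * qcoef v k) (upper_idx n) * wdist x y"
    unfolding wdist_def by (rule L2_set_mult_ineq)
  also have "L2_set (\<lambda>k. goe_sd n k * qcoef v k) (upper_idx n) = sqrt (2 / real n)"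
  proof -
    have "(\<Sum>k\<in>upper_idx n. (goe_sd n k * qcoef v k)\<^sup>2) = (\<Sum>k\<in>upper_idx n. (goe_sd n k)\<^sup>2 * (qcoef v k * qcoef v k))"
      by (intro sum.cong refl) (simp only: power_mult_distrib power2_eq_square[of "qcoef v _"])
    moreover have "(\<Sum>i<n. v i * v i) = 1" using assms by (simp add: power2_eq_square)
    ultimately show ?thesis by (simp add: L2_set_def qcoef_covariance)
  qed
  finally show ?thesis .
qed

text \<open>Comparison of the quadratic form with twice the inner product of \<open>v\<close> and a
  vector of independent Gaussians of variance \<open>1 / n\<close>. On unit vectors with inner
  product \<rho> the covariances differ by a positive multiple of
  \<open>\<rho>\<^sup>2 - 2 * \<rho>\<close>, which is least at \<open>\<rho> = 1\<close>. On the
  linear side, completing the square in each coordinate bounds the maximum by a sum whose mean is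
  the average of \<open>1 / d i\<close>.\<close>

lemma expectation_lse_le:
  fixes V :: "(nat \<Rightarrow> real) set" and d :: "nat \<Rightarrow> real" and \<kappa> s :: real
  assumes V: "finite V" "V \<noteq> {}" and unit: "\<And>v. v \<in> V \<Longrightarrow> (\<Sum>i<n. (v i)\<^sup>2) = 1" and d: "\<And>i. i < n \<Longrightarrow> d i > 0"
    and \<kappa>: "\<kappa> > 0" and s: "s\<^sup>2 = 1"
  shows "(\<integral>\<xi>. lse V (\<lambda>v. \<kappa> * (s * qform n \<xi> v - (\<Sum>i<n. d i * (v i)\<^sup>2))) \<partial>PG) \<le> ln (card V) + \<kappa> * ((\<Sum>i<n. 1 / d i) / n)"
proof -
  \<comment> \<open>The pairs \<open>(n, j)\<close> with \<open>j < n\<close> lie outside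
    \<open>upper_idx n\<close> and off the diagonal, so they supply \<open>n\<close> fresh Gaussians
    of variance \<open>1 / n\<close>.\<close>
  define I' where "I' = upper_idx n \<union> {n} \<times> {..<n}"
  interpret X: gaussian_family I' "goe_sd n"
    using goe_sd_pos by unfold_locales (auto simp: I'_def)
  define w where "w v = - \<kappa> * (\<Sum>i<n. d i * (v i)\<^sup>2)" for v :: "nat \<Rightarrow> real"
  define a where "a v k = (if k \<in> upper_idx n then \<kappa> * s * qcoef v k else 0)" for v k
  define b where "b v k = (if k \<in> {n} \<times> {..<n} then 2 * \<kappa> * v (snd k) else 0)" for v :: "nat \<Rightarrow> real" and k :: "nat \<times> nat"
  have disj: "upper_idx n \<inter> {n} \<times> {..<n} = {}" by (auto simp: upper_idx_def)
  have finI: "finite I'" by (simp add: I'_def)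
  have suma: "(\<Sum>k\<in>I'. f k) = (\<Sum>k\<in>upper_idx n. f k)" if "\<And>k. k \<notin> upper_idx n \<Longrightarrow> f k = 0" for f :: "nat \<times> nat \<Rightarrow> real"
    using that finI by (intro sum.mono_neutral_right) (auto simp: I'_def)
  have sumb: "(\<Sum>k\<in>I'. f k) = (\<Sum>j<n. f (n, j))" if "\<And>k. k \<notin> {n} \<times> {..<n} \<Longrightarrow> f k = 0" for f :: "nat \<times> nat \<Rightarrow> real"
  proof -
    have "(\<Sum>k\<in>I'. f k) = (\<Sum>k\<in>{n} \<times> {..<n}. f k)"
      using that finI by (intro sum.mono_neutral_right) (auto simp: I'_def)
    also have "{n} \<times> {..<n} = Pair n ` {..<n}" by auto
    also have "(\<Sum>k\<in>Pair n ` {..<n}. f k) = (\<Sum>j<n. f (n, j))" by (subst sum.reindex) (auto simp: inj_on_def)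
    finally show ?thesis .
  qed
  have C: "(\<Sum>k\<in>I'. (goe_sd n k)\<^sup>2 * (a v k * a u k - b v k * b u k))
     = \<kappa>\<^sup>2 * (2 / real n) * ((\<Sum>i<n. v i * u i)\<^sup>2 - 2 * (\<Sum>i<n. v i * u i))" for u v
  proof -
    have "(\<Sum>k\<in>I'. (goe_sd n k)\<^sup>2 * (a v k * a u k)) = \<kappa>\<^sup>2 * (2 / real n * (\<Sum>i<n. v i * u i)\<^sup>2)"
      unfolding qcoef_covariance[symmetric] sum_distrib_left
    proof (subst suma)
      show "(\<Sum>k\<in>upper_idx n. (goe_sd n k)\<^sup>2 * (a v k * a u k)) = (\<Sum>k\<in>upper_idx n. \<kappa>\<^sup>2 * ((goe_sd n k)\<^sup>2 * (qcoef v k * qcoef u k)))"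
      proof (intro sum.cong refl)
        fix k assume "k \<in> upper_idx n"
        then have "a v k * a u k = s\<^sup>2 * (\<kappa>\<^sup>2 * (qcoef v k * qcoef u k))" by (simp add: a_def power2_eq_square)
        then show "(goe_sd n k)\<^sup>2 * (a v k * a u k) = \<kappa>\<^sup>2 * ((goe_sd n k)\<^sup>2 * (qcoef v k * qcoef u k))" by (simp add: s)
      qed
    qed (simp add: a_def)
    moreover have "(\<Sum>k\<in>I'. (goe_sd n k)\<^sup>2 * (b v k * b u k)) = \<kappa>\<^sup>2 * (2 / real n * (2 * (\<Sum>i<n. v i * u i)))"
      unfolding sum_distrib_left
    proof (subst sumb)
      show "(\<Sum>j<n. (goe_sd n (n, j))\<^sup>2 * (b v (n, j) * b u (n, j))) = (\<Sum>i<n. \<kappa>\<^sup>2 * (2 / real n * (2 * (v i * u i))))"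
        by (intro sum.cong refl, unfold goe_sd_sq) (auto simp: b_def power2_eq_square)
    qed (simp only: b_def if_False mult_zero_left mult_zero_right)
    moreover have "(\<Sum>k\<in>I'. (goe_sd n k)\<^sup>2 * (a v k * a u k - b v k * b u k))
      = (\<Sum>k\<in>I'. (goe_sd n k)\<^sup>2 * (a v k * a u k)) - (\<Sum>k\<in>I'. (goe_sd n k)\<^sup>2 * (b v k * b u k))"
      by (simp add: right_diff_distrib sum_subtractf)
    ultimately show ?thesis by (simp add: algebra_simps)
  qed
  have SF: "(\<integral>x. lse V (\<lambda>v. w v + (\<Sum>k\<in>I'. a v k * x k)) \<partial>Pi\<^sub>M I' N) \<le> (\<integral>x. lse V (\<lambda>v. w v + (\<Sum>k\<in>I'. b v k * x k)) \<partial>Pi\<^sub>M I' N)"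
  proof (rule X.sudakov_fernique[OF V])
    fix u v assume uv: "u \<in> V" "v \<in> V"
    show "(\<Sum>k\<in>I'. (goe_sd n k)\<^sup>2 * (a u k * b v k)) = 0"
      using disj by (intro sum.neutral) (auto simp: a_def b_def)
    have "(\<Sum>i<n. v i * v i) = 1" using unit[OF uv(2)] by (simp add: power2_eq_square)
    moreover have "(1::real)\<^sup>2 - 2 * 1 \<le> \<rho>\<^sup>2 - 2 * \<rho>" for \<rho> :: real
      using zero_le_power2[of "\<rho> - 1"] by (simp add: power2_diff)
    ultimately show "(\<Sum>k\<in>I'. (goe_sd n k)\<^sup>2 * (a v k * a v k - b v k * b v k)) \<le> (\<Sum>k\<in>I'. (goe_sd n k)\<^sup>2 * (a v k * a u k - b v k * b u k))"
      unfolding C by (intro mult_left_mono) auto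
  qed
  have int2: "integrable (Pi\<^sub>M I' N) (\<lambda>x. x k * x k)" "(\<integral>x. x k * x k \<partial>Pi\<^sub>M I' N) = (goe_sd n k)\<^sup>2" if "k \<in> I'" for k
    using X.integral_two[OF finI that that] by auto
  have mem: "(n, j) \<in> I'" if "j < n" for j using that by (simp add: I'_def)
  have "(\<integral>x. lse V (\<lambda>v. w v + (\<Sum>k\<in>I'. b v k * x k)) \<partial>Pi\<^sub>M I' N) \<le> (\<integral>x. ln (card V) + \<kappa> * (\<Sum>j<n. (1 / d j) * (x (n, j) * x (n, j))) \<partial>Pi\<^sub>M I' N)"
  proof (rule integral_mono')
    show "integrable (Pi\<^sub>M I' N) (\<lambda>x. ln (card V) + \<kappa> * (\<Sum>j<n. (1 / d j) * (x (n, j) * x (n, j))))"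
      by (intro Bochner_Integration.integrable_add integrable_mult_right Bochner_Integration.integrable_sum int2 mem X.P.P.integrable_const) auto
    fix x
    show "0 \<le> ln (card V) + \<kappa> * (\<Sum>j<n. (1 / d j) * (x (n, j) * x (n, j)))"
    proof -
      have "0 \<le> (\<Sum>j<n. (1 / d j) * (x (n, j) * x (n, j)))"
        by (rule sum_nonneg) (use d in \<open>simp add: less_imp_le\<close>)
      moreover have "0 \<le> ln (card V)" using V by (simp add: Suc_le_eq card_gt_0_iff)
      ultimately show ?thesis using \<kappa> by simp
    qed
    show "lse V (\<lambda>v. w v + (\<Sum>k\<in>I'. b v k * x k)) \<le> ln (card V) + \<kappa> * (\<Sum>j<n. (1 / d j) * (x (n, j) * x (n, j)))"
    proof (rule lse_upper[OF V])
      fix v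
      have "w v + (\<Sum>k\<in>I'. b v k * x k) = \<kappa> * (\<Sum>j<n. 2 * v j * x (n, j) - d j * (v j)\<^sup>2)"
        by (subst sumb) (auto simp: b_def w_def sum_subtractf sum_distrib_left sum_negf algebra_simps)
      also have "\<dots> \<le> \<kappa> * (\<Sum>j<n. (1 / d j) * (x (n, j) * x (n, j)))"
      proof (intro mult_left_mono sum_mono)
        fix j assume "j \<in> {..<n}"
        then have dj: "d j > 0" using d by auto
        have "0 \<le> (x (n, j) - d j * v j)\<^sup>2 / d j" using dj by simp
        also have "\<dots> = (1 / d j) * (x (n, j) * x (n, j)) - (2 * v j * x (n, j) - d j * (v j)\<^sup>2)"
          using dj by (simp add: field_simps power2_eq_square)
        finally show "2 * v j * x (n, j) - d j * (v j)\<^sup>2 \<le> (1 / d j) * (x (n, j) * x (n, j))" by simp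
      qed (use \<kappa> in auto)
      finally show "w v + (\<Sum>k\<in>I'. b v k * x k) \<le> \<kappa> * (\<Sum>j<n. (1 / d j) * (x (n, j) * x (n, j)))" .
    qed
  qed
  also have "\<dots> = ln (card V) + \<kappa> * ((\<Sum>i<n. 1 / d i) / n)"
  proof -
    have "(\<integral>x. (\<Sum>j<n. (1 / d j) * (x (n, j) * x (n, j))) \<partial>Pi\<^sub>M I' N) = (\<Sum>j<n. (1 / d j) * (1 / n))"
      using int2 by (subst Bochner_Integration.integral_sum) (auto simp: I'_def goe_sd_sq intro!: sum.cong)
    moreover have "integrable (Pi\<^sub>M I' N) (\<lambda>x. \<kappa> * (\<Sum>j<n. (1 / d j) * (x (n, j) * x (n, j))))"
      by (intro integrable_mult_right Bochner_Integration.integrable_sum int2 mem) auto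
    ultimately show ?thesis
      by (subst Bochner_Integration.integral_add) (auto simp: X.P.P.prob_space sum_divide_distrib)
  qed
  finally have up: "(\<integral>x. lse V (\<lambda>v. w v + (\<Sum>k\<in>I'. b v k * x k)) \<partial>Pi\<^sub>M I' N) \<le> ln (card V) + \<kappa> * ((\<Sum>i<n. 1 / d i) / n)" .
  define f where "f \<xi> = lse V (\<lambda>v. \<kappa> * (s * qform n \<xi> v - (\<Sum>i<n. d i * (v i)\<^sup>2)))" for \<xi>
  have fm: "f \<in> borel_measurable PG"
    unfolding f_def lse_def qform_eq by measurable
  have "(\<integral>\<xi>. f \<xi> \<partial>PG) = (\<integral>\<xi>. f \<xi> \<partial>distr (Pi\<^sub>M I' N) PG (\<lambda>x. restrict x (upper_idx n)))"
    using X.P.distr_PiM_restrict_finite[of "upper_idx n"] by (simp add: I'_def)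
  also have "\<dots> = (\<integral>x. f (restrict x (upper_idx n)) \<partial>Pi\<^sub>M I' N)"
    using fm by (intro integral_distr) (auto intro!: measurable_restrict_subset simp: I'_def)
  also have "\<dots> = (\<integral>x. lse V (\<lambda>v. w v + (\<Sum>k\<in>I'. a v k * x k)) \<partial>Pi\<^sub>M I' N)"
  proof (intro Bochner_Integration.integral_cong refl)
    fix x
    have "(\<Sum>k\<in>I'. a v k * x k) = \<kappa> * s * (\<Sum>k\<in>upper_idx n. qcoef v k * x k)" for v
      by (subst suma) (auto simp: a_def sum_distrib_left ac_simps intro!: sum.cong)
    then show "f (restrict x (upper_idx n)) = lse V (\<lambda>v. w v + (\<Sum>k\<in>I'. a v k * x k))"
      by (simp add: f_def qform_eq w_def algebra_simps cong: sum.cong)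
  qed
  finally show ?thesis using SF up unfolding f_def by linarith
qed

end

section \<open>The spectral edge\<close>

lemma qform_scale: "qform n \<xi> (\<lambda>i. c * v i) = c\<^sup>2 * qform n \<xi> v"
  by (simp add: qform_def sum_distrib_left power2_eq_square algebra_simps)

lemma le_of_scaled:
  fixes s q c D e S :: real
  assumes "s * (c * q) \<le> c * D + e" "S * c = 1" "0 \<le> S"
  shows "s * q \<le> D + e * S"
proof -
  have "S * (s * (c * q)) \<le> S * (c * D + e)" by (rule mult_left_mono[OF assms(1,3)])
  moreover have "S * (s * (c * q)) = (S * c) * (s * q)" by (simp only: ac_simps)
  moreover have "S * (c * D + e) = (S * c) * D + e * S" by (simp only: distrib_left ac_simps)
  ultimately show ?thesis by (simp add: assms(2))
qed

lemma floor_approx_tendsto: "(\<lambda>m. real_of_int \<lfloor>real m * x\<rfloor> / real m) \<longlonglongrightarrow> x"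
proof (rule Lim_transform_eventually)
  show "(\<lambda>m. x - (real m * x - real_of_int \<lfloor>real m * x\<rfloor>) / real m) \<longlonglongrightarrow> x"
  proof -
    have "(\<lambda>m. (real m * x - real_of_int \<lfloor>real m * x\<rfloor>) / real m) \<longlonglongrightarrow> 0"
    proof (rule tendsto_sandwich[OF _ _ tendsto_const lim_inverse_n'])
      show "\<forall>\<^sub>F m in sequentially. 0 \<le> (real m * x - real_of_int \<lfloor>real m * x\<rfloor>) / real m"
        by (intro always_eventually allI divide_nonneg_nonneg) auto
      have "real m * x - real_of_int \<lfloor>real m * x\<rfloor> \<le> 1" for m by linarith
      then show "\<forall>\<^sub>F m in sequentially. (real m * x - real_of_int \<lfloor>real m * x\<rfloor>) / real m \<le> 1 / real m"
        by (intro always_eventually allI divide_right_mono) auto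
    qed
    from tendsto_diff[OF tendsto_const[of x] this] show ?thesis by simp
  qed
  show "\<forall>\<^sub>F m in sequentially. x - (real m * x - real_of_int \<lfloor>real m * x\<rfloor>) / real m = real_of_int \<lfloor>real m * x\<rfloor> / real m"
    using eventually_gt_at_top[of 0] by eventually_elim (simp add: field_simps)
qed

context goe
begin

lemma qform_measurable [measurable]: "(\<lambda>\<xi>. qform n \<xi> v) \<in> borel_measurable PG"
  unfolding qform_eq by measurable

text \<open>The bound is free of the size of \<open>V\<close>: the scale \<kappa> is so large that
  the loss \<open>ln (card V)\<close> uses less than half of \<open>\<kappa> * \<epsilon>\<close>,
  and \<kappa> cancels in the Gaussian exponent.\<close>

lemma edge_finite:
  fixes V :: "(nat \<Rightarrow> real) set" and d :: "nat \<Rightarrow> real" and \<epsilon> s :: real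
  assumes V: "finite V" and unit: "\<And>v. v \<in> V \<Longrightarrow> (\<Sum>i<n. (v i)\<^sup>2) = 1" and d: "\<And>i. i < n \<Longrightarrow> d i > 0"
    and \<epsilon>: "\<epsilon> > 0" and s: "s\<^sup>2 = 1"
  shows "measure PG {\<xi> \<in> space PG. \<exists>v\<in>V. (\<Sum>i<n. d i * (v i)\<^sup>2) + ((\<Sum>i<n. 1 / d i) / n + \<epsilon>) < s * qform n \<xi> v} \<le> exp (- (n * \<epsilon>\<^sup>2) / 32)"
proof (cases "V = {}")
  case True then show ?thesis by simp
next
  case False
  define \<tau> where "\<tau> = (\<Sum>i<n. 1 / d i) / n"
  \<comment> \<open>The summand 1 keeps \<kappa> positive when \<open>V\<close> is a
    singleton.\<close>
  define \<kappa> where "\<kappa> = 2 * (ln (card V) + 1) / \<epsilon>"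
  have c0: "0 \<le> ln (card V)" using V False by (simp add: Suc_le_eq card_gt_0_iff)
  then have \<kappa>: "\<kappa> > 0" using \<epsilon> by (simp add: \<kappa>_def)
  define f where "f \<xi> = lse V (\<lambda>v. \<kappa> * (s * qform n \<xi> v - (\<Sum>i<n. d i * (v i)\<^sup>2)))" for \<xi>
  define L where "L = \<kappa> * sqrt (2 / n)"
  have L: "L > 0" using \<kappa> n_pos by (simp add: L_def)
  have as: "\<bar>s\<bar> = 1" using s by (auto simp: power2_eq_1_iff)
  have lip: "\<bar>f x - f y\<bar> \<le> L * wdist x y" for x y
    unfolding f_def
  proof (rule lse_lipschitz[OF V False])
    fix v assume v: "v \<in> V"
    have "\<bar>\<kappa> * (s * qform n x v - (\<Sum>i<n. d i * (v i)\<^sup>2)) - \<kappa> * (s * qform n y v - (\<Sum>i<n. d i * (v i)\<^sup>2))\<bar> = \<bar>\<kappa> * (s * (qform n x v - qform n y v))\<bar>"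
      by (simp add: algebra_simps)
    also have "\<dots> = \<kappa> * \<bar>qform n x v - qform n y v\<bar>" using \<kappa> as by (simp add: abs_mult)
    also have "\<dots> \<le> \<kappa> * (sqrt (2 / n) * wdist x y)" using qform_lipschitz[OF unit[OF v]] \<kappa> by (intro mult_left_mono) auto
    finally show "\<bar>\<kappa> * (s * qform n x v - (\<Sum>i<n. d i * (v i)\<^sup>2)) - \<kappa> * (s * qform n y v - (\<Sum>i<n. d i * (v i)\<^sup>2))\<bar> \<le> L * wdist x y"
      by (simp add: L_def mult.assoc)
  qed
  have fm: "f \<in> borel_measurable PG" by (rule lipschitz_measurable[OF lip])
  define g where "g = (\<lambda>\<xi>. ln (card V) + (\<Sum>v\<in>V. \<kappa> * ((\<Sum>k\<in>upper_idx n. \<bar>qcoef v k\<bar> * \<bar>\<xi> k\<bar>) + \<bar>\<Sum>i<n. d i * (v i)\<^sup>2\<bar>)))"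
  have ic: "integrable PG (\<lambda>\<xi>. \<Sum>k\<in>upper_idx n. \<bar>qcoef v k\<bar> * \<bar>\<xi> k\<bar>)" for v
    by (rule Bochner_Integration.integrable_sum, rule integrable_mult_right, rule integrable_abs, rule integrable_component)
  have iv: "integrable PG (\<lambda>\<xi>. \<kappa> * ((\<Sum>k\<in>upper_idx n. \<bar>qcoef v k\<bar> * \<bar>\<xi> k\<bar>) + \<bar>\<Sum>i<n. d i * (v i)\<^sup>2\<bar>))" for v
    by (rule integrable_mult_right, rule Bochner_Integration.integrable_add[OF ic P.P.integrable_const])
  have isum: "integrable PG (\<lambda>\<xi>. \<Sum>v\<in>V. \<kappa> * ((\<Sum>k\<in>upper_idx n. \<bar>qcoef v k\<bar> * \<bar>\<xi> k\<bar>) + \<bar>\<Sum>i<n. d i * (v i)\<^sup>2\<bar>))"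
    by (rule Bochner_Integration.integrable_sum) (rule iv)
  have gint: "integrable PG g" unfolding g_def
    by (rule Bochner_Integration.integrable_add[OF P.P.integrable_const isum])
  have gb: "norm (f \<xi>) \<le> norm (g \<xi>)" for \<xi>
    proof -
      define S where "S = (\<Sum>v\<in>V. \<kappa> * ((\<Sum>k\<in>upper_idx n. \<bar>qcoef v k\<bar> * \<bar>\<xi> k\<bar>) + \<bar>\<Sum>i<n. d i * (v i)\<^sup>2\<bar>))"
      have b: "\<bar>\<kappa> * (s * qform n \<xi> v - (\<Sum>i<n. d i * (v i)\<^sup>2))\<bar> \<le> S" if v: "v \<in> V" for v
      proof -
        have "\<bar>s * qform n \<xi> v - (\<Sum>i<n. d i * (v i)\<^sup>2)\<bar> \<le> \<bar>qform n \<xi> v\<bar> + \<bar>\<Sum>i<n. d i * (v i)\<^sup>2\<bar>"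
          using abs_triangle_ineq4[of "s * qform n \<xi> v" "\<Sum>i<n. d i * (v i)\<^sup>2"] by (simp add: abs_mult as)
        also have "\<bar>qform n \<xi> v\<bar> \<le> (\<Sum>k\<in>upper_idx n. \<bar>qcoef v k\<bar> * \<bar>\<xi> k\<bar>)"
          unfolding qform_eq by (rule order_trans[OF sum_abs]) (simp only: abs_mult order_refl)
        finally have "\<bar>\<kappa> * (s * qform n \<xi> v - (\<Sum>i<n. d i * (v i)\<^sup>2))\<bar> \<le> \<kappa> * ((\<Sum>k\<in>upper_idx n. \<bar>qcoef v k\<bar> * \<bar>\<xi> k\<bar>) + \<bar>\<Sum>i<n. d i * (v i)\<^sup>2\<bar>)"
          using \<kappa> by (simp add: abs_mult)
        also have "\<dots> \<le> S" unfolding S_def using V v \<kappa>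
          by (intro member_le_sum) (auto intro!: mult_nonneg_nonneg add_nonneg_nonneg sum_nonneg)
        finally show ?thesis .
      qed
      obtain v0 where v0: "v0 \<in> V" using False by auto
      have "f \<xi> \<le> ln (card V) + S" unfolding f_def
        by (rule lse_upper[OF V False]) (use b abs_le_D1 in blast)
      moreover have "- S \<le> f \<xi>"
        using le_lse[OF V v0, of "\<lambda>v. \<kappa> * (s * qform n \<xi> v - (\<Sum>i<n. d i * (v i)\<^sup>2))"] b[OF v0] unfolding f_def by linarith
      ultimately show ?thesis using c0 unfolding g_def S_def[symmetric] by simp
    qed
  have fint: "integrable PG f"
    by (rule Bochner_Integration.integrable_bound[OF gint fm AE_I2[OF gb]])
  have Ef: "(\<integral>\<xi>. f \<xi> \<partial>PG) \<le> ln (card V) + \<kappa> * \<tau>"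
    unfolding f_def \<tau>_def by (rule expectation_lse_le[OF V False unit d \<kappa> s])
  define t where "t = \<kappa> * \<epsilon> / 2"
  have t: "t > 0" using \<kappa> \<epsilon> by (simp add: t_def)
  have "ln (card V) + t \<le> \<kappa> * \<epsilon>" using \<epsilon> c0 by (simp add: t_def \<kappa>_def)
  then have "{\<xi> \<in> space PG. \<exists>v\<in>V. (\<Sum>i<n. d i * (v i)\<^sup>2) + (\<tau> + \<epsilon>) < s * qform n \<xi> v} \<subseteq> {\<xi> \<in> space PG. (\<integral>\<xi>. f \<xi> \<partial>PG) + t \<le> f \<xi>}"
  proof (intro subsetI, clarify)
    fix \<xi> v assume v: "v \<in> V" and lt: "(\<Sum>i<n. d i * (v i)\<^sup>2) + (\<tau> + \<epsilon>) < s * qform n \<xi> v" and le: "ln (card V) + t \<le> \<kappa> * \<epsilon>"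
    have "\<kappa> * (\<tau> + \<epsilon>) \<le> \<kappa> * (s * qform n \<xi> v - (\<Sum>i<n. d i * (v i)\<^sup>2))" using lt \<kappa> by (intro mult_left_mono) auto
    also have "\<dots> \<le> f \<xi>" unfolding f_def by (rule le_lse[OF V v])
    finally show "(\<integral>\<xi>. f \<xi> \<partial>PG) + t \<le> f \<xi>" using Ef le by (simp add: distrib_left)
  qed
  then have "measure PG {\<xi> \<in> space PG. \<exists>v\<in>V. (\<Sum>i<n. d i * (v i)\<^sup>2) + (\<tau> + \<epsilon>) < s * qform n \<xi> v}
      \<le> measure PG {\<xi> \<in> space PG. (\<integral>\<xi>. f \<xi> \<partial>PG) + t \<le> f \<xi>}"
    using fm by (intro P.P.finite_measure_mono) auto
  also have "\<dots> \<le> exp (- t\<^sup>2 / (4 * L\<^sup>2))" by (rule lipschitz_tail[OF lip fint L t])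
  also have "- t\<^sup>2 / (4 * L\<^sup>2) = - (n * \<epsilon>\<^sup>2) / 32"
    using \<kappa> n_pos by (simp add: t_def L_def power_mult_distrib power_divide field_simps)
  finally show ?thesis by (simp add: \<tau>_def)
qed

text \<open>As the finite bound does not see the cardinality, it survives the increasing union over
  an enumeration of rational directions. Homogeneity removes the normalisation, and density of the
  rationals reaches every \<open>v\<close> on one measurable event.\<close>

lemma edge:
  fixes d :: "nat \<Rightarrow> real" and \<epsilon> s :: real
  assumes d: "\<And>i. i < n \<Longrightarrow> d i > 0" and \<epsilon>: "\<epsilon> > 0" and s: "s\<^sup>2 = 1"
  obtains T where "T \<in> sets PG" "1 - exp (- (n * \<epsilon>\<^sup>2) / 32) \<le> measure PG T"
    "\<And>\<xi> v. \<xi> \<in> T \<Longrightarrow> s * qform n \<xi> v \<le> (\<Sum>i<n. d i * (v i)\<^sup>2) + ((\<Sum>i<n. 1 / d i) / n + \<epsilon>) * (\<Sum>i<n. (v i)\<^sup>2)"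
proof -
  define \<tau> where "\<tau> = (\<Sum>i<n. 1 / d i) / n"
  define nrm where "nrm v = sqrt (\<Sum>i<n. (v i)\<^sup>2)" for v :: "nat \<Rightarrow> real"
  define Q where "Q = {v \<in> {..<n} \<rightarrow>\<^sub>E (\<rat> :: real set). nrm v \<noteq> 0}"
  have "countable ({..<n} \<rightarrow>\<^sub>E (\<rat> :: real set))" by (intro countable_PiE) (auto simp: countable_rat)
  then have Qc: "countable Q" unfolding Q_def by (rule countable_subset[rotated]) auto
  have n1: "nrm (\<lambda>i. if i < n then 1 else undefined) \<noteq> 0" using n_pos by (simp add: nrm_def)
  then have "(\<lambda>i. if i < n then 1 else undefined) \<in> Q" by (auto simp: Q_def PiE_def extensional_def)
  then have Qne: "Q \<noteq> {}" by auto
  \<comment> \<open>The first \<open>m + 1\<close> directions of the enumeration,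
    normalised.\<close>
  define V where "V m = (\<lambda>v i. inverse (nrm v) * v i) ` (from_nat_into Q ` {..m})" for m :: nat
  define bad where "bad m = {\<xi> \<in> space PG. \<exists>v\<in>V m. (\<Sum>i<n. d i * (v i)\<^sup>2) + (\<tau> + \<epsilon>) < s * qform n \<xi> v}" for m
  have Vf: "finite (V m)" for m by (simp add: V_def)
  have Vu: "(\<Sum>i<n. (v i)\<^sup>2) = 1" if vV: "v \<in> V m" for v m
  proof -
    obtain k where k: "v = (\<lambda>i. inverse (nrm (from_nat_into Q k)) * from_nat_into Q k i)"
      using vV by (auto simp: V_def)
    define u where "u = from_nat_into Q k"
    have u: "u \<in> Q" "v = (\<lambda>i. inverse (nrm u) * u i)" using k from_nat_into[OF Qne] by (simp_all add: u_def)
    have "(\<Sum>i<n. (v i)\<^sup>2) = (inverse (nrm u))\<^sup>2 * (nrm u)\<^sup>2"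
      by (simp add: u(2) power_mult_distrib sum_distrib_left nrm_def sum_nonneg)
    also have "\<dots> = (inverse (nrm u) * nrm u)\<^sup>2" by (simp only: power_mult_distrib)
    finally show ?thesis using u(1) by (simp add: Q_def)
  qed
  have bm: "bad m \<in> sets PG" for m
  proof -
    have "bad m = (\<Union>v\<in>V m. {\<xi> \<in> space PG. (\<Sum>i<n. d i * (v i)\<^sup>2) + (\<tau> + \<epsilon>) < s * qform n \<xi> v})" by (auto simp: bad_def)
    also have "\<dots> \<in> sets PG" using Vf by (intro sets.finite_UN) auto
    finally show ?thesis .
  qed
  have ble: "measure PG (bad m) \<le> exp (- (n * \<epsilon>\<^sup>2) / 32)" for m
    unfolding bad_def \<tau>_def by (rule edge_finite[OF Vf Vu d \<epsilon> s])
  have inc: "incseq bad"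
  proof (rule incseq_SucI)
    fix m have "V m \<subseteq> V (Suc m)" unfolding V_def by (intro image_mono) auto
    then show "bad m \<subseteq> bad (Suc m)" by (auto simp: bad_def)
  qed
  define B where "B = (\<Union>m. bad m)"
  have Bm: "B \<in> sets PG" unfolding B_def using bm by auto
  have "(\<lambda>m. measure PG (bad m)) \<longlonglongrightarrow> measure PG B"
    unfolding B_def using bm inc by (intro P.P.finite_Lim_measure_incseq) auto
  then have Ble: "measure PG B \<le> exp (- (n * \<epsilon>\<^sup>2) / 32)"
    by (rule LIMSEQ_le_const2) (use ble in auto)
  define T where "T = space PG - B"
  have "T \<in> sets PG" using Bm by (auto simp: T_def)
  moreover have "1 - exp (- (n * \<epsilon>\<^sup>2) / 32) \<le> measure PG T"
    unfolding T_def using P.P.prob_compl[OF Bm] Ble by simp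
  moreover have "s * qform n \<xi> v \<le> (\<Sum>i<n. d i * (v i)\<^sup>2) + (\<tau> + \<epsilon>) * (\<Sum>i<n. (v i)\<^sup>2)" if \<xi>: "\<xi> \<in> T" for \<xi> v
  proof -
    have rat: "s * qform n \<xi> u \<le> (\<Sum>i<n. d i * (u i)\<^sup>2) + (\<tau> + \<epsilon>) * (\<Sum>i<n. (u i)\<^sup>2)" if u: "\<And>i. i < n \<Longrightarrow> u i \<in> \<rat>" for u
    proof (cases "nrm u = 0")
      case True
      then have "(\<Sum>i<n. (u i)\<^sup>2) = 0" by (simp add: nrm_def)
      then have "\<forall>i<n. u i = 0" by (auto simp: sum_nonneg_eq_0_iff)
      then show ?thesis by (simp add: qform_def)
    next
      case False
      define u' where "u' = restrict u {..<n}"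
      have eqs: "nrm u' = nrm u" "qform n \<xi> u' = qform n \<xi> u" "(\<Sum>i<n. d i * (u' i)\<^sup>2) = (\<Sum>i<n. d i * (u i)\<^sup>2)"
        by (simp_all add: u'_def nrm_def qform_def)
      have "u' \<in> Q" using u False eqs(1) by (auto simp: Q_def u'_def)
      then obtain m where m: "from_nat_into Q m = u'" using from_nat_into_surj[OF Qc] by blast
      define c where "c = inverse (nrm u)"
      have c: "c \<noteq> 0" using False by (simp add: c_def)
      have uV: "(\<lambda>i. c * u' i) \<in> V m" unfolding V_def c_def eqs(1)[symmetric] using m by blast
      have "\<xi> \<notin> bad m" "\<xi> \<in> space PG" using \<xi> by (auto simp: T_def B_def)
      then have nb: "\<not> (\<exists>v\<in>V m. (\<Sum>i<n. d i * (v i)\<^sup>2) + (\<tau> + \<epsilon>) < s * qform n \<xi> v)" by (auto simp only: bad_def mem_Collect_eq)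
      have "s * qform n \<xi> (\<lambda>i. c * u' i) \<le> (\<Sum>i<n. d i * (c * u' i)\<^sup>2) + (\<tau> + \<epsilon>)"
      proof (rule ccontr)
        assume "\<not> ?thesis"
        then have lt: "(\<Sum>i<n. d i * (c * u' i)\<^sup>2) + (\<tau> + \<epsilon>) < s * qform n \<xi> (\<lambda>i. c * u' i)" by (simp only: not_le)
        show False by (rule notE[OF nb], rule bexI[OF _ uV], rule lt)
      qed
      moreover have "(\<Sum>i<n. d i * (c * u' i)\<^sup>2) = c\<^sup>2 * (\<Sum>i<n. d i * (u i)\<^sup>2)"
        unfolding eqs(3)[symmetric] sum_distrib_left by (intro sum.cong refl) (simp only: power_mult_distrib ac_simps)
      ultimately have h1: "s * (c\<^sup>2 * qform n \<xi> u) \<le> c\<^sup>2 * (\<Sum>i<n. d i * (u i)\<^sup>2) + (\<tau> + \<epsilon>)"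
        by (simp add: qform_scale eqs(2))
      have h2: "(nrm u)\<^sup>2 * c\<^sup>2 = 1" unfolding power_mult_distrib[symmetric] using False by (simp add: c_def)
      have "s * qform n \<xi> u \<le> (\<Sum>i<n. d i * (u i)\<^sup>2) + (\<tau> + \<epsilon>) * (nrm u)\<^sup>2"
        by (rule le_of_scaled[OF h1 h2]) simp
      moreover have "(nrm u)\<^sup>2 = (\<Sum>i<n. (u i)\<^sup>2)" unfolding nrm_def by (rule real_sqrt_pow2) (simp add: sum_nonneg)
      ultimately show ?thesis by simp
    qed
    define r where "r m i = real_of_int \<lfloor>real m * v i\<rfloor> / real m" for m i
    have r: "(\<lambda>m. r m i) \<longlonglongrightarrow> v i" for i unfolding r_def by (rule floor_approx_tendsto)
    have "(\<lambda>m. s * qform n \<xi> (r m)) \<longlonglongrightarrow> s * qform n \<xi> v" unfolding qform_def by (intro tendsto_intros r)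
    moreover have "(\<lambda>m. (\<Sum>i<n. d i * (r m i)\<^sup>2) + (\<tau> + \<epsilon>) * (\<Sum>i<n. (r m i)\<^sup>2)) \<longlonglongrightarrow> (\<Sum>i<n. d i * (v i)\<^sup>2) + (\<tau> + \<epsilon>) * (\<Sum>i<n. (v i)\<^sup>2)"
      by (intro tendsto_intros r)
    ultimately show ?thesis
      by (rule LIMSEQ_le) (intro exI allI impI rat, simp add: r_def)
  qed
  ultimately show thesis using that unfolding \<tau>_def by blast
qed

end

section \<open>Operator and Frobenius norms\<close>

definition vnorm :: "real vec \<Rightarrow> real" where "vnorm v = sqrt (v \<bullet> v)"

text \<open>A bound for the spectral norm as a predicate, which avoids introducing the norm as a
  supremum.\<close>

definition op_bound :: "nat \<Rightarrow> real mat \<Rightarrow> real \<Rightarrow> bool" where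
  "op_bound n M b \<longleftrightarrow> M \<in> carrier_mat n n \<and> 0 \<le> b \<and> (\<forall>v\<in>carrier_vec n. vnorm (M *\<^sub>v v) \<le> b * vnorm v)"

definition row_norm :: "nat \<Rightarrow> real mat \<Rightarrow> nat \<Rightarrow> real" where
  "row_norm n M i = L2_set (\<lambda>j. M $$ (i, j)) {..<n}"

definition frob :: "nat \<Rightarrow> real mat \<Rightarrow> real" where
  "frob n M = L2_set (row_norm n M) {..<n}"

definition is_inv :: "nat \<Rightarrow> real mat \<Rightarrow> real mat \<Rightarrow> bool" where
  "is_inv n M X \<longleftrightarrow> M \<in> carrier_mat n n \<and> X \<in> carrier_mat n n \<and> M * X = 1\<^sub>m n \<and> X * M = 1\<^sub>m n"

context
  fixes n :: nat
begin

lemma scalar_prod_lessThan: "w \<in> carrier_vec n \<Longrightarrow> v \<bullet> w = (\<Sum>i<n. v $ i * w $ i)"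
  by (simp add: scalar_prod_def atLeast0LessThan)

lemma vnorm_eq: "v \<in> carrier_vec n \<Longrightarrow> vnorm v = L2_set (\<lambda>i. v $ i) {..<n}"
  by (simp add: vnorm_def scalar_prod_lessThan L2_set_def power2_eq_square)

lemma vnorm_nonneg: "v \<in> carrier_vec n \<Longrightarrow> 0 \<le> vnorm v"
  by (simp add: vnorm_eq L2_set_nonneg)

lemma vnorm_sq: "v \<in> carrier_vec n \<Longrightarrow> (vnorm v)\<^sup>2 = v \<bullet> v"
  by (simp add: vnorm_def scalar_prod_lessThan sum_nonneg)

lemma vnorm_eq_0: "v \<in> carrier_vec n \<Longrightarrow> vnorm v = 0 \<Longrightarrow> v = 0\<^sub>v n"
  by (intro eq_vecI) (auto simp: vnorm_eq L2_set_eq_0_iff)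

lemma vnorm_zero: "vnorm (0\<^sub>v n) = 0"
  by (simp add: vnorm_def)

lemma scalar_prod_le_vnorm:
  assumes "v \<in> carrier_vec n" "w \<in> carrier_vec n"
  shows "\<bar>v \<bullet> w\<bar> \<le> vnorm v * vnorm w"
proof -
  have "\<bar>v \<bullet> w\<bar> \<le> (\<Sum>i<n. \<bar>v $ i\<bar> * \<bar>w $ i\<bar>)"
    unfolding scalar_prod_lessThan[OF assms(2)] by (rule order_trans[OF sum_abs]) (simp only: abs_mult order_refl)
  also have "\<dots> \<le> vnorm v * vnorm w"
    unfolding vnorm_eq[OF assms(1)] vnorm_eq[OF assms(2)] by (rule L2_set_mult_ineq)
  finally show ?thesis .
qed

lemma vnorm_add:
  assumes "v \<in> carrier_vec n" "w \<in> carrier_vec n"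
  shows "vnorm (v + w) \<le> vnorm v + vnorm w"
proof -
  have "vnorm (v + w) = L2_set (\<lambda>i. v $ i + w $ i) {..<n}"
    using assms by (subst vnorm_eq) (auto intro!: L2_set_cong)
  then show ?thesis using L2_set_triangle_ineq[of "\<lambda>i. v $ i" "\<lambda>i. w $ i" "{..<n}"] assms by (simp add: vnorm_eq)
qed

lemma vnorm_smult:
  assumes "v \<in> carrier_vec n"
  shows "vnorm (c \<cdot>\<^sub>v v) = \<bar>c\<bar> * vnorm v"
proof -
  have "(c \<cdot>\<^sub>v v) \<bullet> (c \<cdot>\<^sub>v v) = c\<^sup>2 * (v \<bullet> v)" using assms by (simp add: power2_eq_square)
  then show ?thesis by (simp add: vnorm_def real_sqrt_mult)
qed

lemma smult_mat_vec:
  assumes "M \<in> carrier_mat n n" "v \<in> carrier_vec n"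
  shows "(c \<cdot>\<^sub>m M) *\<^sub>v v = c \<cdot>\<^sub>v (M *\<^sub>v v)"
  using assms by (intro eq_vecI) (auto simp: scalar_prod_lessThan sum_distrib_left algebra_simps)

lemma op_boundI:
  assumes "M \<in> carrier_mat n n" "0 \<le> b" "\<And>v. v \<in> carrier_vec n \<Longrightarrow> vnorm (M *\<^sub>v v) \<le> b * vnorm v"
  shows "op_bound n M b"
  using assms by (simp add: op_bound_def)

lemma op_boundD:
  assumes "op_bound n M b"
  shows "M \<in> carrier_mat n n" "0 \<le> b" "\<And>v. v \<in> carrier_vec n \<Longrightarrow> vnorm (M *\<^sub>v v) \<le> b * vnorm v"
  using assms by (auto simp: op_bound_def)

lemma op_bound_mono: "op_bound n M b \<Longrightarrow> b \<le> b' \<Longrightarrow> op_bound n M b'"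
proof (rule op_boundI)
  assume M: "op_bound n M b" and b: "b \<le> b'"
  show "M \<in> carrier_mat n n" "0 \<le> b'" using op_boundD[OF M] b by auto
  fix v :: "real vec" assume v: "v \<in> carrier_vec n"
  show "vnorm (M *\<^sub>v v) \<le> b' * vnorm v"
    using op_boundD(3)[OF M v] mult_right_mono[OF b vnorm_nonneg[OF v]] by linarith
qed

lemma op_bound_add:
  assumes M: "op_bound n M a" and N: "op_bound n N b"
  shows "op_bound n (M + N) (a + b)"
proof (rule op_boundI)
  note c = op_boundD[OF M] op_boundD[OF N]
  show "M + N \<in> carrier_mat n n" "0 \<le> a + b" using c by auto
  fix v :: "real vec" assume v: "v \<in> carrier_vec n"
  have "vnorm ((M + N) *\<^sub>v v) = vnorm (M *\<^sub>v v + N *\<^sub>v v)" using c v by (simp add: add_mult_distrib_mat_vec)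
  also have "\<dots> \<le> vnorm (M *\<^sub>v v) + vnorm (N *\<^sub>v v)" by (intro vnorm_add mult_mat_vec_carrier[OF c(1) v] mult_mat_vec_carrier[OF c(4) v])
  also have "\<dots> \<le> (a + b) * vnorm v" using c(3)[OF v] c(6)[OF v] by (simp add: distrib_right)
  finally show "vnorm ((M + N) *\<^sub>v v) \<le> (a + b) * vnorm v" .
qed

lemma op_bound_smult:
  assumes M: "op_bound n M a"
  shows "op_bound n (c \<cdot>\<^sub>m M) (\<bar>c\<bar> * a)"
proof (rule op_boundI)
  note m = op_boundD[OF M]
  show "c \<cdot>\<^sub>m M \<in> carrier_mat n n" "0 \<le> \<bar>c\<bar> * a" using m by auto
  fix v :: "real vec" assume v: "v \<in> carrier_vec n"
  have "vnorm ((c \<cdot>\<^sub>m M) *\<^sub>v v) = \<bar>c\<bar> * vnorm (M *\<^sub>v v)"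
    using smult_mat_vec[OF m(1) v] vnorm_smult[OF mult_mat_vec_carrier[OF m(1) v]] by simp
  also have "\<dots> \<le> \<bar>c\<bar> * (a * vnorm v)" using m(3)[OF v] by (rule mult_left_mono) simp
  finally show "vnorm ((c \<cdot>\<^sub>m M) *\<^sub>v v) \<le> \<bar>c\<bar> * a * vnorm v" by (simp add: mult.assoc)
qed

lemma op_bound_diff:
  assumes M: "op_bound n M a" and N: "op_bound n N b"
  shows "op_bound n (M - N) (a + b)"
proof -
  have "M - N = M + (-1) \<cdot>\<^sub>m N" using op_boundD(1)[OF M] op_boundD(1)[OF N] by (intro eq_matI) auto
  then show ?thesis using op_bound_add[OF M op_bound_smult[OF N, of "-1"]] by simp
qed

lemma op_bound_mult:
  assumes M: "op_bound n M a" and N: "op_bound n N b"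
  shows "op_bound n (M * N) (a * b)"
proof (rule op_boundI)
  note c = op_boundD[OF M] op_boundD[OF N]
  show "M * N \<in> carrier_mat n n" "0 \<le> a * b" using c by auto
  fix v :: "real vec" assume v: "v \<in> carrier_vec n"
  have "vnorm ((M * N) *\<^sub>v v) = vnorm (M *\<^sub>v (N *\<^sub>v v))" using c v by simp
  also have "\<dots> \<le> a * vnorm (N *\<^sub>v v)" by (rule c(3)[OF mult_mat_vec_carrier[OF c(4) v]])
  also have "\<dots> \<le> a * (b * vnorm v)" by (rule mult_left_mono[OF c(6)[OF v] c(2)])
  finally show "vnorm ((M * N) *\<^sub>v v) \<le> a * b * vnorm v" by (simp add: mult.assoc)
qed

lemma op_bound_transpose:
  assumes M: "op_bound n M b"
  shows "op_bound n (transpose_mat M) b"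
proof (rule op_boundI)
  note m = op_boundD[OF M]
  show t: "transpose_mat M \<in> carrier_mat n n" "0 \<le> b" using m by auto
  fix v :: "real vec" assume v: "v \<in> carrier_vec n"
  define w where "w = transpose_mat M *\<^sub>v v"
  have w: "w \<in> carrier_vec n" unfolding w_def using t v by auto
  have "(vnorm w)\<^sup>2 = v \<bullet> (M *\<^sub>v w)"
    unfolding vnorm_sq[OF w] using transpose_vec_mult_scalar[OF m(1) w v] by (simp add: w_def)
  also have "\<dots> \<le> vnorm v * vnorm (M *\<^sub>v w)" using scalar_prod_le_vnorm[OF v mult_mat_vec_carrier[OF m(1) w]] by linarith
  also have "\<dots> \<le> vnorm v * (b * vnorm w)" by (rule mult_left_mono[OF m(3)[OF w] vnorm_nonneg[OF v]])
  finally have le: "vnorm w * vnorm w \<le> (b * vnorm v) * vnorm w" by (simp add: power2_eq_square ac_simps)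
  show "vnorm w \<le> b * vnorm v"
  proof (cases "vnorm w = 0")
    case True then show ?thesis using m(2) vnorm_nonneg[OF v] by simp
  next
    case False
    then have "vnorm w > 0" using vnorm_nonneg[OF w] by simp
    then show ?thesis using le by simp
  qed
qed

lemma op_bound_diag:
  assumes "\<And>i. i < n \<Longrightarrow> \<bar>d i\<bar> \<le> b" "0 \<le> b"
  shows "op_bound n (mat_diag n d) b"
proof (rule op_boundI)
  fix v :: "real vec" assume v: "v \<in> carrier_vec n"
  have e: "(mat_diag n d *\<^sub>v v) $ i = d i * v $ i" if "i < n" for i
    using that v by (simp add: scalar_prod_lessThan mat_diag_def if_distrib[of "\<lambda>x. x * _"] cong: if_cong)
  have "vnorm (mat_diag n d *\<^sub>v v) = L2_set (\<lambda>i. d i * v $ i) {..<n}"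
    unfolding vnorm_eq[OF mult_mat_vec_carrier[OF mat_diag_dim v]] using e by (intro L2_set_cong) auto
  also have "\<dots> = sqrt (\<Sum>i<n. (d i)\<^sup>2 * (v $ i)\<^sup>2)" by (simp add: L2_set_def power_mult_distrib)
  also have "\<dots> \<le> sqrt (\<Sum>i<n. b\<^sup>2 * (v $ i)\<^sup>2)"
  proof (intro real_sqrt_le_mono sum_mono mult_right_mono)
    fix i assume "i \<in> {..<n}"
    then show "(d i)\<^sup>2 \<le> b\<^sup>2" using assms by (metis abs_le_square_iff abs_of_nonneg lessThan_iff)
  qed auto
  also have "\<dots> = b * vnorm v"
    using assms(2) v by (simp add: vnorm_eq L2_set_def real_sqrt_mult flip: sum_distrib_left)
  finally show "vnorm (mat_diag n d *\<^sub>v v) \<le> b * vnorm v" .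
qed (use assms in auto)

lemma op_bound_one: "op_bound n (1\<^sub>m n) 1"
  by (rule op_boundI) auto

lemma row_norm_eq: "M \<in> carrier_mat n n \<Longrightarrow> i < n \<Longrightarrow> row_norm n M i = vnorm (row M i)"
  by (subst vnorm_eq) (auto simp: row_norm_def intro!: L2_set_cong)

lemma row_norm_nonneg: "0 \<le> row_norm n M i" by (simp add: row_norm_def L2_set_nonneg)

lemma frob_nonneg: "0 \<le> frob n M" by (simp add: frob_def L2_set_nonneg)

lemma frob_sq: "(frob n M)\<^sup>2 = (\<Sum>i<n. \<Sum>j<n. (M $$ (i, j))\<^sup>2)"
  by (simp add: frob_def row_norm_def L2_set_def sum_nonneg)

lemma frob_eq_sqrt: "frob n M = sqrt (\<Sum>i<n. \<Sum>j<n. (M $$ (i, j))\<^sup>2)"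
  unfolding frob_sq[symmetric] by (simp add: frob_nonneg)

lemma row_norm_add:
  assumes "M \<in> carrier_mat n n" "N \<in> carrier_mat n n" "i < n"
  shows "row_norm n (M + N) i \<le> row_norm n M i + row_norm n N i"
proof -
  have "row_norm n (M + N) i = L2_set (\<lambda>j. M $$ (i, j) + N $$ (i, j)) {..<n}"
    unfolding row_norm_def using assms by (intro L2_set_cong) auto
  then show ?thesis unfolding row_norm_def by (simp add: L2_set_triangle_ineq)
qed

lemma frob_add:
  assumes "M \<in> carrier_mat n n" "N \<in> carrier_mat n n"
  shows "frob n (M + N) \<le> frob n M + frob n N"
proof -
  have "frob n (M + N) \<le> L2_set (\<lambda>i. row_norm n M i + row_norm n N i) {..<n}"
    unfolding frob_def using assms by (intro L2_set_mono row_norm_add) (auto simp: row_norm_nonneg)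
  also have "\<dots> \<le> frob n M + frob n N" unfolding frob_def by (rule L2_set_triangle_ineq)
  finally show ?thesis .
qed

lemma frob_smult:
  assumes "M \<in> carrier_mat n n"
  shows "frob n (c \<cdot>\<^sub>m M) = \<bar>c\<bar> * frob n M"
proof -
  have "(\<Sum>i<n. \<Sum>j<n. ((c \<cdot>\<^sub>m M) $$ (i, j))\<^sup>2) = c\<^sup>2 * (\<Sum>i<n. \<Sum>j<n. (M $$ (i, j))\<^sup>2)"
    unfolding sum_distrib_left using assms by (intro sum.cong refl) (auto simp: power_mult_distrib)
  then show ?thesis by (simp add: frob_eq_sqrt real_sqrt_mult)
qed

lemma frob_transpose:
  assumes "M \<in> carrier_mat n n"
  shows "frob n (transpose_mat M) = frob n M"
proof -
  have "(\<Sum>i<n. \<Sum>j<n. (transpose_mat M $$ (i, j))\<^sup>2) = (\<Sum>i<n. \<Sum>j<n. (M $$ (j, i))\<^sup>2)"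
    using assms by (intro sum.cong refl) auto
  also have "\<dots> = (\<Sum>i<n. \<Sum>j<n. (M $$ (i, j))\<^sup>2)" by (rule sum.swap)
  finally show ?thesis by (simp add: frob_eq_sqrt)
qed

lemma frob_sq_cols:
  assumes "M \<in> carrier_mat n n"
  shows "(frob n M)\<^sup>2 = (\<Sum>j<n. (vnorm (col M j))\<^sup>2)"
proof -
  have "(\<Sum>j<n. (vnorm (col M j))\<^sup>2) = (\<Sum>j<n. \<Sum>i<n. (M $$ (i, j))\<^sup>2)"
  proof (intro sum.cong refl)
    fix j assume j: "j \<in> {..<n}"
    have c: "col M j \<in> carrier_vec n" using assms by auto
    show "(vnorm (col M j))\<^sup>2 = (\<Sum>i<n. (M $$ (i, j))\<^sup>2)"
      unfolding vnorm_sq[OF c] scalar_prod_lessThan[OF c] using assms j by (intro sum.cong refl) (auto simp: power2_eq_square)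
  qed
  also have "\<dots> = (\<Sum>i<n. \<Sum>j<n. (M $$ (i, j))\<^sup>2)" by (rule sum.swap)
  finally show ?thesis by (simp add: frob_sq)
qed

lemma frob_mult_left:
  assumes M: "op_bound n M b" and X: "X \<in> carrier_mat n n"
  shows "frob n (M * X) \<le> b * frob n X"
proof -
  note m = op_boundD[OF M]
  have "(frob n (M * X))\<^sup>2 = (\<Sum>j<n. (vnorm (M *\<^sub>v col X j))\<^sup>2)"
    using m(1) X by (subst frob_sq_cols) (auto intro!: sum.cong)
  also have "\<dots> \<le> (\<Sum>j<n. (b * vnorm (col X j))\<^sup>2)"
  proof (intro sum_mono power_mono)
    fix j
    have c: "col X j \<in> carrier_vec n" using X by auto
    show "vnorm (M *\<^sub>v col X j) \<le> b * vnorm (col X j)" by (rule m(3)[OF c])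
    show "0 \<le> vnorm (M *\<^sub>v col X j)" by (rule vnorm_nonneg[OF mult_mat_vec_carrier[OF m(1) c]])
  qed
  also have "\<dots> = (b * frob n X)\<^sup>2"
    unfolding power_mult_distrib frob_sq_cols[OF X] by (simp add: sum_distrib_left)
  finally show ?thesis using m(2) frob_nonneg by (meson mult_nonneg_nonneg power2_le_imp_le)
qed

lemma frob_mult_right:
  assumes M: "op_bound n M b" and X: "X \<in> carrier_mat n n"
  shows "frob n (X * M) \<le> b * frob n X"
proof -
  note m = op_boundD[OF M]
  have "frob n (X * M) = frob n (transpose_mat (X * M))" using X m by (intro frob_transpose[symmetric]) auto
  also have "transpose_mat (X * M) = transpose_mat M * transpose_mat X" by (rule transpose_mult[OF X m(1)])
  also have "frob n \<dots> \<le> b * frob n (transpose_mat X)" using X by (intro frob_mult_left op_bound_transpose[OF M]) auto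
  finally show ?thesis using frob_transpose[OF X] by simp
qed

lemma frob_one: "frob n (1\<^sub>m n) = sqrt (real n)"
proof -
  have "(\<Sum>i<n. \<Sum>j<n. ((1\<^sub>m n :: real mat) $$ (i, j))\<^sup>2) = (\<Sum>i<n. \<Sum>j<n. if j = i then 1 else 0)"
    by (intro sum.cong refl) auto
  then show ?thesis by (simp add: frob_eq_sqrt)
qed

lemma frob_le_op_bound:
  assumes M: "op_bound n M b"
  shows "frob n M \<le> b * sqrt (real n)"
  using frob_mult_left[OF M, of "1\<^sub>m n"] op_boundD(1)[OF M] by (simp add: frob_one)

lemma op_bound_frob:
  assumes M: "M \<in> carrier_mat n n"
  shows "op_bound n M (frob n M)"
proof (rule op_boundI[OF M frob_nonneg])
  fix v :: "real vec" assume v: "v \<in> carrier_vec n"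
  have "vnorm (M *\<^sub>v v) = L2_set (\<lambda>i. row M i \<bullet> v) {..<n}"
    using M v by (subst vnorm_eq) (auto intro!: L2_set_cong)
  also have "\<dots> \<le> L2_set (\<lambda>i. vnorm v * row_norm n M i) {..<n}"
    unfolding L2_set_def
  proof (intro real_sqrt_le_mono sum_mono)
    fix i assume i: "i \<in> {..<n}"
    have r: "row M i \<in> carrier_vec n" using M by auto
    have "\<bar>row M i \<bullet> v\<bar> \<le> vnorm v * row_norm n M i"
      using scalar_prod_le_vnorm[OF r v] row_norm_eq[OF M] i by (simp add: mult.commute)
    then show "(row M i \<bullet> v)\<^sup>2 \<le> (vnorm v * row_norm n M i)\<^sup>2" by (metis abs_ge_zero power2_abs power_mono)
  qed
  also have "\<dots> = frob n M * vnorm v"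
    unfolding frob_def by (subst L2_set_right_distrib[symmetric]) (simp_all add: vnorm_nonneg[OF v] mult.commute)
  finally show "vnorm (M *\<^sub>v v) \<le> frob n M * vnorm v" .
qed

lemma vnorm_col_le:
  assumes M: "op_bound n M b" and i: "i < n"
  shows "vnorm (col M i) \<le> b"
proof -
  note m = op_boundD[OF M]
  have "col M i = M *\<^sub>v unit_vec n i" using m(1) i by (intro eq_vecI) auto
  moreover have "vnorm (unit_vec n i) = 1" using i by (simp add: vnorm_def)
  ultimately show ?thesis using m(3)[of "unit_vec n i"] by simp
qed

lemma row_norm_le:
  assumes M: "op_bound n M b" and i: "i < n"
  shows "row_norm n M i \<le> b"
proof -
  have "row_norm n M i = vnorm (col (transpose_mat M) i)"
    using op_boundD(1)[OF M] i by (simp add: row_norm_eq)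
  then show ?thesis using vnorm_col_le[OF op_bound_transpose[OF M] i] by simp
qed

lemma is_invD:
  assumes "is_inv n M X"
  shows "M \<in> carrier_mat n n" "X \<in> carrier_mat n n" "M * X = 1\<^sub>m n" "X * M = 1\<^sub>m n"
  using assms by (auto simp: is_inv_def)

lemma is_inv_unique:
  assumes "is_inv n M X" "is_inv n M Y"
  shows "X = Y"
proof -
  note c = is_invD[OF assms(1)] is_invD[OF assms(2)]
  have "X = X * (M * Y)" using c by simp
  also have "\<dots> = (X * M) * Y" using c by (intro assoc_mult_mat[symmetric]) auto
  also have "\<dots> = Y" using c by simp
  finally show ?thesis .
qed

lemma ex_is_inv_of_det:
  assumes M: "M \<in> carrier_mat n n" and d: "Determinant.det M \<noteq> 0"
  shows "is_inv n M ((1 / Determinant.det M) \<cdot>\<^sub>m adj_mat M)"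
proof -
  note a = adj_mat[OF M]
  have "M * ((1 / Determinant.det M) \<cdot>\<^sub>m adj_mat M) = (1 / Determinant.det M) \<cdot>\<^sub>m (M * adj_mat M)" by (rule mult_smult_distrib[OF M a(1)])
  also have "\<dots> = 1\<^sub>m n" unfolding a(2) using d by (intro eq_matI) auto
  finally have 1: "M * ((1 / Determinant.det M) \<cdot>\<^sub>m adj_mat M) = 1\<^sub>m n" .
  have "((1 / Determinant.det M) \<cdot>\<^sub>m adj_mat M) * M = (1 / Determinant.det M) \<cdot>\<^sub>m (adj_mat M * M)" by (rule mult_smult_assoc_mat[OF a(1) M])
  also have "\<dots> = 1\<^sub>m n" unfolding a(3) using d by (intro eq_matI) auto
  finally show ?thesis using 1 M a(1) by (simp add: is_inv_def)
qed

text \<open>A kernel vector would violate the lower bound, so the determinant is nonzero; applied to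
  \<open>X *\<^sub>v v\<close>, the lower bound becomes the norm bound for the inverse.\<close>

lemma is_inv_of_lower_bound:
  assumes M: "M \<in> carrier_mat n n" and s: "s > 0" and low: "\<And>v. v \<in> carrier_vec n \<Longrightarrow> s * vnorm v \<le> vnorm (M *\<^sub>v v)"
  shows "Determinant.det M \<noteq> 0" and "is_inv n M X \<Longrightarrow> op_bound n X (1 / s)"
proof -
  show "Determinant.det M \<noteq> 0"
  proof
    assume "Determinant.det M = 0"
    then obtain v where v: "v \<in> carrier_vec n" "v \<noteq> 0\<^sub>v n" "M *\<^sub>v v = 0\<^sub>v n"
      unfolding det_0_iff_vec_prod_zero[OF M] by auto
    have "s * vnorm v \<le> 0" using low[OF v(1)] v(3) vnorm_zero by simp
    then have "vnorm v = 0" using s vnorm_nonneg[OF v(1)] by (simp add: mult_le_0_iff)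
    then show False using vnorm_eq_0 v by auto
  qed
  assume X: "is_inv n M X"
  note c = is_invD[OF X]
  show "op_bound n X (1 / s)"
  proof (rule op_boundI[OF c(2)])
    show "0 \<le> 1 / s" using s by simp
    fix v :: "real vec" assume v: "v \<in> carrier_vec n"
    have xv: "X *\<^sub>v v \<in> carrier_vec n" by (rule mult_mat_vec_carrier[OF c(2) v])
    have "M *\<^sub>v (X *\<^sub>v v) = v" using assoc_mult_mat_vec[OF c(1,2) v] c(3) v by simp
    then have "s * vnorm (X *\<^sub>v v) \<le> vnorm v" using low[OF xv] by simp
    then show "vnorm (X *\<^sub>v v) \<le> 1 / s * vnorm v" using s by (simp add: field_simps)
  qed
qed

text \<open>The resolvent identity. It speaks of the two inverses only, so no path between
  \<open>M\<close> and \<open>M'\<close> has to stay invertible.\<close>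

lemma inv_diff:
  assumes "is_inv n M X" "is_inv n M' X'"
  shows "X - X' = X * (M' - M) * X'"
proof -
  note c = is_invD[OF assms(1)] is_invD[OF assms(2)]
  have "X * (M' - M) * X' = (X * M' - X * M) * X'" using c by (simp add: mult_minus_distrib_mat)
  also have "\<dots> = X * M' * X' - X * M * X'" using c by (intro minus_mult_distrib_mat) auto
  also have "X * M' * X' = X * (M' * X')" using c by (intro assoc_mult_mat) auto
  also have "X * (M' * X') - X * M * X' = X - X'" using c by simp
  finally show ?thesis by simp
qed

lemma frob_inv_diff:
  assumes X: "is_inv n M X" "op_bound n X a" and X': "is_inv n M' X'" "op_bound n X' b"
  shows "frob n (X - X') \<le> a * b * frob n (M' - M)"
proof -
  note c = is_invD[OF X(1)] is_invD[OF X'(1)]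
  have "frob n (X - X') = frob n (X * (M' - M) * X')" unfolding inv_diff[OF X(1) X'(1)] ..
  also have "\<dots> \<le> b * frob n (X * (M' - M))" using c by (intro frob_mult_right[OF X'(2)]) auto
  also have "\<dots> \<le> b * (a * frob n (M' - M))"
    using c op_boundD(2)[OF X'(2)] by (intro mult_left_mono frob_mult_left[OF X(2)]) auto
  finally show ?thesis by (simp add: ac_simps)
qed

lemma op_bound_inv_diff:
  assumes X: "is_inv n M X" "op_bound n X a" and X': "is_inv n M' X'" "op_bound n X' b" and h: "op_bound n (M' - M) h"
  shows "op_bound n (X - X') (a * b * h)"
  using op_bound_mult[OF op_bound_mult[OF X(2) h] X'(2)] unfolding inv_diff[OF X(1) X'(1)] by (simp add: ac_simps)

definition rsq :: "real mat \<Rightarrow> nat \<Rightarrow> real" where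
  "rsq X i = (\<Sum>j<n. (X $$ (i, j))\<^sup>2)"

lemma row_dot_le: "\<bar>\<Sum>j<n. M $$ (i, j) * N $$ (i, j)\<bar> \<le> row_norm n M i * row_norm n N i"
  unfolding row_norm_def by (rule order_trans[OF sum_abs], unfold abs_mult, rule L2_set_mult_ineq)

text \<open>Differences of squares factor entrywise. The rows of \<open>X + X'\<close> are bounded
  by \<open>2 * a\<close>, and the row norms of \<open>X - X'\<close> combine to the Frobenius norm,
  so no factor \<open>sqrt n\<close> is lost.\<close>

lemma rsq_diff_le:
  assumes X: "op_bound n X a" and X': "op_bound n X' a"
  shows "L2_set (\<lambda>i. rsq X i - rsq X' i) {..<n} \<le> 2 * a * frob n (X - X')"
proof -
  note c = op_boundD(1)[OF X] op_boundD(1)[OF X']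
  have a: "0 \<le> a" by (rule op_boundD(2)[OF X])
  have b: "\<bar>rsq X i - rsq X' i\<bar> \<le> 2 * a * row_norm n (X - X') i" if i: "i < n" for i
  proof -
    have "rsq X i - rsq X' i = (\<Sum>j<n. (X - X') $$ (i, j) * (X + X') $$ (i, j))"
      unfolding rsq_def sum_subtractf[symmetric] using c i
      by (intro sum.cong refl) (auto simp: power2_eq_square algebra_simps)
    also have "\<bar>\<dots>\<bar> \<le> row_norm n (X - X') i * row_norm n (X + X') i" by (rule row_dot_le)
    also have "\<dots> \<le> row_norm n (X - X') i * (a + a)"
      by (intro mult_left_mono row_norm_le[OF op_bound_add[OF X X'] i] row_norm_nonneg)
    finally show ?thesis by (simp add: ac_simps)
  qed
  have "L2_set (\<lambda>i. rsq X i - rsq X' i) {..<n} = L2_set (\<lambda>i. \<bar>rsq X i - rsq X' i\<bar>) {..<n}" by (simp add: L2_set_def)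
  also have "\<dots> \<le> L2_set (\<lambda>i. 2 * a * row_norm n (X - X') i) {..<n}"
    using b by (intro L2_set_mono) auto
  also have "\<dots> = 2 * a * frob n (X - X')" unfolding frob_def by (rule L2_set_right_distrib[symmetric]) (use a in auto)
  finally show ?thesis .
qed

text \<open>Entrywise, the second difference of squares equals the second difference times
  \<open>N + N'\<close>, plus \<open>N0 - N0'\<close> times the change of the sum. The first term is
  small in both variables at once, the second is a product of two first differences.\<close>

lemma rsq_second_diff_le:
  assumes N: "op_bound n N a" "op_bound n N' a" and N0: "op_bound n N0 a" "op_bound n N0' a"
    and h: "op_bound n (N0 - N0') h"
  shows "L2_set (\<lambda>i. (rsq N i - rsq N' i) - (rsq N0 i - rsq N0' i)) {..<n}
    \<le> 2 * a * frob n ((N - N') - (N0 - N0')) + h * (frob n (N - N0) + frob n (N' - N0'))"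
proof -
  note c = op_boundD(1)[OF N(1)] op_boundD(1)[OF N(2)] op_boundD(1)[OF N0(1)] op_boundD(1)[OF N0(2)]
  have a: "0 \<le> a" "0 \<le> h" by (rule op_boundD(2)[OF N(1)], rule op_boundD(2)[OF h])
  let ?E = "(N - N') - (N0 - N0')" and ?S = "(N - N0) + (N' - N0')"
  have b: "\<bar>(rsq N i - rsq N' i) - (rsq N0 i - rsq N0' i)\<bar> \<le> 2 * a * row_norm n ?E i + h * row_norm n ?S i" if i: "i < n" for i
  proof -
    have "(rsq N i - rsq N' i) - (rsq N0 i - rsq N0' i) = (\<Sum>j<n. ?E $$ (i, j) * (N + N') $$ (i, j)) + (\<Sum>j<n. (N0 - N0') $$ (i, j) * ?S $$ (i, j))"
      unfolding rsq_def sum_subtractf[symmetric] sum.distrib[symmetric] using c i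
      by (intro sum.cong refl) (auto simp: power2_eq_square algebra_simps)
    also have "\<bar>\<dots>\<bar> \<le> row_norm n ?E i * row_norm n (N + N') i + row_norm n (N0 - N0') i * row_norm n ?S i"
      by (rule order_trans[OF abs_triangle_ineq add_mono[OF row_dot_le row_dot_le]])
    also have "\<dots> \<le> row_norm n ?E i * (a + a) + h * row_norm n ?S i"
      by (intro add_mono mult_left_mono mult_right_mono row_norm_le[OF op_bound_add[OF N] i] row_norm_le[OF h i] row_norm_nonneg)
    finally show ?thesis by (simp add: ac_simps)
  qed
  have "L2_set (\<lambda>i. (rsq N i - rsq N' i) - (rsq N0 i - rsq N0' i)) {..<n} = L2_set (\<lambda>i. \<bar>(rsq N i - rsq N' i) - (rsq N0 i - rsq N0' i)\<bar>) {..<n}" by (simp add: L2_set_def)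
  also have "\<dots> \<le> L2_set (\<lambda>i. 2 * a * row_norm n ?E i + h * row_norm n ?S i) {..<n}"
    using b by (intro L2_set_mono) auto
  also have "\<dots> \<le> L2_set (\<lambda>i. 2 * a * row_norm n ?E i) {..<n} + L2_set (\<lambda>i. h * row_norm n ?S i) {..<n}" by (rule L2_set_triangle_ineq)
  also have "\<dots> = 2 * a * frob n ?E + h * frob n ?S"
    unfolding frob_def using a by (simp add: L2_set_right_distrib)
  also have "\<dots> \<le> 2 * a * frob n ?E + h * (frob n (N - N0) + frob n (N' - N0'))"
    using c a by (intro add_left_mono mult_left_mono frob_add) auto
  finally show ?thesis .
qed

end

section \<open>The resolvent as a function of the matrix and the profile\<close>

text \<open>The adjugate formula is total and rational in the entries, so measurability can be shown
  without discussing invertibility.\<close>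

definition minv :: "real mat \<Rightarrow> real mat" where
  "minv M = (1 / Determinant.det M) \<cdot>\<^sub>m adj_mat M"

lemma is_inv_minv:
  assumes "is_inv n M X"
  shows "minv M = X"
proof -
  note c = is_invD[OF assms]
  have "Determinant.det M * Determinant.det X = 1" using det_mult[OF c(1,2)] c(3) by simp
  then have "Determinant.det M \<noteq> 0" by auto
  then show ?thesis unfolding minv_def using is_inv_unique[OF ex_is_inv_of_det[OF c(1)] assms] by simp
qed

definition avg :: "nat \<Rightarrow> (nat \<Rightarrow> real) \<Rightarrow> real" where "avg n x = (\<Sum>i<n. x i) / real n"

text \<open>The product \<open>B X\<close>, expanded so that no reciprocal of \<open>x\<close>
  occurs and estimates stay uniform as \<open>x\<close> tends to 0.\<close>

definition resm :: "nat \<Rightarrow> real \<Rightarrow> (nat \<Rightarrow> real) \<Rightarrow> real mat \<Rightarrow> real mat" where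
  "resm n \<beta> x A = 1\<^sub>m n + (\<beta>\<^sup>2 * avg n x) \<cdot>\<^sub>m mat_diag n x - \<beta> \<cdot>\<^sub>m (A * mat_diag n x)"

text \<open>The norm bound 6 leaves room for norm 3 on a typical event and a Frobenius perturbation
  of size 3; \<kappa> bounds the inverse.\<close>

definition good :: "nat \<Rightarrow> real \<Rightarrow> real \<Rightarrow> (nat \<Rightarrow> real) \<Rightarrow> real mat \<Rightarrow> bool" where
  "good n \<beta> \<kappa> x A \<longleftrightarrow> op_bound n A 6 \<and> is_inv n (resm n \<beta> x A) (minv (resm n \<beta> x A)) \<and> op_bound n (minv (resm n \<beta> x A)) \<kappa>"

definition Zd :: "nat \<Rightarrow> real \<Rightarrow> (nat \<Rightarrow> real) \<Rightarrow> real mat \<Rightarrow> nat \<Rightarrow> real" where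
  "Zd n \<beta> x A = rsq n (minv (resm n \<beta> x A))"

definition tlim :: "nat \<Rightarrow> real \<Rightarrow> (nat \<Rightarrow> real) \<Rightarrow> real" where
  "tlim n \<beta> x = 1 / (1 - \<beta>\<^sup>2 * avg n (\<lambda>i. (x i)\<^sup>2))"

lemma resm_carrier: "A \<in> carrier_mat n n \<Longrightarrow> resm n \<beta> x A \<in> carrier_mat n n"
  by (auto simp: resm_def mat_diag_def intro!: carrier_matI)

lemma mult_diag_index:
  "A \<in> carrier_mat n n \<Longrightarrow> i < n \<Longrightarrow> j < n \<Longrightarrow> (A * mat_diag n x) $$ (i, j) = A $$ (i, j) * x j"
  by (subst mat_diag_mult_right[of _ n n]) auto

lemma resm_dim [simp]:
  "A \<in> carrier_mat n n \<Longrightarrow> dim_row (resm n \<beta> x A) = n" "A \<in> carrier_mat n n \<Longrightarrow> dim_col (resm n \<beta> x A) = n"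
  using resm_carrier by blast+

lemma dim_mat_diag [simp]: "dim_row (mat_diag n x) = n" "dim_col (mat_diag n x) = n"
  by (simp_all add: mat_diag_def)

lemma mat_diag_index: "i < n \<Longrightarrow> j < n \<Longrightarrow> mat_diag n x $$ (i, j) = (if i = j then x j else 0)"
  by (simp add: mat_diag_def)

lemma resm_index:
  assumes "A \<in> carrier_mat n n" "i < n" "j < n"
  shows "resm n \<beta> x A $$ (i, j) = (if i = j then 1 + \<beta>\<^sup>2 * avg n x * x j else 0) - \<beta> * (A $$ (i, j) * x j)"
  using assms mult_diag_index[OF assms, of x]
  by (simp add: resm_def mat_diag_def del: index_mult_mat(1))

lemma avg_le:
  assumes "n > 0" "\<And>i. i < n \<Longrightarrow> x i \<le> b"
  shows "avg n x \<le> b"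
proof -
  have "(\<Sum>i<n. x i) \<le> (\<Sum>i<n. b)" by (rule sum_mono) (use assms in auto)
  then show ?thesis using assms(1) by (simp add: avg_def field_simps)
qed

lemma avg_nonneg: "(\<And>i. i < n \<Longrightarrow> 0 \<le> x i) \<Longrightarrow> 0 \<le> avg n x"
  by (auto simp: avg_def intro!: divide_nonneg_nonneg sum_nonneg)

lemma avg_diff: "avg n x - avg n y = avg n (\<lambda>i. x i - y i)"
  by (simp add: avg_def sum_subtractf diff_divide_distrib)

lemma avg_abs: "\<bar>avg n x\<bar> \<le> avg n (\<lambda>i. \<bar>x i\<bar>)"
  by (simp add: avg_def divide_right_mono sum_abs)

lemma abs_avg_diff_le:
  assumes "n > 0" "\<And>i. i < n \<Longrightarrow> \<bar>x i - y i\<bar> \<le> \<delta>"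
  shows "\<bar>avg n x - avg n y\<bar> \<le> \<delta>"
  unfolding avg_diff by (rule order_trans[OF avg_abs avg_le]) (use assms in auto)

lemma resm_diff_A:
  assumes A: "A \<in> carrier_mat n n" "A' \<in> carrier_mat n n"
  shows "resm n \<beta> x A' - resm n \<beta> x A = (- \<beta>) \<cdot>\<^sub>m ((A' - A) * mat_diag n x)"
proof -
  have c: "A' - A \<in> carrier_mat n n" using A by auto
  show ?thesis
    using A by (intro eq_matI) (auto simp: resm_index mult_diag_index[OF c] algebra_simps simp del: index_mult_mat(1))
qed

lemma resm_diff_x:
  assumes A: "A \<in> carrier_mat n n"
  shows "resm n \<beta> x' A - resm n \<beta> x A = mat_diag n (\<lambda>i. \<beta>\<^sup>2 * (avg n x' * x' i - avg n x * x i)) - \<beta> \<cdot>\<^sub>m (A * mat_diag n (\<lambda>i. x' i - x i))"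
  using A by (intro eq_matI) (auto simp: resm_index mult_diag_index[OF A] algebra_simps mat_diag_index simp del: index_mult_mat(1))

locale lip_setting =
  fixes n :: nat and \<beta> :: real
  assumes n0: "n > 0" and \<beta>0: "0 < \<beta>" and \<beta>1: "\<beta> < 1"
begin

lemma frob_resm_diff_A:
  assumes A: "A \<in> carrier_mat n n" "A' \<in> carrier_mat n n" and x: "\<And>i. i < n \<Longrightarrow> 0 \<le> x i \<and> x i \<le> 1"
  shows "frob n (resm n \<beta> x A' - resm n \<beta> x A) \<le> \<beta> * frob n (A' - A)"
proof -
  have c: "A' - A \<in> carrier_mat n n" using A by auto
  have "op_bound n (mat_diag n x) 1" using x by (intro op_bound_diag) auto
  then have "frob n ((A' - A) * mat_diag n x) \<le> 1 * frob n (A' - A)" by (rule frob_mult_right[OF _ c])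
  moreover have "frob n ((- \<beta>) \<cdot>\<^sub>m ((A' - A) * mat_diag n x)) = \<beta> * frob n ((A' - A) * mat_diag n x)"
    using \<beta>0 mult_carrier_mat[OF c mat_diag_dim] by (subst frob_smult) auto
  ultimately show ?thesis unfolding resm_diff_A[OF A] using \<beta>0 by simp
qed

text \<open>The 8 is 6 from the norm of \<open>A\<close> plus 2 from the product rule for
  \<open>avg n x * x i\<close>, with \<open>\<beta>\<^sup>2\<close> estimated by \<beta>.\<close>

lemma op_bound_resm_diff_x:
  assumes A: "op_bound n A 6" and x: "\<And>i. i < n \<Longrightarrow> 0 \<le> x i \<and> x i \<le> 1" "\<And>i. i < n \<Longrightarrow> 0 \<le> x' i \<and> x' i \<le> 1"
    and \<delta>: "\<And>i. i < n \<Longrightarrow> \<bar>x' i - x i\<bar> \<le> \<delta>"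
  shows "op_bound n (resm n \<beta> x' A - resm n \<beta> x A) (8 * \<beta> * \<delta>)"
proof -
  have \<delta>0: "0 \<le> \<delta>" using \<delta>[OF n0] by linarith
  have av: "0 \<le> avg n x'" "avg n x' \<le> 1" using x n0 by (auto intro: avg_nonneg avg_le)
  have 1: "op_bound n (mat_diag n (\<lambda>i. \<beta>\<^sup>2 * (avg n x' * x' i - avg n x * x i))) (2 * \<beta> * \<delta>)"
  proof (rule op_bound_diag)
    fix i assume i: "i < n"
    have "avg n x' * x' i - avg n x * x i = avg n x' * (x' i - x i) + (avg n x' - avg n x) * x i" by (simp add: algebra_simps)
    also have "\<bar>\<dots>\<bar> \<le> \<bar>avg n x' * (x' i - x i)\<bar> + \<bar>(avg n x' - avg n x) * x i\<bar>" by (rule abs_triangle_ineq)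
    also have "\<dots> \<le> 1 * \<delta> + \<delta> * 1"
      unfolding abs_mult using av x(1)[OF i] \<delta>[OF i] \<delta>0 abs_avg_diff_le[OF n0 \<delta>]
      by (intro add_mono mult_mono) auto
    finally have "\<beta>\<^sup>2 * \<bar>avg n x' * x' i - avg n x * x i\<bar> \<le> \<beta> * (2 * \<delta>)"
      using \<beta>0 \<beta>1 \<delta>0 by (intro mult_mono) (auto simp: power2_eq_square mult_left_le_one_le)
    then show "\<bar>\<beta>\<^sup>2 * (avg n x' * x' i - avg n x * x i)\<bar> \<le> 2 * \<beta> * \<delta>" by (simp add: abs_mult)
  qed (use \<beta>0 \<delta>0 in auto)
  have "op_bound n (mat_diag n (\<lambda>i. x' i - x i)) \<delta>" using \<delta> \<delta>0 by (rule op_bound_diag)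
  from op_bound_smult[OF op_bound_mult[OF A this], of \<beta>]
  have 2: "op_bound n (\<beta> \<cdot>\<^sub>m (A * mat_diag n (\<lambda>i. x' i - x i))) (6 * \<beta> * \<delta>)" using \<beta>0 by (simp add: ac_simps)
  show ?thesis unfolding resm_diff_x[OF op_boundD(1)[OF A]]
    by (rule op_bound_mono[OF op_bound_diff[OF 1 2]]) simp
qed

text \<open>Only the term \<open>A * mat_diag n x\<close> couples matrix and profile; the averaged
  diagonal term cancels.\<close>

lemma frob_resm_mixed_diff:
  assumes A: "A \<in> carrier_mat n n" "A0 \<in> carrier_mat n n" and \<delta>: "\<And>i. i < n \<Longrightarrow> \<bar>x' i - x i\<bar> \<le> \<delta>"
  shows "frob n ((resm n \<beta> x' A - resm n \<beta> x A) - (resm n \<beta> x' A0 - resm n \<beta> x A0)) \<le> \<beta> * \<delta> * frob n (A - A0)"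
proof -
  have \<delta>0: "0 \<le> \<delta>" using \<delta>[OF n0] by linarith
  have c: "A - A0 \<in> carrier_mat n n" using A by auto
  have e: "(resm n \<beta> x' A - resm n \<beta> x A) - (resm n \<beta> x' A0 - resm n \<beta> x A0) = (- \<beta>) \<cdot>\<^sub>m ((A - A0) * mat_diag n (\<lambda>i. x' i - x i))"
    using A by (intro eq_matI) (auto simp: resm_index mult_diag_index[OF c] algebra_simps simp del: index_mult_mat(1))
  have "op_bound n (mat_diag n (\<lambda>i. x' i - x i)) \<delta>" using \<delta> \<delta>0 by (rule op_bound_diag)
  then have "frob n ((A - A0) * mat_diag n (\<lambda>i. x' i - x i)) \<le> \<delta> * frob n (A - A0)" by (rule frob_mult_right[OF _ c])
  then have "\<beta> * frob n ((A - A0) * mat_diag n (\<lambda>i. x' i - x i)) \<le> \<beta> * (\<delta> * frob n (A - A0))" using \<beta>0 by (intro mult_left_mono) auto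
  then show ?thesis unfolding e using \<beta>0 mult_carrier_mat[OF c mat_diag_dim] by (subst frob_smult) (auto simp: mult.assoc)
qed

lemma Zd_lipschitz_A:
  assumes g: "good n \<beta> \<kappa> x A" "good n \<beta> \<kappa> x A0" and x: "\<And>i. i < n \<Longrightarrow> 0 \<le> x i \<and> x i \<le> 1"
  shows "L2_set (\<lambda>i. Zd n \<beta> x A i - Zd n \<beta> x A0 i) {..<n} \<le> 2 * \<kappa> ^ 3 * \<beta> * frob n (A0 - A)"
proof -
  have o: "op_bound n A 6" "op_bound n A0 6" "op_bound n (minv (resm n \<beta> x A)) \<kappa>" "op_bound n (minv (resm n \<beta> x A0)) \<kappa>"
    "is_inv n (resm n \<beta> x A) (minv (resm n \<beta> x A))" "is_inv n (resm n \<beta> x A0) (minv (resm n \<beta> x A0))"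
    using g by (auto simp: good_def)
  have \<kappa>: "0 \<le> \<kappa>" using op_boundD(2)[OF o(3)] .
  have "L2_set (\<lambda>i. Zd n \<beta> x A i - Zd n \<beta> x A0 i) {..<n} \<le> 2 * \<kappa> * frob n (minv (resm n \<beta> x A) - minv (resm n \<beta> x A0))"
    unfolding Zd_def by (rule rsq_diff_le[OF o(3,4)])
  also have "\<dots> \<le> 2 * \<kappa> * (\<kappa> * \<kappa> * frob n (resm n \<beta> x A0 - resm n \<beta> x A))"
    using \<kappa> by (intro mult_left_mono frob_inv_diff[OF o(5,3,6,4)]) auto
  also have "\<dots> \<le> 2 * \<kappa> * (\<kappa> * \<kappa> * (\<beta> * frob n (A0 - A)))"
    using \<kappa> by (intro mult_left_mono frob_resm_diff_A op_boundD(1)[OF o(1)] op_boundD(1)[OF o(2)] x) auto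
  also have "\<dots> = 2 * \<kappa> ^ 3 * \<beta> * frob n (A0 - A)" by (simp add: power3_eq_cube)
  finally show ?thesis .
qed

lemma Zd_lipschitz_x:
  assumes g: "good n \<beta> \<kappa> x A" "good n \<beta> \<kappa> x' A" and x: "\<And>i. i < n \<Longrightarrow> 0 \<le> x i \<and> x i \<le> 1" "\<And>i. i < n \<Longrightarrow> 0 \<le> x' i \<and> x' i \<le> 1"
    and \<delta>: "\<And>i. i < n \<Longrightarrow> \<bar>x' i - x i\<bar> \<le> \<delta>"
  shows "L2_set (\<lambda>i. Zd n \<beta> x A i - Zd n \<beta> x' A i) {..<n} \<le> 16 * \<kappa> ^ 3 * \<beta> * \<delta> * sqrt n"
proof -
  have o: "op_bound n A 6" "op_bound n (minv (resm n \<beta> x A)) \<kappa>" "op_bound n (minv (resm n \<beta> x' A)) \<kappa>"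
    "is_inv n (resm n \<beta> x A) (minv (resm n \<beta> x A))" "is_inv n (resm n \<beta> x' A) (minv (resm n \<beta> x' A))"
    using g by (auto simp: good_def)
  have \<kappa>: "0 \<le> \<kappa>" using op_boundD(2)[OF o(2)] .
  have "L2_set (\<lambda>i. Zd n \<beta> x A i - Zd n \<beta> x' A i) {..<n} \<le> 2 * \<kappa> * frob n (minv (resm n \<beta> x A) - minv (resm n \<beta> x' A))"
    unfolding Zd_def by (rule rsq_diff_le[OF o(2,3)])
  also have "\<dots> \<le> 2 * \<kappa> * (\<kappa> * \<kappa> * frob n (resm n \<beta> x' A - resm n \<beta> x A))"
    using \<kappa> by (intro mult_left_mono frob_inv_diff[OF o(4,2,5,3)]) auto
  also have "\<dots> \<le> 2 * \<kappa> * (\<kappa> * \<kappa> * (8 * \<beta> * \<delta> * sqrt n))"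
    using \<kappa> by (intro mult_left_mono frob_le_op_bound op_bound_resm_diff_x o(1) x \<delta>) auto
  also have "\<dots> = 16 * \<kappa> ^ 3 * \<beta> * \<delta> * sqrt n" by (simp add: power3_eq_cube)
  finally show ?thesis .
qed

text \<open>An increment of \<open>Zd\<close> in the profile is Lipschitz in \<open>A\<close> with
  constant of order \<delta>; this is what chaining consumes. The 50 is 6 times 8 plus 2: six
  products of first differences, each with \<open>h = 8 * \<beta> * \<delta>\<close>, and the mixed
  difference of \<open>resm\<close> twice.\<close>

lemma Zd_second_diff:
  assumes g: "good n \<beta> \<kappa> x A" "good n \<beta> \<kappa> x' A" "good n \<beta> \<kappa> x A0" "good n \<beta> \<kappa> x' A0" and \<kappa>1: "1 \<le> \<kappa>"
    and x: "\<And>i. i < n \<Longrightarrow> 0 \<le> x i \<and> x i \<le> 1" "\<And>i. i < n \<Longrightarrow> 0 \<le> x' i \<and> x' i \<le> 1"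
    and \<delta>: "\<And>i. i < n \<Longrightarrow> \<bar>x' i - x i\<bar> \<le> \<delta>"
  shows "L2_set (\<lambda>i. (Zd n \<beta> x A i - Zd n \<beta> x' A i) - (Zd n \<beta> x A0 i - Zd n \<beta> x' A0 i)) {..<n} \<le> 50 * \<kappa> ^ 4 * \<beta> * \<delta> * frob n (A0 - A)"
proof -
  define M where "M = resm n \<beta> x A" define M' where "M' = resm n \<beta> x' A"
  define M0 where "M0 = resm n \<beta> x A0" define M0' where "M0' = resm n \<beta> x' A0"
  define N where "N = minv M" define N' where "N' = minv M'"
  define N0 where "N0 = minv M0" define N0' where "N0' = minv M0'"
  define r where "r = frob n (A0 - A)"
  define h where "h = 8 * \<beta> * \<delta>"
  have oA: "op_bound n A 6" "op_bound n A0 6" using g by (auto simp: good_def)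
  have o: "op_bound n N \<kappa>" "op_bound n N' \<kappa>" "op_bound n N0 \<kappa>" "op_bound n N0' \<kappa>"
    using g by (auto simp: good_def N_def N'_def N0_def N0'_def M_def M'_def M0_def M0'_def)
  have inv: "is_inv n M N" "is_inv n M' N'" "is_inv n M0 N0" "is_inv n M0' N0'"
    using g by (auto simp: good_def N_def N'_def N0_def N0'_def M_def M'_def M0_def M0'_def)
  note cN = op_boundD(1)[OF o(1)] op_boundD(1)[OF o(2)] op_boundD(1)[OF o(3)] op_boundD(1)[OF o(4)]
  note cM = is_invD(1)[OF inv(1)] is_invD(1)[OF inv(2)] is_invD(1)[OF inv(3)] is_invD(1)[OF inv(4)]
  note cA = op_boundD(1)[OF oA(1)] op_boundD(1)[OF oA(2)]
  have \<delta>0: "0 \<le> \<delta>" using \<delta>[OF n0] by linarith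
  have \<kappa>: "0 \<le> \<kappa>" using \<kappa>1 by simp
  have r0: "0 \<le> r" by (simp add: r_def frob_nonneg)
  have h0: "0 \<le> h" using \<beta>0 \<delta>0 by (simp add: h_def)
  have ha: "op_bound n (M' - M) h" "op_bound n (M0' - M0) h"
    unfolding M_def M'_def M0_def M0'_def h_def by (intro op_bound_resm_diff_x oA x \<delta>; assumption)+
  have dN: "frob n (N - N0) \<le> \<kappa> * \<kappa> * (\<beta> * r)" "frob n (N' - N0') \<le> \<kappa> * \<kappa> * (\<beta> * r)"
  proof -
    have "frob n (N - N0) \<le> \<kappa> * \<kappa> * frob n (M0 - M)" by (rule frob_inv_diff[OF inv(1) o(1) inv(3) o(3)])
    also have "\<dots> \<le> \<kappa> * \<kappa> * (\<beta> * r)" unfolding r_def M_def M0_def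
      using \<kappa> by (intro mult_left_mono frob_resm_diff_A cA x) auto
    finally show "frob n (N - N0) \<le> \<kappa> * \<kappa> * (\<beta> * r)" .
    have "frob n (N' - N0') \<le> \<kappa> * \<kappa> * frob n (M0' - M')" by (rule frob_inv_diff[OF inv(2) o(2) inv(4) o(4)])
    also have "\<dots> \<le> \<kappa> * \<kappa> * (\<beta> * r)" unfolding r_def M'_def M0'_def
      using \<kappa> by (intro mult_left_mono frob_resm_diff_A cA x) auto
    finally show "frob n (N' - N0') \<le> \<kappa> * \<kappa> * (\<beta> * r)" .
  qed
  have oD0: "op_bound n (N0 - N0') (\<kappa> * \<kappa> * h)" by (rule op_bound_inv_diff[OF inv(3) o(3) inv(4) o(4) ha(2)])
  have fr: "frob n ((M' - M) - (M0' - M0)) \<le> \<beta> * \<delta> * r"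
  proof -
    have "frob n (A - A0) = r"
    proof -
      have "A - A0 = (-1) \<cdot>\<^sub>m (A0 - A)" using cA by (intro eq_matI) auto
      then show ?thesis using frob_smult[OF minus_carrier_mat[OF cA(1)], where c = "-1"] by (simp add: r_def)
    qed
    then show ?thesis using frob_resm_mixed_diff[OF cA, of x' x \<delta>] \<delta> by (simp add: M_def M'_def M0_def M0'_def)
  qed
  have E: "frob n ((N - N') - (N0 - N0')) \<le> 2 * \<kappa> ^ 3 * (\<beta> * r) * h + \<kappa>\<^sup>2 * (\<beta> * \<delta> * r)"
  proof -
    \<comment> \<open>The product \<open>N * (M' - M) * N'\<close> is changed one factor at a time:
      left inverse, middle difference, right inverse.\<close>
    define P where "P = (N - N0) * (M' - M) * N'"
    define Q where "Q = N0 * ((M' - M) - (M0' - M0)) * N'"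
    define S where "S = N0 * (M0' - M0) * (N' - N0')"
    have cP: "P \<in> carrier_mat n n" "Q \<in> carrier_mat n n" "S \<in> carrier_mat n n" using cN cM by (auto simp: P_def Q_def S_def)
    have c1: "M' - M \<in> carrier_mat n n" "M0' - M0 \<in> carrier_mat n n" "N - N0 \<in> carrier_mat n n" "N' - N0' \<in> carrier_mat n n" using cM cN by auto
    have eq: "(N - N') - (N0 - N0') = P + Q + S"
    proof -
      have p: "P = N * (M' - M) * N' - N0 * (M' - M) * N'"
        unfolding P_def minus_mult_distrib_mat[OF cN(1,3) c1(1)]
        by (rule minus_mult_distrib_mat[OF mult_carrier_mat[OF cN(1) c1(1)] mult_carrier_mat[OF cN(3) c1(1)] cN(2)])
      have q: "Q = N0 * (M' - M) * N' - N0 * (M0' - M0) * N'"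
        unfolding Q_def mult_minus_distrib_mat[OF cN(3) c1(1,2)]
        by (rule minus_mult_distrib_mat[OF mult_carrier_mat[OF cN(3) c1(1)] mult_carrier_mat[OF cN(3) c1(2)] cN(2)])
      have s: "S = N0 * (M0' - M0) * N' - N0 * (M0' - M0) * N0'"
        unfolding S_def by (rule mult_minus_distrib_mat[OF mult_carrier_mat[OF cN(3) c1(2)] cN(2,4)])
      have d: "N - N' = N * (M' - M) * N'" "N0 - N0' = N0 * (M0' - M0) * N0'" by (rule inv_diff[OF inv(1,2)], rule inv_diff[OF inv(3,4)])
      define U where "U = N * (M' - M) * N'" define V where "V = N0 * (M' - M) * N'"
      define W where "W = N0 * (M0' - M0) * N'" define Y where "Y = N0 * (M0' - M0) * N0'"
      have cu: "U \<in> carrier_mat n n" "V \<in> carrier_mat n n" "W \<in> carrier_mat n n" "Y \<in> carrier_mat n n"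
        using cN c1 by (auto simp: U_def V_def W_def Y_def)
      have "U - Y = (U - V) + (V - W) + (W - Y)" using cu by (intro eq_matI) auto
      then show ?thesis by (simp only: d p q s U_def V_def W_def Y_def)
    qed
    have "frob n P \<le> \<kappa> * frob n ((N - N0) * (M' - M))" unfolding P_def by (rule frob_mult_right[OF o(2) mult_carrier_mat[OF c1(3,1)]])
    also have "\<dots> \<le> \<kappa> * (h * frob n (N - N0))" by (rule mult_left_mono[OF frob_mult_right[OF ha(1) c1(3)] \<kappa>])
    also have "\<dots> \<le> \<kappa> * (h * (\<kappa> * \<kappa> * (\<beta> * r)))" using \<kappa> h0 dN by (intro mult_left_mono) auto
    finally have 1: "frob n P \<le> \<kappa> ^ 3 * (\<beta> * r) * h" by (simp add: power3_eq_cube ac_simps)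
    have "frob n Q \<le> \<kappa> * frob n (N0 * ((M' - M) - (M0' - M0)))" unfolding Q_def by (rule frob_mult_right[OF o(2) mult_carrier_mat[OF cN(3) minus_carrier_mat[OF c1(2)]]])
    also have "\<dots> \<le> \<kappa> * (\<kappa> * frob n ((M' - M) - (M0' - M0)))" by (rule mult_left_mono[OF frob_mult_left[OF o(3) minus_carrier_mat[OF c1(2)]] \<kappa>])
    also have "\<dots> \<le> \<kappa> * (\<kappa> * (\<beta> * \<delta> * r))" using \<kappa> fr by (intro mult_left_mono) auto
    finally have 2: "frob n Q \<le> \<kappa>\<^sup>2 * (\<beta> * \<delta> * r)" by (simp add: power2_eq_square ac_simps)
    have "frob n S \<le> \<kappa> * h * frob n (N' - N0')" unfolding S_def by (rule frob_mult_left[OF op_bound_mult[OF o(3) ha(2)] c1(4)])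
    also have "\<dots> \<le> \<kappa> * h * (\<kappa> * \<kappa> * (\<beta> * r))" using \<kappa> h0 dN by (intro mult_left_mono) auto
    finally have 3: "frob n S \<le> \<kappa> ^ 3 * (\<beta> * r) * h" by (simp add: power3_eq_cube ac_simps)
    have "frob n (P + Q + S) \<le> frob n P + frob n Q + frob n S"
      using frob_add[OF add_carrier_mat[OF cP(2)] cP(3), of P] frob_add[OF cP(1,2)] by linarith
    then show ?thesis unfolding eq using 1 2 3 by linarith
  qed
  have "L2_set (\<lambda>i. (rsq n N i - rsq n N' i) - (rsq n N0 i - rsq n N0' i)) {..<n}
    \<le> 2 * \<kappa> * frob n ((N - N') - (N0 - N0')) + (\<kappa> * \<kappa> * h) * (frob n (N - N0) + frob n (N' - N0'))"
    by (rule rsq_second_diff_le[OF o oD0])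
  also have "\<dots> \<le> 2 * \<kappa> * (2 * \<kappa> ^ 3 * (\<beta> * r) * h + \<kappa>\<^sup>2 * (\<beta> * \<delta> * r)) + (\<kappa> * \<kappa> * h) * (\<kappa> * \<kappa> * (\<beta> * r) + \<kappa> * \<kappa> * (\<beta> * r))"
    using E dN \<kappa> h0 by (intro add_mono mult_left_mono) auto
  also have "\<dots> = 6 * (\<kappa> ^ 4 * (\<beta> * r)) * h + 2 * \<kappa> ^ 3 * (\<beta> * \<delta> * r)"
    by (simp add: power4_eq_xxxx power3_eq_cube power2_eq_square algebra_simps)
  also have "\<dots> \<le> 6 * (\<kappa> ^ 4 * (\<beta> * r)) * (8 * \<delta>) + 2 * \<kappa> ^ 4 * (\<beta> * \<delta> * r)"
  proof (intro add_mono mult_left_mono mult_right_mono)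
    show "h \<le> 8 * \<delta>" using \<beta>1 \<beta>0 \<delta>0 unfolding h_def by (simp add: mult_left_le_one_le)
    show "\<kappa> ^ 3 \<le> \<kappa> ^ 4" by (rule power_increasing) (use \<kappa>1 in auto)
  qed (use \<kappa> \<beta>0 r0 \<delta>0 in auto)
  also have "\<dots> = 50 * \<kappa> ^ 4 * \<beta> * \<delta> * r" by (simp add: algebra_simps)
  finally show ?thesis by (simp add: Zd_def N_def N'_def N0_def N0'_def M_def M'_def M0_def M0'_def r_def)
qed

lemma goodI:
  assumes A: "op_bound n A 6" and s: "s > 0" and low: "\<And>v. v \<in> carrier_vec n \<Longrightarrow> s * vnorm v \<le> vnorm (resm n \<beta> x A *\<^sub>v v)" and k: "1 / s \<le> \<kappa>"
  shows "good n \<beta> \<kappa> x A"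
proof -
  note c = resm_carrier[OF op_boundD(1)[OF A], of \<beta> x]
  have i: "is_inv n (resm n \<beta> x A) (minv (resm n \<beta> x A))"
    unfolding minv_def by (rule ex_is_inv_of_det[OF c is_inv_of_lower_bound(1)[OF c s low]])
  show ?thesis unfolding good_def
    using A i op_bound_mono[OF is_inv_of_lower_bound(2)[OF c s low i] k] by blast
qed

text \<open>The perturbation of \<open>resm\<close> is at most
  \<open>8 * \<beta> * \<delta> \<le> s / 2\<close>, so half of the lower bound survives. This
  carries conditioning from a profile to nearby grid points.\<close>

lemma good_perturb:
  assumes A: "op_bound n A 6" and s: "s > 0" and low: "\<And>v. v \<in> carrier_vec n \<Longrightarrow> s * vnorm v \<le> vnorm (resm n \<beta> x A *\<^sub>v v)"
    and x: "\<And>i. i < n \<Longrightarrow> 0 \<le> x i \<and> x i \<le> 1" "\<And>i. i < n \<Longrightarrow> 0 \<le> x' i \<and> x' i \<le> 1"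
    and \<delta>: "\<And>i. i < n \<Longrightarrow> \<bar>x' i - x i\<bar> \<le> \<delta>" and ds: "16 * \<delta> \<le> s" and k: "2 / s \<le> \<kappa>"
  shows "good n \<beta> \<kappa> x' A"
proof (rule goodI[OF A])
  show "s / 2 > 0" "1 / (s / 2) \<le> \<kappa>" using s k by auto
  fix v :: "real vec" assume v: "v \<in> carrier_vec n"
  note c = resm_carrier[OF op_boundD(1)[OF A]]
  have \<delta>0: "0 \<le> \<delta>" using \<delta>[OF n0] by linarith
  have cv: "resm n \<beta> x A *\<^sub>v v \<in> carrier_vec n" "resm n \<beta> x' A *\<^sub>v v \<in> carrier_vec n" by (rule mult_mat_vec_carrier[OF c v])+
  have "vnorm ((resm n \<beta> x A - resm n \<beta> x' A) *\<^sub>v v) \<le> 8 * \<beta> * \<delta> * vnorm v"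
    by (rule op_boundD(3)[OF op_bound_resm_diff_x[OF A x(2,1)] v]) (use \<delta> in \<open>auto simp: abs_minus_commute\<close>)
  also have "\<dots> \<le> s / 2 * vnorm v"
  proof (rule mult_right_mono[OF _ vnorm_nonneg[OF v]])
    have "\<beta> * \<delta> \<le> \<delta>" using \<beta>0 \<beta>1 \<delta>0 by (simp add: mult_left_le_one_le)
    then show "8 * \<beta> * \<delta> \<le> s / 2" using ds by simp
  qed
  finally have 1: "vnorm ((resm n \<beta> x A - resm n \<beta> x' A) *\<^sub>v v) \<le> s / 2 * vnorm v" .
  have "resm n \<beta> x A *\<^sub>v v = resm n \<beta> x' A *\<^sub>v v + (resm n \<beta> x A - resm n \<beta> x' A) *\<^sub>v v"
    unfolding minus_mult_distrib_mat_vec[OF c c v] using cv c[of \<beta> x] c[of \<beta> x'] by (intro eq_vecI) auto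
  then have "vnorm (resm n \<beta> x A *\<^sub>v v) \<le> vnorm (resm n \<beta> x' A *\<^sub>v v) + vnorm ((resm n \<beta> x A - resm n \<beta> x' A) *\<^sub>v v)"
    using vnorm_add[OF cv(2), of "(resm n \<beta> x A - resm n \<beta> x' A) *\<^sub>v v"] c v by (metis minus_carrier_mat mult_mat_vec_carrier)
  then show "s / 2 * vnorm v \<le> vnorm (resm n \<beta> x' A *\<^sub>v v)" using low[OF v] 1 by linarith
qed

end

text \<open>Both denominators stay above \<open>1 - \<beta>\<close> because the averages of squares
  lie in the unit interval.\<close>

lemma tlim_diff_le:
  assumes n: "n > 0" and \<beta>: "0 < \<beta>" "\<beta> < 1"
    and x: "\<And>i. i < n \<Longrightarrow> 0 \<le> x i \<and> x i \<le> 1" "\<And>i. i < n \<Longrightarrow> 0 \<le> x' i \<and> x' i \<le> 1"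
    and \<delta>: "\<And>i. i < n \<Longrightarrow> \<bar>x' i - x i\<bar> \<le> \<delta>"
  shows "\<bar>tlim n \<beta> x' - tlim n \<beta> x\<bar> \<le> 2 * \<beta> * \<delta> / (1 - \<beta>)\<^sup>2"
proof -
  define q where "q = avg n (\<lambda>i. (x i)\<^sup>2)" define q' where "q' = avg n (\<lambda>i. (x' i)\<^sup>2)"
  have q: "q \<le> 1" "q' \<le> 1" "0 \<le> q" "0 \<le> q'"
    unfolding q_def q'_def using x n by (auto intro!: avg_le avg_nonneg simp: power_le_one)
  have "\<bar>q' - q\<bar> \<le> 2 * \<delta>"
    unfolding q_def q'_def
  proof (rule abs_avg_diff_le[OF n])
    fix i assume i: "i < n"
    have "(x' i)\<^sup>2 - (x i)\<^sup>2 = (x' i + x i) * (x' i - x i)" by (simp add: power2_eq_square algebra_simps)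
    also have "\<bar>\<dots>\<bar> \<le> 2 * \<delta>" unfolding abs_mult using x(1)[OF i] x(2)[OF i] \<delta>[OF i] by (intro mult_mono) auto
    finally show "\<bar>(x' i)\<^sup>2 - (x i)\<^sup>2\<bar> \<le> 2 * \<delta>" .
  qed
  moreover have b: "1 - \<beta> \<le> 1 - \<beta>\<^sup>2 * p" if "0 \<le> p" "p \<le> 1" for p
  proof -
    have "\<beta>\<^sup>2 * p \<le> \<beta> * 1" using \<beta> that by (intro mult_mono) (auto simp: power2_eq_square mult_left_le_one_le)
    then show ?thesis by simp
  qed
  have p: "0 < 1 - \<beta>\<^sup>2 * q" "0 < 1 - \<beta>\<^sup>2 * q'" using b[of q] b[of q'] q \<beta> by linarith+
  have b2: "\<beta>\<^sup>2 \<le> \<beta>" using \<beta> by (simp add: power2_eq_square mult_left_le_one_le)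
  have e: "tlim n \<beta> x' - tlim n \<beta> x = \<beta>\<^sup>2 * (q' - q) / ((1 - \<beta>\<^sup>2 * q') * (1 - \<beta>\<^sup>2 * q))"
    unfolding tlim_def q_def[symmetric] q'_def[symmetric] using p by (simp add: field_simps)
  have "\<bar>tlim n \<beta> x' - tlim n \<beta> x\<bar> = \<beta>\<^sup>2 * \<bar>q' - q\<bar> / ((1 - \<beta>\<^sup>2 * q') * (1 - \<beta>\<^sup>2 * q))"
    unfolding e using p by (simp add: abs_mult)
  also have "\<dots> \<le> \<beta> * (2 * \<delta>) / ((1 - \<beta>) * (1 - \<beta>))"
    using \<beta> b[of q] b[of q'] q \<open>\<bar>q' - q\<bar> \<le> 2 * \<delta>\<close>
    p b2 by (intro frac_le mult_mono) auto
  finally show ?thesis by (simp add: power2_eq_square mult.commute mult.left_commute)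
qed

section \<open>The self-consistent equations\<close>

lemma L2_set_one: "L2_set (\<lambda>_. c) {..<n} = \<bar>c\<bar> * sqrt (real n)"
  by (simp add: L2_set_def real_sqrt_mult mult.commute)

lemma L2_set_abs_le:
  assumes "\<And>i. i \<in> A \<Longrightarrow> \<bar>f i\<bar> \<le> g i"
  shows "L2_set f A \<le> L2_set g A"
proof -
  have "L2_set f A = L2_set (\<lambda>i. \<bar>f i\<bar>) A" by (simp add: L2_set_def)
  also have "\<dots> \<le> L2_set g A" using assms by (intro L2_set_mono) auto
  finally show ?thesis .
qed

lemma L2_set_abs: "L2_set (\<lambda>i. \<bar>f i\<bar>) A = L2_set f A"
  by (simp add: L2_set_def)

lemma avg_mult_le:
  assumes "n > 0"
  shows "avg n (\<lambda>i. \<bar>f i\<bar> * \<bar>g i\<bar>) \<le> L2_set f {..<n} * L2_set g {..<n} / n"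
  unfolding avg_def using assms by (intro divide_right_mono L2_set_mult_ineq) auto

lemma avg_abs_le_L2:
  assumes "n > 0"
  shows "avg n (\<lambda>i. \<bar>f i\<bar>) \<le> L2_set f {..<n} / sqrt n"
proof -
  have "avg n (\<lambda>i. \<bar>f i\<bar> * \<bar>1\<bar>) \<le> L2_set f {..<n} * L2_set (\<lambda>_. 1) {..<n} / n"
    by (rule avg_mult_le[OF assms])
  also have "\<dots> = L2_set f {..<n} * (sqrt n / n)" by (simp add: L2_set_one)
  also have "sqrt n / n = 1 / sqrt n" using assms by (simp add: field_simps)
  finally show ?thesis by simp
qed

lemma avg_mono: "n > 0 \<Longrightarrow> (\<And>i. i < n \<Longrightarrow> f i \<le> g i) \<Longrightarrow> avg n f \<le> avg n g"
  unfolding avg_def by (intro divide_right_mono sum_mono) auto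

lemma avg_cmult: "avg n (\<lambda>i. c * f i) = c * avg n f"
  by (simp add: avg_def sum_distrib_left)

lemma avg_add: "avg n (\<lambda>i. f i + g i) = avg n f + avg n g"
  by (simp add: avg_def sum.distrib add_divide_distrib)

lemma avg_cong: "(\<And>i. i < n \<Longrightarrow> f i = g i) \<Longrightarrow> avg n f = avg n g"
  by (simp add: avg_def)

lemma L2_set_sq_avg: "n > 0 \<Longrightarrow> L2_set f {..<n} = sqrt n * sqrt (avg n (\<lambda>i. (f i)\<^sup>2))"
  by (simp add: L2_set_def avg_def real_sqrt_divide)

text \<open>Positivity of the averages of \<open>T\<close> in the second self-consistent equation gives
  \<open>\<beta>\<^sup>2 avg R\<^sup>2 < 1\<close>, which is the stability needed to solve the first one.\<close>

lemma self_consistent_law: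
  fixes x R T e f :: "nat \<Rightarrow> real"
  assumes n: "n > 0" and \<beta>: "0 < \<beta>" "\<beta> < 1" and c: "0 < c" "c \<le> 1"
    and x: "\<And>i. i < n \<Longrightarrow> 0 < x i \<and> x i \<le> 1"
    and R: "\<And>i. i < n \<Longrightarrow> 0 < R i \<and> R i \<le> x i / c"
    and T: "\<And>i. i < n \<Longrightarrow> 0 \<le> T i"
    and eqR: "\<And>i. i < n \<Longrightarrow> R i * (1 / x i - \<beta>\<^sup>2 * (avg n R - avg n x) - e i) = 1"
    and eqT: "\<And>i. i < n \<Longrightarrow> T i = (R i)\<^sup>2 * (1 + \<beta>\<^sup>2 * avg n T + f i)"
    and Ee: "L2_set e {..<n} \<le> Ee" and Ef: "L2_set f {..<n} \<le> Ef"
    and \<rho>: "E\<rho> = 2 * Ee / (c * (1 - \<beta>))"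
    and large: "2 * Ef \<le> c\<^sup>2 * sqrt n" "E\<rho> \<le> sqrt n" "6 * E\<rho> \<le> (1 - \<beta>) * sqrt n"
  shows "L2_set (\<lambda>i. T i / (x i)\<^sup>2 - tlim n \<beta> x) {..<n}
    \<le> 6 / (c * (1 - \<beta>)) * E\<rho> + Ef / c\<^sup>2 + (Ef / c + 9 * E\<rho> / (1 - \<beta>)) / (1 - \<beta>)"
proof -
  define g where "g = 1 - \<beta>"
  define s where "s = sqrt (real n)"
  have g: "0 < g" "g \<le> 1" using \<beta> by (auto simp: g_def)
  have s: "s > 0" "s * s = n" using n by (auto simp: s_def)
  have b2: "\<beta>\<^sup>2 \<le> \<beta>" "0 < \<beta>\<^sup>2" using \<beta> by (auto simp: power2_eq_square mult_left_le_one_le)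
  define q where "q = avg n (\<lambda>i. (R i)\<^sup>2)"
  define Q where "Q = avg n (\<lambda>i. (x i)\<^sup>2)"
  define t' where "t' = 1 + \<beta>\<^sup>2 * avg n T"
  define \<eta> where "\<eta> = \<beta>\<^sup>2 * avg n (\<lambda>i. (R i)\<^sup>2 * f i)"
  define w where "w = \<beta>\<^sup>2 * (avg n R - avg n x)"
  define r where "r i = R i / x i" for i
  have Ee0: "0 \<le> Ee" using Ee L2_set_nonneg[of e] by (meson order_trans)
  have Ef0: "0 \<le> Ef" using Ef L2_set_nonneg[of f] by (meson order_trans)
  have E\<rho>0: "0 \<le> E\<rho>" unfolding \<rho> using Ee0 c \<beta> by simp
  have Rc: "R i \<le> 1 / c" if "i < n" for i
    using R[OF that] x[OF that] c by (meson divide_right_mono less_imp_le order_trans)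
  have T0: "0 \<le> avg n T" using T by (rule avg_nonneg)
  have t'1: "1 \<le> t'" using T0 by (simp add: t'_def)
  \<comment> \<open>The average of \<open>eqT\<close> is a scalar equation for \<open>t'\<close>,
    with \<eta> as its error.\<close>
  have 1: "t' * (1 - \<beta>\<^sup>2 * q) = 1 + \<eta>"
  proof -
    have "avg n T = avg n (\<lambda>i. t' * (R i)\<^sup>2 + (R i)\<^sup>2 * f i)"
      by (rule avg_cong) (simp add: eqT[symmetric] t'_def[symmetric] algebra_simps, simp add: eqT t'_def algebra_simps)
    also have "\<dots> = t' * q + avg n (\<lambda>i. (R i)\<^sup>2 * f i)" by (simp add: avg_add avg_cmult q_def)
    finally have "\<beta>\<^sup>2 * avg n T = \<beta>\<^sup>2 * q * t' + \<eta>" by (simp add: \<eta>_def algebra_simps)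
    then have "t' - \<beta>\<^sup>2 * q * t' = 1 + \<eta>" using t'_def by linarith
    moreover have "t' * (1 - \<beta>\<^sup>2 * q) = t' - \<beta>\<^sup>2 * q * t'" by (simp only: right_diff_distrib mult_1_right ac_simps)
    ultimately show ?thesis by simp
  qed
  have \<eta>a: "\<bar>\<eta>\<bar> \<le> \<beta>\<^sup>2 * (avg n (\<lambda>i. \<bar>R i\<bar> * \<bar>f i\<bar>) / c)"
  proof -
    have "\<bar>avg n (\<lambda>i. (R i)\<^sup>2 * f i)\<bar> \<le> avg n (\<lambda>i. \<bar>(R i)\<^sup>2 * f i\<bar>)" by (rule avg_abs)
    also have "\<dots> \<le> avg n (\<lambda>i. 1 / c * (\<bar>R i\<bar> * \<bar>f i\<bar>))"
    proof (rule avg_mono[OF n])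
      fix i assume i: "i < n"
      have "R i * (R i * \<bar>f i\<bar>) \<le> 1 / c * (R i * \<bar>f i\<bar>)" using R[OF i] by (intro mult_right_mono Rc i) auto
      then show "\<bar>(R i)\<^sup>2 * f i\<bar> \<le> 1 / c * (\<bar>R i\<bar> * \<bar>f i\<bar>)" using R[OF i] by (simp add: abs_mult power2_eq_square mult.assoc)
    qed
    also have "\<dots> = avg n (\<lambda>i. \<bar>R i\<bar> * \<bar>f i\<bar>) / c" unfolding avg_cmult by simp
    finally have k: "\<bar>avg n (\<lambda>i. (R i)\<^sup>2 * f i)\<bar> \<le> avg n (\<lambda>i. \<bar>R i\<bar> * \<bar>f i\<bar>) / c" .
    have "\<bar>\<eta>\<bar> = \<beta>\<^sup>2 * \<bar>avg n (\<lambda>i. (R i)\<^sup>2 * f i)\<bar>" unfolding \<eta>_def by (simp add: abs_mult)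
    then show ?thesis using mult_left_mono[OF k, of "\<beta>\<^sup>2"] by (metis zero_le_power2)
  qed
  have 2: "\<bar>\<eta>\<bar> \<le> 1 / 2"
  proof -
    have "avg n (\<lambda>i. \<bar>R i\<bar> * \<bar>f i\<bar>) \<le> avg n (\<lambda>i. 1 / c * \<bar>f i\<bar>)"
      using Rc R by (intro avg_mono[OF n] mult_right_mono) (auto simp: abs_of_pos)
    also have "\<dots> \<le> 1 / c * (Ef / s)"
      unfolding avg_cmult using c avg_abs_le_L2[OF n, of f] Ef s divide_right_mono[OF Ef, of s] by (intro mult_left_mono) (auto simp: s_def)
    finally have "avg n (\<lambda>i. \<bar>R i\<bar> * \<bar>f i\<bar>) / c \<le> 1 / c * (Ef / s) / c" using c by (intro divide_right_mono) auto
    also have "\<dots> = Ef / (c\<^sup>2 * s)" by (simp add: power2_eq_square field_simps)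
    also have "\<dots> \<le> 1 / 2" using large(1) c s by (simp add: field_simps s_def)
    finally have "\<beta>\<^sup>2 * (avg n (\<lambda>i. \<bar>R i\<bar> * \<bar>f i\<bar>) / c) \<le> 1 * (1 / 2)" using b2 \<beta> c
      by (intro mult_mono) (auto intro!: divide_nonneg_nonneg avg_nonneg)
    then show ?thesis using \<eta>a by linarith
  qed
  have 3: "\<beta>\<^sup>2 * q < 1"
  proof (rule ccontr)
    assume "\<not> \<beta>\<^sup>2 * q < 1"
    then have "t' * (1 - \<beta>\<^sup>2 * q) \<le> 0" using t'1 by (intro mult_nonneg_nonpos) auto
    then show False using 1 2 by linarith
  qed
  have q0: "0 \<le> q" unfolding q_def by (rule avg_nonneg) simp
  have bq: "\<beta> * sqrt q \<le> 1"
  proof -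
    have "sqrt (\<beta>\<^sup>2 * q) \<le> sqrt 1" using 3 by (intro real_sqrt_le_mono) simp
    then show ?thesis using \<beta> by (simp add: real_sqrt_mult)
  qed
  have L2R: "L2_set R {..<n} = s * sqrt q" unfolding s_def q_def by (rule L2_set_sq_avg[OF n])
  \<comment> \<open>Cauchy-Schwarz together with \<open>\<beta> * sqrt q \<le> 1\<close>: averaging
    against \<open>R\<close> keeps one factor \<beta> and costs no power of
    \<open>1 / c\<close>.\<close>
  have avR: "\<beta>\<^sup>2 * avg n (\<lambda>i. \<bar>R i\<bar> * \<bar>h i\<bar>) \<le> \<beta> * (H / s)" if "L2_set h {..<n} \<le> H" for h H
  proof -
    have H: "0 \<le> H" using that L2_set_nonneg[of h] by (meson order_trans)
    have "avg n (\<lambda>i. \<bar>R i\<bar> * \<bar>h i\<bar>) \<le> L2_set R {..<n} * L2_set h {..<n} / n" by (rule avg_mult_le[OF n])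
    also have "\<dots> \<le> s * sqrt q * H / n" unfolding L2R using that s q0 by (intro divide_right_mono mult_left_mono) auto
    also have "\<dots> = sqrt q * (H / s)" unfolding s(2)[symmetric] using s(1) by (simp add: field_simps)
    finally have "\<beta>\<^sup>2 * avg n (\<lambda>i. \<bar>R i\<bar> * \<bar>h i\<bar>) \<le> \<beta>\<^sup>2 * (sqrt q * (H / s))" by (rule mult_left_mono) simp
    also have "\<dots> = \<beta> * ((\<beta> * sqrt q) * (H / s))" by (simp add: power2_eq_square)
    also have "\<dots> \<le> \<beta> * (1 * (H / s))" using bq \<beta> s H by (intro mult_left_mono mult_right_mono) auto
    finally show ?thesis by simp
  qed
  have Rx: "R i - x i = x i * R i * (w + e i)" if i: "i < n" for i
  proof -
    have "x i * (R i * (1 / x i - w - e i)) = x i" using eqR[OF i] unfolding w_def by simp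
    then have "R i - x i * R i * w - x i * R i * e i = x i" using x[OF i] by (simp add: algebra_simps)
    then show ?thesis by (simp add: algebra_simps)
  qed
  \<comment> \<open>Averaging \<open>Rx\<close> gives a linear equation for the common shift
    \<open>w\<close>, with coefficient \<open>1 - u\<close> at least
    \<open>1 - \<beta>\<close>.\<close>
  have 4: "\<bar>w\<bar> * g * s \<le> Ee"
  proof -
    define u where "u = \<beta>\<^sup>2 * avg n (\<lambda>i. x i * R i)"
    have "avg n R - avg n x = avg n (\<lambda>i. w * (x i * R i) + x i * R i * e i)"
      unfolding avg_diff by (rule avg_cong) (simp add: Rx algebra_simps)
    then have "w = \<beta>\<^sup>2 * (w * avg n (\<lambda>i. x i * R i) + avg n (\<lambda>i. x i * R i * e i))"
      unfolding avg_add avg_cmult by (simp add: w_def)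
    then have weq: "w * (1 - u) = \<beta>\<^sup>2 * avg n (\<lambda>i. x i * R i * e i)" by (simp add: u_def algebra_simps)
    have "avg n (\<lambda>i. x i * R i) \<le> avg n (\<lambda>i. \<bar>R i\<bar> * \<bar>1\<bar>)"
      using x R by (intro avg_mono[OF n]) (auto simp: abs_of_pos mult_left_le_one_le less_imp_le)
    then have "u \<le> \<beta>\<^sup>2 * avg n (\<lambda>i. \<bar>R i\<bar> * \<bar>1\<bar>)" unfolding u_def by (rule mult_left_mono) simp
    also have "\<dots> \<le> \<beta> * (s / s)" by (rule avR) (simp add: L2_set_one s_def)
    finally have u: "g \<le> 1 - u" using s by (simp add: g_def)
    have "\<bar>w\<bar> * g \<le> \<bar>w\<bar> * (1 - u)" using u by (intro mult_left_mono) auto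
    also have "\<dots> = \<bar>w * (1 - u)\<bar>" using u g by (simp add: abs_mult)
    also have "\<dots> = \<beta>\<^sup>2 * \<bar>avg n (\<lambda>i. x i * R i * e i)\<bar>" unfolding weq by (simp add: abs_mult)
    also have "\<dots> \<le> \<beta>\<^sup>2 * avg n (\<lambda>i. \<bar>R i\<bar> * \<bar>e i\<bar>)"
    proof (intro mult_left_mono order_trans[OF avg_abs] avg_mono[OF n])
      fix i assume i: "i < n"
      have "x i * (\<bar>R i\<bar> * \<bar>e i\<bar>) \<le> 1 * (\<bar>R i\<bar> * \<bar>e i\<bar>)" using x[OF i] by (intro mult_right_mono) auto
      then show "\<bar>x i * R i * e i\<bar> \<le> \<bar>R i\<bar> * \<bar>e i\<bar>" using x[OF i] by (simp add: abs_mult)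
    qed auto
    also have "\<dots> \<le> \<beta> * (Ee / s)" by (rule avR[OF Ee])
    also have "\<dots> \<le> 1 * (Ee / s)" using \<beta> Ee0 s by (intro mult_right_mono) auto
    finally have "\<bar>w\<bar> * g * s \<le> Ee / s * s" using s by (intro mult_right_mono) auto
    then show ?thesis using s by simp
  qed
  have r1: "r i - 1 = R i * (w + e i)" if i: "i < n" for i
    using Rx[OF i] x[OF i] unfolding r_def by (simp add: field_simps)
  have 5: "L2_set (\<lambda>i. r i - 1) {..<n} \<le> E\<rho>"
  proof -
    have "L2_set (\<lambda>i. r i - 1) {..<n} \<le> L2_set (\<lambda>i. 1 / c * (\<bar>w\<bar> + \<bar>e i\<bar>)) {..<n}"
    proof (rule L2_set_abs_le)
      fix i assume "i \<in> {..<n}"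
      then have i: "i < n" by simp
      have "\<bar>r i - 1\<bar> = R i * \<bar>w + e i\<bar>" unfolding r1[OF i] using R[OF i] by (simp add: abs_mult)
      also have "\<dots> \<le> 1 / c * (\<bar>w\<bar> + \<bar>e i\<bar>)" using R[OF i] Rc[OF i] c by (intro mult_mono) auto
      finally show "\<bar>r i - 1\<bar> \<le> 1 / c * (\<bar>w\<bar> + \<bar>e i\<bar>)" .
    qed
    also have "\<dots> = 1 / c * L2_set (\<lambda>i. \<bar>w\<bar> + \<bar>e i\<bar>) {..<n}" by (rule L2_set_right_distrib[symmetric]) (use c in auto)
    also have "\<dots> \<le> 1 / c * (L2_set (\<lambda>i. \<bar>w\<bar>) {..<n} + L2_set (\<lambda>i. \<bar>e i\<bar>) {..<n})" using c by (intro mult_left_mono L2_set_triangle_ineq) auto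
    also have "\<dots> \<le> 1 / c * (Ee / g + Ee / g)"
    proof (intro mult_left_mono add_mono)
      show "L2_set (\<lambda>i. \<bar>w\<bar>) {..<n} \<le> Ee / g" using 4 g by (simp add: L2_set_one s_def[symmetric] pos_le_divide_eq ac_simps)
      have "Ee * g \<le> Ee * 1" using g Ee0 by (intro mult_left_mono) auto
      then have "Ee \<le> Ee / g" using g by (simp add: pos_le_divide_eq)
      then show "L2_set (\<lambda>i. \<bar>e i\<bar>) {..<n} \<le> Ee / g" using Ee by (simp add: L2_set_abs)
    qed (use c in auto)
    also have "\<dots> = E\<rho>" unfolding \<rho> g_def[symmetric] using c g by (simp add: field_simps)
    finally show ?thesis .
  qed
  have 6: "\<bar>q - Q\<bar> * s \<le> 3 * E\<rho>"
  proof -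
    have "\<bar>q - Q\<bar> \<le> avg n (\<lambda>i. \<bar>(R i)\<^sup>2 - (x i)\<^sup>2\<bar>)" unfolding q_def Q_def avg_diff by (rule avg_abs)
    also have "\<dots> \<le> avg n (\<lambda>i. 2 * \<bar>r i - 1\<bar> + \<bar>r i - 1\<bar> * \<bar>r i - 1\<bar>)"
    proof (rule avg_mono[OF n])
      fix i assume i: "i < n"
      have "(R i)\<^sup>2 - (x i)\<^sup>2 = (x i)\<^sup>2 * (2 * (r i - 1) + (r i - 1) * (r i - 1))"
        using x[OF i] by (simp add: r_def power2_eq_square field_simps)
      then have "\<bar>(R i)\<^sup>2 - (x i)\<^sup>2\<bar> = (x i)\<^sup>2 * \<bar>2 * (r i - 1) + (r i - 1) * (r i - 1)\<bar>" by (simp add: abs_mult)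
      also have "\<dots> \<le> 1 * \<bar>2 * (r i - 1) + (r i - 1) * (r i - 1)\<bar>" using x[OF i] by (intro mult_right_mono) (auto simp: power_le_one)
      also have "\<dots> \<le> 2 * \<bar>r i - 1\<bar> + \<bar>r i - 1\<bar> * \<bar>r i - 1\<bar>" unfolding mult_1
        by (rule order_trans[OF abs_triangle_ineq]) (simp only: abs_mult abs_numeral order_refl)
      finally show "\<bar>(R i)\<^sup>2 - (x i)\<^sup>2\<bar> \<le> 2 * \<bar>r i - 1\<bar> + \<bar>r i - 1\<bar> * \<bar>r i - 1\<bar>" .
    qed
    also have "\<dots> \<le> 2 * (E\<rho> / s) + E\<rho> * E\<rho> / n"
      unfolding avg_add avg_cmult
    proof (rule add_mono)
      show "2 * avg n (\<lambda>i. \<bar>r i - 1\<bar>) \<le> 2 * (E\<rho> / s)"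
        using avg_abs_le_L2[OF n, of "\<lambda>i. r i - 1"] divide_right_mono[OF 5, of s] s unfolding s_def by linarith
      show "avg n (\<lambda>i. \<bar>r i - 1\<bar> * \<bar>r i - 1\<bar>) \<le> E\<rho> * E\<rho> / n"
        using avg_mult_le[OF n, of "\<lambda>i. r i - 1" "\<lambda>i. r i - 1"] 5 E\<rho>0
        by (meson L2_set_nonneg divide_right_mono mult_mono of_nat_0_le_iff order_trans)
    qed
    finally have "\<bar>q - Q\<bar> * s \<le> (2 * (E\<rho> / s) + E\<rho> * E\<rho> / n) * s" using s by (intro mult_right_mono) auto
    also have "\<dots> = 2 * E\<rho> + E\<rho> * (E\<rho> / s)" unfolding s(2)[symmetric] using s(1) by (simp add: field_simps)
    also have "\<dots> \<le> 2 * E\<rho> + E\<rho> * 1" using large(2) s E\<rho>0 by (intro add_left_mono mult_left_mono) (auto simp: s_def)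
    finally show ?thesis by simp
  qed
  have Q: "0 \<le> Q" "Q \<le> 1" unfolding Q_def using x n by (auto intro!: avg_nonneg avg_le simp: power_le_one less_imp_le)
  have bQ: "g \<le> 1 - \<beta>\<^sup>2 * Q"
    using mult_mono[OF b2(1) Q(2)] \<beta> Q by (simp add: g_def)
  have bqQ: "\<beta>\<^sup>2 * \<bar>q - Q\<bar> \<le> \<bar>q - Q\<bar>" using b2 \<beta> by (intro mult_left_le_one_le) auto
  \<comment> \<open>So far \<open>1 - \<beta>\<^sup>2 * q\<close> was only known to be positive.
    Closeness of \<open>q\<close> to \<open>Q\<close> now bounds it below by
    \<open>g / 2\<close>.\<close>
  have 7: "t' \<le> 3 / g"
  proof -
    have "\<bar>q - Q\<bar> * s \<le> g / 2 * s" using 6 large(3) unfolding s_def[symmetric] g_def by simp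
    then have "\<bar>q - Q\<bar> \<le> g / 2" using s by simp
    then have "\<beta>\<^sup>2 * \<bar>q - Q\<bar> \<le> g / 2" using bqQ by linarith
    moreover have "\<beta>\<^sup>2 * (q - Q) \<le> \<beta>\<^sup>2 * \<bar>q - Q\<bar>" by (intro mult_left_mono) auto
    ultimately have "g / 2 \<le> 1 - \<beta>\<^sup>2 * q" using bQ by (simp add: algebra_simps)
    then have "t' * (g / 2) \<le> t' * (1 - \<beta>\<^sup>2 * q)" using t'1 by (intro mult_left_mono) auto
    then have "t' * (g / 2) \<le> 3 / 2" using 1 2 by linarith
    then show ?thesis using g by (simp add: field_simps)
  qed
  define t where "t = tlim n \<beta> x"
  have tdef: "t = 1 / (1 - \<beta>\<^sup>2 * Q)" by (simp add: t_def tlim_def Q_def)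
  have t: "0 \<le> t" "t \<le> 1 / g" unfolding tdef using bQ g by (auto intro: divide_left_mono)
  have 8: "\<bar>t' - t\<bar> * s \<le> (Ef / c + 9 * E\<rho> / g) / g"
  proof -
    have "1 - \<beta>\<^sup>2 * Q \<noteq> 0" using bQ g by simp
    then have "t' - t = t * (t' * (1 - \<beta>\<^sup>2 * Q) - 1)" by (simp add: tdef field_simps)
    also have "t' * (1 - \<beta>\<^sup>2 * Q) - 1 = \<eta> + t' * (\<beta>\<^sup>2 * (q - Q))" using 1 by (simp add: algebra_simps)
    finally have e: "\<bar>t' - t\<bar> = t * \<bar>\<eta> + t' * (\<beta>\<^sup>2 * (q - Q))\<bar>" using t by (simp add: abs_mult)
    have \<eta>s: "\<bar>\<eta>\<bar> * s \<le> Ef / c"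
    proof -
      have "\<bar>\<eta>\<bar> \<le> (\<beta>\<^sup>2 * avg n (\<lambda>i. \<bar>R i\<bar> * \<bar>f i\<bar>)) / c" using \<eta>a by simp
      also have "\<dots> \<le> \<beta> * (Ef / s) / c" using c by (intro divide_right_mono avR[OF Ef]) auto
      also have "\<dots> \<le> 1 * (Ef / s) / c" using \<beta> Ef0 s c by (intro divide_right_mono mult_right_mono) auto
      finally have "\<bar>\<eta>\<bar> * s \<le> 1 * (Ef / s) / c * s" using s by (intro mult_right_mono) auto
      then show ?thesis using s by simp
    qed
    have "\<bar>\<eta> + t' * (\<beta>\<^sup>2 * (q - Q))\<bar> \<le> \<bar>\<eta>\<bar> + t' * (\<beta>\<^sup>2 * \<bar>q - Q\<bar>)"
      by (rule order_trans[OF abs_triangle_ineq]) (use t'1 in \<open>simp add: abs_mult\<close>)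
    also have "\<dots> \<le> \<bar>\<eta>\<bar> + 3 / g * \<bar>q - Q\<bar>" using 7 bqQ t'1 g by (intro add_left_mono mult_mono) auto
    finally have "\<bar>\<eta> + t' * (\<beta>\<^sup>2 * (q - Q))\<bar> * s \<le> (\<bar>\<eta>\<bar> + 3 / g * \<bar>q - Q\<bar>) * s" using s by (intro mult_right_mono) auto
    also have "\<dots> = \<bar>\<eta>\<bar> * s + 3 / g * (\<bar>q - Q\<bar> * s)" by (simp add: algebra_simps)
    also have "\<dots> \<le> Ef / c + 3 / g * (3 * E\<rho>)" using \<eta>s 6 g by (intro add_mono mult_left_mono) auto
    finally have k: "\<bar>\<eta> + t' * (\<beta>\<^sup>2 * (q - Q))\<bar> * s \<le> Ef / c + 9 * E\<rho> / g" by simp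
    have "\<bar>t' - t\<bar> * s = t * (\<bar>\<eta> + t' * (\<beta>\<^sup>2 * (q - Q))\<bar> * s)" unfolding e by simp
    also have "\<dots> \<le> 1 / g * (Ef / c + 9 * E\<rho> / g)" using k t s g by (intro mult_mono) auto
    finally show ?thesis by simp
  qed
  have r0: "0 < r i \<and> r i \<le> 1 / c" if i: "i < n" for i
    using R[OF i] x[OF i] c unfolding r_def by (auto simp: field_simps)
  have "L2_set (\<lambda>i. T i / (x i)\<^sup>2 - t) {..<n} \<le> L2_set (\<lambda>i. (6 / (c * g) * \<bar>r i - 1\<bar> + 1 / c\<^sup>2 * \<bar>f i\<bar>) + \<bar>t' - t\<bar>) {..<n}"
  proof (rule L2_set_abs_le)
    fix i assume "i \<in> {..<n}"
    then have i: "i < n" by simp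
    \<comment> \<open>The error splits into the relative error of \<open>R\<close>, the fluctuation
      \<open>f\<close>, and the shift from \<open>t'\<close> to \<open>t\<close> common to all
      indices.\<close>
    have "T i / (x i)\<^sup>2 = (r i)\<^sup>2 * (t' + f i)" using eqT[OF i] by (simp add: t'_def r_def power_divide)
    then have "T i / (x i)\<^sup>2 - t = t' * ((r i + 1) * (r i - 1)) + (r i)\<^sup>2 * f i + (t' - t)" by (simp add: power2_eq_square algebra_simps)
    then have "\<bar>T i / (x i)\<^sup>2 - t\<bar> \<le> \<bar>t' * ((r i + 1) * (r i - 1))\<bar> + \<bar>(r i)\<^sup>2 * f i\<bar> + \<bar>t' - t\<bar>" by linarith
    moreover have "\<bar>t' * ((r i + 1) * (r i - 1))\<bar> \<le> 3 / g * (2 / c * \<bar>r i - 1\<bar>)"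
    proof -
      have "r i + 1 \<le> 2 / c" using r0[OF i] c by (auto simp: field_simps)
      then show ?thesis unfolding abs_mult using 7 t'1 r0[OF i] g c by (intro mult_mono) auto
    qed
    moreover have "\<bar>(r i)\<^sup>2 * f i\<bar> \<le> 1 / c\<^sup>2 * \<bar>f i\<bar>"
    proof -
      have "(r i)\<^sup>2 \<le> (1 / c)\<^sup>2" using r0[OF i] by (intro power_mono) auto
      then show ?thesis unfolding abs_mult by (intro mult_right_mono) (auto simp: power_divide)
    qed
    moreover have "3 / g * (2 / c * \<bar>r i - 1\<bar>) = 6 / (c * g) * \<bar>r i - 1\<bar>" by (simp add: field_simps)
    ultimately show "\<bar>T i / (x i)\<^sup>2 - t\<bar> \<le> (6 / (c * g) * \<bar>r i - 1\<bar> + 1 / c\<^sup>2 * \<bar>f i\<bar>) + \<bar>t' - t\<bar>" by linarith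
  qed
  also have "\<dots> \<le> L2_set (\<lambda>i. 6 / (c * g) * \<bar>r i - 1\<bar> + 1 / c\<^sup>2 * \<bar>f i\<bar>) {..<n} + L2_set (\<lambda>i. \<bar>t' - t\<bar>) {..<n}"
    by (rule L2_set_triangle_ineq)
  also have "\<dots> \<le> (L2_set (\<lambda>i. 6 / (c * g) * \<bar>r i - 1\<bar>) {..<n} + L2_set (\<lambda>i. 1 / c\<^sup>2 * \<bar>f i\<bar>) {..<n}) + L2_set (\<lambda>i. \<bar>t' - t\<bar>) {..<n}"
    by (intro add_right_mono L2_set_triangle_ineq)
  also have "\<dots> = (6 / (c * g) * L2_set (\<lambda>i. r i - 1) {..<n} + 1 / c\<^sup>2 * L2_set f {..<n}) + \<bar>t' - t\<bar> * s"
    using c g L2_set_right_distrib[of "6 / (c * g)" "\<lambda>i. \<bar>r i - 1\<bar>" "{..<n}"] L2_set_right_distrib[of "1 / c\<^sup>2" "\<lambda>i. \<bar>f i\<bar>" "{..<n}"]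
    by (simp add: L2_set_one L2_set_abs s_def)
  also have "\<dots> \<le> (6 / (c * g) * E\<rho> + 1 / c\<^sup>2 * Ef) + (Ef / c + 9 * E\<rho> / g) / g"
    using 5 Ef 8 c g by (intro add_mono mult_left_mono) auto
  finally show ?thesis unfolding t_def g_def by simp
qed

section \<open>Cavity equations\<close>

definition symm :: "nat \<Rightarrow> real mat \<Rightarrow> bool" where
  "symm n A \<longleftrightarrow> A \<in> carrier_mat n n \<and> (\<forall>i<n. \<forall>j<n. A $$ (i, j) = A $$ (j, i))"

definition Bm :: "nat \<Rightarrow> real \<Rightarrow> (nat \<Rightarrow> real) \<Rightarrow> real mat \<Rightarrow> real mat" where
  "Bm n \<beta> x A = mat_diag n (\<lambda>i. 1 / x i + \<beta>\<^sup>2 * avg n x) - \<beta> \<cdot>\<^sub>m A"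

text \<open>The relation \<open>B \<succeq> c D\<close> for the diagonal matrix \<open>D\<close>
  with entries \<open>1 / x i\<close>, expressed by quadratic forms.\<close>

definition pdc :: "nat \<Rightarrow> real \<Rightarrow> (nat \<Rightarrow> real) \<Rightarrow> real mat \<Rightarrow> bool" where
  "pdc n c x B \<longleftrightarrow> symm n B \<and> (\<forall>v\<in>carrier_vec n. c * (\<Sum>i<n. (v $ i)\<^sup>2 / x i) \<le> v \<bullet> (B *\<^sub>v v))"

definition trc :: "nat \<Rightarrow> real mat \<Rightarrow> real" where "trc n M = (\<Sum>j<n. M $$ (j, j))"

text \<open>Row and column \<open>i\<close> are zeroed rather than deleted: the dimension stays
  \<open>n\<close>, and index \<open>i\<close> decouples from the rest.\<close>

definition zrow :: "nat \<Rightarrow> nat \<Rightarrow> real mat \<Rightarrow> real mat" where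
  "zrow n i A = Matrix.mat n n (\<lambda>(j, k). if j = i \<or> k = i then 0 else A $$ (j, k))"

lemma symm_carrier: "symm n A \<Longrightarrow> A \<in> carrier_mat n n" by (simp add: symm_def)

lemma symm_transpose: "symm n A \<Longrightarrow> transpose_mat A = A"
  by (intro eq_matI) (auto simp: symm_def)

lemma mat_vec_index:
  fixes M :: "real mat"
  assumes "M \<in> carrier_mat n n" "v \<in> carrier_vec n" "i < n"
  shows "(M *\<^sub>v v) $ i = (\<Sum>j<n. M $$ (i, j) * v $ j)"
  using assms by (auto simp: scalar_prod_lessThan intro!: sum.cong)

lemma mat_mult_index:
  fixes M :: "real mat"
  assumes "M \<in> carrier_mat n n" "N \<in> carrier_mat n n" "i < n" "j < n"
  shows "(M * N) $$ (i, j) = (\<Sum>k<n. M $$ (i, k) * N $$ (k, j))"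
  using assms by (auto simp: scalar_prod_lessThan[of _ n] intro!: sum.cong)

lemma quad_sum:
  fixes M :: "real mat"
  assumes "M \<in> carrier_mat n n" "v \<in> carrier_vec n"
  shows "v \<bullet> (M *\<^sub>v v) = (\<Sum>i<n. \<Sum>j<n. v $ i * v $ j * M $$ (i, j))"
proof -
  have "v \<bullet> (M *\<^sub>v v) = (\<Sum>i<n. v $ i * (M *\<^sub>v v) $ i)" by (rule scalar_prod_lessThan[OF mult_mat_vec_carrier[OF assms]])
  also have "\<dots> = (\<Sum>i<n. \<Sum>j<n. v $ i * v $ j * M $$ (i, j))"
    by (intro sum.cong refl) (simp only: mat_vec_index[OF assms] lessThan_iff sum_distrib_left ac_simps)
  finally show ?thesis .
qed

lemma trc_mult_comm:
  assumes "M \<in> carrier_mat n n" "N \<in> carrier_mat n n"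
  shows "trc n (M * N) = trc n (N * M)"
proof -
  have "trc n (M * N) = (\<Sum>j<n. \<Sum>k<n. M $$ (j, k) * N $$ (k, j))"
    unfolding trc_def by (intro sum.cong refl mat_mult_index assms) auto
  also have "\<dots> = (\<Sum>k<n. \<Sum>j<n. N $$ (k, j) * M $$ (j, k))" by (subst sum.swap) (simp add: mult.commute)
  also have "\<dots> = trc n (N * M)"
    unfolding trc_def by (intro sum.cong refl mat_mult_index[symmetric] assms) auto
  finally show ?thesis .
qed

lemma Bm_carrier: "A \<in> carrier_mat n n \<Longrightarrow> Bm n \<beta> x A \<in> carrier_mat n n"
  by (auto simp: Bm_def intro!: carrier_matI)

lemma Bm_index:
  assumes "A \<in> carrier_mat n n" "i < n" "j < n"
  shows "Bm n \<beta> x A $$ (i, j) = (if i = j then 1 / x j + \<beta>\<^sup>2 * avg n x else 0) - \<beta> * A $$ (i, j)"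
  using assms by (simp add: Bm_def mat_diag_index)

lemma Bm_symm: "symm n A \<Longrightarrow> symm n (Bm n \<beta> x A)"
  by (auto simp: symm_def Bm_index Bm_carrier)

lemma resm_eq_Bm:
  assumes A: "A \<in> carrier_mat n n" and x: "\<And>i. i < n \<Longrightarrow> x i \<noteq> 0"
  shows "resm n \<beta> x A = Bm n \<beta> x A * mat_diag n x"
proof (rule eq_matI)
  note b = Bm_carrier[OF A, of \<beta> x]
  fix i j assume "i < dim_row (Bm n \<beta> x A * mat_diag n x)" "j < dim_col (Bm n \<beta> x A * mat_diag n x)"
  then have ij: "i < n" "j < n" using b by auto
  then show "resm n \<beta> x A $$ (i, j) = (Bm n \<beta> x A * mat_diag n x) $$ (i, j)"
    unfolding mult_diag_index[OF b ij] Bm_index[OF A ij] resm_index[OF A ij] using x[OF ij(2)] by (simp add: algebra_simps)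
qed (use A Bm_carrier[OF A, of \<beta> x] in auto)

lemma quad_Bm:
  assumes A: "A \<in> carrier_mat n n" and v: "v \<in> carrier_vec n"
  shows "v \<bullet> (Bm n \<beta> x A *\<^sub>v v) = (\<Sum>i<n. (1 / x i + \<beta>\<^sup>2 * avg n x) * (v $ i)\<^sup>2) - \<beta> * (\<Sum>i<n. \<Sum>j<n. v $ i * v $ j * A $$ (i, j))"
proof -
  have "v \<bullet> (Bm n \<beta> x A *\<^sub>v v) = (\<Sum>i<n. \<Sum>j<n. (if i = j then (1 / x i + \<beta>\<^sup>2 * avg n x) * (v $ i)\<^sup>2 else 0) - \<beta> * (v $ i * v $ j * A $$ (i, j)))"
    unfolding quad_sum[OF Bm_carrier[OF A] v]
    by (intro sum.cong refl) (auto simp: Bm_index[OF A] power2_eq_square algebra_simps)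
  also have "\<dots> = (\<Sum>i<n. (1 / x i + \<beta>\<^sup>2 * avg n x) * (v $ i)\<^sup>2) - \<beta> * (\<Sum>i<n. \<Sum>j<n. v $ i * v $ j * A $$ (i, j))"
    by (simp add: sum_subtractf sum_distrib_left)
  finally show ?thesis .
qed

lemma symm_square_index:
  assumes S: "symm n S" and i: "i < n"
  shows "(S * S) $$ (i, i) = rsq n S i"
  unfolding mat_mult_index[OF symm_carrier[OF S] symm_carrier[OF S] i i] rsq_def
  using S i by (intro sum.cong refl) (auto simp: symm_def power2_eq_square)

locale pd_setting = lip_setting +
  fixes x :: "nat \<Rightarrow> real" and c :: real
  assumes x: "\<And>i. i < n \<Longrightarrow> 0 < x i \<and> x i \<le> 1" and c0: "0 < c" and c1: "2 * c \<le> 1"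
begin

lemma avg_x: "0 \<le> avg n x" "avg n x \<le> 1"
proof -
  show "0 \<le> avg n x" by (rule avg_nonneg) (use x in \<open>auto intro: less_imp_le\<close>)
  show "avg n x \<le> 1" by (rule avg_le[OF n0]) (use x in auto)
qed

lemma weighted_sum_ge: "v \<in> carrier_vec n \<Longrightarrow> v \<bullet> v \<le> (\<Sum>i<n. (v $ i)\<^sup>2 / x i)"
proof -
  assume v: "v \<in> carrier_vec n"
  have "(v $ i)\<^sup>2 \<le> (v $ i)\<^sup>2 / x i" if "i < n" for i
    using x[OF that] mult_left_mono[of "x i" 1 "(v $ i)\<^sup>2"] by (simp add: pos_le_divide_eq)
  then show ?thesis unfolding scalar_prod_lessThan[OF v] power2_eq_square[symmetric] by (intro sum_mono) auto
qed

lemma pdc_lower: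
  assumes B: "pdc n c x B" and v: "v \<in> carrier_vec n"
  shows "c * vnorm v \<le> vnorm (B *\<^sub>v v)"
proof (cases "vnorm v = 0")
  case True
  have Bc: "B \<in> carrier_mat n n" using B by (simp add: pdc_def symm_def)
  show ?thesis using True vnorm_nonneg[OF mult_mat_vec_carrier[OF Bc v]] by simp
next
  case False
  have Bc: "B \<in> carrier_mat n n" using B by (simp add: pdc_def symm_def)
  have p: "vnorm v > 0" using False vnorm_nonneg[OF v] by simp
  have "c * (vnorm v)\<^sup>2 \<le> c * (\<Sum>i<n. (v $ i)\<^sup>2 / x i)" unfolding vnorm_sq[OF v] using c0 by (intro mult_left_mono weighted_sum_ge v) auto
  also have "\<dots> \<le> v \<bullet> (B *\<^sub>v v)" using B v by (simp add: pdc_def)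
  also have "\<dots> \<le> vnorm v * vnorm (B *\<^sub>v v)" using scalar_prod_le_vnorm[OF v mult_mat_vec_carrier[OF Bc v]] by linarith
  finally have "vnorm v * (c * vnorm v) \<le> vnorm v * vnorm (B *\<^sub>v v)" by (simp add: power2_eq_square ac_simps)
  then show ?thesis using p by simp
qed

lemma pdc_inv:
  assumes B: "pdc n c x B"
  shows "is_inv n B (minv B)" "op_bound n (minv B) (1 / c)" "symm n (minv B)"
proof -
  have Bc: "B \<in> carrier_mat n n" "symm n B" using B by (auto simp: pdc_def symm_def)
  show i: "is_inv n B (minv B)"
    unfolding minv_def by (rule ex_is_inv_of_det[OF Bc(1) is_inv_of_lower_bound(1)[OF Bc(1) c0 pdc_lower[OF B]]])
  show "op_bound n (minv B) (1 / c)" by (rule is_inv_of_lower_bound(2)[OF Bc(1) c0 pdc_lower[OF B] i])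
  note d = is_invD[OF i]
  have "is_inv n B (transpose_mat (minv B))"
  proof -
    have "B * transpose_mat (minv B) = transpose_mat (minv B * B)"
      unfolding transpose_mult[OF d(2,1)] symm_transpose[OF Bc(2)] ..
    moreover have "transpose_mat (minv B) * B = transpose_mat (B * minv B)"
      unfolding transpose_mult[OF d(1,2)] symm_transpose[OF Bc(2)] ..
    ultimately show ?thesis using d by (simp add: is_inv_def)
  qed
  then have e: "transpose_mat (minv B) = minv B" using is_inv_unique[OF _ i] by blast
  have "minv B $$ (k, j) = minv B $$ (j, k)" if "k < n" "j < n" for k j
    using arg_cong[OF e, of "\<lambda>M. M $$ (k, j)"] d(2) that by simp
  then show "symm n (minv B)" using d(2) by (simp add: symm_def)
qed

text \<open>The lower bound is tested on \<open>y = minv B *\<^sub>v unit_vec n i\<close>, whose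
  quadratic form is \<open>y $ i\<close>. Dropping all but one term leaves
  \<open>c * ((y $ i)\<^sup>2 / x i) \<le> y $ i\<close>.\<close>

lemma pdc_inv_diag:
  assumes B: "pdc n c x B" and i: "i < n"
  shows "0 < minv B $$ (i, i) \<and> minv B $$ (i, i) \<le> x i / c"
proof -
  note d = is_invD[OF pdc_inv(1)[OF B]]
  define y where "y = minv B *\<^sub>v unit_vec n i"
  have u: "unit_vec n i \<in> carrier_vec n" by simp
  have y: "y \<in> carrier_vec n" unfolding y_def by (rule mult_mat_vec_carrier[OF d(2) u])
  have yi: "y $ i = minv B $$ (i, i)" unfolding y_def using d(2) i by simp
  have By: "B *\<^sub>v y = unit_vec n i" unfolding y_def using assoc_mult_mat_vec[OF d(1,2) u] d(3) u by simp
  have "c * (\<Sum>j<n. (y $ j)\<^sup>2 / x j) \<le> y \<bullet> unit_vec n i" using B y unfolding pdc_def By[symmetric] by auto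
  also have "y \<bullet> unit_vec n i = y $ i" using y i by simp
  finally have 1: "c * (\<Sum>j<n. (y $ j)\<^sup>2 / x j) \<le> y $ i" .
  have nn: "0 \<le> (y $ j)\<^sup>2 / x j" if "j < n" for j using x[OF that] by simp
  have "(y $ i)\<^sup>2 / x i \<le> (\<Sum>j<n. (y $ j)\<^sup>2 / x j)" using i nn by (intro member_le_sum) auto
  then have 2: "c * ((y $ i)\<^sup>2 / x i) \<le> y $ i" using 1 c0 by (meson mult_left_mono order_trans less_imp_le)
  have "y $ i \<noteq> 0"
  proof
    assume z: "y $ i = 0"
    have "0 \<le> c * (\<Sum>j<n. (y $ j)\<^sup>2 / x j)" using c0 nn by (intro mult_nonneg_nonneg sum_nonneg) auto
    then have "(\<Sum>j<n. (y $ j)\<^sup>2 / x j) = 0" using 1 z c0 by simp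
    then have "\<forall>j\<in>{..<n}. (y $ j)\<^sup>2 / x j = 0" using nn by (subst (asm) sum_nonneg_eq_0_iff) auto
    then have "y $ j = 0" if "j < n" for j using x[OF that] that by auto
    then have "y = 0\<^sub>v n" using y by (intro eq_vecI) auto
    moreover have "B *\<^sub>v 0\<^sub>v n = 0\<^sub>v n" using d(1) by (intro eq_vecI) auto
    ultimately have "unit_vec n i = (0\<^sub>v n :: real vec)" using By by simp
    then have "(unit_vec n i :: real vec) $ i = 0\<^sub>v n $ i" by simp
    then show False using i by simp
  qed
  moreover have "0 \<le> c * ((y $ i)\<^sup>2 / x i)" by (intro mult_nonneg_nonneg less_imp_le[OF c0] nn[OF i])
  ultimately have p: "0 < y $ i" using 2 by linarith
  have "y $ i * (c * y $ i) \<le> y $ i * x i"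
    using 2 x[OF i] by (simp add: pos_divide_le_eq power2_eq_square ac_simps)
  then have "c * y $ i \<le> x i" using p by simp
  then show ?thesis using p c0 unfolding yi by (simp add: pos_le_divide_eq mult.commute)
qed

lemma rsq_nonneg: "0 \<le> rsq n M i" unfolding rsq_def by (simp add: sum_nonneg)

lemma rsq_le:
  assumes "op_bound n M b" "i < n"
  shows "rsq n M i \<le> b\<^sup>2"
proof -
  have "rsq n M i = (row_norm n M i)\<^sup>2" by (simp add: rsq_def row_norm_def L2_set_def sum_nonneg)
  also have "\<dots> \<le> b\<^sup>2" by (intro power_mono row_norm_le[OF assms] row_norm_nonneg)
  finally show ?thesis .
qed

text \<open>The entries \<open>1 / x i\<close> have no uniform bound, yet with \<open>R\<close> the
  inverse of \<open>B\<close> and \<open>E\<close> the bounded part,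
  \<open>D R = (B - E) R = I - E R\<close>. Hence the inverse of \<open>resm\<close>, which is
  \<open>D R\<close>, has norm at most \<open>1 + 7 / c\<close>.\<close>

lemma pdc_good:
  assumes A: "op_bound n A 6" "symm n A" and B: "pdc n c x (Bm n \<beta> x A)"
  shows "good n \<beta> (8 / c) x A" and "\<And>i. i < n \<Longrightarrow> Zd n \<beta> x A i = rsq n (minv (Bm n \<beta> x A)) i / (x i)\<^sup>2"
proof -
  define R where "R = minv (Bm n \<beta> x A)"
  define N where "N = mat_diag n (\<lambda>i. 1 / x i) * R"
  note cA = symm_carrier[OF A(2)]
  note inv = pdc_inv(1)[OF B, folded R_def]
  note d = is_invD[OF inv]
  have cN: "N \<in> carrier_mat n n" unfolding N_def by (rule mult_carrier_mat[OF mat_diag_dim d(2)])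
  have XD: "mat_diag n x * mat_diag n (\<lambda>i. 1 / x i) = 1\<^sub>m n" "mat_diag n (\<lambda>i. 1 / x i) * mat_diag n x = 1\<^sub>m n"
    unfolding mat_diag_diag using x by (auto intro!: eq_matI simp: mat_diag_index less_imp_neq[THEN not_sym])
  have re: "resm n \<beta> x A = Bm n \<beta> x A * mat_diag n x" by (rule resm_eq_Bm[OF cA]) (use x in \<open>auto simp: less_imp_neq[THEN not_sym]\<close>)
  have iN: "is_inv n (resm n \<beta> x A) N"
  proof -
    have "resm n \<beta> x A * N = Bm n \<beta> x A * (mat_diag n x * N)" unfolding re by (rule assoc_mult_mat[OF d(1) mat_diag_dim cN])
    also have "mat_diag n x * N = R"
      unfolding N_def assoc_mult_mat[OF mat_diag_dim mat_diag_dim d(2), symmetric] XD using d(2) by simp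
    finally have 1: "resm n \<beta> x A * N = 1\<^sub>m n" using d by simp
    have "N * resm n \<beta> x A = mat_diag n (\<lambda>i. 1 / x i) * (R * resm n \<beta> x A)"
      unfolding N_def by (rule assoc_mult_mat[OF mat_diag_dim d(2) resm_carrier[OF cA]])
    also have "R * resm n \<beta> x A = mat_diag n x"
      unfolding re assoc_mult_mat[OF d(2,1) mat_diag_dim, symmetric] d(4) by simp
    finally have "N * resm n \<beta> x A = 1\<^sub>m n" using XD by simp
    then show ?thesis using 1 cN resm_carrier[OF cA] by (simp add: is_inv_def)
  qed
  have mN: "minv (resm n \<beta> x A) = N" by (rule is_inv_minv[OF iN])
  define E where "E = (\<beta>\<^sup>2 * avg n x) \<cdot>\<^sub>m 1\<^sub>m n - \<beta> \<cdot>\<^sub>m A"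
  note av = avg_x
  have oE: "op_bound n E 7"
  proof -
    have "op_bound n E (\<bar>\<beta>\<^sup>2 * avg n x\<bar> * 1 + \<bar>\<beta>\<bar> * 6)" unfolding E_def by (intro op_bound_diff op_bound_smult op_bound_one A)
    moreover have "\<bar>\<beta>\<^sup>2 * avg n x\<bar> * 1 + \<bar>\<beta>\<bar> * 6 \<le> 7"
    proof -
      have "\<beta>\<^sup>2 * avg n x \<le> 1 * 1" using \<beta>0 \<beta>1 av by (intro mult_mono) (auto simp: power_le_one)
      then show ?thesis using \<beta>0 \<beta>1 av by simp
    qed
    ultimately show ?thesis by (rule op_bound_mono)
  qed
  have "mat_diag n (\<lambda>i. 1 / x i) = Bm n \<beta> x A - E"
    using cA Bm_carrier[OF cA, of \<beta> x] by (intro eq_matI) (auto simp: E_def Bm_index mat_diag_index)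
  then have "N = Bm n \<beta> x A * R - E * R" unfolding N_def using minus_mult_distrib_mat[OF d(1) op_boundD(1)[OF oE] d(2)] by simp
  then have "N = 1\<^sub>m n - E * R" using d(3) by simp
  then have "op_bound n N (1 + 7 * (1 / c))"
    using op_bound_diff[OF op_bound_one op_bound_mult[OF oE pdc_inv(2)[OF B, folded R_def]]] by simp
  then have oN: "op_bound n N (8 / c)" by (rule op_bound_mono) (use c0 c1 in \<open>simp add: field_simps\<close>)
  show "good n \<beta> (8 / c) x A" unfolding good_def mN using A(1) iN oN by simp
  fix i assume i: "i < n"
  have "N $$ (i, j) = 1 / x i * R $$ (i, j)" if "j < n" for j
    unfolding N_def mat_diag_mult_left[OF d(2)] using i that by simp
  then have "rsq n N i = (\<Sum>j<n. (1 / x i)\<^sup>2 * (R $$ (i, j))\<^sup>2)"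
    unfolding rsq_def by (intro sum.cong refl) (simp add: power_mult_distrib power_divide)
  also have "\<dots> = rsq n R i / (x i)\<^sup>2" unfolding sum_distrib_left[symmetric] rsq_def by (simp add: power_divide)
  finally show "Zd n \<beta> x A i = rsq n (minv (Bm n \<beta> x A)) i / (x i)\<^sup>2" unfolding Zd_def mN R_def .
qed

section \<open>Decoupling one row and column\<close>

lemma zrow_carrier: "zrow n i A \<in> carrier_mat n n" by (simp add: zrow_def)

lemma zrow_index: "j < n \<Longrightarrow> k < n \<Longrightarrow> zrow n i A $$ (j, k) = (if j = i \<or> k = i then 0 else A $$ (j, k))"
  by (simp add: zrow_def)

lemma zrow_symm: "symm n A \<Longrightarrow> symm n (zrow n i A)"
  by (auto simp: symm_def zrow_carrier zrow_index)

text \<open>The quadratic form splits: \<open>u\<close>, which is \<open>v\<close> with coordinate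
  \<open>i\<close> set to 0, is governed by the original matrix, and coordinate \<open>i\<close>
  alone contributes at least \<open>c * ((v $ i)\<^sup>2 / x i)\<close>.\<close>

lemma pdc_zrow:
  assumes A: "symm n A" and B: "pdc n c x (Bm n \<beta> x A)" and i: "i < n"
  shows "pdc n c x (Bm n \<beta> x (zrow n i A))"
proof -
  note cA = symm_carrier[OF A]
  note av = avg_x(1)
  have "c * (\<Sum>j<n. (v $ j)\<^sup>2 / x j) \<le> v \<bullet> (Bm n \<beta> x (zrow n i A) *\<^sub>v v)" if v: "v \<in> carrier_vec n" for v
  proof -
    define u where "u = Matrix.vec n (\<lambda>j. if j = i then 0 else v $ j)"
    have u: "u \<in> carrier_vec n" by (simp add: u_def)
    have ui: "j < n \<Longrightarrow> u $ j = (if j = i then 0 else v $ j)" for j by (simp add: u_def)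
    have split: "(\<Sum>j<n. f j * (v $ j)\<^sup>2) = (\<Sum>j<n. f j * (u $ j)\<^sup>2) + f i * (v $ i)\<^sup>2" for f :: "nat \<Rightarrow> real"
    proof -
      have "(\<Sum>j<n. f j * (v $ j)\<^sup>2) = f i * (v $ i)\<^sup>2 + (\<Sum>j\<in>{..<n} - {i}. f j * (v $ j)\<^sup>2)" using i by (intro sum.remove) auto
      moreover have "(\<Sum>j<n. f j * (u $ j)\<^sup>2) = f i * (u $ i)\<^sup>2 + (\<Sum>j\<in>{..<n} - {i}. f j * (u $ j)\<^sup>2)" using i by (intro sum.remove) auto
      moreover have "(\<Sum>j\<in>{..<n} - {i}. f j * (u $ j)\<^sup>2) = (\<Sum>j\<in>{..<n} - {i}. f j * (v $ j)\<^sup>2)" by (intro sum.cong refl) (auto simp: ui)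
      ultimately show ?thesis using i by (simp add: ui)
    qed
    have q: "(\<Sum>j<n. \<Sum>k<n. v $ j * v $ k * zrow n i A $$ (j, k)) = (\<Sum>j<n. \<Sum>k<n. u $ j * u $ k * A $$ (j, k))"
      by (intro sum.cong refl) (auto simp: ui zrow_index)
    have "v \<bullet> (Bm n \<beta> x (zrow n i A) *\<^sub>v v) = u \<bullet> (Bm n \<beta> x A *\<^sub>v u) + (1 / x i + \<beta>\<^sup>2 * avg n x) * (v $ i)\<^sup>2"
      unfolding quad_Bm[OF zrow_carrier v] quad_Bm[OF cA u] q split[of "\<lambda>j. 1 / x j + \<beta>\<^sup>2 * avg n x"] by simp
    moreover have "c * (\<Sum>j<n. (u $ j)\<^sup>2 / x j) \<le> u \<bullet> (Bm n \<beta> x A *\<^sub>v u)" using B u by (simp add: pdc_def)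
    moreover have "(\<Sum>j<n. (v $ j)\<^sup>2 / x j) = (\<Sum>j<n. (u $ j)\<^sup>2 / x j) + (v $ i)\<^sup>2 / x i"
      using split[of "\<lambda>j. 1 / x j"] by simp
    moreover have "c * ((v $ i)\<^sup>2 / x i) \<le> (1 / x i + \<beta>\<^sup>2 * avg n x) * (v $ i)\<^sup>2"
    proof -
      have "c * (1 / x i) \<le> 1 * (1 / x i)" using c1 c0 x[OF i] by (intro mult_right_mono) auto
      moreover have "0 \<le> \<beta>\<^sup>2 * avg n x" using av by simp
      ultimately have "c * (1 / x i) \<le> 1 / x i + \<beta>\<^sup>2 * avg n x" by linarith
      then have "(c * (1 / x i)) * (v $ i)\<^sup>2 \<le> (1 / x i + \<beta>\<^sup>2 * avg n x) * (v $ i)\<^sup>2" by (rule mult_right_mono) simp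
      then show ?thesis by simp
    qed
    ultimately show ?thesis by (simp add: distrib_left)
  qed
  then show ?thesis unfolding pdc_def using Bm_symm[OF zrow_symm[OF A]] by blast
qed

text \<open>The Schur complement without block matrices. With \<open>z = S *\<^sub>v b\<close> and
  \<open>w\<close> the unit vector at \<open>i\<close> plus \<beta> times \<open>z\<close>, the
  original matrix maps \<open>w\<close> to \<open>p\<close> times that unit vector, so column
  \<open>i\<close> of \<open>R\<close> is \<open>w\<close> divided by \<open>p\<close>. Its entry at
  \<open>i\<close> gives the first identity, its squared length the second.\<close>

lemma cavity:
  fixes A
  assumes A: "symm n A" and B: "pdc n c x (Bm n \<beta> x A)" and i: "i < n"
  defines "R \<equiv> minv (Bm n \<beta> x A)" and "S \<equiv> minv (Bm n \<beta> x (zrow n i A))"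
  defines "a \<equiv> (\<lambda>j. if j = i then 0 else A $$ (i, j))"
  shows "R $$ (i, i) * (1 / x i + \<beta>\<^sup>2 * avg n x - \<beta> * A $$ (i, i) - \<beta>\<^sup>2 * (\<Sum>j<n. \<Sum>k<n. a j * a k * S $$ (j, k))) = 1"
    and "rsq n R i = (R $$ (i, i))\<^sup>2 * (1 + \<beta>\<^sup>2 * (\<Sum>j<n. \<Sum>k<n. a j * a k * (S * S) $$ (j, k)))"
proof -
  note cA = symm_carrier[OF A]
  note B' = pdc_zrow[OF A B i]
  have invR: "is_inv n (Bm n \<beta> x A) R" and symR: "symm n R" unfolding R_def using pdc_inv[OF B] by auto
  have invS: "is_inv n (Bm n \<beta> x (zrow n i A)) S" and symS: "symm n S" unfolding S_def using pdc_inv[OF B'] by auto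
  note dR = is_invD[OF invR] and dS = is_invD[OF invS]
  define h where "h = 1 / x i + \<beta>\<^sup>2 * avg n x"
  have h0: "h > 0" using x[OF i] avg_x(1) by (auto simp: h_def intro!: add_pos_nonneg mult_nonneg_nonneg)
  define b where "b = Matrix.vec n a"
  have b: "b \<in> carrier_vec n" "\<And>j. j < n \<Longrightarrow> b $ j = a j" by (auto simp: b_def)
  define z where "z = S *\<^sub>v b"
  have z: "z \<in> carrier_vec n" unfolding z_def by (rule mult_mat_vec_carrier[OF dS(2) b(1)])
  have Bz: "Bm n \<beta> x (zrow n i A) *\<^sub>v z = b" unfolding z_def using assoc_mult_mat_vec[OF dS(1,2) b(1)] dS(3) b(1) by simp
  have rowi: "(\<Sum>k<n. Bm n \<beta> x (zrow n i A) $$ (j, k) * v k) = (\<Sum>k<n. Bm n \<beta> x (zrow n i A) $$ (j, k) * v k)" for j and v :: "nat \<Rightarrow> real" ..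
  \<comment> \<open>At the decoupled index the matrix acts as multiplication by \<open>h\<close>,
    and \<open>b\<close> vanishes there.\<close>
  have zi: "z $ i = 0"
  proof -
    have "0 = b $ i" using b(2)[OF i] by (simp add: a_def)
    also have "\<dots> = (\<Sum>k<n. Bm n \<beta> x (zrow n i A) $$ (i, k) * z $ k)" unfolding Bz[symmetric] by (rule mat_vec_index[OF dS(1) z i])
    also have "\<dots> = (\<Sum>k<n. if k = i then h * z $ k else 0)"
      using i by (intro sum.cong refl) (auto simp: Bm_index[OF zrow_carrier] zrow_index h_def)
    also have "\<dots> = h * z $ i" using i by simp
    finally show ?thesis using h0 by simp
  qed
  define w where "w = Matrix.vec n (\<lambda>j. (if j = i then 1 else 0) + \<beta> * z $ j)"
  have w: "w \<in> carrier_vec n" "\<And>j. j < n \<Longrightarrow> w $ j = (if j = i then 1 else 0) + \<beta> * z $ j" by (auto simp: w_def)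
  have wi: "w $ i = 1" using w(2)[OF i] zi by simp
  define p where "p = h - \<beta> * A $$ (i, i) - \<beta>\<^sup>2 * (\<Sum>k<n. a k * z $ k)"
  have Bw: "Bm n \<beta> x A *\<^sub>v w = p \<cdot>\<^sub>v unit_vec n i"
  proof (rule eq_vecI)
    fix j assume "j < dim_vec (p \<cdot>\<^sub>v unit_vec n i)"
    then have j: "j < n" by simp
    have "(Bm n \<beta> x A *\<^sub>v w) $ j = (\<Sum>k<n. Bm n \<beta> x A $$ (j, k) * w $ k)" by (rule mat_vec_index[OF dR(1) w(1) j])
    also have "\<dots> = (\<Sum>k<n. Bm n \<beta> x (zrow n i A) $$ (j, k) * (if k = i then 1 else 0)) + \<beta> * (\<Sum>k<n. Bm n \<beta> x (zrow n i A) $$ (j, k) * z $ k)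
       - \<beta> * (\<Sum>k<n. (A $$ (j, k) - zrow n i A $$ (j, k)) * w $ k)"
      unfolding sum_distrib_left sum.distrib[symmetric] sum_subtractf[symmetric]
      using j by (intro sum.cong refl) (simp add: Bm_index[OF zrow_carrier] Bm_index[OF cA] w(2) algebra_simps)
    also have "(\<Sum>k<n. Bm n \<beta> x (zrow n i A) $$ (j, k) * (if k = i then 1 else 0)) = (if j = i then h else 0)"
      using i j by (simp add: if_distrib[of "\<lambda>t. _ * t"] Bm_index[OF zrow_carrier] zrow_index h_def cong: if_cong)
    also have "(\<Sum>k<n. Bm n \<beta> x (zrow n i A) $$ (j, k) * z $ k) = a j"
      unfolding mat_vec_index[OF dS(1) z j, symmetric] Bz using b(2)[OF j] .
    also have "(\<Sum>k<n. (A $$ (j, k) - zrow n i A $$ (j, k)) * w $ k) = (if j = i then A $$ (i, i) + \<beta> * (\<Sum>k<n. a k * z $ k) else a j)"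
    proof (cases "j = i")
      case True
      have "(\<Sum>k<n. (A $$ (j, k) - zrow n i A $$ (j, k)) * w $ k) = (\<Sum>k<n. (if k = i then A $$ (i, i) else 0) + \<beta> * (a k * z $ k))"
        using True i by (intro sum.cong refl) (auto simp: zrow_index w(2) a_def zi)
      then show ?thesis using True i by (simp add: sum.distrib sum_distrib_left)
    next
      case False
      have "(\<Sum>k<n. (A $$ (j, k) - zrow n i A $$ (j, k)) * w $ k) = (\<Sum>k<n. if k = i then A $$ (j, i) else 0)"
        using False i j by (intro sum.cong refl) (auto simp: zrow_index wi)
      also have "\<dots> = a j" using False i j A by (auto simp: a_def symm_def)
      finally show ?thesis using False by simp
    qed
    also have "(if j = i then h else 0) + \<beta> * a j - \<beta> * (if j = i then A $$ (i, i) + \<beta> * (\<Sum>k<n. a k * z $ k) else a j) = (p \<cdot>\<^sub>v unit_vec n i) $ j"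
      using i j by (auto simp: p_def a_def power2_eq_square algebra_simps)
    finally show "(Bm n \<beta> x A *\<^sub>v w) $ j = (p \<cdot>\<^sub>v unit_vec n i) $ j" .
  qed (use dR in auto)
  have wR: "w $ j = p * R $$ (j, i)" if j: "j < n" for j
  proof -
    have "w = R *\<^sub>v (Bm n \<beta> x A *\<^sub>v w)" using assoc_mult_mat_vec[OF dR(2,1) w(1)] dR(4) w(1) by simp
    also have "\<dots> = p \<cdot>\<^sub>v (R *\<^sub>v unit_vec n i)" unfolding Bw by (rule mult_mat_vec[OF dR(2)]) simp
    finally have "w $ j = (p \<cdot>\<^sub>v (R *\<^sub>v unit_vec n i)) $ j" by simp
    also have "\<dots> = p * R $$ (j, i)" using dR(2) i j by simp
    finally show ?thesis .
  qed
  have pR: "R $$ (i, i) * p = 1" using wR[OF i] wi by (simp add: mult.commute)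
  have az: "(\<Sum>k<n. a k * z $ k) = (\<Sum>j<n. \<Sum>k<n. a j * a k * S $$ (j, k))"
  proof -
    have "z $ j = (\<Sum>k<n. S $$ (j, k) * a k)" if "j < n" for j
      unfolding z_def mat_vec_index[OF dS(2) b(1) that] by (intro sum.cong refl) (simp add: b(2))
    then show ?thesis by (intro sum.cong refl) (simp add: sum_distrib_left ac_simps)
  qed
  show "R $$ (i, i) * (1 / x i + \<beta>\<^sup>2 * avg n x - \<beta> * A $$ (i, i) - \<beta>\<^sup>2 * (\<Sum>j<n. \<Sum>k<n. a j * a k * S $$ (j, k))) = 1"
    using pR unfolding p_def h_def az .
  have "z \<bullet> z = b \<bullet> (S *\<^sub>v z)"
    using transpose_vec_mult_scalar[OF dS(2) z b(1)] unfolding symm_transpose[OF symS] z_def[symmetric] .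
  also have "S *\<^sub>v z = (S * S) *\<^sub>v b" unfolding z_def using dS(2) b(1) by simp
  also have "b \<bullet> ((S * S) *\<^sub>v b) = (\<Sum>j<n. \<Sum>k<n. b $ j * b $ k * (S * S) $$ (j, k))" by (rule quad_sum[OF mult_carrier_mat[OF dS(2) dS(2)] b(1)])
  also have "\<dots> = (\<Sum>j<n. \<Sum>k<n. a j * a k * (S * S) $$ (j, k))" by (intro sum.cong refl) (simp add: b(2) del: index_mult_mat)
  finally have zz: "z \<bullet> z = (\<Sum>j<n. \<Sum>k<n. a j * a k * (S * S) $$ (j, k))" .
  have "p\<^sup>2 * rsq n R i = (\<Sum>j<n. (w $ j)\<^sup>2)"
    unfolding rsq_def sum_distrib_left using symR i by (intro sum.cong refl) (auto simp: wR symm_def power_mult_distrib)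
  also have "\<dots> = (\<Sum>j<n. (if j = i then 1 else 0) + \<beta>\<^sup>2 * (z $ j * z $ j))"
    by (intro sum.cong refl) (auto simp: w(2) zi power_mult_distrib power2_eq_square)
  also have "\<dots> = 1 + \<beta>\<^sup>2 * (z \<bullet> z)" unfolding scalar_prod_lessThan[OF z] using i by (simp add: sum.distrib sum_distrib_left)
  finally have "(R $$ (i, i))\<^sup>2 * (p\<^sup>2 * rsq n R i) = (R $$ (i, i))\<^sup>2 * (1 + \<beta>\<^sup>2 * (z \<bullet> z))" by simp
  moreover have "(R $$ (i, i))\<^sup>2 * p\<^sup>2 = 1" unfolding power_mult_distrib[symmetric] pR by simp
  ultimately show "rsq n R i = (R $$ (i, i))\<^sup>2 * (1 + \<beta>\<^sup>2 * (\<Sum>j<n. \<Sum>k<n. a j * a k * (S * S) $$ (j, k)))"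
    unfolding zz by (simp add: mult.assoc[symmetric])
qed

text \<open>The difference lives on row and column \<open>i\<close>. By cyclicity the trace pairs it
  with \<open>Q * P\<close>, which leaves two inner products of a row or column of \<open>A\<close>
  with a column or row of \<open>Q * P\<close>, each at most \<open>6 * p * q\<close>.\<close>

lemma trc_cross_le:
  assumes A: "op_bound n A 6" and P: "op_bound n P p" and Q: "op_bound n Q q" and i: "i < n"
  shows "\<bar>trc n (P * (A - zrow n i A) * Q)\<bar> \<le> 12 * p * q"
proof -
  define D where "D = A - zrow n i A"
  define G where "G = Q * P"
  note cA = op_boundD(1)[OF A] and cP = op_boundD(1)[OF P] and cQ = op_boundD(1)[OF Q]
  have cD: "D \<in> carrier_mat n n" using cA by (auto simp: D_def zrow_def)
  have G: "op_bound n G (q * p)" unfolding G_def by (rule op_bound_mult[OF Q P])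
  note cG = op_boundD(1)[OF G]
  have b0: "0 \<le> q * p" by (rule op_boundD(2)[OF G])
  have Di: "D $$ (k, l) = (if k = i \<or> l = i then A $$ (k, l) else 0)" if "k < n" "l < n" for k l
    using that cA by (auto simp: D_def zrow_def)
  have "trc n (P * D * Q) = trc n (P * (D * Q))" unfolding assoc_mult_mat[OF cP cD cQ] ..
  also have "\<dots> = trc n (D * Q * P)" by (rule trc_mult_comm[OF cP mult_carrier_mat[OF cD cQ]])
  also have "D * Q * P = D * G" unfolding G_def by (rule assoc_mult_mat[OF cD cQ cP])
  also have "trc n (D * G) = (\<Sum>k<n. \<Sum>l<n. D $$ (k, l) * G $$ (l, k))"
    unfolding trc_def by (intro sum.cong refl mat_mult_index cD cG) auto
  also have "\<dots> = (\<Sum>l<n. D $$ (i, l) * G $$ (l, i)) + (\<Sum>k\<in>{..<n} - {i}. \<Sum>l<n. D $$ (k, l) * G $$ (l, k))"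
    using i by (intro sum.remove) auto
  also have "(\<Sum>l<n. D $$ (i, l) * G $$ (l, i)) = row A i \<bullet> col G i"
    using i cA cG by (subst scalar_prod_lessThan[of _ n]) (auto simp: Di intro!: sum.cong)
  also have "(\<Sum>k\<in>{..<n} - {i}. \<Sum>l<n. D $$ (k, l) * G $$ (l, k)) = (\<Sum>k\<in>{..<n} - {i}. A $$ (k, i) * G $$ (i, k))"
  proof (intro sum.cong refl)
    fix k assume k: "k \<in> {..<n} - {i}"
    have "(\<Sum>l<n. D $$ (k, l) * G $$ (l, k)) = (\<Sum>l<n. if l = i then A $$ (k, i) * G $$ (i, k) else 0)"
      using k i by (intro sum.cong refl) (auto simp: Di)
    then show "(\<Sum>l<n. D $$ (k, l) * G $$ (l, k)) = A $$ (k, i) * G $$ (i, k)" using i by simp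
  qed
  finally have e: "trc n (P * D * Q) = row A i \<bullet> col G i + (\<Sum>k\<in>{..<n} - {i}. A $$ (k, i) * G $$ (i, k))" .
  have r: "row A i \<in> carrier_vec n" "col G i \<in> carrier_vec n" "col A i \<in> carrier_vec n" "row G i \<in> carrier_vec n" using cA cG by auto
  have rn: "vnorm (row A i) \<le> 6" "vnorm (row G i) \<le> q * p"
    using row_norm_le[OF A i] row_norm_le[OF G i] row_norm_eq[OF cA i] row_norm_eq[OF cG i] by auto
  have cn: "vnorm (col A i) \<le> 6" "vnorm (col G i) \<le> q * p" by (rule vnorm_col_le[OF A i], rule vnorm_col_le[OF G i])
  have 1: "\<bar>row A i \<bullet> col G i\<bar> \<le> 6 * (q * p)"
    using scalar_prod_le_vnorm[OF r(1,2)] mult_mono[OF rn(1) cn(2)] vnorm_nonneg[OF r(2)] by simp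
  have 2: "\<bar>\<Sum>k\<in>{..<n} - {i}. A $$ (k, i) * G $$ (i, k)\<bar> \<le> 6 * (q * p)"
  proof -
    have "\<bar>\<Sum>k\<in>{..<n} - {i}. A $$ (k, i) * G $$ (i, k)\<bar> \<le> (\<Sum>k\<in>{..<n} - {i}. \<bar>A $$ (k, i)\<bar> * \<bar>G $$ (i, k)\<bar>)"
      by (rule order_trans[OF sum_abs]) (simp only: abs_mult order_refl)
    also have "\<dots> \<le> (\<Sum>k<n. \<bar>A $$ (k, i)\<bar> * \<bar>G $$ (i, k)\<bar>)" by (intro sum_mono2) auto
    also have "\<dots> = (\<Sum>k<n. \<bar>col A i $ k\<bar> * \<bar>row G i $ k\<bar>)" using cA cG i by (intro sum.cong refl) auto
    also have "\<dots> \<le> vnorm (col A i) * vnorm (row G i)"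
      unfolding vnorm_eq[OF r(3)] vnorm_eq[OF r(4)] by (rule L2_set_mult_ineq)
    also have "\<dots> \<le> 6 * (q * p)" using cn(1) rn(2) vnorm_nonneg[OF r(4)] by (intro mult_mono) auto
    finally show ?thesis .
  qed
  have "\<bar>trc n (P * D * Q)\<bar> \<le> 6 * (q * p) + 6 * (q * p)" unfolding e using 1 2 by linarith
  then show ?thesis unfolding D_def by (simp add: ac_simps)
qed

lemma trc_diff: "M \<in> carrier_mat n n \<Longrightarrow> N \<in> carrier_mat n n \<Longrightarrow> trc n (M - N) = trc n M - trc n N"
  by (auto simp: trc_def sum_subtractf[symmetric] intro!: sum.cong)

lemma trc_smult: "M \<in> carrier_mat n n \<Longrightarrow> trc n (b \<cdot>\<^sub>m M) = b * trc n M"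
  by (auto simp: trc_def sum_distrib_left intro!: sum.cong)

text \<open>The resolvent identity writes \<open>R - S\<close> as \<beta> times a product with the
  cross-shaped difference in the middle; for the squares it is used twice. The last unit in 13 and
  in 25 pays for the omitted diagonal entry at \<open>i\<close>.\<close>

lemma cavity_traces:
  fixes A
  assumes A: "op_bound n A 6" "symm n A" and B: "pdc n c x (Bm n \<beta> x A)" and i: "i < n"
  defines "R \<equiv> minv (Bm n \<beta> x A)" and "S \<equiv> minv (Bm n \<beta> x (zrow n i A))"
  shows "\<bar>(\<Sum>j\<in>{..<n} - {i}. S $$ (j, j)) - (\<Sum>j<n. R $$ (j, j))\<bar> \<le> 13 / c\<^sup>2"
    and "\<bar>(\<Sum>j\<in>{..<n} - {i}. (S * S) $$ (j, j)) - (\<Sum>j<n. rsq n R j)\<bar> \<le> 25 / c ^ 3"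
proof -
  note cA = symm_carrier[OF A(2)]
  note B' = pdc_zrow[OF A(2) B i]
  have invR: "is_inv n (Bm n \<beta> x A) R" and oR: "op_bound n R (1 / c)" and symR: "symm n R" unfolding R_def using pdc_inv[OF B] by auto
  have invS: "is_inv n (Bm n \<beta> x (zrow n i A)) S" and oS: "op_bound n S (1 / c)" and symS: "symm n S" unfolding S_def using pdc_inv[OF B'] by auto
  note dR = is_invD[OF invR] and dS = is_invD[OF invS]
  define D where "D = A - zrow n i A"
  have cD: "D \<in> carrier_mat n n" unfolding D_def by (rule minus_carrier_mat[OF zrow_carrier])
  have BD: "Bm n \<beta> x (zrow n i A) - Bm n \<beta> x A = \<beta> \<cdot>\<^sub>m D"
    using cA zrow_carrier[of i A] Bm_carrier[OF cA, of \<beta> x] Bm_carrier[OF zrow_carrier, of \<beta> x i A] unfolding D_def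
    by (intro eq_matI) (auto simp: Bm_index algebra_simps)
  have RS: "R - S = \<beta> \<cdot>\<^sub>m (R * D * S)"
    unfolding inv_diff[OF invR invS] BD mult_smult_distrib[OF dR(2) cD]
    by (rule mult_smult_assoc_mat[OF mult_carrier_mat[OF dR(2) cD] dS(2)])
  have cc: "1 / c * (1 / c) = 1 / c\<^sup>2" "1 / c * (1 / c) * (1 / c) = 1 / c ^ 3" by (auto simp: power2_eq_square power3_eq_cube)
  have c21: "1 / c\<^sup>2 \<ge> 1 / c" "1 / c ^ 3 \<ge> 1 / c\<^sup>2"
    using c0 c1 by (auto simp: field_simps power2_eq_square power3_eq_cube)
  have t1: "\<bar>trc n R - trc n S\<bar> \<le> 12 / c\<^sup>2"
  proof -
    have "trc n R - trc n S = \<beta> * trc n (R * D * S)"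
      unfolding trc_diff[OF dR(2) dS(2), symmetric] RS
      by (rule trc_smult[OF mult_carrier_mat[OF mult_carrier_mat[OF dR(2) cD] dS(2)]])
    also have "\<bar>\<dots>\<bar> = \<beta> * \<bar>trc n (R * D * S)\<bar>" using \<beta>0 by (simp add: abs_mult)
    also have "\<dots> \<le> 1 * (12 * (1 / c) * (1 / c))" unfolding D_def using \<beta>0 \<beta>1 by (intro mult_mono trc_cross_le[OF A(1) oR oS i]) auto
    finally show ?thesis by (simp add: power2_eq_square)
  qed
  have Si: "0 \<le> S $$ (i, i)" "S $$ (i, i) \<le> 1 / c"
  proof -
    have "x i / c \<le> 1 / c" using x[OF i] c0 by (intro divide_right_mono) auto
    then show "0 \<le> S $$ (i, i)" "S $$ (i, i) \<le> 1 / c" using pdc_inv_diag[OF B' i] unfolding S_def[symmetric] by auto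
  qed
  have "(\<Sum>j\<in>{..<n} - {i}. S $$ (j, j)) = trc n S - S $$ (i, i)" unfolding trc_def using i by (simp add: sum_diff1)
  then show "\<bar>(\<Sum>j\<in>{..<n} - {i}. S $$ (j, j)) - (\<Sum>j<n. R $$ (j, j))\<bar> \<le> 13 / c\<^sup>2"
    using t1 Si c21(1) unfolding trc_def by (simp add: abs_le_iff)
  have t2: "\<bar>trc n (R * R) - trc n (S * S)\<bar> \<le> 24 / c ^ 3"
  proof -
    define U where "U = R * D * S"
    have cU: "U \<in> carrier_mat n n" unfolding U_def by (rule mult_carrier_mat[OF mult_carrier_mat[OF dR(2) cD] dS(2)])
    have RSU: "R - S = \<beta> \<cdot>\<^sub>m U" using RS by (simp add: U_def)
    have e1: "R * R - R * S = \<beta> \<cdot>\<^sub>m (R * U)" unfolding mult_minus_distrib_mat[OF dR(2) dR(2) dS(2), symmetric] RSU by (rule mult_smult_distrib[OF dR(2) cU])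
    have e2: "R * S - S * S = \<beta> \<cdot>\<^sub>m (U * S)" unfolding minus_mult_distrib_mat[OF dR(2) dS(2) dS(2), symmetric] RSU by (rule mult_smult_assoc_mat[OF cU dS(2)])
    have cRU: "R * U \<in> carrier_mat n n" "U * S \<in> carrier_mat n n" "R * R \<in> carrier_mat n n" "S * S \<in> carrier_mat n n" "R * S \<in> carrier_mat n n"
      using dR(2) dS(2) cU by auto
    have "trc n (R * R) - trc n (S * S) = trc n (R * R - R * S) + trc n (R * S - S * S)"
      unfolding trc_diff[OF cRU(3,5)] trc_diff[OF cRU(5,4)] by simp
    also have "\<dots> = \<beta> * (trc n (R * U) + trc n (U * S))" unfolding e1 e2 trc_smult[OF cRU(1)] trc_smult[OF cRU(2)] by (simp add: distrib_left)
    finally have e: "\<bar>trc n (R * R) - trc n (S * S)\<bar> = \<beta> * \<bar>trc n (R * U) + trc n (U * S)\<bar>" using \<beta>0 by (simp add: abs_mult)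
    have RU: "R * U = (R * R) * D * S" unfolding U_def
      using assoc_mult_mat[OF dR(2) mult_carrier_mat[OF dR(2) cD] dS(2)] assoc_mult_mat[OF dR(2) dR(2) cD] by simp
    have US: "U * S = R * D * (S * S)" unfolding U_def by (rule assoc_mult_mat[OF mult_carrier_mat[OF dR(2) cD] dS(2) dS(2)])
    have "\<bar>trc n (R * U)\<bar> \<le> 12 * (1 / c * (1 / c)) * (1 / c)" unfolding RU D_def by (rule trc_cross_le[OF A(1) op_bound_mult[OF oR oR] oS i])
    moreover have "\<bar>trc n (U * S)\<bar> \<le> 12 * (1 / c) * (1 / c * (1 / c))" unfolding US D_def by (rule trc_cross_le[OF A(1) oR op_bound_mult[OF oS oS] i])
    ultimately have "\<bar>trc n (R * U) + trc n (U * S)\<bar> \<le> 24 / c ^ 3" by (simp add: power3_eq_cube)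
    then have "\<beta> * \<bar>trc n (R * U) + trc n (U * S)\<bar> \<le> 1 * (24 / c ^ 3)" using \<beta>0 \<beta>1 by (intro mult_mono) auto
    then show ?thesis unfolding e by simp
  qed
  have SSi: "0 \<le> (S * S) $$ (i, i)" "(S * S) $$ (i, i) \<le> 1 / c\<^sup>2"
    unfolding symm_square_index[OF symS i] using rsq_nonneg rsq_le[OF oS i] by (auto simp: power_divide)
  have "(\<Sum>j\<in>{..<n} - {i}. (S * S) $$ (j, j)) = trc n (S * S) - (S * S) $$ (i, i)" unfolding trc_def using i by (simp add: sum_diff1 del: index_mult_mat)
  moreover have "trc n (R * R) = (\<Sum>j<n. rsq n R j)" unfolding trc_def by (intro sum.cong refl symm_square_index[OF symR]) auto
  moreover have "25 / c ^ 3 = 24 / c ^ 3 + 1 / c ^ 3" by (simp add: add_divide_distrib[symmetric])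
  ultimately show "\<bar>(\<Sum>j\<in>{..<n} - {i}. (S * S) $$ (j, j)) - (\<Sum>j<n. rsq n R j)\<bar> \<le> 25 / c ^ 3"
    using t2 SSi c21(2) by (simp add: abs_le_iff del: index_mult_mat)
qed

text \<open>Under the GOE, row \<open>i\<close> off the diagonal is independent of the decoupled
  matrix, so this is a quadratic form in that row minus its conditional mean. \<open>Fdev\<close> is
  the analogue for the squared inverse.\<close>

definition Edev :: "real mat \<Rightarrow> nat \<Rightarrow> real" where
  "Edev A i = (\<Sum>j\<in>{..<n} - {i}. \<Sum>k\<in>{..<n} - {i}. minv (Bm n \<beta> x (zrow n i A)) $$ (j, k) * (A $$ (i, j) * A $$ (i, k)))
     - (\<Sum>j\<in>{..<n} - {i}. minv (Bm n \<beta> x (zrow n i A)) $$ (j, j)) / n"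

definition Fdev :: "real mat \<Rightarrow> nat \<Rightarrow> real" where
  "Fdev A i = (\<Sum>j\<in>{..<n} - {i}. \<Sum>k\<in>{..<n} - {i}. (minv (Bm n \<beta> x (zrow n i A)) * minv (Bm n \<beta> x (zrow n i A))) $$ (j, k) * (A $$ (i, j) * A $$ (i, k)))
     - (\<Sum>j\<in>{..<n} - {i}. (minv (Bm n \<beta> x (zrow n i A)) * minv (Bm n \<beta> x (zrow n i A))) $$ (j, j)) / n"

lemma double_sum_remove:
  fixes f :: "nat \<Rightarrow> nat \<Rightarrow> real"
  assumes "i < n" "\<And>j. f i j = 0" "\<And>j. f j i = 0"
  shows "(\<Sum>j<n. \<Sum>k<n. f j k) = (\<Sum>j\<in>{..<n} - {i}. \<Sum>k\<in>{..<n} - {i}. f j k)"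
proof -
  have "(\<Sum>j<n. \<Sum>k<n. f j k) = (\<Sum>j\<in>{..<n} - {i}. \<Sum>k<n. f j k)" by (rule sum.mono_neutral_right) (use assms in auto)
  also have "\<dots> = (\<Sum>j\<in>{..<n} - {i}. \<Sum>k\<in>{..<n} - {i}. f j k)"
    by (intro sum.cong refl sum.mono_neutral_right) (use assms in auto)
  finally show ?thesis .
qed

text \<open>Replacing each cavity trace by the full trace turns the cavity equations into the
  hypotheses of \<open>self_consistent_law\<close>, with errors whose \<open>L2_set\<close> norms
  are of order \<open>\<beta> / c\<close> and \<open>\<beta> / c\<^sup>2\<close>. The three bounds
  with 32 are what Markov's inequality will supply, as 16 times a mean of size 2.\<close>

lemma fixed_law:
  fixes A
  assumes A: "op_bound n A 6" "symm n A" and B: "pdc n c x (Bm n \<beta> x A)"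
    and c\<beta>: "2 * c = (1 - \<beta>)\<^sup>2"
    and E: "(\<Sum>i<n. (Edev A i)\<^sup>2) \<le> 32 / c\<^sup>2" and F: "(\<Sum>i<n. (Fdev A i)\<^sup>2) \<le> 32 / c ^ 4"
    and G: "(\<Sum>i<n. (A $$ (i, i))\<^sup>2) \<le> 32" and large: "400 / c ^ 4 \<le> sqrt n"
  shows "L2_set (\<lambda>i. Zd n \<beta> x A i - tlim n \<beta> x) {..<n} \<le> 150 * \<beta> / c ^ 4"
proof -
  define R where "R = minv (Bm n \<beta> x A)"
  define g where "g = 1 - \<beta>"
  have g: "0 < g" "g \<le> 1" "g\<^sup>2 = 2 * c" using \<beta>0 \<beta>1 c\<beta> by (auto simp: g_def)
  have s: "sqrt n > 0" "sqrt n * sqrt n = n" using n0 by auto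
  define S where "S i = minv (Bm n \<beta> x (zrow n i A))" for i
  define Ri where "Ri i = R $$ (i, i)" for i
  define Ti where "Ti i = rsq n R i" for i
  define az where "az i = (\<Sum>j\<in>{..<n} - {i}. \<Sum>k\<in>{..<n} - {i}. S i $$ (j, k) * (A $$ (i, j) * A $$ (i, k)))" for i
  define zz where "zz i = (\<Sum>j\<in>{..<n} - {i}. \<Sum>k\<in>{..<n} - {i}. (S i * S i) $$ (j, k) * (A $$ (i, j) * A $$ (i, k)))" for i
  define e where "e i = \<beta>\<^sup>2 * (az i - avg n Ri) + \<beta> * A $$ (i, i)" for i
  define f where "f i = \<beta>\<^sup>2 * (zz i - avg n Ti)" for i
  have Rb: "0 < Ri i \<and> Ri i \<le> x i / c" if "i < n" for i using pdc_inv_diag[OF B that] by (simp add: Ri_def R_def)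
  have rem: "(\<Sum>j<n. \<Sum>k<n. (if j = i then 0 else A $$ (i, j)) * (if k = i then 0 else A $$ (i, k)) * M $$ (j, k))
     = (\<Sum>j\<in>{..<n} - {i}. \<Sum>k\<in>{..<n} - {i}. M $$ (j, k) * (A $$ (i, j) * A $$ (i, k)))" if i: "i < n" for i M
    by (subst double_sum_remove[OF i]) (auto intro!: sum.cong)
  have cav: "Ri i * (1 / x i + \<beta>\<^sup>2 * avg n x - \<beta> * A $$ (i, i) - \<beta>\<^sup>2 * az i) = 1" "Ti i = (Ri i)\<^sup>2 * (1 + \<beta>\<^sup>2 * zz i)" if i: "i < n" for i
    using cavity[OF A(2) B i] unfolding rem[OF i] R_def[symmetric] S_def[symmetric] az_def[symmetric] zz_def[symmetric] Ri_def[symmetric] Ti_def[symmetric] by auto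
  have eqR: "Ri i * (1 / x i - \<beta>\<^sup>2 * (avg n Ri - avg n x) - e i) = 1" if i: "i < n" for i
    using cav(1)[OF i] by (simp add: e_def algebra_simps)
  have eqT: "Ti i = (Ri i)\<^sup>2 * (1 + \<beta>\<^sup>2 * avg n Ti + f i)" if i: "i < n" for i
    using cav(2)[OF i] by (simp add: f_def algebra_simps)
  have b2: "\<beta>\<^sup>2 \<le> \<beta>" "0 \<le> \<beta>\<^sup>2" using \<beta>0 \<beta>1 by (auto simp: power2_eq_square mult_left_le_one_le)
  have cp: "0 < c" "c \<le> 1" using c0 c1 by auto
  have c4: "c ^ 4 \<le> c\<^sup>2" "c ^ 4 \<le> c ^ 3" "c ^ 4 \<le> c" "c ^ 4 \<le> 1" "c\<^sup>2 \<le> c" "0 < c ^ 4" "c ^ 3 \<le> c\<^sup>2"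
    using cp power_decreasing[of 2 4 c] power_decreasing[of 3 4 c] power_decreasing[of 1 4 c] power_decreasing[of 0 4 c] power_decreasing[of 1 2 c] power_decreasing[of 2 3 c] by auto
  have s4: "400 \<le> c ^ 4 * sqrt n" using large c4(6) by (simp add: pos_divide_le_eq mult.commute)
  have eb: "\<bar>e i\<bar> \<le> \<beta> * (\<bar>Edev A i\<bar> + (13 / (c\<^sup>2 * n) + \<bar>A $$ (i, i)\<bar>))" if i: "i < n" for i
  proof -
    define dev where "dev = ((\<Sum>j\<in>{..<n} - {i}. S i $$ (j, j)) - (\<Sum>j<n. R $$ (j, j))) / n"
    have "\<bar>dev\<bar> \<le> 13 / c\<^sup>2 / n" unfolding dev_def abs_divide using divide_right_mono[OF cavity_traces(1)[OF A B i], of "real n"] unfolding S_def R_def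
      by simp
    then have dv: "\<bar>dev\<bar> \<le> 13 / (c\<^sup>2 * n)" by simp
    have "az i - avg n Ri = Edev A i + dev"
      by (simp add: az_def S_def Edev_def dev_def avg_def Ri_def diff_divide_distrib)
    then have "\<bar>e i\<bar> \<le> \<beta>\<^sup>2 * \<bar>Edev A i + dev\<bar> + \<beta> * \<bar>A $$ (i, i)\<bar>"
      unfolding e_def using \<beta>0 by (intro order_trans[OF abs_triangle_ineq]) (simp add: abs_mult)
    also have "\<dots> \<le> \<beta> * (\<bar>Edev A i\<bar> + 13 / (c\<^sup>2 * n)) + \<beta> * \<bar>A $$ (i, i)\<bar>"
      using b2 \<beta>0 dv by (intro add_right_mono mult_mono) auto
    finally show ?thesis by (simp add: distrib_left)
  qed
  have fb: "\<bar>f i\<bar> \<le> \<beta> * (\<bar>Fdev A i\<bar> + 25 / (c ^ 3 * n))" if i: "i < n" for i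
  proof -
    define dev where "dev = ((\<Sum>j\<in>{..<n} - {i}. (S i * S i) $$ (j, j)) - (\<Sum>j<n. rsq n R j)) / n"
    have "\<bar>dev\<bar> \<le> 25 / c ^ 3 / n" unfolding dev_def abs_divide using divide_right_mono[OF cavity_traces(2)[OF A B i], of "real n"] unfolding S_def R_def
      by simp
    then have dv: "\<bar>dev\<bar> \<le> 25 / (c ^ 3 * n)" by simp
    have "zz i - avg n Ti = Fdev A i + dev"
      by (simp add: zz_def S_def Fdev_def dev_def avg_def Ti_def diff_divide_distrib)
    then have "\<bar>f i\<bar> = \<beta>\<^sup>2 * \<bar>Fdev A i + dev\<bar>" by (simp add: f_def abs_mult)
    also have "\<dots> \<le> \<beta> * (\<bar>Fdev A i\<bar> + 25 / (c ^ 3 * n))" using b2 \<beta>0 dv by (intro mult_mono) auto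
    finally show ?thesis .
  qed
  have LE: "L2_set (Edev A) {..<n} \<le> 6 / c"
  proof -
    have "sqrt (\<Sum>i<n. (Edev A i)\<^sup>2) \<le> sqrt ((6 / c)\<^sup>2)"
      by (intro real_sqrt_le_mono order_trans[OF E]) (use cp in \<open>simp add: power_divide divide_right_mono\<close>)
    then show ?thesis using cp by (simp add: L2_set_def)
  qed
  have LF: "L2_set (Fdev A) {..<n} \<le> 6 / c\<^sup>2"
  proof -
    have "sqrt (\<Sum>i<n. (Fdev A i)\<^sup>2) \<le> sqrt ((6 / c\<^sup>2)\<^sup>2)"
      by (intro real_sqrt_le_mono order_trans[OF F]) (use cp in \<open>simp add: power_divide divide_right_mono power_mult[symmetric]\<close>)
    then show ?thesis using cp by (simp add: L2_set_def)
  qed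
  have LG: "L2_set (\<lambda>i. A $$ (i, i)) {..<n} \<le> 6 / c"
  proof -
    have "sqrt (\<Sum>i<n. (A $$ (i, i))\<^sup>2) \<le> sqrt (6\<^sup>2)" using G by (intro real_sqrt_le_mono) auto
    moreover have "6 \<le> 6 / c" using cp by (simp add: field_simps)
    ultimately show ?thesis by (simp add: L2_set_def)
  qed
  have L13: "L2_set (\<lambda>i. 13 / (c\<^sup>2 * n)) {..<n} \<le> 1 / c"
  proof -
    have "L2_set (\<lambda>i. 13 / (c\<^sup>2 * n)) {..<n} = 13 / (c\<^sup>2 * n) * sqrt n" using cp by (simp add: L2_set_one)
    also have "\<dots> = 13 / c\<^sup>2 * (sqrt n / n)" by simp
    also have "\<dots> = 13 / (c\<^sup>2 * sqrt n)" by (simp add: sqrt_divide_self_eq inverse_eq_divide)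
    also have "\<dots> \<le> 1 / c"
    proof -
      have "c ^ 4 * sqrt n \<le> c * sqrt n" using c4 s by (intro mult_right_mono) auto
      then have "13 \<le> c * sqrt n" using s4 by linarith
      then have "13 * c \<le> c * sqrt n * c" using cp by (intro mult_right_mono) auto
      then show ?thesis using cp s by (simp add: divide_le_eq pos_le_divide_eq power2_eq_square field_simps)
    qed
    finally show ?thesis .
  qed
  have L25: "L2_set (\<lambda>i. 25 / (c ^ 3 * n)) {..<n} \<le> 1 / c\<^sup>2"
  proof -
    have "L2_set (\<lambda>i. 25 / (c ^ 3 * n)) {..<n} = 25 / (c ^ 3 * n) * sqrt n" using cp by (simp add: L2_set_one)
    also have "\<dots> = 25 / c ^ 3 * (sqrt n / n)" by simp
    also have "\<dots> = 25 / (c ^ 3 * sqrt n)" by (simp add: sqrt_divide_self_eq inverse_eq_divide)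
    also have "\<dots> \<le> 1 / c\<^sup>2"
    proof -
      have "c ^ 4 * sqrt n \<le> c * sqrt n" using c4 s by (intro mult_right_mono) auto
      then have "25 \<le> c * sqrt n" using s4 by linarith
      then have "25 * c\<^sup>2 \<le> c * sqrt n * c\<^sup>2" using cp by (intro mult_right_mono) auto
      then show ?thesis using cp s by (simp add: divide_le_eq pos_le_divide_eq power2_eq_square power3_eq_cube field_simps)
    qed
    finally show ?thesis .
  qed
  define Ee where "Ee = 13 * \<beta> / c"
  define Ef where "Ef = 7 * \<beta> / c\<^sup>2"
  have Ee: "L2_set e {..<n} \<le> Ee"
  proof -
    have "L2_set e {..<n} \<le> L2_set (\<lambda>i. \<beta> * (\<bar>Edev A i\<bar> + (13 / (c\<^sup>2 * n) + \<bar>A $$ (i, i)\<bar>))) {..<n}" using eb by (intro L2_set_abs_le) auto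
    also have "\<dots> = \<beta> * L2_set (\<lambda>i. \<bar>Edev A i\<bar> + (13 / (c\<^sup>2 * n) + \<bar>A $$ (i, i)\<bar>)) {..<n}" by (rule L2_set_right_distrib[symmetric]) (use \<beta>0 in auto)
    also have "\<dots> \<le> \<beta> * (L2_set (\<lambda>i. \<bar>Edev A i\<bar>) {..<n} + (L2_set (\<lambda>i. 13 / (c\<^sup>2 * n)) {..<n} + L2_set (\<lambda>i. \<bar>A $$ (i, i)\<bar>) {..<n}))"
      using \<beta>0 by (intro mult_left_mono order_trans[OF L2_set_triangle_ineq] add_left_mono L2_set_triangle_ineq) auto
    also have "\<dots> \<le> \<beta> * (6 / c + (1 / c + 6 / c))" unfolding L2_set_abs using \<beta>0 LE L13 LG by (intro mult_left_mono add_mono) auto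
    finally show ?thesis by (simp add: Ee_def add_divide_distrib[symmetric] mult.commute)
  qed
  have Ef: "L2_set f {..<n} \<le> Ef"
  proof -
    have "L2_set f {..<n} \<le> L2_set (\<lambda>i. \<beta> * (\<bar>Fdev A i\<bar> + 25 / (c ^ 3 * n))) {..<n}" using fb by (intro L2_set_abs_le) auto
    also have "\<dots> = \<beta> * L2_set (\<lambda>i. \<bar>Fdev A i\<bar> + 25 / (c ^ 3 * n)) {..<n}" by (rule L2_set_right_distrib[symmetric]) (use \<beta>0 in auto)
    also have "\<dots> \<le> \<beta> * (L2_set (\<lambda>i. \<bar>Fdev A i\<bar>) {..<n} + L2_set (\<lambda>i. 25 / (c ^ 3 * n)) {..<n})"
      using \<beta>0 by (intro mult_left_mono L2_set_triangle_ineq) auto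
    also have "\<dots> \<le> \<beta> * (6 / c\<^sup>2 + 1 / c\<^sup>2)" unfolding L2_set_abs using \<beta>0 LF L25 by (intro mult_left_mono add_mono) auto
    finally show ?thesis by (simp add: Ef_def add_divide_distrib[symmetric] mult.commute)
  qed
  define E\<rho> where "E\<rho> = 2 * Ee / (c * (1 - \<beta>))"
  have E\<rho>e: "E\<rho> = 26 * \<beta> / (c\<^sup>2 * g)" by (simp add: E\<rho>_def Ee_def g_def power2_eq_square)
  \<comment> \<open>From \<open>g\<^sup>2 = 2 * c\<close> and \<open>g \<le> 1\<close> follows
    \<open>2 * c \<le> g\<close>, so every \<open>1 / g\<close> can be traded for half of
    \<open>1 / c\<close>.\<close>
  have gg: "1 / g \<le> 1 / c / 2"
  proof -
    have "2 * c \<le> g" using g by (simp add: power2_eq_square flip: g(3)) 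
    then show ?thesis using g cp by (simp add: field_simps)
  qed
  have E\<rho>le: "E\<rho> \<le> 13 * \<beta> / c ^ 3"
  proof -
    have "26 * \<beta> / c\<^sup>2 * (1 / g) \<le> 26 * \<beta> / c\<^sup>2 * (1 / c / 2)" using gg \<beta>0 by (intro mult_left_mono) auto
    then show ?thesis unfolding E\<rho>e by (simp add: power2_eq_square power3_eq_cube)
  qed
  have small: "13 * \<beta> / c ^ 3 \<le> 13 / c ^ 3" using \<beta>1 \<beta>0 cp by (intro divide_right_mono) auto
  have "L2_set (\<lambda>i. Ti i / (x i)\<^sup>2 - tlim n \<beta> x) {..<n}
    \<le> 6 / (c * (1 - \<beta>)) * E\<rho> + Ef / c\<^sup>2 + (Ef / c + 9 * E\<rho> / (1 - \<beta>)) / (1 - \<beta>)"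
  proof (rule self_consistent_law[OF n0 \<beta>0 \<beta>1 cp x Rb _ eqR eqT Ee Ef E\<rho>_def])
    show "0 \<le> Ti i" for i by (simp add: Ti_def rsq_nonneg)
    have "14 / c\<^sup>2 \<le> c\<^sup>2 * sqrt n"
    proof -
      have "14 \<le> (c\<^sup>2 * sqrt n) * c\<^sup>2" using s4 by (simp add: power2_eq_square power4_eq_xxxx ac_simps)
      then show ?thesis using cp by (simp add: pos_divide_le_eq)
    qed
    moreover have "2 * Ef \<le> 14 / c\<^sup>2" unfolding Ef_def using \<beta>1 cp by (simp add: divide_right_mono)
    ultimately show "2 * Ef \<le> c\<^sup>2 * sqrt n" by linarith
    have "78 / c ^ 3 \<le> c * sqrt n"
    proof -
      have "78 \<le> (c * sqrt n) * c ^ 3" using s4 by (simp add: power3_eq_cube power4_eq_xxxx ac_simps)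
      then show ?thesis using cp by (simp add: pos_divide_le_eq)
    qed
    then have k: "6 * E\<rho> \<le> c * sqrt n" using E\<rho>le small by linarith
    have E\<rho>0: "0 \<le> E\<rho>" unfolding E\<rho>e using \<beta>0 g by simp
    have "c * sqrt n \<le> 1 * sqrt n" using cp by (intro mult_right_mono) auto
    then show "E\<rho> \<le> sqrt n" using k E\<rho>0 by linarith
    have "c \<le> g" using gg g cp by (simp add: field_simps)
    then have "c * sqrt n \<le> g * sqrt n" by (intro mult_right_mono) auto
    then show "6 * E\<rho> \<le> (1 - \<beta>) * sqrt n" using k by (simp add: g_def)
  qed
  also have "\<dots> = 156 * \<beta> / (c ^ 3 * g\<^sup>2) + 7 * \<beta> / c ^ 4 + 7 * \<beta> / (c ^ 3 * g) + 234 * \<beta> / (c\<^sup>2 * (g\<^sup>2 * g))"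
    unfolding E\<rho>e Ef_def g_def[symmetric] using g cp
    by (simp add: power2_eq_square power3_eq_cube power4_eq_xxxx field_simps)
  \<comment> \<open>The four terms are rounded so that the coefficients 78, 7, 4 and 61 add up to
    150.\<close>
  also have "\<dots> \<le> 78 * \<beta> / c ^ 4 + 7 * \<beta> / c ^ 4 + 4 * \<beta> / c ^ 4 + 61 * \<beta> / c ^ 4"
  proof (intro add_mono)
    show "156 * \<beta> / (c ^ 3 * g\<^sup>2) \<le> 78 * \<beta> / c ^ 4" unfolding g(3) using cp by (simp add: power3_eq_cube power4_eq_xxxx)
    have "7 * \<beta> / c ^ 3 * (1 / g) \<le> 7 * \<beta> / c ^ 3 * (1 / c / 2)" using gg \<beta>0 cp by (intro mult_left_mono) auto
    also have "\<dots> \<le> 4 * \<beta> / c ^ 4" using \<beta>0 cp by (simp add: power3_eq_cube power4_eq_xxxx field_simps)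
    finally show "7 * \<beta> / (c ^ 3 * g) \<le> 4 * \<beta> / c ^ 4" by simp
    have "234 * \<beta> / (c\<^sup>2 * (g\<^sup>2 * g)) = 117 * \<beta> / c ^ 3 * (1 / g)" unfolding g(3) using cp by (simp add: power2_eq_square power3_eq_cube)
    also have "\<dots> \<le> 117 * \<beta> / c ^ 3 * (1 / c / 2)" using gg \<beta>0 cp by (intro mult_left_mono) auto
    also have "\<dots> \<le> 61 * \<beta> / c ^ 4" using \<beta>0 cp by (simp add: power3_eq_cube power4_eq_xxxx field_simps)
    finally show "234 * \<beta> / (c\<^sup>2 * (g\<^sup>2 * g)) \<le> 61 * \<beta> / c ^ 4" .
  qed auto
  also have "\<dots> = 150 * \<beta> / c ^ 4" by (simp add: add_divide_distrib[symmetric])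
  finally have fin: "L2_set (\<lambda>i. Ti i / (x i)\<^sup>2 - tlim n \<beta> x) {..<n} \<le> 150 * \<beta> / c ^ 4" .
  have "L2_set (\<lambda>i. Zd n \<beta> x A i - tlim n \<beta> x) {..<n} = L2_set (\<lambda>i. Ti i / (x i)\<^sup>2 - tlim n \<beta> x) {..<n}"
    by (intro L2_set_cong refl) (simp add: pdc_good(2)[OF A B] Ti_def R_def)
  then show ?thesis using fin by simp
qed

end

section \<open>The law for a fixed profile\<close>

lemma borel_measurable_det:
  assumes M: "\<And>\<xi>. M \<xi> \<in> carrier_mat m m" and e: "\<And>i j. i < m \<Longrightarrow> j < m \<Longrightarrow> (\<lambda>\<xi>. M \<xi> $$ (i, j) :: real) \<in> borel_measurable P"
  shows "(\<lambda>\<xi>. Determinant.det (M \<xi>)) \<in> borel_measurable P"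
proof -
  have "(\<lambda>\<xi>. \<Sum>p\<in>{p. p permutes {0..<m}}. signof p * (\<Prod>i = 0..<m. M \<xi> $$ (i, p i))) \<in> borel_measurable P"
  proof (intro borel_measurable_sum borel_measurable_times borel_measurable_const borel_measurable_prod)
    fix p i assume "p \<in> {p. p permutes {0..<m}}" "i \<in> {0..<m}"
    then have "p i < m" "i < m" using permutes_in_image[of p "{0..<m}" i] by auto
    then show "(\<lambda>\<xi>. M \<xi> $$ (i, p i)) \<in> borel_measurable P" using e by blast
  qed
  then show ?thesis unfolding det_def'[OF M] .
qed

lemma borel_measurable_minv:
  assumes M: "\<And>\<xi>. M \<xi> \<in> carrier_mat m m" and e: "\<And>i j. i < m \<Longrightarrow> j < m \<Longrightarrow> (\<lambda>\<xi>. M \<xi> $$ (i, j) :: real) \<in> borel_measurable P"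
    and ij: "i < m" "j < m"
  shows "(\<lambda>\<xi>. minv (M \<xi>) $$ (i, j)) \<in> borel_measurable P"
proof -
  have c: "mat_delete (M \<xi>) j i \<in> carrier_mat (m - 1) (m - 1)" for \<xi> using mat_delete_carrier[OF M[of \<xi>]] .
  have d: "(\<lambda>\<xi>. mat_delete (M \<xi>) j i $$ (k, l)) \<in> borel_measurable P" if kl: "k < m - 1" "l < m - 1" for k l
  proof -
    have "mat_delete (M \<xi>) j i $$ (k, l) = M \<xi> $$ (if k < j then k else Suc k, if l < i then l else Suc l)" for \<xi>
      using kl M[of \<xi>] by (simp add: mat_delete_def)
    moreover have "(\<lambda>\<xi>. M \<xi> $$ (if k < j then k else Suc k, if l < i then l else Suc l)) \<in> borel_measurable P"
      using kl by (intro e) auto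
    ultimately show ?thesis by simp
  qed
  have "minv (M \<xi>) $$ (i, j) = (1 / Determinant.det (M \<xi>)) * ((-1) ^ (j + i) * Determinant.det (mat_delete (M \<xi>) j i))" for \<xi>
    using M[of \<xi>] ij by (simp add: minv_def adj_mat_def cofactor_def)
  moreover have "(\<lambda>\<xi>. (1 / Determinant.det (M \<xi>)) * ((-1) ^ (j + i) * Determinant.det (mat_delete (M \<xi>) j i))) \<in> borel_measurable P"
    by (intro borel_measurable_times borel_measurable_divide borel_measurable_const borel_measurable_det[OF M e] borel_measurable_det[OF c d])
  ultimately show ?thesis by simp
qed

text \<open>Polarisation. Let \<open>u\<close> be the multiple of \<open>A *\<^sub>v v\<close> with
  the length of \<open>v\<close>. By symmetry the forms at \<open>u + v\<close> and
  \<open>u - v\<close> differ by \<open>4 * (u \<bullet> w)\<close>, and the parallelogram law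
  bounds that difference.\<close>

lemma op_bound_of_quadratic_form:
  assumes A: "symm n A" and b: "0 \<le> b" and q: "\<And>v. v \<in> carrier_vec n \<Longrightarrow> \<bar>v \<bullet> (A *\<^sub>v v)\<bar> \<le> b * (v \<bullet> v)"
  shows "op_bound n A b"
proof (rule op_boundI[OF symm_carrier[OF A] b])
  note cA = symm_carrier[OF A]
  fix v :: "real vec" assume v: "v \<in> carrier_vec n"
  define w where "w = A *\<^sub>v v"
  have w: "w \<in> carrier_vec n" unfolding w_def by (rule mult_mat_vec_carrier[OF cA v])
  have nv: "0 \<le> vnorm v" by (rule vnorm_nonneg[OF v])
  show "vnorm (A *\<^sub>v v) \<le> b * vnorm v"
  proof (cases "vnorm w = 0")
    case True
    then show ?thesis using b nv unfolding w_def by simp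
  next
    case False
    then have wp: "vnorm w > 0" using vnorm_nonneg[OF w] by simp
    define k where "k = vnorm v / vnorm w"
    define u where "u = k \<cdot>\<^sub>v w"
    have u: "u \<in> carrier_vec n" using w by (simp add: u_def)
    have uu: "u \<bullet> u = v \<bullet> v"
    proof -
      have "vnorm u = vnorm v" unfolding u_def vnorm_smult[OF w] k_def using wp nv by simp
      then show ?thesis using vnorm_sq[OF u] vnorm_sq[OF v] by simp
    qed
    have uw: "u \<bullet> w = vnorm v * vnorm w"
    proof -
      have "u \<bullet> w = k * (w \<bullet> w)" unfolding u_def using w by simp
      also have "w \<bullet> w = vnorm w * vnorm w" using vnorm_sq[OF w] by (simp add: power2_eq_square)
      finally show ?thesis unfolding k_def using wp by simp
    qed
    have Au: "A *\<^sub>v u \<in> carrier_vec n" by (rule mult_mat_vec_carrier[OF cA u])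
    have sym: "v \<bullet> (A *\<^sub>v u) = u \<bullet> w"
    proof -
      have "v \<bullet> (A *\<^sub>v u) = (A *\<^sub>v v) \<bullet> u" using transpose_vec_mult_scalar[OF cA u v] symm_transpose[OF A] by simp
      also have "\<dots> = u \<bullet> w" unfolding w_def[symmetric] by (rule comm_scalar_prod[OF w u])
      finally show ?thesis .
    qed
    have vAv: "v \<bullet> (A *\<^sub>v v) = v \<bullet> w" by (simp add: w_def)
    have p: "(u + v) \<bullet> (A *\<^sub>v (u + v)) = u \<bullet> (A *\<^sub>v u) + 2 * (u \<bullet> w) + v \<bullet> w"
    proof -
      have "A *\<^sub>v (u + v) = A *\<^sub>v u + w" unfolding w_def by (rule mult_add_distrib_mat_vec[OF cA u v])
      then show ?thesis using u v w Au sym by (simp add: add_scalar_prod_distrib[of _ n] scalar_prod_add_distrib[of _ n])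
    qed
    have m: "(u - v) \<bullet> (A *\<^sub>v (u - v)) = u \<bullet> (A *\<^sub>v u) - 2 * (u \<bullet> w) + v \<bullet> w"
    proof -
      have "A *\<^sub>v (u - v) = A *\<^sub>v u - w" unfolding w_def by (rule mult_minus_distrib_mat_vec[OF cA u v])
      then show ?thesis using u v w Au sym by (simp add: minus_scalar_prod_distrib[of _ n] scalar_prod_minus_distrib[of _ n])
    qed
    have pu: "(u + v) \<bullet> (u + v) = 2 * (v \<bullet> v) + 2 * (u \<bullet> v)"
      using u v uu comm_scalar_prod[OF v u] by (simp add: add_scalar_prod_distrib[of _ n] scalar_prod_add_distrib[of _ n])
    have mu: "(u - v) \<bullet> (u - v) = 2 * (v \<bullet> v) - 2 * (u \<bullet> v)"
      using u v uu comm_scalar_prod[OF v u] by (simp add: minus_scalar_prod_distrib[of _ n] scalar_prod_minus_distrib[of _ n])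
    have "\<bar>(u + v) \<bullet> (A *\<^sub>v (u + v))\<bar> \<le> b * ((u + v) \<bullet> (u + v))" "\<bar>(u - v) \<bullet> (A *\<^sub>v (u - v))\<bar> \<le> b * ((u - v) \<bullet> (u - v))"
      using u v by (auto intro!: q)
    then have "4 * (u \<bullet> w) \<le> b * ((u + v) \<bullet> (u + v)) + b * ((u - v) \<bullet> (u - v))" unfolding p m by linarith
    also have "\<dots> = 4 * (b * (v \<bullet> v))" unfolding pu mu by (simp add: algebra_simps)
    finally have "vnorm v * vnorm w \<le> b * (vnorm v * vnorm v)" unfolding uw vnorm_sq[OF v, symmetric] power2_eq_square by simp
    then have le: "vnorm v * vnorm w \<le> vnorm v * (b * vnorm v)" by (simp add: ac_simps)
    show ?thesis
    proof (cases "vnorm v = 0")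
      case True
      have "v = 0\<^sub>v n" by (rule vnorm_eq_0[OF v True])
      then have "w = 0\<^sub>v n" unfolding w_def using cA by (intro eq_vecI) auto
      then show ?thesis using False vnorm_zero by simp
    next
      case False
      then show ?thesis using le nv unfolding w_def[symmetric] by simp
    qed
  qed
qed

context goe
begin

abbreviation amat :: "(nat \<times> nat \<Rightarrow> real) \<Rightarrow> real mat" where "amat \<equiv> sym_mat_of n"

lemma amat_index: "i < n \<Longrightarrow> j < n \<Longrightarrow> amat \<xi> $$ (i, j) = ent \<xi> i j"
  by (simp add: sym_mat_of_def ent_def)

lemma amat_carrier [simp]: "amat \<xi> \<in> carrier_mat n n" by (simp add: sym_mat_of_def)

lemma ent_sym: "ent \<xi> i j = ent \<xi> j i" by (simp add: ent_def min.commute max.commute)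

lemma amat_symm: "symm n (amat \<xi>)"
  by (auto simp: symm_def amat_index ent_sym)

lemma ent_measurable [measurable]: "i < n \<Longrightarrow> j < n \<Longrightarrow> (\<lambda>\<xi>. ent \<xi> i j) \<in> borel_measurable PG"
  unfolding ent_def using measurable_component_singleton[of "(min i j, max i j)" "upper_idx n" N]
  by (auto simp: upper_idx_def cong: measurable_cong_sets)

lemma qform_amat:
  assumes "v \<in> carrier_vec n"
  shows "qform n \<xi> (\<lambda>i. v $ i) = v \<bullet> (amat \<xi> *\<^sub>v v)"
  unfolding quad_sum[OF amat_carrier assms] qform_def by (intro sum.cong refl) (simp add: amat_index)

lemma frob_amat: "frob n (amat \<xi> - amat \<xi>') = sqrt (2 / n) * wdist \<xi> \<xi>'"
proof -
  have "(frob n (amat \<xi> - amat \<xi>'))\<^sup>2 = (\<Sum>i<n. \<Sum>j<n. (ent \<xi> i j - ent \<xi>' i j)\<^sup>2)"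
    unfolding frob_sq by (intro sum.cong refl) (simp add: amat_index carrier_matD[OF amat_carrier])
  also have "\<dots> = 2 / n * (wdist \<xi> \<xi>')\<^sup>2" unfolding wdist_ent using n_pos by simp
  also have "\<dots> = (sqrt (2 / n) * wdist \<xi> \<xi>')\<^sup>2" by (simp add: power_mult_distrib)
  finally show ?thesis by (rule power2_eq_imp_eq) (auto simp: frob_nonneg wdist_nonneg)
qed

text \<open>The edge bound with all weights and the slack equal to 1, for both signs: the constant
  is 1 + (1 + 1) = 3.\<close>

lemma op_norm_event:
  obtains T where "T \<in> sets PG" "1 - 2 * exp (- real n / 32) \<le> measure PG T" "\<And>\<xi>. \<xi> \<in> T \<Longrightarrow> op_bound n (amat \<xi>) 3"
proof -
  obtain T1 where T1: "T1 \<in> sets PG" "1 - exp (- (n * 1\<^sup>2) / 32) \<le> measure PG T1"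
    "\<And>\<xi> v. \<xi> \<in> T1 \<Longrightarrow> 1 * qform n \<xi> v \<le> (\<Sum>i<n. 1 * (v i)\<^sup>2) + ((\<Sum>i<n. 1 / 1) / n + 1) * (\<Sum>i<n. (v i)\<^sup>2)"
    by (rule edge[of "\<lambda>_. 1" 1 1]) auto
  obtain T2 where T2: "T2 \<in> sets PG" "1 - exp (- (n * 1\<^sup>2) / 32) \<le> measure PG T2"
    "\<And>\<xi> v. \<xi> \<in> T2 \<Longrightarrow> (-1) * qform n \<xi> v \<le> (\<Sum>i<n. 1 * (v i)\<^sup>2) + ((\<Sum>i<n. 1 / 1) / n + 1) * (\<Sum>i<n. (v i)\<^sup>2)"
    by (rule edge[of "\<lambda>_. 1" 1 "-1"]) auto
  show thesis
  proof (rule that)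
    show "T1 \<inter> T2 \<in> sets PG" using T1 T2 by auto
    have "measure PG (space PG - T1 \<inter> T2) \<le> measure PG ((space PG - T1) \<union> (space PG - T2))"
      using T1 T2 by (intro P.P.finite_measure_mono) auto
    also have "\<dots> \<le> measure PG (space PG - T1) + measure PG (space PG - T2)"
      using T1 T2 by (intro measure_Un_le) auto
    finally show "1 - 2 * exp (- real n / 32) \<le> measure PG (T1 \<inter> T2)"
      using P.P.prob_compl[OF T1(1)] P.P.prob_compl[OF T2(1)] P.P.prob_compl[of "T1 \<inter> T2"] T1 T2 by auto
    fix \<xi> assume \<xi>: "\<xi> \<in> T1 \<inter> T2"
    show "op_bound n (amat \<xi>) 3"
    proof (rule op_bound_of_quadratic_form[OF amat_symm])
      fix v :: "real vec" assume v: "v \<in> carrier_vec n"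
      have vv: "(\<Sum>i<n. (v $ i)\<^sup>2) = v \<bullet> v" unfolding scalar_prod_lessThan[OF v] by (simp add: power2_eq_square)
      have "qform n \<xi> (\<lambda>i. v $ i) \<le> 3 * (v \<bullet> v)" using T1(3)[of \<xi> "\<lambda>i. v $ i"] \<xi> n_pos by (simp add: vv)
      moreover have "- qform n \<xi> (\<lambda>i. v $ i) \<le> 3 * (v \<bullet> v)" using T2(3)[of \<xi> "\<lambda>i. v $ i"] \<xi> n_pos by (simp add: vv)
      ultimately show "\<bar>v \<bullet> (amat \<xi> *\<^sub>v v)\<bar> \<le> 3 * (v \<bullet> v)" unfolding qform_amat[OF v] by linarith
    qed simp
  qed
qed

text \<open>The row \<open>i\<close> of the matrix is independent of the remaining entries, on which \<open>W\<close> depends.\<close>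

lemma row_variance:
  assumes i: "i < n" and W: "\<And>j k. j < n \<Longrightarrow> k < n \<Longrightarrow> (\<lambda>\<xi>. W \<xi> j k) \<in> borel_measurable PG"
    and dep: "\<And>\<xi> \<xi>'. (\<And>j k. j < n \<Longrightarrow> k < n \<Longrightarrow> j \<noteq> i \<Longrightarrow> k \<noteq> i \<Longrightarrow> ent \<xi> j k = ent \<xi>' j k) \<Longrightarrow> W \<xi> = W \<xi>'"
    and b: "0 \<le> b"
  shows "(\<integral>\<^sup>+\<xi>. indicator {\<xi>. (\<forall>j<n. \<forall>k<n. W \<xi> j k = W \<xi> k j) \<and> (\<Sum>j<n. \<Sum>k<n. (W \<xi> j k)\<^sup>2) \<le> b} \<xi> *
      ennreal (((\<Sum>j\<in>{..<n} - {i}. \<Sum>k\<in>{..<n} - {i}. W \<xi> j k * (ent \<xi> i j * ent \<xi> i k)) - (\<Sum>j\<in>{..<n} - {i}. W \<xi> j j) / n)\<^sup>2) \<partial>PG)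
    \<le> ennreal (2 * b / n\<^sup>2)"
proof -
  \<comment> \<open>The position of the entry \<open>(i, j)\<close> in the upper triangle;
    \<open>oth\<close> recovers \<open>j\<close> from it.\<close>
  define r where "r j = (min i j, max i j)" for j
  define oth where "oth p = (if fst p = i then snd p else fst p)" for p :: "nat \<times> nat"
  define K where "K = {..<n} - {i}"
  define J where "J = r ` K"
  define I0 where "I0 = upper_idx n - J"
  have fK: "finite K" by (simp add: K_def)
  have or: "oth (r j) = j" if "j \<in> K" for j using that by (auto simp: oth_def r_def K_def min_def max_def)
  have inj: "inj_on r K" by (metis inj_onI or)
  have JU: "J \<subseteq> upper_idx n" using i by (auto simp: J_def r_def K_def upper_idx_def)
  have U: "I0 \<union> J = upper_idx n" using JU by (auto simp: I0_def)
  have fin: "finite I0" "finite J" "I0 \<inter> J = {}" by (auto simp: I0_def J_def fK)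
  have sJ: "goe_sd n p = sqrt (1 / n)" if p: "p \<in> J" for p
  proof -
    obtain j where j: "j \<noteq> i" "p = r j" using p by (auto simp: J_def K_def)
    have "min i j \<noteq> max i j" using j(1) by (auto simp: min_def max_def)
    then show ?thesis unfolding j(2) r_def by (simp add: goe_sd_def)
  qed
  \<comment> \<open>Off this event nothing is known about \<open>W\<close>. Since the event depends
    on \<open>W\<close> alone, it is decided before row \<open>i\<close> is integrated.\<close>
  define G where "G \<xi> \<longleftrightarrow> (\<forall>j<n. \<forall>k<n. W \<xi> j k = W \<xi> k j) \<and> (\<Sum>j<n. \<Sum>k<n. (W \<xi> j k)\<^sup>2) \<le> b" for \<xi>
  define D where "D \<xi> = (\<Sum>j\<in>K. \<Sum>k\<in>K. W \<xi> j k * (ent \<xi> i j * ent \<xi> i k)) - (\<Sum>j\<in>K. W \<xi> j j) / n" for \<xi>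
  have WK: "(\<lambda>\<xi>. W \<xi> j k) \<in> borel_measurable PG" if "j \<in> K" "k \<in> K" for j k using W that by (auto simp: K_def)
  have eK: "(\<lambda>\<xi>. ent \<xi> i j) \<in> borel_measurable PG" if "j \<in> K" for j using ent_measurable[OF i] that by (auto simp: K_def)
  have Dm: "D \<in> borel_measurable PG" unfolding D_def
    by (intro borel_measurable_diff borel_measurable_sum borel_measurable_times borel_measurable_divide borel_measurable_const WK eK)
  have GW: "{\<xi> \<in> space PG. W \<xi> j k = W \<xi> k j} \<in> sets PG" if "j < n" "k < n" for j k
    using W[OF that] W[OF that(2,1)] by measurable
  have "{\<xi> \<in> space PG. (\<Sum>j<n. \<Sum>k<n. (W \<xi> j k)\<^sup>2) \<le> b} \<in> sets PG"
  proof -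
    have "(\<lambda>\<xi>. \<Sum>j<n. \<Sum>k<n. (W \<xi> j k)\<^sup>2) \<in> borel_measurable PG"
      by (intro borel_measurable_sum borel_measurable_power W) auto
    then show ?thesis by measurable
  qed
  moreover have "{\<xi> \<in> space PG. \<forall>j<n. \<forall>k<n. W \<xi> j k = W \<xi> k j} \<in> sets PG"
  proof -
    have "{\<xi> \<in> space PG. \<forall>j\<in>{..<n}. \<forall>k\<in>{..<n}. W \<xi> j k = W \<xi> k j} \<in> sets PG"
      by (intro sets.sets_Collect_finite_All GW) auto
    then show ?thesis unfolding Ball_def lessThan_iff .
  qed
  ultimately have "{\<xi> \<in> space PG. (\<forall>j<n. \<forall>k<n. W \<xi> j k = W \<xi> k j) \<and> (\<Sum>j<n. \<Sum>k<n. (W \<xi> j k)\<^sup>2) \<le> b} \<in> sets PG"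
    by (intro sets.sets_Collect_conj)
  then have Gm: "{\<xi> \<in> space PG. G \<xi>} \<in> sets PG" unfolding G_def .
  define H where "H \<xi> = indicator {\<xi>. G \<xi>} \<xi> * ennreal ((D \<xi>)\<^sup>2)" for \<xi>
  have Hm: "H \<in> borel_measurable PG"
  proof -
    have "(\<lambda>\<xi>. indicator {\<xi>. G \<xi>} \<xi> :: ennreal) \<in> borel_measurable PG"
      by (rule borel_measurable_indicator') (use Gm in simp)
    then show ?thesis unfolding H_def using Dm by measurable
  qed
  have "(\<integral>\<^sup>+\<xi>. H \<xi> \<partial>PG) = (\<integral>\<^sup>+x. (\<integral>\<^sup>+y. H (merge I0 J (x, y)) \<partial>Pi\<^sub>M J N) \<partial>Pi\<^sub>M I0 N)"
    using P.product_nn_integral_fold[OF fin(3,1,2), of H] Hm unfolding U by simp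
  also have "\<dots> \<le> (\<integral>\<^sup>+x. ennreal (2 * b / n\<^sup>2) \<partial>Pi\<^sub>M I0 N)"
  proof (rule nn_integral_mono)
    fix x
    \<comment> \<open>\<open>W\<close> ignores the coordinates in \<open>J\<close>, so any reference
      value serves.\<close>
    define y0 where "y0 = (\<lambda>_::nat \<times> nat. 0::real)"
    define W' where "W' = W (merge I0 J (x, y0))"
    have Wc: "W (merge I0 J (x, y)) = W'" for y
      unfolding W'_def
    proof (rule dep)
      fix j k assume jk: "j < n" "k < n" "j \<noteq> i" "k \<noteq> i"
      have "(min j k, max j k) \<in> upper_idx n" using jk by (auto simp: upper_idx_def)
      moreover have "(min j k, max j k) \<notin> J" using jk by (auto simp: J_def r_def K_def min_def max_def split: if_splits)
      ultimately have "(min j k, max j k) \<in> I0" by (simp add: I0_def)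
      then show "ent (merge I0 J (x, y)) j k = ent (merge I0 J (x, y0)) j k" by (simp add: ent_def merge_def)
    qed
    have ey: "ent (merge I0 J (x, y)) i j = y (r j)" if "j \<in> K" for y j
    proof -
      have "r j \<in> J" "r j \<notin> I0" using that by (auto simp: J_def I0_def)
      then show ?thesis unfolding ent_def r_def[symmetric] by (simp add: merge_def)
    qed
    define R where "R p q = W' (oth p) (oth q)" for p q
    define s where "s = sqrt (1 / real n)"
    have s2: "s\<^sup>2 = 1 / n" "s ^ 4 = 1 / n\<^sup>2"
    proof -
      show "s\<^sup>2 = 1 / n" by (simp add: s_def)
      then have "(s\<^sup>2)\<^sup>2 = 1 / n\<^sup>2" by (simp add: power_divide)
      then show "s ^ 4 = 1 / n\<^sup>2" by (simp add: power_mult[symmetric])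
    qed
    have DJ: "D (merge I0 J (x, y)) = (\<Sum>p\<in>J. \<Sum>q\<in>J. R p q * (y p * y q)) - s\<^sup>2 * (\<Sum>p\<in>J. R p p)" for y
    proof -
      have "(\<Sum>p\<in>J. \<Sum>q\<in>J. R p q * (y p * y q)) = (\<Sum>j\<in>K. \<Sum>k\<in>K. W' j k * (y (r j) * y (r k)))"
        unfolding J_def sum.reindex[OF inj] comp_def by (intro sum.cong refl) (simp add: R_def or)
      moreover have "(\<Sum>p\<in>J. R p p) = (\<Sum>j\<in>K. W' j j)"
        unfolding J_def sum.reindex[OF inj] comp_def by (intro sum.cong refl) (simp add: R_def or)
      moreover have "(\<Sum>j\<in>K. \<Sum>k\<in>K. W' j k * (ent (merge I0 J (x, y)) i j * ent (merge I0 J (x, y)) i k)) = (\<Sum>j\<in>K. \<Sum>k\<in>K. W' j k * (y (r j) * y (r k)))"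
        by (intro sum.cong refl) (simp add: ey)
      ultimately show ?thesis unfolding D_def Wc s2 by simp
    qed
    show "(\<integral>\<^sup>+y. H (merge I0 J (x, y)) \<partial>Pi\<^sub>M J N) \<le> ennreal (2 * b / n\<^sup>2)"
    proof (cases "G (merge I0 J (x, y0))")
      case False
      then have "\<not> G (merge I0 J (x, y))" for y unfolding G_def Wc .
      then have "H (merge I0 J (x, y)) = 0" for y by (simp add: H_def)
      then show ?thesis by simp
    next
      case True
      have Ws: "\<And>j k. j < n \<Longrightarrow> k < n \<Longrightarrow> W' j k = W' k j" and Wb: "(\<Sum>j<n. \<Sum>k<n. (W' j k)\<^sup>2) \<le> b"
        using True unfolding G_def W'_def by auto
      have "(\<integral>\<^sup>+y. H (merge I0 J (x, y)) \<partial>Pi\<^sub>M J N) \<le> (\<integral>\<^sup>+y. ennreal (((\<Sum>p\<in>J. \<Sum>q\<in>J. R p q * (y p * y q)) - s\<^sup>2 * (\<Sum>p\<in>J. R p p))\<^sup>2) \<partial>Pi\<^sub>M J N)"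
        unfolding H_def DJ by (intro nn_integral_mono) (auto simp: indicator_def)
      also have "\<dots> = ennreal (2 * s ^ 4 * (\<Sum>p\<in>J. \<Sum>q\<in>J. (R p q)\<^sup>2))"
      proof -
        have sR: "R p q = R q p" if pq: "p \<in> J" "q \<in> J" for p q
        proof -
          obtain j k where jk: "j \<in> K" "k \<in> K" "p = r j" "q = r k" using pq unfolding J_def by blast
          have "j < n" "k < n" using jk(1,2) by (simp_all add: K_def)
          then show ?thesis unfolding R_def jk(3,4) or[OF jk(1)] or[OF jk(2)] by (rule Ws)
        qed
        note v = quadratic_form_variance[OF fin(2) sJ[folded s_def] sR]
        show ?thesis using nn_integral_eq_integral[OF v(1)] v(2) by simp
      qed
      also have "\<dots> \<le> ennreal (2 * b / n\<^sup>2)"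
      proof (rule ennreal_leI)
        have "(\<Sum>p\<in>J. \<Sum>q\<in>J. (R p q)\<^sup>2) = (\<Sum>j\<in>K. \<Sum>k\<in>K. (W' j k)\<^sup>2)"
          unfolding J_def sum.reindex[OF inj] comp_def by (intro sum.cong refl) (simp add: R_def or)
        also have "\<dots> \<le> (\<Sum>j\<in>K. \<Sum>k<n. (W' j k)\<^sup>2)" by (intro sum_mono sum_mono2) (auto simp: K_def)
        also have "\<dots> \<le> (\<Sum>j<n. \<Sum>k<n. (W' j k)\<^sup>2)" by (intro sum_mono2) (auto simp: K_def sum_nonneg)
        finally have "(\<Sum>p\<in>J. \<Sum>q\<in>J. (R p q)\<^sup>2) \<le> b" using Wb by linarith
        then have "2 * (1 / n\<^sup>2) * (\<Sum>p\<in>J. \<Sum>q\<in>J. (R p q)\<^sup>2) \<le> 2 * (1 / n\<^sup>2) * b" by (intro mult_left_mono) auto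
        then show "2 * s ^ 4 * (\<Sum>p\<in>J. \<Sum>q\<in>J. (R p q)\<^sup>2) \<le> 2 * b / n\<^sup>2" unfolding s2 by simp
      qed
      finally show ?thesis .
    qed
  qed
  also have "\<dots> = ennreal (2 * b / n\<^sup>2)"
  proof -
    interpret I0: prob_space "Pi\<^sub>M I0 N" by (intro prob_space_PiM prob_N)
    show ?thesis by (simp add: I0.emeasure_space_1)
  qed
  finally show ?thesis unfolding H_def D_def K_def G_def .
qed

text \<open>The factor 16 is such that three failures still leave mass 3/4 in
  \<open>typical_law\<close>.\<close>

lemma markov:
  assumes u: "u \<in> borel_measurable PG" and le: "(\<integral>\<^sup>+\<xi>. u \<xi> \<partial>PG) \<le> ennreal a" and a: "0 < a"
  shows "measure PG {\<xi> \<in> space PG. ennreal (16 * a) \<le> u \<xi>} \<le> 1 / 16"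
proof -
  have S: "{\<xi> \<in> space PG. ennreal (16 * a) \<le> u \<xi>} \<in> sets PG" using u by measurable
  have "ennreal (16 * a) * emeasure PG {\<xi> \<in> space PG. ennreal (16 * a) \<le> u \<xi>} = (\<integral>\<^sup>+\<xi>. ennreal (16 * a) * indicator {\<xi> \<in> space PG. ennreal (16 * a) \<le> u \<xi>} \<xi> \<partial>PG)"
    using S by (simp add: nn_integral_cmult_indicator)
  also have "\<dots> \<le> (\<integral>\<^sup>+\<xi>. u \<xi> \<partial>PG)" by (intro nn_integral_mono) (auto simp: indicator_def)
  also have "\<dots> \<le> ennreal a" by (rule le)
  finally have "ennreal (16 * a * measure PG {\<xi> \<in> space PG. ennreal (16 * a) \<le> u \<xi>}) \<le> ennreal a"
    unfolding P.P.emeasure_eq_measure using a by (subst ennreal_mult) auto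
  then have "16 * a * measure PG {\<xi> \<in> space PG. ennreal (16 * a) \<le> u \<xi>} \<le> a" using a by simp
  then show ?thesis using a by (simp add: field_simps)
qed

end

locale fixed_x = pd_setting +
  assumes c\<beta>: "2 * c = (1 - \<beta>)\<^sup>2"
begin

sublocale goe n using n0 by unfold_locales

text \<open>Let \<open>W\<close> and \<open>V\<close> be the weighted and the plain squared length,
  so \<open>V \<le> W\<close>. As \<open>\<beta>\<^sup>2 * \<tau> - \<beta> * \<tau> = - \<beta> *
  (1 - \<beta>) * \<tau>\<close> and \<open>\<tau> \<le> 1\<close>, the edge bound with slack
  \<open>c\<close> leaves at least \<open>((1 - \<beta>)\<^sup>2 - c) * W\<close>. Taking
  \<open>c\<close> to be half of \<open>(1 - \<beta>)\<^sup>2\<close> makes this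
  \<open>c * W\<close>.\<close>

lemma edge_imp_pdc:
  assumes \<xi>: "\<And>v. 1 * qform n \<xi> v \<le> (\<Sum>i<n. (1 / x i) * (v i)\<^sup>2) + ((\<Sum>i<n. 1 / (1 / x i)) / n + c) * (\<Sum>i<n. (v i)\<^sup>2)"
  shows "pdc n c x (Bm n \<beta> x (amat \<xi>))"
  unfolding pdc_def
proof (intro conjI ballI Bm_symm amat_symm)
  fix v :: "real vec" assume v: "v \<in> carrier_vec n"
  define W where "W = (\<Sum>i<n. (v $ i)\<^sup>2 / x i)"
  define V where "V = (\<Sum>i<n. (v $ i)\<^sup>2)"
  define q where "q = qform n \<xi> (\<lambda>i. v $ i)"
  define \<tau> where "\<tau> = avg n x"
  have VW: "V \<le> W" "0 \<le> V" using weighted_sum_ge[OF v] by (auto simp: V_def W_def scalar_prod_lessThan[OF v] power2_eq_square sum_nonneg)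
  have qle: "q \<le> W + (\<tau> + c) * V" using \<xi>[of "\<lambda>i. v $ i"] by (simp add: q_def W_def V_def \<tau>_def avg_def)
  have "v \<bullet> (Bm n \<beta> x (amat \<xi>) *\<^sub>v v) = W + \<beta>\<^sup>2 * \<tau> * V - \<beta> * q"
    unfolding quad_Bm[OF amat_carrier v] W_def V_def q_def qform_def \<tau>_def
    by (simp add: amat_index sum.distrib distrib_right sum_distrib_left)
  also have "\<dots> \<ge> W + \<beta>\<^sup>2 * \<tau> * V - \<beta> * (W + (\<tau> + c) * V)" using mult_left_mono[OF qle, of \<beta>] \<beta>0 by simp
  also have "W + \<beta>\<^sup>2 * \<tau> * V - \<beta> * (W + (\<tau> + c) * V) = (1 - \<beta>) * W - \<beta> * (1 - \<beta>) * (\<tau> * V) - \<beta> * c * V"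
    by (simp add: power2_eq_square algebra_simps)
  also have "\<dots> \<ge> (1 - \<beta>) * W - \<beta> * (1 - \<beta>) * W - 1 * c * W"
  proof -
    have "\<tau> * V \<le> 1 * W" using avg_x VW unfolding \<tau>_def by (intro mult_mono) auto
    then have "\<beta> * (1 - \<beta>) * (\<tau> * V) \<le> \<beta> * (1 - \<beta>) * W" using \<beta>0 \<beta>1 by (intro mult_left_mono) auto
    moreover have "\<beta> * c * V \<le> 1 * c * W" using \<beta>0 \<beta>1 c0 VW by (intro mult_mono) auto
    ultimately show ?thesis by linarith
  qed
  also have "(1 - \<beta>) * W - \<beta> * (1 - \<beta>) * W - 1 * c * W = ((1 - \<beta>)\<^sup>2 - c) * W" by (simp add: power2_eq_square algebra_simps)
  also have "\<dots> = c * W" unfolding c\<beta>[symmetric] by simp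
  finally show "c * (\<Sum>i<n. (v $ i)\<^sup>2 / x i) \<le> v \<bullet> (Bm n \<beta> x (amat \<xi>) *\<^sub>v v)" unfolding W_def by simp
qed

text \<open>Positivity comes from the edge bound with weights \<open>1 / x i\<close> and slack
  \<open>c\<close>, the norm from \<open>op_norm_event\<close>; the failures 1/64 and 2/64 stay
  below 1/16.\<close>

lemma typical_event:
  assumes n1: "exp (- (n * c\<^sup>2) / 32) \<le> 1 / 64" and n2: "exp (- real n / 32) \<le> 1 / 64"
  obtains T where "T \<in> sets PG" "15 / 16 \<le> measure PG T" "\<And>\<xi>. \<xi> \<in> T \<Longrightarrow> op_bound n (amat \<xi>) 6 \<and> pdc n c x (Bm n \<beta> x (amat \<xi>))"
proof -
  obtain T1 where T1: "T1 \<in> sets PG" "1 - exp (- (n * c\<^sup>2) / 32) \<le> measure PG T1"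
    "\<And>\<xi> v. \<xi> \<in> T1 \<Longrightarrow> 1 * qform n \<xi> v \<le> (\<Sum>i<n. (1 / x i) * (v i)\<^sup>2) + ((\<Sum>i<n. 1 / (1 / x i)) / n + c) * (\<Sum>i<n. (v i)\<^sup>2)"
    by (rule edge[of "\<lambda>i. 1 / x i" c 1]) (use x c0 in auto)
  obtain T2 where T2: "T2 \<in> sets PG" "1 - 2 * exp (- real n / 32) \<le> measure PG T2" "\<And>\<xi>. \<xi> \<in> T2 \<Longrightarrow> op_bound n (amat \<xi>) 3"
    by (rule op_norm_event) blast
  show thesis
  proof (rule that)
    show "T1 \<inter> T2 \<in> sets PG" using T1 T2 by auto
    have "measure PG (space PG - T1 \<inter> T2) \<le> measure PG ((space PG - T1) \<union> (space PG - T2))"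
      using T1 T2 by (intro P.P.finite_measure_mono) auto
    also have "\<dots> \<le> measure PG (space PG - T1) + measure PG (space PG - T2)"
      using T1 T2 by (intro measure_Un_le) auto
    finally show "15 / 16 \<le> measure PG (T1 \<inter> T2)"
      using P.P.prob_compl[OF T1(1)] P.P.prob_compl[OF T2(1)] P.P.prob_compl[of "T1 \<inter> T2"] T1 T2 n1 n2 by auto
    fix \<xi> assume \<xi>: "\<xi> \<in> T1 \<inter> T2"
    show "op_bound n (amat \<xi>) 6 \<and> pdc n c x (Bm n \<beta> x (amat \<xi>))"
      using op_bound_mono[OF T2(3), of \<xi> 6] edge_imp_pdc[OF T1(3), of \<xi>] \<xi> by auto
  qed
qed

lemma zrow_dep:
  assumes "\<And>j k. j < n \<Longrightarrow> k < n \<Longrightarrow> j \<noteq> i \<Longrightarrow> k \<noteq> i \<Longrightarrow> ent \<xi> j k = ent \<xi>' j k"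
  shows "zrow n i (amat \<xi>) = zrow n i (amat \<xi>')"
  using assms by (intro eq_matI) (auto simp: zrow_def amat_index)

lemma cavity_measurable:
  assumes "j < n" "k < n"
  shows "(\<lambda>\<xi>. minv (Bm n \<beta> x (zrow n i (amat \<xi>))) $$ (j, k)) \<in> borel_measurable PG"
proof (rule borel_measurable_minv[OF _ _ assms])
  show "Bm n \<beta> x (zrow n i (amat \<xi>)) \<in> carrier_mat n n" for \<xi> by (rule Bm_carrier[OF zrow_carrier])
  fix j k assume jk: "j < n" "k < n"
  have "(\<lambda>\<xi>. (if j = k then 1 / x k + \<beta>\<^sup>2 * avg n x else 0) - \<beta> * (if j = i \<or> k = i then 0 else ent \<xi> j k)) \<in> borel_measurable PG"
    using ent_measurable[OF jk] by (cases "j = i \<or> k = i") auto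
  moreover have "Bm n \<beta> x (zrow n i (amat \<xi>)) $$ (j, k) = (if j = k then 1 / x k + \<beta>\<^sup>2 * avg n x else 0) - \<beta> * (if j = i \<or> k = i then 0 else ent \<xi> j k)" for \<xi>
    using jk by (simp add: Bm_index[OF zrow_carrier] zrow_index amat_index)
  ultimately show "(\<lambda>\<xi>. Bm n \<beta> x (zrow n i (amat \<xi>)) $$ (j, k)) \<in> borel_measurable PG" by (simp only:)
qed

text \<open>The squared Frobenius norm of the decoupled inverse is at most
  \<open>n / c\<^sup>2\<close>, and \<open>row_variance\<close> divides by \<open>n\<^sup>2\<close>,
  so each row fluctuates with variance of order \<open>1 / n\<close>. The sum over the rows is
  bounded in mean and Markov's inequality suffices; the mass is 15/16 minus three times
  1/16.\<close>

lemma typical_law: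
  assumes n1: "exp (- (n * c\<^sup>2) / 32) \<le> 1 / 64" and n2: "exp (- real n / 32) \<le> 1 / 64" and large: "400 / c ^ 4 \<le> sqrt n"
  obtains T where "T \<in> sets PG" "3 / 4 \<le> measure PG T"
    "\<And>\<xi>. \<xi> \<in> T \<Longrightarrow> L2_set (\<lambda>i. Zd n \<beta> x (amat \<xi>) i - tlim n \<beta> x) {..<n} \<le> 150 * \<beta> / c ^ 4"
proof -
  obtain T where T: "T \<in> sets PG" "15 / 16 \<le> measure PG T" "\<And>\<xi>. \<xi> \<in> T \<Longrightarrow> op_bound n (amat \<xi>) 6 \<and> pdc n c x (Bm n \<beta> x (amat \<xi>))"
    by (rule typical_event[OF n1 n2]) blast
  define S where "S i \<xi> = minv (Bm n \<beta> x (zrow n i (amat \<xi>)))" for i \<xi>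
  \<comment> \<open>The truncation yields bounds in mean although the inverse is uncontrolled off
    the typical event.\<close>
  define Wb where "Wb W b = {\<xi>. (\<forall>j<n. \<forall>k<n. W \<xi> j k = W \<xi> k j) \<and> (\<Sum>j<n. \<Sum>k<n. (W \<xi> j k)\<^sup>2) \<le> b}" for W :: "(nat \<times> nat \<Rightarrow> real) \<Rightarrow> nat \<Rightarrow> nat \<Rightarrow> real" and b
  define W1 where "W1 i \<xi> j k = S i \<xi> $$ (j, k)" for i \<xi> j k
  define W2 where "W2 i \<xi> j k = (\<Sum>l<n. S i \<xi> $$ (j, l) * S i \<xi> $$ (l, k))" for i \<xi> j k
  define dv where "dv W i \<xi> = (\<Sum>j\<in>{..<n} - {i}. \<Sum>k\<in>{..<n} - {i}. W \<xi> j k * (ent \<xi> i j * ent \<xi> i k)) - (\<Sum>j\<in>{..<n} - {i}. W \<xi> j j) / n" for W :: "(nat \<times> nat \<Rightarrow> real) \<Rightarrow> nat \<Rightarrow> nat \<Rightarrow> real" and i \<xi>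
  have m1: "(\<lambda>\<xi>. W1 i \<xi> j k) \<in> borel_measurable PG" if "j < n" "k < n" for i j k
    unfolding W1_def S_def by (rule cavity_measurable[OF that])
  have m2: "(\<lambda>\<xi>. W2 i \<xi> j k) \<in> borel_measurable PG" if "j < n" "k < n" for i j k
    unfolding W2_def S_def using that by (intro borel_measurable_sum borel_measurable_times cavity_measurable) auto
  have Scar: "S i \<xi> \<in> carrier_mat n n" for i \<xi>
    unfolding S_def minv_def using adj_mat(1)[OF Bm_carrier[OF zrow_carrier]] by auto
  have W2e: "W2 i \<xi> j k = (S i \<xi> * S i \<xi>) $$ (j, k)" if "j < n" "k < n" for i \<xi> j k
    unfolding W2_def by (rule mat_mult_index[OF Scar Scar that, symmetric])
  have bound: "(\<integral>\<^sup>+\<xi>. (\<Sum>i<n. indicator (Wb (W i) b) \<xi> * ennreal ((dv (W i) i \<xi>)\<^sup>2)) \<partial>PG) \<le> ennreal (2 * b / n)"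
    and bmeas: "(\<lambda>\<xi>. \<Sum>i<n. indicator (Wb (W i) b) \<xi> * ennreal ((dv (W i) i \<xi>)\<^sup>2)) \<in> borel_measurable PG"
    if Wm: "\<And>i j k. j < n \<Longrightarrow> k < n \<Longrightarrow> (\<lambda>\<xi>. W i \<xi> j k) \<in> borel_measurable PG"
      and dep: "\<And>i \<xi> \<xi>'. S i \<xi> = S i \<xi>' \<Longrightarrow> W i \<xi> = W i \<xi>'" and b: "0 \<le> b" for W b
  proof -
    have ms: "(\<lambda>\<xi>. indicator (Wb (W i) b) \<xi> * ennreal ((dv (W i) i \<xi>)\<^sup>2)) \<in> borel_measurable PG" if i: "i < n" for i
    proof -
      have GW: "{\<xi> \<in> space PG. W i \<xi> j k = W i \<xi> k j} \<in> sets PG" if "j \<in> {..<n}" "k \<in> {..<n}" for j k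
        using Wm[of j k i] Wm[of k j i] that by simp
      have "{\<xi> \<in> space PG. \<forall>j\<in>{..<n}. \<forall>k\<in>{..<n}. W i \<xi> j k = W i \<xi> k j} \<in> sets PG"
        by (intro sets.sets_Collect_finite_All GW) auto
      moreover have "(\<lambda>\<xi>. \<Sum>j<n. \<Sum>k<n. (W i \<xi> j k)\<^sup>2) \<in> borel_measurable PG"
        by (intro borel_measurable_sum borel_measurable_power Wm) auto
      then have "{\<xi> \<in> space PG. (\<Sum>j<n. \<Sum>k<n. (W i \<xi> j k)\<^sup>2) \<le> b} \<in> sets PG" by measurable
      ultimately have "{\<xi> \<in> space PG. (\<forall>j\<in>{..<n}. \<forall>k\<in>{..<n}. W i \<xi> j k = W i \<xi> k j) \<and> (\<Sum>j<n. \<Sum>k<n. (W i \<xi> j k)\<^sup>2) \<le> b} \<in> sets PG"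
        by (intro sets.sets_Collect_conj)
      then have "{\<xi> \<in> space PG. \<xi> \<in> Wb (W i) b} \<in> sets PG" unfolding Wb_def Ball_def lessThan_iff mem_Collect_eq .
      then have "(\<lambda>\<xi>. indicator (Wb (W i) b) \<xi> :: ennreal) \<in> borel_measurable PG" by (intro borel_measurable_indicator') simp
      moreover have "dv (W i) i \<in> borel_measurable PG" unfolding dv_def
        by (intro borel_measurable_diff borel_measurable_sum borel_measurable_times borel_measurable_divide borel_measurable_const Wm ent_measurable i) auto
      ultimately show ?thesis by measurable
    qed
    then show "(\<lambda>\<xi>. \<Sum>i<n. indicator (Wb (W i) b) \<xi> * ennreal ((dv (W i) i \<xi>)\<^sup>2)) \<in> borel_measurable PG"
      by (intro borel_measurable_sum) auto
    have "(\<integral>\<^sup>+\<xi>. (\<Sum>i<n. indicator (Wb (W i) b) \<xi> * ennreal ((dv (W i) i \<xi>)\<^sup>2)) \<partial>PG) = (\<Sum>i<n. \<integral>\<^sup>+\<xi>. indicator (Wb (W i) b) \<xi> * ennreal ((dv (W i) i \<xi>)\<^sup>2) \<partial>PG)"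
      using ms by (intro nn_integral_sum) auto
    also have "\<dots> \<le> (\<Sum>i<n. ennreal (2 * b / n\<^sup>2))"
    proof (intro sum_mono)
      fix i assume i: "i \<in> {..<n}"
      show "(\<integral>\<^sup>+\<xi>. indicator (Wb (W i) b) \<xi> * ennreal ((dv (W i) i \<xi>)\<^sup>2) \<partial>PG) \<le> ennreal (2 * b / n\<^sup>2)"
        unfolding Wb_def dv_def
      proof (rule row_variance[OF _ Wm _ b])
        show "i < n" using i by simp
        fix \<xi> \<xi>' assume e: "\<And>j k. j < n \<Longrightarrow> k < n \<Longrightarrow> j \<noteq> i \<Longrightarrow> k \<noteq> i \<Longrightarrow> ent \<xi> j k = ent \<xi>' j k"
        have "zrow n i (amat \<xi>) = zrow n i (amat \<xi>')" by (rule zrow_dep) (rule e)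
        then have "S i \<xi> = S i \<xi>'" unfolding S_def by (rule arg_cong)
        then show "W i \<xi> = W i \<xi>'" by (rule dep)
      qed
    qed
    also have "\<dots> = ennreal (n * (2 * b / n\<^sup>2))" using b by (simp add: ennreal_mult[symmetric] ennreal_of_nat_eq_real_of_nat)
    also have "n * (2 * b / n\<^sup>2) = 2 * b / n" using n0 by (simp add: power2_eq_square)
    finally show "(\<integral>\<^sup>+\<xi>. (\<Sum>i<n. indicator (Wb (W i) b) \<xi> * ennreal ((dv (W i) i \<xi>)\<^sup>2)) \<partial>PG) \<le> ennreal (2 * b / n)" .
  qed
  define u1 where "u1 \<xi> = (\<Sum>i<n. indicator (Wb (W1 i) (n / c\<^sup>2)) \<xi> * ennreal ((dv (W1 i) i \<xi>)\<^sup>2))" for \<xi>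
  define u2 where "u2 \<xi> = (\<Sum>i<n. indicator (Wb (W2 i) (n / c ^ 4)) \<xi> * ennreal ((dv (W2 i) i \<xi>)\<^sup>2))" for \<xi>
  define u3 where "u3 \<xi> = ennreal (\<Sum>i<n. ent \<xi> i i * ent \<xi> i i)" for \<xi>
  have d1: "W1 i \<xi> = W1 i \<xi>'" if "S i \<xi> = S i \<xi>'" for i \<xi> \<xi>' by (intro ext) (simp add: W1_def that)
  have d2: "W2 i \<xi> = W2 i \<xi>'" if "S i \<xi> = S i \<xi>'" for i \<xi> \<xi>' by (intro ext) (simp add: W2_def that)
  have M1: "measure PG {\<xi> \<in> space PG. ennreal (16 * (2 / c\<^sup>2)) \<le> u1 \<xi>} \<le> 1 / 16"
  proof (rule markov)
    show "u1 \<in> borel_measurable PG" unfolding u1_def by (rule bmeas[OF m1 d1]) simp_all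
    show "(\<integral>\<^sup>+\<xi>. u1 \<xi> \<partial>PG) \<le> ennreal (2 / c\<^sup>2)" unfolding u1_def by (rule order_trans[OF bound[OF m1 d1]]) (use n0 in simp_all)
  qed (use c0 in simp)
  have M2: "measure PG {\<xi> \<in> space PG. ennreal (16 * (2 / c ^ 4)) \<le> u2 \<xi>} \<le> 1 / 16"
  proof (rule markov)
    show "u2 \<in> borel_measurable PG" unfolding u2_def by (rule bmeas[OF m2 d2]) simp_all
    show "(\<integral>\<^sup>+\<xi>. u2 \<xi> \<partial>PG) \<le> ennreal (2 / c ^ 4)" unfolding u2_def by (rule order_trans[OF bound[OF m2 d2]]) (use n0 in simp_all)
  qed (use c0 in simp)
  have ii: "(i, i) \<in> upper_idx n" if "i < n" for i using that by (simp add: upper_idx_def)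
  have M3: "measure PG {\<xi> \<in> space PG. ennreal (16 * 2) \<le> u3 \<xi>} \<le> 1 / 16"
  proof (rule markov)
    have em: "(\<lambda>\<xi>. \<Sum>i<n. ent \<xi> i i * ent \<xi> i i) \<in> borel_measurable PG" by (intro borel_measurable_sum borel_measurable_times ent_measurable) auto
    then show "u3 \<in> borel_measurable PG" unfolding u3_def by simp
    have int: "integrable PG (\<lambda>\<xi>. ent \<xi> i i * ent \<xi> i i)" "(\<integral>\<xi>. ent \<xi> i i * ent \<xi> i i \<partial>PG) = 2 / n" if "i < n" for i
      using integral_two[OF finite_upper_idx ii[OF that] ii[OF that]] by (auto simp: ent_def goe_sd_sq)
    have ints: "integrable PG (\<lambda>\<xi>. \<Sum>i<n. ent \<xi> i i * ent \<xi> i i)" by (intro Bochner_Integration.integrable_sum int) auto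
    have "(\<integral>\<^sup>+\<xi>. u3 \<xi> \<partial>PG) = ennreal (\<integral>\<xi>. (\<Sum>i<n. ent \<xi> i i * ent \<xi> i i) \<partial>PG)"
      unfolding u3_def by (rule nn_integral_eq_integral[OF ints]) (simp add: sum_nonneg)
    also have "(\<integral>\<xi>. (\<Sum>i<n. ent \<xi> i i * ent \<xi> i i) \<partial>PG) = (\<Sum>i<n. 2 / n)"
      using int by (subst Bochner_Integration.integral_sum) auto
    also have "\<dots> = 2" using n0 by simp
    finally show "(\<integral>\<^sup>+\<xi>. u3 \<xi> \<partial>PG) \<le> ennreal 2" by simp
  qed simp
  define B where "B = {\<xi> \<in> space PG. ennreal (16 * (2 / c\<^sup>2)) \<le> u1 \<xi>} \<union> ({\<xi> \<in> space PG. ennreal (16 * (2 / c ^ 4)) \<le> u2 \<xi>} \<union> {\<xi> \<in> space PG. ennreal (16 * 2) \<le> u3 \<xi>})"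
  have um: "u1 \<in> borel_measurable PG" "u2 \<in> borel_measurable PG" "u3 \<in> borel_measurable PG"
  proof -
    show "u1 \<in> borel_measurable PG" unfolding u1_def by (rule bmeas[OF m1 d1]) simp_all
    show "u2 \<in> borel_measurable PG" unfolding u2_def by (rule bmeas[OF m2 d2]) simp_all
    have "(\<lambda>\<xi>. \<Sum>i<n. ent \<xi> i i * ent \<xi> i i) \<in> borel_measurable PG" by (intro borel_measurable_sum borel_measurable_times ent_measurable) auto
    then show "u3 \<in> borel_measurable PG" unfolding u3_def by simp
  qed
  have sB: "{\<xi> \<in> space PG. ennreal (16 * (2 / c\<^sup>2)) \<le> u1 \<xi>} \<in> sets PG" "{\<xi> \<in> space PG. ennreal (16 * (2 / c ^ 4)) \<le> u2 \<xi>} \<in> sets PG"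
    "{\<xi> \<in> space PG. ennreal (16 * 2) \<le> u3 \<xi>} \<in> sets PG" using um by measurable
  have Bm': "B \<in> sets PG" unfolding B_def using sB by blast
  have B3: "measure PG B \<le> 3 / 16"
  proof -
    have "measure PG B \<le> measure PG {\<xi> \<in> space PG. ennreal (16 * (2 / c\<^sup>2)) \<le> u1 \<xi>} + measure PG ({\<xi> \<in> space PG. ennreal (16 * (2 / c ^ 4)) \<le> u2 \<xi>} \<union> {\<xi> \<in> space PG. ennreal (16 * 2) \<le> u3 \<xi>})"
      unfolding B_def using sB by (intro measure_Un_le) auto
    also have "measure PG ({\<xi> \<in> space PG. ennreal (16 * (2 / c ^ 4)) \<le> u2 \<xi>} \<union> {\<xi> \<in> space PG. ennreal (16 * 2) \<le> u3 \<xi>})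
      \<le> measure PG {\<xi> \<in> space PG. ennreal (16 * (2 / c ^ 4)) \<le> u2 \<xi>} + measure PG {\<xi> \<in> space PG. ennreal (16 * 2) \<le> u3 \<xi>}"
      using sB by (intro measure_Un_le) auto
    finally show ?thesis using M1 M2 M3 by linarith
  qed
  show thesis
  proof (rule that)
    show "T - B \<in> sets PG" using T(1) Bm' by auto
    have "measure PG T \<le> measure PG (T - B) + measure PG B"
      using order_trans[OF P.P.finite_measure_mono[of T "(T - B) \<union> B"] measure_Un_le[of "T - B" PG B]] T(1) Bm' by auto
    then show "3 / 4 \<le> measure PG (T - B)" using T(2) B3 by linarith
    fix \<xi> assume \<xi>: "\<xi> \<in> T - B"
    have \<xi>s: "\<xi> \<in> space PG" using \<xi> sets.sets_into_space[OF T(1)] by auto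
    define A where "A = amat \<xi>"
    have oA: "op_bound n A 6" and pA: "pdc n c x (Bm n \<beta> x A)" using T(3)[of \<xi>] \<xi> by (auto simp: A_def)
    have sA: "symm n A" unfolding A_def by (rule amat_symm)
    have Sprops: "op_bound n (S i \<xi>) (1 / c)" "symm n (S i \<xi>)" if i: "i < n" for i
      using pdc_inv(2,3)[OF pdc_zrow[OF sA pA i]] by (auto simp: S_def A_def)
    have fr: "(\<Sum>j<n. \<Sum>k<n. (M $$ (j, k))\<^sup>2) \<le> b\<^sup>2 * n" if "op_bound n M b" for M b
    proof -
      have "(frob n M)\<^sup>2 \<le> (b * sqrt n)\<^sup>2" by (intro power_mono frob_le_op_bound[OF that] frob_nonneg)
      then show ?thesis unfolding frob_sq by (simp add: power_mult_distrib)
    qed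
    \<comment> \<open>On the typical event the truncation is inactive.\<close>
    have in1: "\<xi> \<in> Wb (W1 i) (n / c\<^sup>2)" if i: "i < n" for i
      using fr[OF Sprops(1)[OF i]] Sprops(2)[OF i] by (auto simp: Wb_def W1_def symm_def power_divide)
    have in2: "\<xi> \<in> Wb (W2 i) (n / c ^ 4)" if i: "i < n" for i
    proof -
      have "(\<Sum>j<n. \<Sum>k<n. ((S i \<xi> * S i \<xi>) $$ (j, k))\<^sup>2) \<le> (1 / c * (1 / c))\<^sup>2 * n"
        by (rule fr[OF op_bound_mult[OF Sprops(1)[OF i] Sprops(1)[OF i]]])
      also have "(1 / c * (1 / c))\<^sup>2 * n = n / c ^ 4" by (simp add: power2_eq_square power4_eq_xxxx)
      finally have "(\<Sum>j<n. \<Sum>k<n. (W2 i \<xi> j k)\<^sup>2) \<le> n / c ^ 4" by (simp add: W2e del: index_mult_mat)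
      moreover have "W2 i \<xi> j k = W2 i \<xi> k j" if "j < n" "k < n" for j k
        unfolding W2_def using Sprops(2)[OF i] that by (intro sum.cong refl) (auto simp: symm_def mult.commute)
      ultimately show ?thesis by (simp add: Wb_def)
    qed
    have nb: "u1 \<xi> < ennreal (32 / c\<^sup>2)" "u2 \<xi> < ennreal (32 / c ^ 4)" "u3 \<xi> < ennreal 32"
      using \<xi> \<xi>s by (auto simp: B_def not_le)
    have e1: "dv (W1 i) i \<xi> = Edev A i" if i: "i < n" for i
    proof -
      have "(\<Sum>j\<in>{..<n} - {i}. \<Sum>k\<in>{..<n} - {i}. W1 i \<xi> j k * (ent \<xi> i j * ent \<xi> i k)) = (\<Sum>j\<in>{..<n} - {i}. \<Sum>k\<in>{..<n} - {i}. S i \<xi> $$ (j, k) * (A $$ (i, j) * A $$ (i, k)))"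
        using i by (intro sum.cong refl) (auto simp: W1_def A_def amat_index)
      then show ?thesis by (simp add: dv_def Edev_def W1_def S_def A_def)
    qed
    have e2: "dv (W2 i) i \<xi> = Fdev A i" if i: "i < n" for i
    proof -
      have "(\<Sum>j\<in>{..<n} - {i}. \<Sum>k\<in>{..<n} - {i}. W2 i \<xi> j k * (ent \<xi> i j * ent \<xi> i k)) = (\<Sum>j\<in>{..<n} - {i}. \<Sum>k\<in>{..<n} - {i}. (S i \<xi> * S i \<xi>) $$ (j, k) * (A $$ (i, j) * A $$ (i, k)))"
        using i by (intro sum.cong refl) (simp add: W2e A_def amat_index del: index_mult_mat)
      moreover have "(\<Sum>j\<in>{..<n} - {i}. W2 i \<xi> j j) = (\<Sum>j\<in>{..<n} - {i}. (S i \<xi> * S i \<xi>) $$ (j, j))"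
        by (intro sum.cong refl) (auto simp: W2e simp del: index_mult_mat)
      ultimately show ?thesis unfolding dv_def Fdev_def S_def[symmetric] A_def by (simp only: S_def)
    qed
    have E: "(\<Sum>i<n. (Edev A i)\<^sup>2) \<le> 32 / c\<^sup>2"
    proof -
      have "u1 \<xi> = (\<Sum>i<n. ennreal ((Edev A i)\<^sup>2))" unfolding u1_def by (intro sum.cong refl) (simp add: in1 e1)
      also have "\<dots> = ennreal (\<Sum>i<n. (Edev A i)\<^sup>2)" by (simp add: sum_ennreal)
      finally show ?thesis using nb(1) by (simp add: ennreal_less_iff sum_nonneg)
    qed
    have F: "(\<Sum>i<n. (Fdev A i)\<^sup>2) \<le> 32 / c ^ 4"
    proof -
      have "u2 \<xi> = (\<Sum>i<n. ennreal ((Fdev A i)\<^sup>2))" unfolding u2_def by (intro sum.cong refl) (simp add: in2 e2)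
      also have "\<dots> = ennreal (\<Sum>i<n. (Fdev A i)\<^sup>2)" by (simp add: sum_ennreal)
      finally show ?thesis using nb(2) by (simp add: ennreal_less_iff sum_nonneg)
    qed
    have G: "(\<Sum>i<n. (A $$ (i, i))\<^sup>2) \<le> 32"
    proof -
      have "(\<Sum>i<n. (A $$ (i, i))\<^sup>2) = (\<Sum>i<n. ent \<xi> i i * ent \<xi> i i)" by (intro sum.cong refl) (simp add: A_def amat_index power2_eq_square)
      then show ?thesis using nb(3) unfolding u3_def by (simp add: ennreal_less_iff sum_nonneg)
    qed
    show "L2_set (\<lambda>i. Zd n \<beta> x (amat \<xi>) i - tlim n \<beta> x) {..<n} \<le> 150 * \<beta> / c ^ 4"
      using fixed_law[OF oA sA pA c\<beta> E F G large] by (simp add: A_def)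
  qed
qed

end

section \<open>Chaining\<close>

lemma abs_sum_mult_le:
  assumes "L2_set u I \<le> 1"
  shows "\<bar>\<Sum>i\<in>I. u i * w i\<bar> \<le> L2_set w I"
proof -
  have "\<bar>\<Sum>i\<in>I. u i * w i\<bar> \<le> (\<Sum>i\<in>I. \<bar>u i\<bar> * \<bar>w i\<bar>)" by (rule order_trans[OF sum_abs]) (simp add: abs_mult)
  also have "\<dots> \<le> L2_set u I * L2_set w I" by (rule L2_set_mult_ineq)
  also have "\<dots> \<le> 1 * L2_set w I" using assms by (intro mult_right_mono L2_set_nonneg)
  finally show ?thesis by simp
qed

lemma exp_neg_le_half_power: "exp (- real m) \<le> (1 / 2) ^ m"
proof -
  have "exp (- real m) = exp (- 1) ^ m" by (simp add: exp_of_nat_mult[symmetric])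
  also have "\<dots> \<le> (1 / 2) ^ m"
  proof (rule power_mono)
    have "(2::real) \<le> exp 1" using exp_ge_add_one_self[of "1::real"] by simp
    then show "exp (- 1) \<le> (1 / 2 :: real)" by (simp add: exp_minus field_simps)
  qed simp
  finally show ?thesis .
qed

context prob_space
begin

text \<open>Values are controlled on \<open>T\<close> only, so a mean is not at hand.
  \<open>m\<close> is the infimum of the levels below which \<open>f\<close> has mass 1/4 on
  \<open>T\<close>; just under it less than 1/4 lies below, so at least 1/4 of the mass of
  \<open>T\<close> lies above. The tolerance \<eta> avoids any discussion of atoms.\<close>

lemma approximate_median:
  fixes f :: "'a \<Rightarrow> real"
  assumes T: "T \<in> events" "1 / 2 \<le> prob T" and f: "f \<in> borel_measurable M"
    and b: "\<And>\<omega>. \<omega> \<in> T \<Longrightarrow> \<bar>f \<omega>\<bar> \<le> b" and \<eta>: "0 < \<eta>"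
  obtains m where "1 / 4 \<le> prob {\<omega> \<in> T. f \<omega> \<le> m + \<eta>}" "1 / 4 \<le> prob {\<omega> \<in> T. m - \<eta> \<le> f \<omega>}"
proof -
  define F where "F a = prob {\<omega> \<in> T. f \<omega> \<le> a}" for a
  have Ts: "T \<subseteq> space M" using sets.sets_into_space[OF T(1)] .
  have ev: "{\<omega> \<in> T. P (f \<omega>)} \<in> events" if "{\<omega> \<in> space M. P (f \<omega>)} \<in> events" for P
  proof -
    have "{\<omega> \<in> T. P (f \<omega>)} = T \<inter> {\<omega> \<in> space M. P (f \<omega>)}" using Ts by auto
    then show ?thesis using T(1) that by simp
  qed
  have e1: "{\<omega> \<in> T. f \<omega> \<le> a} \<in> events" for a by (rule ev) (use f in measurable)
  have e2: "{\<omega> \<in> T. a \<le> f \<omega>} \<in> events" for a by (rule ev) (use f in measurable)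
  define S where "S = {a. 1 / 4 \<le> F a}"
  have bS: "b \<in> S"
  proof -
    have "{\<omega> \<in> T. f \<omega> \<le> b} = T" using b by fastforce
    then show ?thesis using T(2) by (simp add: S_def F_def)
  qed
  have low: "- b \<le> a" if "a \<in> S" for a
  proof (rule ccontr)
    assume "\<not> - b \<le> a"
    then have "{\<omega> \<in> T. f \<omega> \<le> a} = {}" using b by fastforce
    then have "F a = 0" unfolding F_def by (simp only: measure_empty)
    then show False using that by (simp add: S_def)
  qed
  have bdd: "bdd_below S" by (rule bdd_belowI[of _ "- b"]) (rule low)
  define m where "m = Inf S"
  obtain a where a: "a \<in> S" "a < m + \<eta>"
    using cInf_less_iff[of S "m + \<eta>"] bS bdd \<eta> by (auto simp: m_def)
  have up: "1 / 4 \<le> prob {\<omega> \<in> T. f \<omega> \<le> m + \<eta>}"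
  proof -
    have "F a \<le> prob {\<omega> \<in> T. f \<omega> \<le> m + \<eta>}" unfolding F_def using a(2) by (intro finite_measure_mono e1) auto
    then show ?thesis using a(1) by (simp add: S_def)
  qed
  have "m - \<eta> \<notin> S"
  proof
    assume "m - \<eta> \<in> S"
    then have "m \<le> m - \<eta>" unfolding m_def by (rule cInf_lower) (rule bdd)
    then show False using \<eta> by simp
  qed
  then have "prob {\<omega> \<in> T. f \<omega> \<le> m - \<eta>} < 1 / 4" by (simp add: S_def F_def)
  moreover have "prob T \<le> prob {\<omega> \<in> T. f \<omega> \<le> m - \<eta>} + prob {\<omega> \<in> T. m - \<eta> \<le> f \<omega>}"
    by (rule order_trans[OF finite_measure_mono measure_Un_le]) (use e1 e2 in auto)
  ultimately have "1 / 4 \<le> prob {\<omega> \<in> T. m - \<eta> \<le> f \<omega>}" using T(2) by linarith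
  then show thesis using that up by blast
qed

text \<open>Exceptional sets are handled through measurable covers, so that \<open>Q\<close> itself
  may define a nonmeasurable set.\<close>

lemma union_bound:
  assumes J: "finite J" and B: "\<And>j. j \<in> J \<Longrightarrow> \<exists>B\<in>events. prob B \<le> q j \<and> (\<forall>\<omega>\<in>space M - B. Q j \<omega>)"
  shows "\<exists>B\<in>events. prob B \<le> (\<Sum>j\<in>J. q j) \<and> (\<forall>\<omega>\<in>space M - B. \<forall>j\<in>J. Q j \<omega>)"
proof -
  obtain b where b: "\<And>j. j \<in> J \<Longrightarrow> b j \<in> events \<and> prob (b j) \<le> q j \<and> (\<forall>\<omega>\<in>space M - b j. Q j \<omega>)"
    using bchoice[of J "\<lambda>j B. B \<in> events \<and> prob B \<le> q j \<and> (\<forall>\<omega>\<in>space M - B. Q j \<omega>)"] B by blast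
  show ?thesis
  proof (intro bexI conjI ballI)
    show "(\<Union>j\<in>J. b j) \<in> events" using J b by auto
    have "prob (\<Union>j\<in>J. b j) \<le> (\<Sum>j\<in>J. prob (b j))" using J b by (intro finite_measure_subadditive_finite) auto
    also have "\<dots> \<le> (\<Sum>j\<in>J. q j)" using b by (intro sum_mono) auto
    finally show "prob (\<Union>j\<in>J. b j) \<le> (\<Sum>j\<in>J. q j)" .
    fix \<omega> j assume "\<omega> \<in> space M - (\<Union>j\<in>J. b j)" "j \<in> J"
    then show "Q j \<omega>" using b by blast
  qed
qed

end

lemma good_mono: "good n \<beta> \<kappa> x A \<Longrightarrow> \<kappa> \<le> \<kappa>' \<Longrightarrow> good n \<beta> \<kappa>' x A"
  unfolding good_def using op_bound_mono by blast

lemma rsq_le: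
  assumes "op_bound n X b" "i < n"
  shows "0 \<le> rsq n X i" "rsq n X i \<le> b\<^sup>2"
proof -
  have e: "rsq n X i = (row_norm n X i)\<^sup>2" by (simp add: rsq_def row_norm_def L2_set_def sum_nonneg)
  show "0 \<le> rsq n X i" unfolding e by simp
  show "rsq n X i \<le> b\<^sup>2" unfolding e by (intro power_mono row_norm_le[OF assms] row_norm_nonneg)
qed

locale chaining = lip_setting +
  fixes c \<kappa> :: real
  assumes c\<beta>: "2 * c = (1 - \<beta>)\<^sup>2" and c\<kappa>: "8 / c \<le> \<kappa>"
    and n1: "exp (- (n * c\<^sup>2) / 32) \<le> 1 / 64" and n2: "exp (- real n / 32) \<le> 1 / 64" and large: "400 / c ^ 4 \<le> sqrt n"
begin

sublocale goe n using n0 by unfold_locales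

lemma c0: "0 < c" using c\<beta> \<beta>1 by (smt (verit) zero_less_power)

lemma c1: "2 * c \<le> 1"
  unfolding c\<beta> using \<beta>0 \<beta>1 by (simp add: power_le_one)

lemma \<kappa>16: "16 \<le> \<kappa>"
proof -
  have "16 \<le> 8 / c" using c0 c1 by (simp add: field_simps)
  then show ?thesis using c\<kappa> by linarith
qed

lemma \<kappa>1: "1 \<le> \<kappa>" using \<kappa>16 by simp

definition cube :: "(nat \<Rightarrow> real) set" where "cube = {x. \<forall>i<n. 0 < x i \<and> x i \<le> 1}"

text \<open>Testing against a direction \<open>u\<close> makes the deviation scalar, so that it has
  medians; a finite net of directions recovers the norm.\<close>

definition dev :: "(nat \<Rightarrow> real) \<Rightarrow> (nat \<Rightarrow> real) \<Rightarrow> (nat \<times> nat \<Rightarrow> real) \<Rightarrow> real" where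
  "dev x u \<xi> = (\<Sum>i<n. u i * (Zd n \<beta> x (amat \<xi>) i - tlim n \<beta> x))"

text \<open>With \<eta> equal to \<open>\<kappa> ^ 3 * \<beta> / sqrt n\<close>, the Lipschitz bound
  over a standardised distance of 6 is at most 17 times \<eta>, because
  \<open>12 * sqrt 2 \<le> 17\<close>; the tolerance of the median adds one more \<eta>.\<close>

definition \<delta> :: real where "\<delta> = 18 * \<kappa> ^ 3 * \<beta> / sqrt n"

lemma \<delta>_pos: "0 < \<delta>" unfolding \<delta>_def using \<kappa>16 \<beta>0 n0 by simp

lemma cube_fixed_x: "x \<in> cube \<Longrightarrow> fixed_x n \<beta> x c"
  using c0 c1 c\<beta> by unfold_locales (auto simp: cube_def)

lemma cube_le: "x \<in> cube \<Longrightarrow> i < n \<Longrightarrow> 0 \<le> x i \<and> x i \<le> 1"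
  by (simp add: cube_def less_imp_le)

lemma amat_entry_measurable: "i < n \<Longrightarrow> j < n \<Longrightarrow> (\<lambda>\<xi>. amat \<xi> $$ (i, j)) \<in> borel_measurable PG"
  unfolding amat_index by (rule ent_measurable)

lemma resm_measurable:
  assumes "i < n" "j < n"
  shows "(\<lambda>\<xi>. minv (resm n \<beta> x (amat \<xi>)) $$ (i, j)) \<in> borel_measurable PG"
proof (rule borel_measurable_minv[OF resm_carrier[OF amat_carrier] _ assms])
  fix i j assume ij: "i < n" "j < n"
  show "(\<lambda>\<xi>. resm n \<beta> x (amat \<xi>) $$ (i, j)) \<in> borel_measurable PG"
    unfolding resm_index[OF amat_carrier ij]
    by (intro borel_measurable_diff borel_measurable_times borel_measurable_const amat_entry_measurable ij)
qed

lemma dev_measurable: "dev x u \<in> borel_measurable PG"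
  unfolding dev_def Zd_def rsq_def
  by (intro borel_measurable_sum borel_measurable_times borel_measurable_const borel_measurable_diff borel_measurable_power resm_measurable) auto

lemma dev_lipschitz:
  assumes x: "x \<in> cube" and u: "L2_set u {..<n} \<le> 1" and g: "good n \<beta> \<kappa> x (amat \<xi>)" "good n \<beta> \<kappa> x (amat \<xi>')"
  shows "\<bar>dev x u \<xi> - dev x u \<xi>'\<bar> \<le> 2 * \<kappa> ^ 3 * \<beta> * frob n (amat \<xi>' - amat \<xi>)"
proof -
  have "dev x u \<xi> - dev x u \<xi>' = (\<Sum>i<n. u i * (Zd n \<beta> x (amat \<xi>) i - Zd n \<beta> x (amat \<xi>') i))"
    unfolding dev_def sum_subtractf[symmetric] by (intro sum.cong refl) (simp add: algebra_simps)
  also have "\<bar>\<dots>\<bar> \<le> L2_set (\<lambda>i. Zd n \<beta> x (amat \<xi>) i - Zd n \<beta> x (amat \<xi>') i) {..<n}" by (rule abs_sum_mult_le[OF u])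
  also have "\<dots> \<le> 2 * \<kappa> ^ 3 * \<beta> * frob n (amat \<xi>' - amat \<xi>)" by (rule Zd_lipschitz_A[OF g cube_le[OF x]])
  finally show ?thesis .
qed

lemma dev_second_diff:
  assumes x: "x \<in> cube" "x' \<in> cube" and u: "L2_set u {..<n} \<le> 1"
    and g: "good n \<beta> \<kappa> x (amat \<xi>)" "good n \<beta> \<kappa> x' (amat \<xi>)" "good n \<beta> \<kappa> x (amat \<xi>')" "good n \<beta> \<kappa> x' (amat \<xi>')"
    and d: "\<And>i. i < n \<Longrightarrow> \<bar>x' i - x i\<bar> \<le> d"
  shows "\<bar>(dev x u \<xi> - dev x' u \<xi>) - (dev x u \<xi>' - dev x' u \<xi>')\<bar> \<le> 50 * \<kappa> ^ 4 * \<beta> * d * frob n (amat \<xi>' - amat \<xi>)"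
proof -
  define w where "w i = (Zd n \<beta> x (amat \<xi>) i - Zd n \<beta> x' (amat \<xi>) i) - (Zd n \<beta> x (amat \<xi>') i - Zd n \<beta> x' (amat \<xi>') i)" for i
  have e: "(dev x u \<xi> - dev x' u \<xi>) - (dev x u \<xi>' - dev x' u \<xi>') = (\<Sum>i<n. u i * w i)"
    unfolding dev_def sum_subtractf[symmetric] by (intro sum.cong refl) (simp add: w_def algebra_simps)
  have "L2_set w {..<n} \<le> 50 * \<kappa> ^ 4 * \<beta> * d * frob n (amat \<xi>' - amat \<xi>)"
    unfolding w_def by (rule Zd_second_diff[OF g \<kappa>1 cube_le[OF x(1)] cube_le[OF x(2)] d])
  then show ?thesis unfolding e using abs_sum_mult_le[OF u, of w] by linarith
qed

text \<open>With mass 7/8, the concentration sets of two profiles still meet in at least half of the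
  space, which the increments require.\<close>

definition centered :: "(nat \<Rightarrow> real) \<Rightarrow> (nat \<Rightarrow> real) \<Rightarrow> real \<Rightarrow> (nat \<times> nat \<Rightarrow> real) set \<Rightarrow> bool" where
  "centered x u m T \<longleftrightarrow> T \<in> sets PG \<and> 7 / 8 \<le> measure PG T \<and> (\<forall>\<xi>\<in>T. good n \<beta> \<kappa> x (amat \<xi>) \<and> \<bar>dev x u \<xi> - m\<bar> \<le> \<delta>) \<and> \<bar>m\<bar> \<le> \<delta> + 150 * \<beta> / c ^ 4"

text \<open>The parts of the typical event below and above an approximate median are both enlarged
  by 6; each enlargement fails with probability at most 1/64, and the intersection with the typical
  event keeps 7/8. The median is small because this set and the set of \<open>typical_law\<close>
  have masses adding to more than 1, hence share a point.\<close>

lemma ex_centered: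
  assumes x: "x \<in> cube" and u: "L2_set u {..<n} \<le> 1"
  shows "\<exists>m T. centered x u m T"
proof -
  interpret F: fixed_x n \<beta> x c by (rule cube_fixed_x[OF x])
  define \<eta> where "\<eta> = \<delta> / 18"
  have \<eta>: "0 < \<eta>" "\<eta> = \<kappa> ^ 3 * \<beta> / sqrt n" using \<delta>_pos by (simp_all add: \<eta>_def \<delta>_def)
  obtain T where T: "T \<in> sets PG" "15 / 16 \<le> measure PG T" and TT: "\<And>\<xi>. \<xi> \<in> T \<Longrightarrow> op_bound n (amat \<xi>) 6 \<and> pdc n c x (Bm n \<beta> x (amat \<xi>))"
    by (rule F.typical_event[OF n1 n2]) blast
  have g: "good n \<beta> \<kappa> x (amat \<xi>)" if "\<xi> \<in> T" for \<xi>
    using good_mono[OF F.pdc_good(1)[OF _ amat_symm] c\<kappa>] TT[OF that] by blast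
  have bnd: "\<bar>dev x u \<xi>\<bar> \<le> (\<kappa>\<^sup>2 + \<bar>tlim n \<beta> x\<bar>) * sqrt n" if "\<xi> \<in> T" for \<xi>
  proof -
    have "\<bar>dev x u \<xi>\<bar> \<le> L2_set (\<lambda>i. Zd n \<beta> x (amat \<xi>) i - tlim n \<beta> x) {..<n}" unfolding dev_def by (rule abs_sum_mult_le[OF u])
    also have "\<dots> \<le> L2_set (\<lambda>_. \<kappa>\<^sup>2 + \<bar>tlim n \<beta> x\<bar>) {..<n}"
    proof (rule L2_set_abs_le)
      fix i assume "i \<in> {..<n}"
      then have "0 \<le> Zd n \<beta> x (amat \<xi>) i" "Zd n \<beta> x (amat \<xi>) i \<le> \<kappa>\<^sup>2"
        unfolding Zd_def using rsq_le g[OF that] unfolding good_def by auto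
      then show "\<bar>Zd n \<beta> x (amat \<xi>) i - tlim n \<beta> x\<bar> \<le> \<kappa>\<^sup>2 + \<bar>tlim n \<beta> x\<bar>" by linarith
    qed
    also have "\<dots> = (\<kappa>\<^sup>2 + \<bar>tlim n \<beta> x\<bar>) * sqrt n" unfolding L2_set_one by simp
    finally show ?thesis .
  qed
  obtain m where m: "1 / 4 \<le> measure PG {\<xi> \<in> T. dev x u \<xi> \<le> m + \<eta>}" "1 / 4 \<le> measure PG {\<xi> \<in> T. m - \<eta> \<le> dev x u \<xi>}"
    by (rule P.P.approximate_median[OF T(1) _ dev_measurable bnd \<eta>(1)]) (use T(2) in auto)
  have Ts: "T \<subseteq> space PG" using sets.sets_into_space[OF T(1)] .
  have S: "{\<xi> \<in> T. dev x u \<xi> \<le> m + \<eta>} \<in> sets PG" "{\<xi> \<in> T. m - \<eta> \<le> dev x u \<xi>} \<in> sets PG"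
  proof -
    have "{\<xi> \<in> T. dev x u \<xi> \<le> m + \<eta>} = T \<inter> {\<xi> \<in> space PG. dev x u \<xi> \<le> m + \<eta>}" using Ts by auto
    moreover have "{\<xi> \<in> space PG. dev x u \<xi> \<le> m + \<eta>} \<in> sets PG" using dev_measurable[of x u] by (rule borel_measurable_le) simp
    ultimately show "{\<xi> \<in> T. dev x u \<xi> \<le> m + \<eta>} \<in> sets PG" using T(1) by (simp only: sets.Int)
    have "{\<xi> \<in> T. m - \<eta> \<le> dev x u \<xi>} = T \<inter> {\<xi> \<in> space PG. m - \<eta> \<le> dev x u \<xi>}" using Ts by auto
    moreover have "{\<xi> \<in> space PG. m - \<eta> \<le> dev x u \<xi>} \<in> sets PG" by (rule borel_measurable_le[OF _ dev_measurable]) simp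
    ultimately show "{\<xi> \<in> T. m - \<eta> \<le> dev x u \<xi>} \<in> sets PG" using T(1) by (simp only: sets.Int)
  qed
  have e9: "exp (- (6::real)\<^sup>2 / 4) / (1 / 4) \<le> 1 / 64" using exp_neg_le_half_power[of 9] by (simp add: power_divide)
  obtain B1 where B1: "B1 \<in> sets PG" "measure PG B1 \<le> exp (- 6\<^sup>2 / 4) / (1 / 4)"
    "\<And>\<xi>. \<xi> \<in> space PG \<Longrightarrow> \<xi> \<notin> B1 \<Longrightarrow> \<exists>y\<in>{\<xi> \<in> T. dev x u \<xi> \<le> m + \<eta>}. wdist \<xi> y \<le> 6"
    by (rule enlargement[OF S(1) _ m(1), of 6]) auto
  obtain B2 where B2: "B2 \<in> sets PG" "measure PG B2 \<le> exp (- 6\<^sup>2 / 4) / (1 / 4)"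
    "\<And>\<xi>. \<xi> \<in> space PG \<Longrightarrow> \<xi> \<notin> B2 \<Longrightarrow> \<exists>y\<in>{\<xi> \<in> T. m - \<eta> \<le> dev x u \<xi>}. wdist \<xi> y \<le> 6"
    by (rule enlargement[OF S(2) _ m(2), of 6]) auto
  have lip: "\<bar>dev x u \<xi> - dev x u y\<bar> \<le> 17 * \<eta>" if \<xi>: "\<xi> \<in> T" and y: "y \<in> T" and w: "wdist \<xi> y \<le> 6" for \<xi> y
  proof -
    have "sqrt 2 \<le> (17 / 12 :: real)" by (rule real_le_lsqrt) (simp_all add: power_divide)
    then have s2: "sqrt 2 * 12 \<le> 17" by simp
    have "frob n (amat y - amat \<xi>) \<le> sqrt (2 / n) * 6" unfolding frob_amat wdist_sym[of y] using w by (intro mult_left_mono) auto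
    then have "2 * \<kappa> ^ 3 * \<beta> * frob n (amat y - amat \<xi>) \<le> 2 * \<kappa> ^ 3 * \<beta> * (sqrt (2 / n) * 6)"
      using \<kappa>16 \<beta>0 by (intro mult_left_mono) auto
    also have "\<dots> = (sqrt 2 * 12) * \<eta>" unfolding \<eta>(2) real_sqrt_divide by (simp add: ac_simps)
    also have "\<dots> \<le> 17 * \<eta>" using s2 \<eta>(1) by (intro mult_right_mono) auto
    finally show ?thesis using dev_lipschitz[OF x u g[OF \<xi>] g[OF y]] by linarith
  qed
  define T' where "T' = T - (B1 \<union> B2)"
  have T's: "T' \<in> sets PG" unfolding T'_def using T(1) B1(1) B2(1) by blast
  have T'p: "7 / 8 \<le> measure PG T'"
  proof -
    have "measure PG T \<le> measure PG (T' \<union> (B1 \<union> B2))" using T's T(1) B1(1) B2(1) by (intro P.P.finite_measure_mono) (auto simp: T'_def)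
    also have "\<dots> \<le> measure PG T' + measure PG (B1 \<union> B2)" using T's B1(1) B2(1) by (intro measure_Un_le) auto
    also have "measure PG (B1 \<union> B2) \<le> measure PG B1 + measure PG B2" using B1(1) B2(1) by (intro measure_Un_le)
    finally show ?thesis using T(2) B1(2) B2(2) e9 by linarith
  qed
  have conc: "\<bar>dev x u \<xi> - m\<bar> \<le> \<delta>" if \<xi>: "\<xi> \<in> T'" for \<xi>
  proof -
    have \<xi>T: "\<xi> \<in> T" "\<xi> \<notin> B1" "\<xi> \<notin> B2" "\<xi> \<in> space PG" using \<xi> Ts by (auto simp: T'_def)
    obtain y where y: "y \<in> T" "dev x u y \<le> m + \<eta>" "wdist \<xi> y \<le> 6" using B1(3)[OF \<xi>T(4,2)] by blast
    obtain z where z: "z \<in> T" "m - \<eta> \<le> dev x u z" "wdist \<xi> z \<le> 6" using B2(3)[OF \<xi>T(4,3)] by blast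
    have "\<delta> = 18 * \<eta>" by (simp add: \<eta>_def)
    then show ?thesis using lip[OF \<xi>T(1) y(1,3)] lip[OF \<xi>T(1) z(1,3)] y(2) z(2) by linarith
  qed
  obtain T2 where T2: "T2 \<in> sets PG" "3 / 4 \<le> measure PG T2"
    and TL: "\<And>\<xi>. \<xi> \<in> T2 \<Longrightarrow> L2_set (\<lambda>i. Zd n \<beta> x (amat \<xi>) i - tlim n \<beta> x) {..<n} \<le> 150 * \<beta> / c ^ 4"
    by (rule F.typical_law[OF n1 n2 large]) blast
  have "T' \<inter> T2 \<noteq> {}"
  proof
    assume "T' \<inter> T2 = {}"
    then have "measure PG (T' \<union> T2) = measure PG T' + measure PG T2" using T's T2(1) by (intro P.P.finite_measure_Union) auto
    then show False using T'p T2(2) P.P.prob_le_1[of "T' \<union> T2"] by linarith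
  qed
  then obtain \<xi> where \<xi>: "\<xi> \<in> T'" "\<xi> \<in> T2" by blast
  have "\<bar>dev x u \<xi>\<bar> \<le> 150 * \<beta> / c ^ 4" unfolding dev_def by (rule order_trans[OF abs_sum_mult_le[OF u] TL[OF \<xi>(2)]])
  then have "\<bar>m\<bar> \<le> \<delta> + 150 * \<beta> / c ^ 4" using conc[OF \<xi>(1)] by linarith
  then have "centered x u m T'" unfolding centered_def using T's T'p conc g by (auto simp: T'_def)
  then show ?thesis by blast
qed

text \<open>One fixed number for each \<open>x\<close> and \<open>u\<close>, so that differences of
  centres telescope along a chain.\<close>

definition cen :: "(nat \<Rightarrow> real) \<Rightarrow> (nat \<Rightarrow> real) \<Rightarrow> real" where "cen x u = (SOME m. \<exists>T. centered x u m T)"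

lemma cen:
  assumes "x \<in> cube" "L2_set u {..<n} \<le> 1"
  obtains T where "T \<in> sets PG" "7 / 8 \<le> measure PG T" "\<And>\<xi>. \<xi> \<in> T \<Longrightarrow> good n \<beta> \<kappa> x (amat \<xi>)"
    "\<And>\<xi>. \<xi> \<in> T \<Longrightarrow> \<bar>dev x u \<xi> - cen x u\<bar> \<le> \<delta>"
proof -
  have "\<exists>T. centered x u (cen x u) T" unfolding cen_def by (rule someI_ex) (rule ex_centered[OF assms])
  then show thesis using that unfolding centered_def by blast
qed

lemma cen_le:
  assumes "x \<in> cube" "L2_set u {..<n} \<le> 1"
  shows "\<bar>cen x u\<bar> \<le> \<delta> + 150 * \<beta> / c ^ 4"
proof -
  have "\<exists>T. centered x u (cen x u) T" unfolding cen_def by (rule someI_ex) (rule ex_centered[OF assms])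
  then show ?thesis unfolding centered_def by blast
qed

text \<open>Standardised distance is \<open>sqrt (n / 2)\<close> times Frobenius distance, which
  turns the exponent \<open>r\<^sup>2 / 4\<close> into
  \<open>n * \<rho>\<^sup>2 / 8\<close>.\<close>

lemma frob_enlargement:
  assumes S: "S \<in> sets PG" "1 / 2 \<le> measure PG S" and \<rho>: "0 < \<rho>"
  obtains B where "B \<in> sets PG" "measure PG B \<le> 2 * exp (- (real n * \<rho>\<^sup>2) / 8)"
    "\<And>\<xi>. \<xi> \<in> space PG \<Longrightarrow> \<xi> \<notin> B \<Longrightarrow> \<exists>y\<in>S. frob n (amat y - amat \<xi>) \<le> \<rho>"
proof -
  define r where "r = \<rho> * sqrt (n / 2)"
  have r: "0 < r" using \<rho> n0 by (simp add: r_def)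
  have r2: "r\<^sup>2 / 4 = real n * \<rho>\<^sup>2 / 8" by (simp add: r_def power_mult_distrib)
  obtain B where B: "B \<in> sets PG" "measure PG B \<le> exp (- r\<^sup>2 / 4) / (1 / 2)"
    "\<And>\<xi>. \<xi> \<in> space PG \<Longrightarrow> \<xi> \<notin> B \<Longrightarrow> \<exists>y\<in>S. wdist \<xi> y \<le> r"
    by (rule enlargement[OF S(1) _ S(2) r]) auto
  show thesis
  proof (rule that[OF B(1)])
    show "measure PG B \<le> 2 * exp (- (real n * \<rho>\<^sup>2) / 8)" using B(2) r2 by simp
    fix \<xi> assume "\<xi> \<in> space PG" "\<xi> \<notin> B"
    then obtain y where y: "y \<in> S" "wdist \<xi> y \<le> r" using B(3) by blast
    have "frob n (amat y - amat \<xi>) \<le> sqrt (2 / n) * r" unfolding frob_amat wdist_sym[of y] using y(2) by (intro mult_left_mono) auto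
    also have "\<dots> = \<rho> * (sqrt (2 / n) * sqrt (n / 2))" by (simp add: r_def)
    also have "sqrt (2 / n) * sqrt (n / 2) = 1" using n0 by (simp add: real_sqrt_mult[symmetric])
    finally show "\<exists>y\<in>S. frob n (amat y - amat \<xi>) \<le> \<rho>" using y(1) by auto
  qed
qed

text \<open>Off \<open>B\<close> some point of the concentration set lies within \<rho>. If the
  given point is well conditioned too, the Lipschitz bound between these two points transfers the
  deviation.\<close>

lemma base_event:
  assumes x: "x \<in> cube" and u: "L2_set u {..<n} \<le> 1" and \<rho>: "0 < \<rho>"
  shows "\<exists>B\<in>sets PG. measure PG B \<le> 2 * exp (- (real n * \<rho>\<^sup>2) / 8) \<and>
    (\<forall>\<xi>\<in>space PG - B. good n \<beta> \<kappa> x (amat \<xi>) \<longrightarrow> \<bar>dev x u \<xi> - cen x u\<bar> \<le> \<delta> + 2 * \<kappa> ^ 3 * \<beta> * \<rho>)"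
proof -
  obtain T where T: "T \<in> sets PG" "7 / 8 \<le> measure PG T" "\<And>\<xi>. \<xi> \<in> T \<Longrightarrow> good n \<beta> \<kappa> x (amat \<xi>)"
    "\<And>\<xi>. \<xi> \<in> T \<Longrightarrow> \<bar>dev x u \<xi> - cen x u\<bar> \<le> \<delta>" by (rule cen[OF x u]) blast
  have half: "1 / 2 \<le> measure PG T" using T(2) by simp
  obtain B where B: "B \<in> sets PG" "measure PG B \<le> 2 * exp (- (real n * \<rho>\<^sup>2) / 8)"
    "\<And>\<xi>. \<xi> \<in> space PG \<Longrightarrow> \<xi> \<notin> B \<Longrightarrow> \<exists>y\<in>T. frob n (amat y - amat \<xi>) \<le> \<rho>" by (rule frob_enlargement[OF T(1) half \<rho>]) blast
  have "\<bar>dev x u \<xi> - cen x u\<bar> \<le> \<delta> + 2 * \<kappa> ^ 3 * \<beta> * \<rho>" if \<xi>: "\<xi> \<in> space PG" "\<xi> \<notin> B" and g: "good n \<beta> \<kappa> x (amat \<xi>)" for \<xi>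
  proof -
    obtain y where y: "y \<in> T" "frob n (amat y - amat \<xi>) \<le> \<rho>" using B(3)[OF \<xi>] by blast
    have "2 * \<kappa> ^ 3 * \<beta> * frob n (amat y - amat \<xi>) \<le> 2 * \<kappa> ^ 3 * \<beta> * \<rho>" using y(2) \<kappa>16 \<beta>0 by (intro mult_left_mono) auto
    then show ?thesis using dev_lipschitz[OF x u g T(3)[OF y(1)]] T(4)[OF y(1)] by linarith
  qed
  then show ?thesis using B(1,2) by blast
qed

text \<open>The enlargement now starts from the intersection of the two concentration sets. The
  second difference bound gains the factor \<open>d\<close>, and the two centres cost
  \<open>2 * \<delta>\<close>.\<close>

lemma increment_event:
  assumes x: "x \<in> cube" "x' \<in> cube" and u: "L2_set u {..<n} \<le> 1" and \<rho>: "0 < \<rho>" and d: "\<And>i. i < n \<Longrightarrow> \<bar>x' i - x i\<bar> \<le> d"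
  shows "\<exists>B\<in>sets PG. measure PG B \<le> 2 * exp (- (real n * \<rho>\<^sup>2) / 8) \<and>
    (\<forall>\<xi>\<in>space PG - B. good n \<beta> \<kappa> x (amat \<xi>) \<and> good n \<beta> \<kappa> x' (amat \<xi>) \<longrightarrow>
      \<bar>(dev x' u \<xi> - dev x u \<xi>) - (cen x' u - cen x u)\<bar> \<le> 2 * \<delta> + 50 * \<kappa> ^ 4 * \<beta> * d * \<rho>)"
proof -
  obtain T where T: "T \<in> sets PG" "7 / 8 \<le> measure PG T" "\<And>\<xi>. \<xi> \<in> T \<Longrightarrow> good n \<beta> \<kappa> x (amat \<xi>)"
    "\<And>\<xi>. \<xi> \<in> T \<Longrightarrow> \<bar>dev x u \<xi> - cen x u\<bar> \<le> \<delta>" by (rule cen[OF x(1) u]) blast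
  obtain T' where T': "T' \<in> sets PG" "7 / 8 \<le> measure PG T'" "\<And>\<xi>. \<xi> \<in> T' \<Longrightarrow> good n \<beta> \<kappa> x' (amat \<xi>)"
    "\<And>\<xi>. \<xi> \<in> T' \<Longrightarrow> \<bar>dev x' u \<xi> - cen x' u\<bar> \<le> \<delta>" by (rule cen[OF x(2) u]) blast
  have TT: "T \<inter> T' \<in> sets PG" using T(1) T'(1) by blast
  have half: "1 / 2 \<le> measure PG (T \<inter> T')"
  proof -
    have "measure PG T \<le> measure PG ((T \<inter> T') \<union> (space PG - T'))"
      using T(1) T'(1) TT sets.sets_into_space[OF T(1)] by (intro P.P.finite_measure_mono) auto
    also have "\<dots> \<le> measure PG (T \<inter> T') + measure PG (space PG - T')" using TT T'(1) by (intro measure_Un_le) auto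
    finally show ?thesis using T(2) T'(2) P.P.prob_compl[OF T'(1)] by linarith
  qed
  obtain B where B: "B \<in> sets PG" "measure PG B \<le> 2 * exp (- (real n * \<rho>\<^sup>2) / 8)"
    "\<And>\<xi>. \<xi> \<in> space PG \<Longrightarrow> \<xi> \<notin> B \<Longrightarrow> \<exists>y\<in>T \<inter> T'. frob n (amat y - amat \<xi>) \<le> \<rho>" by (rule frob_enlargement[OF TT half \<rho>]) blast
  have d0: "0 \<le> d" using d[OF n0] by linarith
  have "\<bar>(dev x' u \<xi> - dev x u \<xi>) - (cen x' u - cen x u)\<bar> \<le> 2 * \<delta> + 50 * \<kappa> ^ 4 * \<beta> * d * \<rho>"
    if \<xi>: "\<xi> \<in> space PG" "\<xi> \<notin> B" and g: "good n \<beta> \<kappa> x (amat \<xi>)" "good n \<beta> \<kappa> x' (amat \<xi>)" for \<xi>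
  proof -
    obtain y where y: "y \<in> T" "y \<in> T'" "frob n (amat y - amat \<xi>) \<le> \<rho>" using B(3)[OF \<xi>] by blast
    have "50 * \<kappa> ^ 4 * \<beta> * d * frob n (amat y - amat \<xi>) \<le> 50 * \<kappa> ^ 4 * \<beta> * d * \<rho>" using y(3) \<kappa>16 \<beta>0 d0 by (intro mult_left_mono) auto
    then show ?thesis using dev_second_diff[OF x u g T(3)[OF y(1)] T'(3)[OF y(2)] d] T(4)[OF y(1)] T'(4)[OF y(2)] by linarith
  qed
  then show ?thesis using B(1,2) by blast
qed

text \<open>Enlarging the event of norm 3 by Frobenius radius 3 improves the failure exponent from
  \<open>n / 32\<close> to \<open>9 * n / 8\<close>, at the price of the norm bound 6.\<close>

lemma norm_event: "\<exists>B\<in>sets PG. measure PG B \<le> 2 * exp (- real n) \<and> (\<forall>\<xi>\<in>space PG - B. op_bound n (amat \<xi>) 6)"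
proof -
  obtain T where T: "T \<in> sets PG" "1 - 2 * exp (- real n / 32) \<le> measure PG T" "\<And>\<xi>. \<xi> \<in> T \<Longrightarrow> op_bound n (amat \<xi>) 3"
    by (rule op_norm_event) blast
  have half: "1 / 2 \<le> measure PG T" using T(2) n2 by linarith
  obtain B where B: "B \<in> sets PG" "measure PG B \<le> 2 * exp (- (n * 3\<^sup>2) / 8)"
    "\<And>\<xi>. \<xi> \<in> space PG \<Longrightarrow> \<xi> \<notin> B \<Longrightarrow> \<exists>y\<in>T. frob n (amat y - amat \<xi>) \<le> 3" by (rule frob_enlargement[OF T(1) half, of 3]) auto
  have "op_bound n (amat \<xi>) 6" if \<xi>: "\<xi> \<in> space PG" "\<xi> \<notin> B" for \<xi>
  proof -
    obtain y where y: "y \<in> T" "frob n (amat y - amat \<xi>) \<le> 3" using B(3)[OF \<xi>] by blast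
    have "op_bound n (amat y - amat \<xi>) 3" by (rule op_bound_mono[OF op_bound_frob y(2)]) (intro minus_carrier_mat amat_carrier)
    then have "op_bound n (amat y - (amat y - amat \<xi>)) (3 + 3)" by (rule op_bound_diff[OF T(3)[OF y(1)]])
    moreover have "amat y - (amat y - amat \<xi>) = amat \<xi>" by (intro eq_matI) (auto simp: carrier_matD[OF amat_carrier])
    ultimately show ?thesis by simp
  qed
  moreover have "exp (- (n * 3\<^sup>2) / 8) \<le> exp (- real n)" by simp
  then have "measure PG B \<le> 2 * exp (- real n)" using B(2) by linarith
  ultimately show ?thesis using B(1) by blast
qed

end

section \<open>Nets of directions and dyadic scales\<close>

lemma integer_truncation:
  fixes v h :: real
  assumes h: "0 < h"
  obtains z :: int where "(h * z)\<^sup>2 \<le> v\<^sup>2" "v\<^sup>2 - h * \<bar>v\<bar> \<le> h * z * v"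
proof -
  define y where "y = h * \<lfloor>\<bar>v\<bar> / h\<rfloor>"
  have y: "0 \<le> y" "y \<le> \<bar>v\<bar>" "\<bar>v\<bar> - h \<le> y"
  proof -
    have f: "of_int \<lfloor>\<bar>v\<bar> / h\<rfloor> \<le> \<bar>v\<bar> / h" "\<bar>v\<bar> / h \<le> of_int \<lfloor>\<bar>v\<bar> / h\<rfloor> + 1" "0 \<le> \<lfloor>\<bar>v\<bar> / h\<rfloor>" using h by (auto simp: floor_correct less_imp_le)
    have "h * of_int \<lfloor>\<bar>v\<bar> / h\<rfloor> \<le> h * (\<bar>v\<bar> / h)" "h * (\<bar>v\<bar> / h) \<le> h * (of_int \<lfloor>\<bar>v\<bar> / h\<rfloor> + 1)" "0 \<le> h * of_int \<lfloor>\<bar>v\<bar> / h\<rfloor>"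
      using mult_left_mono[OF f(1), of h] mult_left_mono[OF f(2), of h] f(3) h by simp_all
    then show "0 \<le> y" "y \<le> \<bar>v\<bar>" "\<bar>v\<bar> - h \<le> y" unfolding y_def using h by (simp_all add: distrib_left)
  qed
  have sq: "y\<^sup>2 \<le> v\<^sup>2" using power_mono[OF y(2,1), of 2] by simp
  have "(\<bar>v\<bar> - h) * \<bar>v\<bar> \<le> y * \<bar>v\<bar>" using y(3) by (intro mult_right_mono) auto
  then have low: "v\<^sup>2 - h * \<bar>v\<bar> \<le> y * \<bar>v\<bar>" by (simp add: left_diff_distrib power2_eq_square)
  show thesis
  proof (cases "0 \<le> v")
    case True
    then show thesis using that[of "\<lfloor>\<bar>v\<bar> / h\<rfloor>"] sq low by (simp add: y_def)
  next
    case False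
    then show thesis using that[of "- \<lfloor>\<bar>v\<bar> / h\<rfloor>"] sq low by (simp add: y_def)
  qed
qed

lemma sum_half_power_abs: "(\<Sum>z\<in>{- int m..int m}. (1 / 2 :: real) ^ nat \<bar>z\<bar>) \<le> 3"
proof -
  have "(\<Sum>z\<in>{- int m..int m}. (1 / 2 :: real) ^ nat \<bar>z\<bar>) = 3 - 2 * (1 / 2) ^ m"
  proof (induction m)
    case (Suc m)
    have "{- int (Suc m)..int (Suc m)} = insert (int (Suc m)) (insert (- int (Suc m)) {- int m..int m})" by auto
    then have "(\<Sum>z\<in>{- int (Suc m)..int (Suc m)}. (1 / 2 :: real) ^ nat \<bar>z\<bar>) = 2 * (1 / 2) ^ Suc m + (\<Sum>z\<in>{- int m..int m}. (1 / 2) ^ nat \<bar>z\<bar>)"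
      by (simp add: nat_add_distrib)
    then show ?case using Suc by simp
  qed simp
  then show ?thesis by simp
qed

text \<open>The net consists of the lattice points of mesh \<open>1 / (2 * sqrt n)\<close> in the
  unit ball. Rounding a unit vector towards zero keeps it in the ball and loses at most
  \<open>h * sqrt n = 1 / 2\<close> in the inner product, hence the factor 2.\<close>

lemma direction_net:
  assumes n: "n > 0"
  obtains U :: "(nat \<Rightarrow> real) set" where "finite U" "real (card U) \<le> 48 ^ n" "\<And>u. u \<in> U \<Longrightarrow> L2_set u {..<n} \<le> 1"
    "\<And>w. \<exists>u\<in>U. L2_set w {..<n} \<le> 2 * (\<Sum>i<n. u i * w i)"
proof -
  define h where "h = 1 / (2 * sqrt n)"
  have h: "0 < h" using n by (simp add: h_def)
  have h2: "h\<^sup>2 = 1 / (4 * n)" by (simp add: h_def power_mult_distrib power_divide)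
  define Z where "Z = {z \<in> PiE {..<n} (\<lambda>_. {- int (4 * n)..int (4 * n)}). (\<Sum>i<n. (z i)\<^sup>2) \<le> int (4 * n)}"
  have fP: "finite (PiE {..<n} (\<lambda>_. {- int (4 * n)..int (4 * n)}))" by (intro finite_PiE) auto
  have fZ: "finite Z" unfolding Z_def using fP by simp
  have abs_sq: "\<bar>a\<bar> \<le> a\<^sup>2" for a :: int
  proof (cases "a = 0")
    case False
    then have "1 \<le> \<bar>a\<bar>" by linarith
    then have "\<bar>a\<bar> * 1 \<le> \<bar>a\<bar> * \<bar>a\<bar>" by (intro mult_left_mono) auto
    then show ?thesis by (simp add: power2_eq_square)
  qed simp
  have cZ: "real (card Z) \<le> 48 ^ n"
  proof -
    have "real (card Z) = (\<Sum>z\<in>Z. 1)" by simp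
    \<comment> \<open>A weighted count. On \<open>Z\<close> the sum of the absolute values is at
      most \<open>4 * n\<close>, so each product of powers of 1/2 is at least
      \<open>1 / 16 ^ n\<close>; over the whole box these products factorise and sum to at most
      \<open>3 ^ n\<close>.\<close>
    also have "\<dots> \<le> (\<Sum>z\<in>Z. 16 ^ n * (\<Prod>i<n. (1 / 2) ^ nat \<bar>z i\<bar>))"
    proof (rule sum_mono)
      fix z assume z: "z \<in> Z"
      have "(\<Sum>i<n. \<bar>z i\<bar>) \<le> (\<Sum>i<n. (z i)\<^sup>2)" by (intro sum_mono abs_sq)
      also have "\<dots> \<le> int (4 * n)" using z by (simp add: Z_def)
      finally have "int (\<Sum>i<n. nat \<bar>z i\<bar>) \<le> int (4 * n)" by simp
      then have le: "(\<Sum>i<n. nat \<bar>z i\<bar>) \<le> 4 * n" by (simp only: of_nat_le_iff)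
      have "(16::real) ^ n * (1 / 2) ^ (4 * n) \<le> 16 ^ n * (1 / 2) ^ (\<Sum>i<n. nat \<bar>z i\<bar>)"
        by (intro mult_left_mono power_decreasing[OF le]) auto
      moreover have "(16::real) ^ n * (1 / 2) ^ (4 * n) = 1" unfolding power_mult power_mult_distrib[symmetric] by (simp add: power4_eq_xxxx)
      ultimately show "1 \<le> 16 ^ n * (\<Prod>i<n. (1 / 2 :: real) ^ nat \<bar>z i\<bar>)" by (simp only: power_sum)
    qed
    also have "\<dots> \<le> (\<Sum>z\<in>PiE {..<n} (\<lambda>_. {- int (4 * n)..int (4 * n)}). 16 ^ n * (\<Prod>i<n. (1 / 2) ^ nat \<bar>z i\<bar>))"
      using fP by (intro sum_mono2) (auto simp: Z_def prod_nonneg)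
    also have "\<dots> = 16 ^ n * (\<Prod>i<n. \<Sum>z\<in>{- int (4 * n)..int (4 * n)}. (1 / 2) ^ nat \<bar>z\<bar>)"
      by (subst prod_sum_PiE) (auto simp: sum_distrib_left)
    also have "\<dots> \<le> 16 ^ n * (\<Prod>i<n. 3)"
      by (intro mult_left_mono prod_mono conjI sum_nonneg sum_half_power_abs) auto
    also have "\<dots> = 48 ^ n" by (simp add: power_mult_distrib[symmetric])
    finally show ?thesis .
  qed
  define U where "U = (\<lambda>z i. h * real_of_int (z i)) ` Z"
  show thesis
  proof (rule that)
    show "finite U" unfolding U_def using fZ by simp
    have "card U \<le> card Z" unfolding U_def by (rule card_image_le[OF fZ])
    then show "real (card U) \<le> 48 ^ n" using cZ by linarith
  next
    fix u assume "u \<in> U"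
    then obtain z where z: "z \<in> Z" "u = (\<lambda>i. h * real_of_int (z i))" by (auto simp: U_def)
    have "real_of_int (\<Sum>i<n. (z i)\<^sup>2) \<le> real_of_int (int (4 * n))" using z(1) unfolding of_int_le_iff by (simp add: Z_def)
    then have "h\<^sup>2 * (\<Sum>i<n. (real_of_int (z i))\<^sup>2) \<le> h\<^sup>2 * (4 * n)" by (intro mult_left_mono) auto
    also have "\<dots> = 1" using n by (simp add: h2)
    finally have "(\<Sum>i<n. (u i)\<^sup>2) \<le> 1" by (simp add: z(2) power_mult_distrib sum_distrib_left)
    then show "L2_set u {..<n} \<le> 1" by (simp add: L2_set_def)
  next
    fix w :: "nat \<Rightarrow> real"
    define L where "L = L2_set w {..<n}"
    define v where "v i = (if L = 0 then 0 else w i / L)" for i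
    have L0: "0 \<le> L" by (simp add: L_def L2_set_nonneg)
    have wv: "w i = L * v i" if "i < n" for i
      using that L2_set_eq_0_iff[of "{..<n}" w] by (auto simp: v_def L_def)
    have v1: "(\<Sum>i<n. (v i)\<^sup>2) = (if L = 0 then 0 else 1)"
    proof (cases "L = 0")
      case False
      have "(\<Sum>i<n. (v i)\<^sup>2) = (\<Sum>i<n. (w i)\<^sup>2) / L\<^sup>2" using False by (simp add: v_def power_divide sum_divide_distrib)
      also have "(\<Sum>i<n. (w i)\<^sup>2) = L\<^sup>2" by (simp add: L_def L2_set_def sum_nonneg)
      finally show ?thesis using False by simp
    qed (simp add: v_def)
    have "\<exists>z::int. (h * z)\<^sup>2 \<le> (v i)\<^sup>2 \<and> (v i)\<^sup>2 - h * \<bar>v i\<bar> \<le> h * z * v i" for i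
      by (rule integer_truncation[OF h, of "v i"]) blast
    then obtain \<zeta> :: "nat \<Rightarrow> int" where \<zeta>: "\<And>i. (h * \<zeta> i)\<^sup>2 \<le> (v i)\<^sup>2" "\<And>i. (v i)\<^sup>2 - h * \<bar>v i\<bar> \<le> h * \<zeta> i * v i" by metis
    define z where "z = restrict \<zeta> {..<n}"
    have sz: "(\<Sum>i<n. (\<zeta> i)\<^sup>2) \<le> int (4 * n)"
    proof -
      have "h\<^sup>2 * (\<Sum>i<n. (real_of_int (\<zeta> i))\<^sup>2) \<le> (\<Sum>i<n. (v i)\<^sup>2)"
        unfolding sum_distrib_left power_mult_distrib[symmetric] by (intro sum_mono \<zeta>(1))
      also have "\<dots> \<le> h\<^sup>2 * (4 * n)" using v1 n by (simp add: h2)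
      finally have "(\<Sum>i<n. (real_of_int (\<zeta> i))\<^sup>2) \<le> 4 * n" using h by simp
      then have "real_of_int (\<Sum>i<n. (\<zeta> i)\<^sup>2) \<le> real_of_int (int (4 * n))" by simp
      then show ?thesis by (simp only: of_int_le_iff)
    qed
    have zZ: "z \<in> Z"
    proof -
      have "\<bar>\<zeta> i\<bar> \<le> int (4 * n)" if "i < n" for i
      proof -
        have "(\<zeta> i)\<^sup>2 \<le> (\<Sum>i<n. (\<zeta> i)\<^sup>2)" using that by (intro member_le_sum) auto
        then show ?thesis using abs_sq[of "\<zeta> i"] sz by linarith
      qed
      then have "z \<in> PiE {..<n} (\<lambda>_. {- int (4 * n)..int (4 * n)})" unfolding z_def by (auto simp: abs_le_iff) (smt (verit))
      moreover have "(\<Sum>i<n. (z i)\<^sup>2) = (\<Sum>i<n. (\<zeta> i)\<^sup>2)" by (intro sum.cong) (auto simp: z_def)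
      ultimately show ?thesis using sz by (simp add: Z_def)
    qed
    define u where "u = (\<lambda>i. h * real_of_int (z i))"
    have "L \<le> 2 * (\<Sum>i<n. u i * w i)"
    proof (cases "L = 0")
      case True
      then have "(\<Sum>i<n. u i * w i) = 0" using wv by simp
      then show ?thesis using True by simp
    next
      case False
      have sv: "(\<Sum>i<n. \<bar>v i\<bar>) \<le> sqrt n"
      proof -
        have "(\<Sum>i<n. \<bar>1\<bar> * \<bar>v i\<bar>) \<le> L2_set (\<lambda>_. 1) {..<n} * L2_set v {..<n}" by (rule L2_set_mult_ineq)
        also have "L2_set v {..<n} = 1" using v1 False by (simp add: L2_set_def)
        finally show ?thesis by (simp add: L2_set_one)
      qed
      have "1 / 2 = 1 - h * sqrt n" using n by (simp add: h_def)
      also have "\<dots> \<le> (\<Sum>i<n. (v i)\<^sup>2) - h * (\<Sum>i<n. \<bar>v i\<bar>)" using v1 False sv h by simp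
      also have "\<dots> = (\<Sum>i<n. (v i)\<^sup>2 - h * \<bar>v i\<bar>)" by (simp add: sum_subtractf sum_distrib_left)
      also have "\<dots> \<le> (\<Sum>i<n. u i * v i)" by (intro sum_mono) (use \<zeta>(2) in \<open>simp add: u_def z_def\<close>)
      finally have "L * (1 / 2) \<le> L * (\<Sum>i<n. u i * v i)" using L0 by (intro mult_left_mono)
      also have "\<dots> = (\<Sum>i<n. u i * w i)" unfolding sum_distrib_left by (intro sum.cong refl) (simp add: wv)
      finally show ?thesis by simp
    qed
    then show "\<exists>u\<in>U. L2_set w {..<n} \<le> 2 * (\<Sum>i<n. u i * w i)" unfolding L_def using zZ by (auto simp: U_def u_def)
  qed
qed

lemma dyadic_scale:
  fixes a :: real
  assumes a: "1 \<le> a"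
  obtains k :: nat where "a \<le> 2 ^ k" "2 ^ k \<le> 2 * a" "real k \<le> 2 * a"
proof -
  define k where "k = (LEAST k. a \<le> 2 ^ k)"
  have ex: "\<exists>k. a \<le> 2 ^ k" using real_arch_pow[of 2 a] by (auto intro: less_imp_le)
  have k: "a \<le> 2 ^ k" unfolding k_def by (rule LeastI_ex[OF ex])
  have k2: "2 ^ k \<le> 2 * a"
  proof (cases k)
    case 0
    then show ?thesis using a by simp
  next
    case (Suc l)
    have "\<not> a \<le> 2 ^ l" by (rule not_less_Least) (use Suc in \<open>simp add: k_def\<close>)
    then show ?thesis using Suc by simp
  qed
  have "real k < 2 ^ k" by (rule of_nat_less_two_power)
  then show thesis using that[OF k k2] k2 by linarith
qed

lemma sum_dyadic_le: "(\<Sum>k\<in>{l..<m}. real (k + 2) / 2 ^ k) \<le> 6"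
proof -
  have e: "(\<Sum>k<m. real (k + 2) / 2 ^ k) = 6 - (2 * m + 6) / 2 ^ m"
    by (induction m) (simp_all add: add_divide_distrib diff_divide_distrib)
  have "(\<Sum>k\<in>{l..<m}. real (k + 2) / 2 ^ k) \<le> (\<Sum>k<m. real (k + 2) / 2 ^ k)" by (intro sum_mono2) auto
  then show ?thesis unfolding e by (smt (verit) divide_nonneg_pos of_nat_0_le_iff zero_less_power)
qed

section \<open>Dyadic grids and the uniform bound\<close>

context chaining
begin

definition grid :: "nat \<Rightarrow> (nat \<Rightarrow> real) set" where
  "grid k = PiE {..<n} (\<lambda>_. (\<lambda>j. real j / 2 ^ k) ` {1..2 ^ k})"

text \<open>Rounding up keeps every coordinate positive, so a rounded profile stays in
  \<open>cube\<close>.\<close>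

definition rup :: "nat \<Rightarrow> (nat \<Rightarrow> real) \<Rightarrow> nat \<Rightarrow> real" where
  "rup k x = (\<lambda>i\<in>{..<n}. of_int \<lceil>2 ^ k * x i\<rceil> / 2 ^ k)"

lemma finite_grid: "finite (grid k)" unfolding grid_def by (intro finite_PiE) auto

lemma card_grid: "real (card (grid k)) \<le> (2 ^ k) ^ n"
proof -
  have "card (grid k) = card ((\<lambda>j. real j / 2 ^ k) ` {1..2 ^ k}) ^ n" unfolding grid_def by (simp add: card_PiE)
  also have "\<dots> \<le> (2 ^ k) ^ n" using card_image_le[of "{1..2 ^ k}" "\<lambda>j. real j / 2 ^ k"] by (intro power_mono) auto
  finally have "real (card (grid k)) \<le> real ((2 ^ k) ^ n)" by (simp only: of_nat_le_iff)
  then show ?thesis by simp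
qed

lemma grid_cube:
  assumes x: "x \<in> grid k"
  shows "x \<in> cube"
proof -
  have "0 < x i \<and> x i \<le> 1" if i: "i < n" for i
  proof -
    have "x i \<in> (\<lambda>j. real j / 2 ^ k) ` {1..2 ^ k}" using PiE_mem[OF x[unfolded grid_def], of i] i by simp
    then obtain j where j: "x i = real j / 2 ^ k" "1 \<le> j" "j \<le> 2 ^ k" by auto
    have "real j \<le> real (2 ^ k)" using j(3) by (simp only: of_nat_le_iff)
    then show ?thesis using j by simp
  qed
  then show "x \<in> cube" by (simp add: cube_def)
qed

lemma rup:
  assumes x: "x \<in> cube"
  shows "rup k x \<in> grid k" and "\<And>i. i < n \<Longrightarrow> x i \<le> rup k x i \<and> rup k x i \<le> x i + 1 / 2 ^ k"
proof -
  have p: "(0::real) < 2 ^ k" by simp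
  have c: "2 ^ k * x i \<le> of_int \<lceil>2 ^ k * x i\<rceil>" "of_int \<lceil>2 ^ k * x i\<rceil> \<le> 2 ^ k * x i + 1" for i by (simp_all add: of_int_ceiling_le_add_one)
  show "x i \<le> rup k x i \<and> rup k x i \<le> x i + 1 / 2 ^ k" if "i < n" for i
    using c[of i] that p by (simp add: rup_def field_simps)
  show "rup k x \<in> grid k" unfolding grid_def rup_def
  proof (rule restrict_PiE_iff[THEN iffD2], intro ballI)
    fix i assume "i \<in> {..<n}"
    then have xi: "0 < x i" "x i \<le> 1" using x by (auto simp: cube_def)
    have "0 < \<lceil>2 ^ k * x i\<rceil>" using xi by (simp add: zero_less_ceiling)
    moreover have "\<lceil>2 ^ k * x i\<rceil> \<le> 2 ^ k"
    proof -
      have "2 ^ k * x i \<le> 2 ^ k * 1" using xi by (intro mult_left_mono) auto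
      then show ?thesis by (simp add: ceiling_le_iff)
    qed
    ultimately have "nat \<lceil>2 ^ k * x i\<rceil> \<in> {1..2 ^ k}" "real_of_int \<lceil>2 ^ k * x i\<rceil> = real (nat \<lceil>2 ^ k * x i\<rceil>)"
    proof -
      assume a: "0 < \<lceil>2 ^ k * x i\<rceil>" "\<lceil>2 ^ k * x i\<rceil> \<le> 2 ^ k"
      have "1 \<le> nat \<lceil>2 ^ k * x i\<rceil>" using a(1) by linarith
      moreover have "nat \<lceil>2 ^ k * x i\<rceil> \<le> 2 ^ k" using a(2) by (simp add: nat_le_iff)
      ultimately show "nat \<lceil>2 ^ k * x i\<rceil> \<in> {1..2 ^ k}" by simp
      show "real_of_int \<lceil>2 ^ k * x i\<rceil> = real (nat \<lceil>2 ^ k * x i\<rceil>)" using a(1) by simp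
    qed
    then show "real_of_int \<lceil>2 ^ k * x i\<rceil> / 2 ^ k \<in> (\<lambda>j. real j / 2 ^ k) ` {1..2 ^ k}" by (metis imageI)
  qed
qed

text \<open>The count is at most \<open>exp (n * (2 * k + 7))\<close>, against a concentration
  exponent \<open>25 * n * (k + 2)\<^sup>2 / 8\<close>. The radius \<open>5 * (k + 2)\<close> thus
  pays for the entropy and leaves a factor summable in \<open>k\<close>.\<close>

lemma entropy_bound:
  assumes c: "cd \<le> (2 ^ (2 * k + 1)) ^ n * 48 ^ n"
  shows "cd * (2 * exp (- (n * (5 * real (k + 2))\<^sup>2) / 8)) \<le> 2 * exp (- real n * real (k + 1))"
proof -
  have two: "(2::real) \<le> exp 1" using exp_ge_add_one_self[of "1::real"] by simp
  have p: "2 ^ m \<le> exp (real m)" for m :: nat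
    using power_mono[OF two, of m] by (simp add: exp_of_nat_mult[symmetric])
  have "(48::real) \<le> 2 ^ 6" by simp
  also have "\<dots> \<le> exp 6" using p[of 6] by simp
  finally have p6: "(48::real) \<le> exp 6" .
  have "(2 ^ (2 * k + 1)) ^ n * 48 ^ n \<le> exp (real (2 * k + 1)) ^ n * exp 6 ^ n"
    by (intro mult_mono power_mono p p6) auto
  also have "\<dots> = exp (real n * (2 * k + 7))" by (simp add: exp_of_nat_mult[symmetric] exp_add[symmetric] algebra_simps)
  finally have "cd \<le> exp (real n * (2 * k + 7))" using c by linarith
  then have "cd * (2 * exp (- (n * (5 * real (k + 2))\<^sup>2) / 8)) \<le> exp (real n * (2 * k + 7)) * (2 * exp (- (n * (5 * real (k + 2))\<^sup>2) / 8))"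
    by (intro mult_right_mono) auto
  also have "\<dots> = 2 * exp (real n * (2 * k + 7) - n * (5 * real (k + 2))\<^sup>2 / 8)" by (simp add: exp_add[symmetric] exp_diff field_simps exp_minus)
  also have "\<dots> \<le> 2 * exp (- real n * real (k + 1))"
  proof -
    have "(2 * real k + 7) - (5 * real (k + 2))\<^sup>2 / 8 \<le> - real (k + 1)" by (simp add: power2_eq_square algebra_simps)
    then have "real n * ((2 * real k + 7) - (5 * real (k + 2))\<^sup>2 / 8) \<le> real n * (- real (k + 1))" by (intro mult_left_mono) auto
    then show ?thesis by (simp add: algebra_simps)
  qed
  finally show ?thesis .
qed

text \<open>The chain starts at mesh at most \<open>1 / (4 * \<kappa>)\<close>, fine enough for grid
  points to inherit the conditioning of \<open>x\<close>, and ends near \<open>1 / sqrt n\<close>,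
  where the deterministic Lipschitz bound in \<open>x\<close> costs a constant. There are at most
  \<open>2 * sqrt n\<close> levels, so the errors \<open>2 * \<delta>\<close> from the centres also
  add up to a constant.\<close>

lemma uniform_law:
  assumes big: "8 * \<kappa> \<le> sqrt n"
  obtains E where "E \<in> sets PG" "1 - 8 * exp (- real n) \<le> measure PG E"
    "\<And>\<xi>. \<xi> \<in> E \<Longrightarrow> op_bound n (amat \<xi>) 6"
    "\<And>\<xi> x. \<xi> \<in> E \<Longrightarrow> x \<in> cube \<Longrightarrow> \<forall>v\<in>carrier_vec n. 4 / \<kappa> * vnorm v \<le> vnorm (resm n \<beta> x (amat \<xi>) *\<^sub>v v) \<Longrightarrow>
      L2_set (\<lambda>i. Zd n \<beta> x (amat \<xi>) i - tlim n \<beta> x) {..<n} \<le> 4000 * \<kappa> ^ 4 * \<beta>"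
proof -
  obtain U :: "(nat \<Rightarrow> real) set" where U: "finite U" "real (card U) \<le> 48 ^ n" "\<And>u. u \<in> U \<Longrightarrow> L2_set u {..<n} \<le> 1"
    "\<And>w. \<exists>u\<in>U. L2_set w {..<n} \<le> 2 * (\<Sum>i<n. u i * w i)" by (rule direction_net[OF n0]) blast
  define \<rho> where "\<rho> k = 5 * real (k + 2)" for k :: nat
  have \<rho>: "0 < \<rho> k" for k by (simp add: \<rho>_def)
  have n1': "1 \<le> sqrt n" using n0 by simp
  obtain k0 :: nat where k0: "4 * \<kappa> \<le> 2 ^ k0" "2 ^ k0 \<le> 2 * (4 * \<kappa>)" "k0 \<le> 2 * (4 * \<kappa>)"
    by (rule dyadic_scale[of "4 * \<kappa>"]) (use \<kappa>16 in auto)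
  obtain K :: nat where K: "sqrt n \<le> 2 ^ K" "2 ^ K \<le> 2 * sqrt n" "K \<le> 2 * sqrt n" by (rule dyadic_scale[OF n1']) blast
  have k0K: "k0 \<le> K"
  proof -
    have "(2::real) ^ k0 \<le> 2 ^ K" using k0(2) big K(1) by linarith
    then show ?thesis by (simp add: power_increasing_iff)
  qed
  have base: "\<exists>B\<in>sets PG. measure PG B \<le> 2 * exp (- real n) \<and> (\<forall>\<xi>\<in>space PG - B. \<forall>x\<in>grid k0. \<forall>u\<in>U. good n \<beta> \<kappa> x (amat \<xi>) \<longrightarrow>
    \<bar>dev x u \<xi> - cen x u\<bar> \<le> \<delta> + 2 * \<kappa> ^ 3 * \<beta> * \<rho> k0)"
  proof -
    define J where "J = grid k0 \<times> U"
    have fJ: "finite J" unfolding J_def using finite_grid U(1) by simp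
    define Q where "Q j \<xi> \<longleftrightarrow> (good n \<beta> \<kappa> (fst j) (amat \<xi>) \<longrightarrow> \<bar>dev (fst j) (snd j) \<xi> - cen (fst j) (snd j)\<bar> \<le> \<delta> + 2 * \<kappa> ^ 3 * \<beta> * \<rho> k0)" for j \<xi>
    have ev: "\<exists>B\<in>sets PG. measure PG B \<le> 2 * exp (- (n * (\<rho> k0)\<^sup>2) / 8) \<and> (\<forall>\<xi>\<in>space PG - B. Q j \<xi>)" if j: "j \<in> J" for j
    proof -
      have "fst j \<in> cube" "L2_set (snd j) {..<n} \<le> 1" using j U(3) by (auto simp: J_def intro: grid_cube)
      from base_event[OF this \<rho>] show ?thesis unfolding Q_def .
    qed
    have "\<exists>B\<in>sets PG. measure PG B \<le> (\<Sum>j\<in>J. 2 * exp (- (n * (\<rho> k0)\<^sup>2) / 8)) \<and> (\<forall>\<xi>\<in>space PG - B. \<forall>j\<in>J. Q j \<xi>)"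
      by (rule P.P.union_bound[OF fJ]) (rule ev)
    then obtain B where B: "B \<in> sets PG" "measure PG B \<le> (\<Sum>j\<in>J. 2 * exp (- (n * (\<rho> k0)\<^sup>2) / 8))" "\<And>\<xi> j. \<xi> \<in> space PG \<Longrightarrow> \<xi> \<notin> B \<Longrightarrow> j \<in> J \<Longrightarrow> Q j \<xi>"
      by blast
    have "real (card J) \<le> (2 ^ k0) ^ n * 48 ^ n"
      unfolding J_def card_cartesian_product of_nat_mult by (intro mult_mono card_grid U(2)) auto
    also have "\<dots> \<le> (2 ^ (2 * k0 + 1)) ^ n * 48 ^ n" by (intro mult_right_mono power_mono power_increasing) auto
    finally have "measure PG B \<le> 2 * exp (- real n * real (k0 + 1))" using B(2) entropy_bound[of "real (card J)" k0] by (simp add: \<rho>_def)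
    also have "\<dots> \<le> 2 * exp (- real n)" by (simp add: algebra_simps)
    finally have "measure PG B \<le> 2 * exp (- real n)" .
    moreover have "\<forall>\<xi>\<in>space PG - B. \<forall>x\<in>grid k0. \<forall>u\<in>U. good n \<beta> \<kappa> x (amat \<xi>) \<longrightarrow> \<bar>dev x u \<xi> - cen x u\<bar> \<le> \<delta> + 2 * \<kappa> ^ 3 * \<beta> * \<rho> k0"
      using B(3)[of _ "(x, u)" for x u] by (simp add: Q_def J_def)
    ultimately show ?thesis using B(1) by blast
  qed
  define near where "near k x x' \<longleftrightarrow> (\<forall>i<n. \<bar>x' i - x i\<bar> \<le> 1 / 2 ^ k)" for k :: nat and x x' :: "nat \<Rightarrow> real"
  define R where "R k \<xi> \<longleftrightarrow> (\<forall>x\<in>grid k. \<forall>x'\<in>grid (Suc k). \<forall>u\<in>U. near k x x' \<longrightarrow> good n \<beta> \<kappa> x (amat \<xi>) \<and> good n \<beta> \<kappa> x' (amat \<xi>) \<longrightarrow>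
    \<bar>(dev x' u \<xi> - dev x u \<xi>) - (cen x' u - cen x u)\<bar> \<le> 2 * \<delta> + 50 * \<kappa> ^ 4 * \<beta> * (1 / 2 ^ k) * \<rho> k)" for k \<xi>
  have level: "\<exists>B\<in>sets PG. measure PG B \<le> 2 * exp (- real n * real (k + 1)) \<and> (\<forall>\<xi>\<in>space PG - B. R k \<xi>)" for k
  proof -
    define J where "J = {(x, x', u) \<in> grid k \<times> grid (Suc k) \<times> U. near k x x'}"
    have JS: "J \<subseteq> grid k \<times> grid (Suc k) \<times> U" unfolding J_def by blast
    have fS: "finite (grid k \<times> grid (Suc k) \<times> U)" using finite_grid U(1) by simp
    have fJ: "finite J" by (rule finite_subset[OF JS fS])
    define Q where "Q j \<xi> \<longleftrightarrow> (good n \<beta> \<kappa> (fst j) (amat \<xi>) \<and> good n \<beta> \<kappa> (fst (snd j)) (amat \<xi>) \<longrightarrow>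
      \<bar>(dev (fst (snd j)) (snd (snd j)) \<xi> - dev (fst j) (snd (snd j)) \<xi>) - (cen (fst (snd j)) (snd (snd j)) - cen (fst j) (snd (snd j)))\<bar> \<le> 2 * \<delta> + 50 * \<kappa> ^ 4 * \<beta> * (1 / 2 ^ k) * \<rho> k)" for j \<xi>
    have ev: "\<exists>B\<in>sets PG. measure PG B \<le> 2 * exp (- (n * (\<rho> k)\<^sup>2) / 8) \<and> (\<forall>\<xi>\<in>space PG - B. Q j \<xi>)" if j: "j \<in> J" for j
    proof -
      have c: "fst j \<in> cube" "fst (snd j) \<in> cube" "L2_set (snd (snd j)) {..<n} \<le> 1" using j U(3) by (auto simp: J_def intro: grid_cube)
      have d: "\<bar>fst (snd j) i - fst j i\<bar> \<le> 1 / 2 ^ k" if "i < n" for i using j that by (auto simp: J_def near_def)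
      from increment_event[OF c \<rho> d] show ?thesis unfolding Q_def .
    qed
    have "\<exists>B\<in>sets PG. measure PG B \<le> (\<Sum>j\<in>J. 2 * exp (- (n * (\<rho> k)\<^sup>2) / 8)) \<and> (\<forall>\<xi>\<in>space PG - B. \<forall>j\<in>J. Q j \<xi>)"
      by (rule P.P.union_bound[OF fJ]) (rule ev)
    then obtain B where B: "B \<in> sets PG" "measure PG B \<le> (\<Sum>j\<in>J. 2 * exp (- (n * (\<rho> k)\<^sup>2) / 8))" "\<And>\<xi> j. \<xi> \<in> space PG \<Longrightarrow> \<xi> \<notin> B \<Longrightarrow> j \<in> J \<Longrightarrow> Q j \<xi>"
      by blast
    have "real (card J) \<le> real (card (grid k \<times> grid (Suc k) \<times> U))" unfolding of_nat_le_iff by (rule card_mono[OF fS JS])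
    also have "\<dots> \<le> (2 ^ k) ^ n * ((2 ^ Suc k) ^ n * 48 ^ n)"
      unfolding card_cartesian_product of_nat_mult by (intro mult_mono card_grid U(2)) auto
    also have "\<dots> = (2 ^ (2 * k + 1)) ^ n * 48 ^ n"
    proof -
      have "2 * k + 1 = k + Suc k" by simp
      then have "(2::real) ^ (2 * k + 1) = 2 ^ k * 2 ^ Suc k" by (simp only: power_add)
      then show ?thesis by (simp only: power_mult_distrib mult.assoc)
    qed
    finally have "measure PG B \<le> 2 * exp (- real n * real (k + 1))" using B(2) entropy_bound[of "real (card J)" k] by (simp add: \<rho>_def)
    moreover have "R k \<xi>" if "\<xi> \<in> space PG - B" for \<xi>
      unfolding R_def
    proof (intro ballI impI)
      fix x x' u assume "x \<in> grid k" "x' \<in> grid (Suc k)" "u \<in> U" "near k x x'" and g: "good n \<beta> \<kappa> x (amat \<xi>) \<and> good n \<beta> \<kappa> x' (amat \<xi>)"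
      then have "(x, x', u) \<in> J" by (simp add: J_def)
      then have "Q (x, x', u) \<xi>" using B(3) that by blast
      then show "\<bar>(dev x' u \<xi> - dev x u \<xi>) - (cen x' u - cen x u)\<bar> \<le> 2 * \<delta> + 50 * \<kappa> ^ 4 * \<beta> * (1 / 2 ^ k) * \<rho> k" using g by (simp add: Q_def)
    qed
    ultimately show ?thesis using B(1) by blast
  qed
  obtain B1 where B1: "B1 \<in> sets PG" "measure PG B1 \<le> 2 * exp (- real n)" "\<And>\<xi>. \<xi> \<in> space PG \<Longrightarrow> \<xi> \<notin> B1 \<Longrightarrow> op_bound n (amat \<xi>) 6"
    using norm_event by blast
  obtain B2 where B2: "B2 \<in> sets PG" "measure PG B2 \<le> 2 * exp (- real n)"
    "\<And>\<xi> x u. \<xi> \<in> space PG \<Longrightarrow> \<xi> \<notin> B2 \<Longrightarrow> x \<in> grid k0 \<Longrightarrow> u \<in> U \<Longrightarrow> good n \<beta> \<kappa> x (amat \<xi>) \<Longrightarrow> \<bar>dev x u \<xi> - cen x u\<bar> \<le> \<delta> + 2 * \<kappa> ^ 3 * \<beta> * \<rho> k0"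
    using base by blast
  have "\<exists>B\<in>sets PG. measure PG B \<le> (\<Sum>k\<in>{k0..<K}. 2 * exp (- real n * real (k + 1))) \<and> (\<forall>\<xi>\<in>space PG - B. \<forall>k\<in>{k0..<K}. R k \<xi>)"
    by (rule P.P.union_bound[OF finite_atLeastLessThan]) (rule level)
  then obtain B3 where B3: "B3 \<in> sets PG" "measure PG B3 \<le> (\<Sum>k\<in>{k0..<K}. 2 * exp (- real n * real (k + 1)))" "\<And>\<xi> k. \<xi> \<in> space PG \<Longrightarrow> \<xi> \<notin> B3 \<Longrightarrow> k \<in> {k0..<K} \<Longrightarrow> R k \<xi>"
    by blast
  have B3p: "measure PG B3 \<le> 4 * exp (- real n)"
  proof -
    have "(\<Sum>k\<in>{k0..<K}. 2 * exp (- real n * real (k + 1))) \<le> (\<Sum>k\<in>{k0..<K}. 2 * exp (- real n) * (1 / 2) ^ k)"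
    proof (rule sum_mono)
      fix k
      have "exp (- real n * real (k + 1)) = exp (- real n) * exp (- (real n * real k))" by (simp add: exp_add[symmetric] algebra_simps)
      also have "\<dots> \<le> exp (- real n) * (1 / 2) ^ k"
      proof (rule mult_left_mono)
        have "1 * real k \<le> real n * real k" using n0 by (intro mult_right_mono) auto
        then have "exp (- (real n * real k)) \<le> exp (- real k)" by simp
        then show "exp (- (real n * real k)) \<le> (1 / 2) ^ k" using exp_neg_le_half_power[of k] by linarith
      qed simp
      finally show "2 * exp (- real n * real (k + 1)) \<le> 2 * exp (- real n) * (1 / 2) ^ k" by simp
    qed
    also have "\<dots> \<le> (\<Sum>k<K. 2 * exp (- real n) * (1 / 2) ^ k)" by (intro sum_mono2) auto
    also have "\<dots> = 2 * exp (- real n) * (\<Sum>k<K. (1 / 2) ^ k)" by (simp add: sum_distrib_left)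
    also have "\<dots> \<le> 2 * exp (- real n) * 2" by (intro mult_left_mono) (simp_all add: geometric_sum)
    finally show ?thesis using B3(2) by linarith
  qed
  define E where "E = space PG - (B1 \<union> (B2 \<union> B3))"
  have BB: "B1 \<union> (B2 \<union> B3) \<in> sets PG" using B1(1) B2(1) B3(1) by blast
  have pB: "measure PG (B1 \<union> (B2 \<union> B3)) \<le> 8 * exp (- real n)"
  proof -
    have "measure PG (B1 \<union> (B2 \<union> B3)) \<le> measure PG B1 + measure PG (B2 \<union> B3)" using B1(1) B2(1) B3(1) by (intro measure_Un_le) auto
    also have "measure PG (B2 \<union> B3) \<le> measure PG B2 + measure PG B3" using B2(1) B3(1) by (intro measure_Un_le)
    finally show ?thesis using B1(2) B2(2) B3p by linarith
  qed
  \<comment> \<open>The unit in which all contributions are counted; since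
    \<open>\<kappa> \<ge> 16\<close>, each \<open>\<kappa> ^ 3 * \<beta>\<close> is at most a
    sixteenth of it.\<close>
  define q where "q = \<kappa> ^ 4 * \<beta>"
  have k3: "\<kappa> ^ 3 * \<beta> * 16 \<le> q"
  proof -
    have "\<kappa> ^ 3 * \<beta> * 16 \<le> \<kappa> ^ 3 * \<beta> * \<kappa>" using \<kappa>16 \<beta>0 by (intro mult_left_mono) auto
    also have "\<dots> = q" by (simp add: q_def power4_eq_xxxx power3_eq_cube)
    finally show ?thesis .
  qed
  have q0: "0 < q" using \<kappa>16 \<beta>0 by (simp add: q_def)
  have \<delta>n: "\<delta> * sqrt n = 18 * (\<kappa> ^ 3 * \<beta>)" using n0 by (simp add: \<delta>_def)
  have \<delta>q: "\<delta> \<le> 2 * q"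
  proof -
    have "\<delta> * 1 \<le> \<delta> * sqrt n" using n1' \<delta>_pos by (intro mult_left_mono) auto
    then show ?thesis using \<delta>n k3 q0 by linarith
  qed
  have K\<delta>: "2 * (K * \<delta>) \<le> 5 * q"
  proof -
    have "K * \<delta> \<le> 2 * sqrt n * \<delta>" using K(3) \<delta>_pos by (intro mult_right_mono) auto
    also have "\<dots> = 36 * (\<kappa> ^ 3 * \<beta>)" using \<delta>n by (simp add: ac_simps)
    finally show ?thesis using k3 q0 by linarith
  qed
  have ck: "1 / c \<le> \<kappa> / 8" using c\<kappa> by simp
  have c4: "150 * \<beta> / c ^ 4 \<le> q"
  proof -
    have "(1 / c) ^ 4 \<le> (\<kappa> / 8) ^ 4" using ck c0 by (intro power_mono) auto
    then have "150 * \<beta> * (1 / c) ^ 4 \<le> 150 * \<beta> * (\<kappa> / 8) ^ 4" using \<beta>0 by (intro mult_left_mono) auto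
    also have "\<dots> = 150 / 4096 * q" by (simp add: q_def power_divide)
    also have "\<dots> \<le> q" using q0 by simp
    finally show ?thesis by (simp add: power_divide)
  qed
  have \<rho>0: "2 * \<kappa> ^ 3 * \<beta> * \<rho> k0 \<le> 100 * q"
  proof -
    have "\<rho> k0 \<le> 50 * \<kappa>" using k0(3) \<kappa>16 by (simp add: \<rho>_def)
    then have "2 * \<kappa> ^ 3 * \<beta> * \<rho> k0 \<le> 2 * \<kappa> ^ 3 * \<beta> * (50 * \<kappa>)" using \<kappa>16 \<beta>0 by (intro mult_left_mono) auto
    also have "\<dots> = 100 * q" by (simp add: q_def power4_eq_xxxx power3_eq_cube)
    finally show ?thesis .
  qed
  show thesis
  proof (rule that)
    show "E \<in> sets PG" unfolding E_def using BB by blast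
    show "1 - 8 * exp (- real n) \<le> measure PG E" unfolding E_def P.P.prob_compl[OF BB] using pB by linarith
    show "op_bound n (amat \<xi>) 6" if "\<xi> \<in> E" for \<xi> using that B1(3) by (simp add: E_def)
    fix \<xi> x assume \<xi>: "\<xi> \<in> E" and x: "x \<in> cube" and low': "\<forall>v\<in>carrier_vec n. 4 / \<kappa> * vnorm v \<le> vnorm (resm n \<beta> x (amat \<xi>) *\<^sub>v v)"
    have low: "4 / \<kappa> * vnorm v \<le> vnorm (resm n \<beta> x (amat \<xi>) *\<^sub>v v)" if "v \<in> carrier_vec n" for v using low' that by blast
    have \<xi>s: "\<xi> \<in> space PG" "\<xi> \<notin> B1" "\<xi> \<notin> B2" "\<xi> \<notin> B3" using \<xi> by (auto simp: E_def)
    note op6 = B1(3)[OF \<xi>s(1,2)]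
    have s0: "0 < 4 / \<kappa>" using \<kappa>16 by simp
    have gx: "good n \<beta> \<kappa> x (amat \<xi>)" by (rule goodI[OF op6 s0 low]) (use \<kappa>16 in auto)
    define y where "y k = rup k x" for k
    have yc: "y k \<in> cube" for k unfolding y_def by (rule grid_cube[OF rup(1)[OF x]])
    have yg: "y k \<in> grid k" for k unfolding y_def by (rule rup(1)[OF x])
    have yx: "\<bar>y k i - x i\<bar> \<le> 1 / 2 ^ k" if "i < n" for k i using rup(2)[OF x that, of k] by (simp add: y_def)
    have gy: "good n \<beta> \<kappa> (y k) (amat \<xi>)" if k: "k0 \<le> k" for k
    proof (rule good_perturb[OF op6 s0 low cube_le[OF x] cube_le[OF yc] yx])
      have "4 * \<kappa> \<le> 2 ^ k" using k0(1) power_increasing[OF k, of "2::real"] by linarith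
      then show "16 * (1 / 2 ^ k) \<le> 4 / \<kappa>" using \<kappa>16 by (simp add: field_simps)
      show "2 / (4 / \<kappa>) \<le> \<kappa>" using \<kappa>16 by simp
    qed
    have near: "near k (y k) (y (Suc k))" for k
      unfolding near_def
    proof (intro allI impI)
      fix i assume i: "i < n"
      have "(1::real) / 2 ^ Suc k \<le> 1 / 2 ^ k" by (simp add: field_simps)
      then show "\<bar>y (Suc k) i - y k i\<bar> \<le> 1 / 2 ^ k" using rup(2)[OF x i, of k] rup(2)[OF x i, of "Suc k"] unfolding y_def by linarith
    qed
    have devK: "\<bar>dev (y K) u \<xi>\<bar> \<le> 1610 * q" if u: "u \<in> U" for u
    proof -
      \<comment> \<open>Centred deviations telescope; the only centre left over is that of
        \<open>y K\<close>, which \<open>cen_le\<close> bounds.\<close>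
      define D where "D k = dev (y k) u \<xi> - cen (y k) u" for k
      have D0: "\<bar>D k0\<bar> \<le> \<delta> + 2 * \<kappa> ^ 3 * \<beta> * \<rho> k0" unfolding D_def by (rule B2(3)[OF \<xi>s(1,3) yg u gy]) simp
      have "\<bar>D K - D k0\<bar> = \<bar>\<Sum>k\<in>{k0..<K}. D (Suc k) - D k\<bar>" unfolding sum_Suc_diff'[OF k0K] ..
      also have "\<dots> \<le> (\<Sum>k\<in>{k0..<K}. \<bar>D (Suc k) - D k\<bar>)" by (rule sum_abs)
      also have "\<dots> \<le> (\<Sum>k\<in>{k0..<K}. 2 * \<delta> + 250 * q * (real (k + 2) / 2 ^ k))"
      proof (rule sum_mono)
        fix k assume k: "k \<in> {k0..<K}"
        have "\<bar>(dev (y (Suc k)) u \<xi> - dev (y k) u \<xi>) - (cen (y (Suc k)) u - cen (y k) u)\<bar> \<le> 2 * \<delta> + 50 * \<kappa> ^ 4 * \<beta> * (1 / 2 ^ k) * \<rho> k"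
          using B3(3)[OF \<xi>s(1,4) k] yg u near gy[of k] gy[of "Suc k"] k unfolding R_def by (simp del: power_Suc)
        then show "\<bar>D (Suc k) - D k\<bar> \<le> 2 * \<delta> + 250 * q * (real (k + 2) / 2 ^ k)" unfolding D_def \<rho>_def q_def by (simp add: algebra_simps)
      qed
      also have "\<dots> = real (K - k0) * (2 * \<delta>) + 250 * q * (\<Sum>k\<in>{k0..<K}. real (k + 2) / 2 ^ k)" by (simp only: sum.distrib sum_distrib_left sum_constant card_atLeastLessThan)
      also have "\<dots> \<le> real K * (2 * \<delta>) + 250 * q * 6"
        using \<delta>_pos q0 by (intro add_mono mult_right_mono mult_left_mono sum_dyadic_le) auto
      finally have "\<bar>D K - D k0\<bar> \<le> 1505 * q" using K\<delta> by simp
      moreover have "\<bar>dev (y K) u \<xi>\<bar> \<le> \<bar>D K\<bar> + \<bar>cen (y K) u\<bar>" unfolding D_def by linarith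
      \<comment> \<open>The 1610 is 1505 from the chain, 102 from the starting level and 3 from the
        last centre.\<close>
      ultimately show ?thesis using D0 cen_le[OF yc U(3)[OF u], of K] \<rho>0 \<delta>q c4 by linarith
    qed
    define w where "w i = Zd n \<beta> (y K) (amat \<xi>) i - tlim n \<beta> (y K)" for i
    have "L2_set w {..<n} \<le> 3220 * q"
    proof -
      obtain u where u: "u \<in> U" "L2_set w {..<n} \<le> 2 * (\<Sum>i<n. u i * w i)" using U(4) by blast
      have "(\<Sum>i<n. u i * w i) = dev (y K) u \<xi>" by (simp add: dev_def w_def)
      then show ?thesis using u(2) devK[OF u(1)] by linarith
    qed
    \<comment> \<open>From the last grid point to \<open>x\<close> no probability is spent: the
      factor \<open>sqrt n\<close> is absorbed by \<open>2 ^ K\<close>.\<close>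
    moreover have "L2_set (\<lambda>i. Zd n \<beta> x (amat \<xi>) i - Zd n \<beta> (y K) (amat \<xi>) i) {..<n} \<le> q"
    proof -
      have "L2_set (\<lambda>i. Zd n \<beta> x (amat \<xi>) i - Zd n \<beta> (y K) (amat \<xi>) i) {..<n} \<le> 16 * \<kappa> ^ 3 * \<beta> * (1 / 2 ^ K) * sqrt n"
        by (rule Zd_lipschitz_x[OF gx gy[OF k0K] cube_le[OF x] cube_le[OF yc] yx])
      also have "\<dots> = 16 * (\<kappa> ^ 3 * \<beta>) * (sqrt n / 2 ^ K)" by simp
      also have "\<dots> \<le> 16 * (\<kappa> ^ 3 * \<beta>) * 1" using K(1) \<kappa>16 \<beta>0 by (intro mult_left_mono) auto
      finally show ?thesis using k3 by linarith
    qed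
    moreover have "L2_set (\<lambda>_. tlim n \<beta> (y K) - tlim n \<beta> x) {..<n} \<le> q"
    proof -
      have "\<bar>tlim n \<beta> (y K) - tlim n \<beta> x\<bar> \<le> 2 * \<beta> * (1 / 2 ^ K) / (1 - \<beta>)\<^sup>2"
        by (rule tlim_diff_le[OF n0 \<beta>0 \<beta>1 cube_le[OF x] cube_le[OF yc] yx])
      then have "L2_set (\<lambda>_. tlim n \<beta> (y K) - tlim n \<beta> x) {..<n} \<le> 2 * \<beta> * (1 / 2 ^ K) / (1 - \<beta>)\<^sup>2 * sqrt n"
        unfolding L2_set_one by (intro mult_right_mono) auto
      also have "\<dots> = \<beta> * (1 / c) * (sqrt n / 2 ^ K)" unfolding c\<beta>[symmetric] by simp
      also have "\<dots> \<le> \<beta> * \<kappa> * 1" using K(1) ck \<beta>0 \<kappa>16 c0 by (intro mult_mono) auto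
      also have "\<beta> * \<kappa> * 1 \<le> \<kappa> ^ 3 * \<beta>"
      proof -
        have "\<kappa> ^ 1 \<le> \<kappa> ^ 3" using \<kappa>1 by (intro power_increasing) auto
        then show ?thesis using \<beta>0 by simp
      qed
      finally show ?thesis using k3 q0 \<beta>0 \<kappa>16 by linarith
    qed
    moreover have "L2_set (\<lambda>i. Zd n \<beta> x (amat \<xi>) i - tlim n \<beta> x) {..<n}
      \<le> L2_set (\<lambda>i. Zd n \<beta> x (amat \<xi>) i - Zd n \<beta> (y K) (amat \<xi>) i) {..<n} + (L2_set w {..<n} + L2_set (\<lambda>_. tlim n \<beta> (y K) - tlim n \<beta> x) {..<n})"
    proof -
      have "(\<lambda>i. Zd n \<beta> x (amat \<xi>) i - tlim n \<beta> x) = (\<lambda>i. (Zd n \<beta> x (amat \<xi>) i - Zd n \<beta> (y K) (amat \<xi>) i) + (w i + (tlim n \<beta> (y K) - tlim n \<beta> x)))"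
        by (simp add: w_def)
      then show ?thesis using L2_set_triangle_ineq[of "\<lambda>i. Zd n \<beta> x (amat \<xi>) i - Zd n \<beta> (y K) (amat \<xi>) i" "\<lambda>i. w i + (tlim n \<beta> (y K) - tlim n \<beta> x)" "{..<n}"]
        L2_set_triangle_ineq[of w "\<lambda>_. tlim n \<beta> (y K) - tlim n \<beta> x" "{..<n}"] by simp
    qed
    ultimately show "L2_set (\<lambda>i. Zd n \<beta> x (amat \<xi>) i - tlim n \<beta> x) {..<n} \<le> 4000 * \<kappa> ^ 4 * \<beta>" using q0 unfolding q_def by linarith
  qed
qed

end

section \<open>Translation to the Hessian\<close>

lemma matinv_eq:
  assumes "is_inv n X Y"
  shows "matinv X = Y"
proof -
  note i = is_invD[OF assms]
  have "invertible_mat X"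
    unfolding invertible_mat_def inverts_mat_def using i by (intro conjI exI[of _ Y]) auto
  note m = matinv[OF i(1) this]
  have "is_inv n X (matinv X)" using i(1) m by (simp add: is_inv_def)
  then show ?thesis using is_inv_unique assms by blast
qed

lemma diag_mats_eq: "D \<in> diag_mats n K \<Longrightarrow> D = mat_diag n (\<lambda>i. D $$ (i, i))"
  by (intro eq_matI) (auto simp: diag_mats_def diagonal_mat_def mat_diag_index)

lemma is_inv_mat_diag:
  fixes d :: "nat \<Rightarrow> real"
  assumes "\<And>i. i < n \<Longrightarrow> d i \<noteq> 0"
  shows "is_inv n (mat_diag n d) (mat_diag n (\<lambda>i. 1 / d i))"
proof -
  have "mat_diag n (\<lambda>i. d i * (1 / d i)) = 1\<^sub>m n" "mat_diag n (\<lambda>i. 1 / d i * d i) = 1\<^sub>m n"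
    using assms by (auto intro!: eq_matI simp: mat_diag_index)
  then show ?thesis by (simp add: is_inv_def)
qed

lemma matinv_mat_diag:
  fixes d :: "nat \<Rightarrow> real"
  assumes "\<And>i. i < n \<Longrightarrow> d i \<noteq> 0"
  shows "matinv (mat_diag n d) = mat_diag n (\<lambda>i. 1 / d i)"
  by (rule matinv_eq[OF is_inv_mat_diag]) (rule assms)

lemma ntr_mat_diag: "ntr (mat_diag n f) = avg n f"
  by (simp add: ntr_def avg_def mat_diag_index)

lemma pow_mat_two: "X \<in> carrier_mat n n \<Longrightarrow> X ^\<^sub>m 2 = X * X" for X :: "real mat"
  by (simp add: numeral_2_eq_2)

lemma shifted_mat_eq:
  assumes A: "A \<in> carrier_mat n n" and d: "\<And>i. i < n \<Longrightarrow> d i \<noteq> 0"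
  shows "shifted_mat n \<beta> A (mat_diag n d) = Bm n \<beta> (\<lambda>i. 1 / d i) A"
proof (rule eq_matI)
  have di: "matinv (mat_diag n d) = mat_diag n (\<lambda>i. 1 / d i)" by (rule matinv_mat_diag) (rule d)
  fix i j assume "i < dim_row (Bm n \<beta> (\<lambda>i. 1 / d i) A)" "j < dim_col (Bm n \<beta> (\<lambda>i. 1 / d i) A)"
  then have ij: "i < n" "j < n" using Bm_carrier[OF A, of \<beta> "\<lambda>i. 1 / d i"] by auto
  show "shifted_mat n \<beta> A (mat_diag n d) $$ (i, j) = Bm n \<beta> (\<lambda>i. 1 / d i) A $$ (i, j)"
    unfolding shifted_mat_def di ntr_mat_diag Bm_index[OF A ij]
    using A ij by (simp add: mat_diag_index)
qed (use A in \<open>simp_all add: shifted_mat_def Bm_def\<close>)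

lemma inverse_symm:
  assumes B: "symm n B" and R: "is_inv n B R"
  shows "symm n R"
proof -
  note i = is_invD[OF R]
  have "B * transpose_mat R = transpose_mat (R * B)" using transpose_mult[OF i(2,1)] symm_transpose[OF B] by simp
  moreover have "transpose_mat R * B = transpose_mat (B * R)" using transpose_mult[OF i(1,2)] symm_transpose[OF B] by simp
  ultimately have "is_inv n B (transpose_mat R)" using i by (simp add: is_inv_def)
  then have "transpose_mat R = R" using is_inv_unique R by blast
  then show ?thesis unfolding symm_def using i(2) by (metis carrier_matD index_transpose_mat(1))
qed

lemma norm_L2_mat_diag:
  assumes "n > 0"
  shows "norm_L2 (mat_diag n e) = L2_set e {..<n} / sqrt n"
proof -
  have "transpose_mat (mat_diag n e) = mat_diag n e" by (intro eq_matI) (auto simp: mat_diag_index)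
  then have "norm_L2 (mat_diag n e) = sqrt (avg n (\<lambda>i. (e i)\<^sup>2))" by (simp add: norm_L2_def ntr_mat_diag power2_eq_square)
  then show ?thesis using assms by (simp add: L2_set_sq_avg)
qed

text \<open>If \<open>R\<close> is the inverse of the shifted matrix, then the inverse of
  \<open>resm\<close> is \<open>M = D R\<close>. As \<open>R\<close> is symmetric,
  \<open>D R R D\<close> is \<open>M\<close> times its transpose, so its diagonal consists of the
  squared row norms of \<open>M\<close>.\<close>

lemma norm_L2_resolvent_diagonal:
  assumes n: "n > 0" and A: "symm n A" and d: "\<And>i. i < n \<Longrightarrow> d i \<noteq> 0"
    and N: "is_inv n (resm n \<beta> (\<lambda>i. 1 / d i) A) (minv (resm n \<beta> (\<lambda>i. 1 / d i) A))"
  defines "D \<equiv> mat_diag n d"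
  shows "norm_L2 (diag_part (D * (matinv (shifted_mat n \<beta> A D) ^\<^sub>m 2) * D) - (1 / (1 - \<beta>\<^sup>2 * ntr (matinv D ^\<^sub>m 2))) \<cdot>\<^sub>m 1\<^sub>m n)
    = L2_set (\<lambda>i. Zd n \<beta> (\<lambda>i. 1 / d i) A i - tlim n \<beta> (\<lambda>i. 1 / d i)) {..<n} / sqrt n"
proof -
  define x where "x = (\<lambda>i. 1 / d i)"
  define B where "B = Bm n \<beta> x A"
  define M where "M = minv (resm n \<beta> x A)"
  define R where "R = mat_diag n x * M"
  note cA = symm_carrier[OF A]
  have sB: "symm n B" unfolding B_def by (rule Bm_symm[OF A])
  note cB = symm_carrier[OF sB]
  have re: "resm n \<beta> x A = B * mat_diag n x" unfolding B_def by (rule resm_eq_Bm[OF cA]) (use d in \<open>simp add: x_def\<close>)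
  note iM = is_invD[OF N, folded x_def, folded M_def]
  have cR: "R \<in> carrier_mat n n" unfolding R_def using iM(2) by auto
  have BR: "B * R = 1\<^sub>m n"
    using iM(3) assoc_mult_mat[OF cB mat_diag_dim iM(2), of x] unfolding R_def re by simp
  have iR: "is_inv n B R" unfolding is_inv_def using cB cR BR mat_mult_left_right_inverse[OF cB cR BR] by simp
  have sR: "symm n R" by (rule inverse_symm[OF sB iR])
  have di: "matinv (mat_diag n d) = mat_diag n x" unfolding x_def by (rule matinv_mat_diag) (rule d)
  have "shifted_mat n \<beta> A (mat_diag n d) = B" unfolding B_def x_def by (rule shifted_mat_eq[OF cA]) (rule d)
  then have sh: "matinv (shifted_mat n \<beta> A D) = R"
    unfolding D_def by (simp only: matinv_eq[OF iR])
  have tr: "ntr (matinv D ^\<^sub>m 2) = avg n (\<lambda>i. (x i)\<^sup>2)"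
    unfolding D_def di pow_mat_two[OF mat_diag_dim] mat_diag_diag ntr_mat_diag
    by (simp add: power2_eq_square)
  have dg: "(D * (R * R) * D) $$ (i, i) = rsq n M i" if i: "i < n" for i
  proof -
    have cRR: "R * R \<in> carrier_mat n n" using cR by simp
    have "(D * (R * R) * D) $$ (i, i) = d i * (R * R) $$ (i, i) * d i"
      unfolding D_def mat_diag_mult_left[OF cRR] using i by (subst mat_diag_mult_right[of _ n]) auto
    also have "(R * R) $$ (i, i) = rsq n R i" by (rule symm_square_index[OF sR i])
    also have "rsq n R i = (x i)\<^sup>2 * rsq n M i"
      unfolding rsq_def sum_distrib_left
    proof (intro sum.cong refl)
      fix j assume "j \<in> {..<n}"
      then show "(R $$ (i, j))\<^sup>2 = (x i)\<^sup>2 * (M $$ (i, j))\<^sup>2" unfolding R_def mat_diag_mult_left[OF iM(2)] using i by (simp add: power_mult_distrib)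
    qed
    finally show ?thesis using d[OF i] by (simp add: x_def power2_eq_square)
  qed
  have "diag_part (D * (R * R) * D) - (1 / (1 - \<beta>\<^sup>2 * avg n (\<lambda>i. (x i)\<^sup>2))) \<cdot>\<^sub>m 1\<^sub>m n = mat_diag n (\<lambda>i. Zd n \<beta> x A i - tlim n \<beta> x)"
  proof (rule eq_matI)
    have dD: "dim_row (D * (R * R) * D) = n" by (simp add: D_def)
    fix i j assume "i < dim_row (mat_diag n (\<lambda>i. Zd n \<beta> x A i - tlim n \<beta> x))" "j < dim_col (mat_diag n (\<lambda>i. Zd n \<beta> x A i - tlim n \<beta> x))"
    then have ij: "i < n" "j < n" by auto
    then show "(diag_part (D * (R * R) * D) - (1 / (1 - \<beta>\<^sup>2 * avg n (\<lambda>i. (x i)\<^sup>2))) \<cdot>\<^sub>m 1\<^sub>m n) $$ (i, j) = mat_diag n (\<lambda>i. Zd n \<beta> x A i - tlim n \<beta> x) $$ (i, j)"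
      unfolding diag_part_def dD by (simp add: mat_diag_index dg Zd_def tlim_def M_def[symmetric] del: index_mult_mat)
  qed (simp_all add: diag_part_def D_def)
  then show ?thesis unfolding sh tr pow_mat_two[OF cR] x_def[symmetric] using norm_L2_mat_diag[OF n] by simp
qed

text \<open>The matrix in the hypothesis is the Gram matrix of \<open>resm\<close>: with
  \<open>C = B X\<close>, the product \<open>X B B X\<close> is the transpose of \<open>C\<close>
  times \<open>C\<close>. So \<gamma> bounds the squared singular values from below.\<close>

lemma loewner_imp_lower_bound:
  assumes A: "symm n A" and d: "\<And>i. i < n \<Longrightarrow> d i \<noteq> 0" and g: "0 \<le> \<gamma>"
    and L: "loewner_le n (\<gamma> \<cdot>\<^sub>m 1\<^sub>m n) (matinv (mat_diag n d) * (shifted_mat n \<beta> A (mat_diag n d) ^\<^sub>m 2) * matinv (mat_diag n d))"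
    and v: "v \<in> carrier_vec n"
  shows "sqrt \<gamma> * vnorm v \<le> vnorm (resm n \<beta> (\<lambda>i. 1 / d i) A *\<^sub>v v)"
proof -
  define x where "x = (\<lambda>i. 1 / d i)"
  define B where "B = Bm n \<beta> x A"
  define X where "X = mat_diag n x"
  define C where "C = resm n \<beta> x A"
  note cA = symm_carrier[OF A]
  have sB: "symm n B" unfolding B_def by (rule Bm_symm[OF A])
  note cB = symm_carrier[OF sB]
  have cX: "X \<in> carrier_mat n n" by (simp add: X_def)
  have tX: "transpose_mat X = X" by (intro eq_matI) (auto simp: X_def mat_diag_index)
  have re: "C = B * X" unfolding B_def C_def X_def by (rule resm_eq_Bm[OF cA]) (use d in \<open>simp add: x_def\<close>)
  have cC: "C \<in> carrier_mat n n" unfolding re using cB cX by simp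
  have di: "matinv (mat_diag n d) = X" unfolding X_def x_def by (rule matinv_mat_diag) (rule d)
  have sh: "shifted_mat n \<beta> A (mat_diag n d) = B" unfolding B_def x_def by (rule shifted_mat_eq[OF cA]) (rule d)
  have "X * (B * B) * X = transpose_mat C * C"
  proof -
    have "transpose_mat C = X * B" unfolding re transpose_mult[OF cB cX] tX symm_transpose[OF sB] ..
    moreover have "X * (B * B) * X = (X * B) * (B * X)"
      using cB cX by (simp add: assoc_mult_mat[of _ n n _ n _ n])
    ultimately show ?thesis by (simp add: re)
  qed
  then have e: "matinv (mat_diag n d) * (shifted_mat n \<beta> A (mat_diag n d) ^\<^sub>m 2) * matinv (mat_diag n d) = transpose_mat C * C"
    unfolding sh di pow_mat_two[OF cB] .
  have Cv: "C *\<^sub>v v \<in> carrier_vec n" by (rule mult_mat_vec_carrier[OF cC v])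
  have cCC: "transpose_mat C * C \<in> carrier_mat n n" using cC by simp
  have "0 \<le> v \<bullet> ((transpose_mat C * C - \<gamma> \<cdot>\<^sub>m 1\<^sub>m n) *\<^sub>v v)" using L v unfolding e loewner_le_def pos_semidef_def by blast
  also have "(transpose_mat C * C - \<gamma> \<cdot>\<^sub>m 1\<^sub>m n) *\<^sub>v v = (transpose_mat C * C) *\<^sub>v v - (\<gamma> \<cdot>\<^sub>m 1\<^sub>m n) *\<^sub>v v"
    by (rule minus_mult_distrib_mat_vec[OF cCC _ v]) simp
  also have "(transpose_mat C * C) *\<^sub>v v = transpose_mat C *\<^sub>v (C *\<^sub>v v)" by (rule assoc_mult_mat_vec[OF _ cC v]) (use cC in simp)
  also have "(\<gamma> \<cdot>\<^sub>m 1\<^sub>m n) *\<^sub>v v = \<gamma> \<cdot>\<^sub>v v" using smult_mat_vec[OF one_carrier_mat v] v by simp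
  also have "v \<bullet> (transpose_mat C *\<^sub>v (C *\<^sub>v v) - \<gamma> \<cdot>\<^sub>v v) = v \<bullet> (transpose_mat C *\<^sub>v (C *\<^sub>v v)) - \<gamma> * (v \<bullet> v)"
    using v cC Cv by (subst scalar_prod_minus_distrib[of _ n]) auto
  also have "v \<bullet> (transpose_mat C *\<^sub>v (C *\<^sub>v v)) = (C *\<^sub>v v) \<bullet> (C *\<^sub>v v)"
    using transpose_vec_mult_scalar[OF cC v Cv] comm_scalar_prod[of v n "transpose_mat C *\<^sub>v (C *\<^sub>v v)"] v cC Cv by simp
  finally have "\<gamma> * (vnorm v)\<^sup>2 \<le> (vnorm (C *\<^sub>v v))\<^sup>2" unfolding vnorm_sq[OF v] vnorm_sq[OF Cv] by simp
  then have "(sqrt \<gamma> * vnorm v)\<^sup>2 \<le> (vnorm (C *\<^sub>v v))\<^sup>2" using g by (simp add: power_mult_distrib)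
  then show ?thesis unfolding C_def x_def[symmetric] by (rule power2_le_imp_le) (rule vnorm_nonneg[OF Cv[unfolded C_def]])
qed

text \<open>The rank-one term of the Hessian is negative semidefinite, so dropping it leaves
  \<open>B \<succeq> a D \<succeq> a I\<close>; the scalar term matches because
  \<open>avg n x\<close> is 1 minus the mean square of \<open>m\<close>. With \<open>w = X v\<close>
  and \<open>p = B w\<close>, the vector \<open>v = D w\<close> is \<open>p\<close> plus two terms
  of total length at most \<open>7 * \<beta> * vnorm w\<close>, and \<open>vnorm w\<close> is at
  most \<open>vnorm p / a\<close>.\<close>

lemma S_set_imp_lower_bound:
  assumes n: "n > 0" and A: "symm n A" "op_bound n A 6" and \<beta>: "0 < \<beta>" "\<beta> < 1" and a: "0 < a" and m: "m \<in> S_set n \<beta> A a"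
    and v: "v \<in> carrier_vec n"
  shows "vnorm v \<le> (1 + 7 * \<beta> / a) * vnorm (resm n \<beta> (\<lambda>i. 1 - (m $ i)\<^sup>2) A *\<^sub>v v)"
proof -
  define x where "x = (\<lambda>i. 1 - (m $ i)\<^sup>2)"
  define B where "B = Bm n \<beta> x A"
  have cm: "m \<in> carrier_vec n" and mi: "\<And>i. i < n \<Longrightarrow> (m $ i)\<^sup>2 < 1"
    using m by (auto simp: S_set_def open_cube_def abs_square_less_1 abs_less_iff)
  then have x: "0 < x i" "x i \<le> 1" if "i < n" for i using that by (simp_all add: x_def)
  note cA = symm_carrier[OF A(1)]
  have sB: "symm n B" unfolding B_def by (rule Bm_symm[OF A(1)])
  note cB = symm_carrier[OF sB]
  have av: "avg n x = 1 - (m \<bullet> m) / n"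
    using n unfolding avg_def x_def scalar_prod_lessThan[OF cm] by (simp add: sum_subtractf diff_divide_distrib power2_eq_square)
  have av01: "0 \<le> avg n x" "avg n x \<le> 1" using avg_nonneg[of n x] avg_le[OF n, of x 1] x less_imp_le[OF x(1)] by blast+
  have pd: "a * (w \<bullet> w) \<le> w \<bullet> (B *\<^sub>v w)" if w: "w \<in> carrier_vec n" for w
  proof -
    define H where "H = hess_TAP n \<beta> A m - a \<cdot>\<^sub>m D_of m"
    have dm: "dim_vec m = n" using cm by simp
    have cH: "H \<in> carrier_mat n n" unfolding H_def hess_TAP_def D_of_def outer_square_def dm by (intro carrier_matI) simp_all
    have iH: "H $$ (i, j) = B $$ (i, j) - 2 * \<beta>\<^sup>2 / n * (m $ i * m $ j) - (if i = j then a / x i else 0)" if ij: "i < n" "j < n" for i j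
      using ij cA unfolding H_def B_def Bm_index[OF cA ij] hess_TAP_def D_of_def outer_square_def dm
      by (simp add: mat_diag_index av[symmetric, unfolded x_def] x_def)
    have "0 \<le> w \<bullet> (H *\<^sub>v w)"
    proof (cases "w = 0\<^sub>v n")
      case True
      then show ?thesis using mult_mat_vec_carrier[OF cH w] by simp
    next
      case False
      then have "0 < w \<bullet> (H *\<^sub>v w)" using m w unfolding H_def S_set_def loewner_less_def pos_def_def by blast
      then show ?thesis by simp
    qed
    also have "w \<bullet> (H *\<^sub>v w) = w \<bullet> (B *\<^sub>v w) - 2 * \<beta>\<^sup>2 / n * (\<Sum>i<n. m $ i * w $ i)\<^sup>2 - a * (\<Sum>i<n. (w $ i)\<^sup>2 / x i)"
    proof -
      have "w \<bullet> (H *\<^sub>v w) = (\<Sum>i<n. \<Sum>j<n. w $ i * w $ j * B $$ (i, j) - 2 * \<beta>\<^sup>2 / n * ((m $ i * w $ i) * (m $ j * w $ j)) - (if i = j then a * ((w $ i)\<^sup>2 / x i) else 0))"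
        unfolding quad_sum[OF cH w] by (intro sum.cong refl) (auto simp: iH power2_eq_square algebra_simps)
      also have "\<dots> = (\<Sum>i<n. \<Sum>j<n. w $ i * w $ j * B $$ (i, j)) - 2 * \<beta>\<^sup>2 / n * ((\<Sum>i<n. m $ i * w $ i) * (\<Sum>i<n. m $ i * w $ i)) - a * (\<Sum>i<n. (w $ i)\<^sup>2 / x i)"
        unfolding sum_product by (simp add: sum_subtractf sum_distrib_left)
      finally show ?thesis unfolding quad_sum[OF cB w] by (simp add: power2_eq_square)
    qed
    finally have "a * (\<Sum>i<n. (w $ i)\<^sup>2 / x i) \<le> w \<bullet> (B *\<^sub>v w) - 2 * \<beta>\<^sup>2 / n * (\<Sum>i<n. m $ i * w $ i)\<^sup>2" by linarith
    also have "\<dots> \<le> w \<bullet> (B *\<^sub>v w)" by simp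
    finally have "a * (\<Sum>i<n. (w $ i)\<^sup>2 / x i) \<le> w \<bullet> (B *\<^sub>v w)" .
    moreover have "w \<bullet> w \<le> (\<Sum>i<n. (w $ i)\<^sup>2 / x i)"
      unfolding scalar_prod_lessThan[OF w]
    proof (rule sum_mono)
      fix i assume "i \<in> {..<n}"
      then have "(w $ i)\<^sup>2 * x i \<le> (w $ i)\<^sup>2 * 1" "0 < x i" using x[of i] mult_left_mono[of "x i" 1 "(w $ i)\<^sup>2"] by auto
      then show "w $ i * w $ i \<le> (w $ i)\<^sup>2 / x i" by (simp add: pos_le_divide_eq power2_eq_square)
    qed
    ultimately show ?thesis using a by (meson mult_left_mono less_imp_le order_trans)
  qed
  have aw: "a * vnorm w \<le> vnorm (B *\<^sub>v w)" if w: "w \<in> carrier_vec n" for w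
  proof (cases "vnorm w = 0")
    case True
    then show ?thesis using vnorm_nonneg[OF mult_mat_vec_carrier[OF cB w]] by simp
  next
    case False
    then have p: "0 < vnorm w" using vnorm_nonneg[OF w] by simp
    have "vnorm w * (a * vnorm w) \<le> vnorm w * vnorm (B *\<^sub>v w)"
      using pd[OF w] scalar_prod_le_vnorm[OF w mult_mat_vec_carrier[OF cB w]] unfolding vnorm_sq[OF w, symmetric] by (simp add: power2_eq_square ac_simps)
    then show ?thesis using p by simp
  qed
  define w where "w = mat_diag n x *\<^sub>v v"
  have w: "w \<in> carrier_vec n" unfolding w_def by (rule mult_mat_vec_carrier[OF mat_diag_dim v])
  have Bw: "B *\<^sub>v w = resm n \<beta> x A *\<^sub>v v"
  proof -
    have "resm n \<beta> x A = B * mat_diag n x" unfolding B_def by (rule resm_eq_Bm[OF cA]) (use x in force)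
    then show ?thesis unfolding w_def using assoc_mult_mat_vec[OF cB mat_diag_dim v] by simp
  qed
  define p where "p = B *\<^sub>v w"
  define r where "r = A *\<^sub>v w"
  have p: "p \<in> carrier_vec n" unfolding p_def by (rule mult_mat_vec_carrier[OF cB w])
  have r: "r \<in> carrier_vec n" unfolding r_def by (rule mult_mat_vec_carrier[OF cA w])
  have wi: "w $ i = x i * v $ i" if "i < n" for i
  proof -
    have "w $ i = (\<Sum>j<n. if i = j then x j * v $ j else 0)"
      unfolding w_def mat_vec_index[OF mat_diag_dim v that] using that by (intro sum.cong refl) (auto simp: mat_diag_index)
    then show ?thesis using that by simp
  qed
  have veq: "v = p + (\<beta> \<cdot>\<^sub>v r + (- (\<beta>\<^sup>2 * avg n x)) \<cdot>\<^sub>v w)"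
  proof (rule eq_vecI)
    fix i assume "i < dim_vec (p + (\<beta> \<cdot>\<^sub>v r + (- (\<beta>\<^sup>2 * avg n x)) \<cdot>\<^sub>v w))"
    then have i: "i < n" using w by simp
    have "p $ i = (\<Sum>j<n. (if i = j then (1 / x j + \<beta>\<^sup>2 * avg n x) * w $ j else 0) - \<beta> * (A $$ (i, j) * w $ j))"
      unfolding p_def mat_vec_index[OF cB w i] by (intro sum.cong refl) (use i in \<open>auto simp: B_def Bm_index[OF cA] algebra_simps\<close>)
    also have "\<dots> = (1 / x i + \<beta>\<^sup>2 * avg n x) * w $ i - \<beta> * r $ i"
      unfolding r_def mat_vec_index[OF cA w i] using i by (simp add: sum_subtractf sum_distrib_left)
    also have "(1 / x i + \<beta>\<^sup>2 * avg n x) * w $ i = v $ i + \<beta>\<^sup>2 * avg n x * w $ i" using wi[OF i] x[OF i] by (simp add: distrib_right)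
    finally show "v $ i = (p + (\<beta> \<cdot>\<^sub>v r + (- (\<beta>\<^sup>2 * avg n x)) \<cdot>\<^sub>v w)) $ i" using i p r w by simp
  qed (use v w in simp)
  have nw: "0 \<le> vnorm w" by (rule vnorm_nonneg[OF w])
  have "vnorm v \<le> vnorm p + vnorm (\<beta> \<cdot>\<^sub>v r + (- (\<beta>\<^sup>2 * avg n x)) \<cdot>\<^sub>v w)"
    by (subst veq) (rule vnorm_add, use p r w in auto)
  also have "vnorm (\<beta> \<cdot>\<^sub>v r + (- (\<beta>\<^sup>2 * avg n x)) \<cdot>\<^sub>v w) \<le> vnorm (\<beta> \<cdot>\<^sub>v r) + vnorm ((- (\<beta>\<^sup>2 * avg n x)) \<cdot>\<^sub>v w)"
    by (rule vnorm_add) (use r w in auto)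
  also have "\<dots> = \<beta> * vnorm r + \<beta>\<^sup>2 * avg n x * vnorm w" unfolding vnorm_smult[OF r] vnorm_smult[OF w] using \<beta> av01 by simp
  also have "\<dots> \<le> \<beta> * (6 * vnorm w) + \<beta> * 1 * vnorm w"
  proof -
    have "\<beta>\<^sup>2 * avg n x \<le> \<beta> * 1" unfolding power2_eq_square mult.assoc
      using \<beta> av01 mult_le_one[of \<beta> "avg n x"] by (intro mult_left_mono) auto
    then show ?thesis unfolding r_def using \<beta> nw op_boundD(3)[OF A(2) w] by (intro add_mono mult_left_mono mult_right_mono) auto
  qed
  also have "\<dots> = 7 * \<beta> * vnorm w" by simp
  also have "\<dots> \<le> 7 * \<beta> * (vnorm p / a)" using aw[OF w] a \<beta> by (intro mult_left_mono) (auto simp: p_def field_simps)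
  finally show ?thesis unfolding x_def[symmetric] Bw[symmetric] p_def[symmetric] by (simp add: algebra_simps)
qed

text \<open>The universal constant is 4000 times the fourth power of 8. The fourth power of
  \<open>1 / sqrt \<gamma>\<close> supplies \<open>1 / \<gamma>\<^sup>2\<close>, and the normalised
  norm supplies \<open>1 / sqrt n\<close>.\<close>

lemma diag_bound_of_L2_set_le:
  assumes n: "n > 0" and A: "symm n A" and d: "\<And>i. i < n \<Longrightarrow> d i \<noteq> 0"
    and N: "is_inv n (resm n \<beta> (\<lambda>i. 1 / d i) A) (minv (resm n \<beta> (\<lambda>i. 1 / d i) A))" and g: "0 < \<gamma>"
    and le: "L2_set (\<lambda>i. Zd n \<beta> (\<lambda>i. 1 / d i) A i - tlim n \<beta> (\<lambda>i. 1 / d i)) {..<n} \<le> 4000 * (8 / sqrt \<gamma>) ^ 4 * \<beta>"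
  shows "diag_bound n 16384000 \<beta> \<gamma> A (mat_diag n d)"
proof -
  have "(sqrt \<gamma>) ^ 4 = \<gamma>\<^sup>2" using g by (simp add: power4_eq_xxxx power2_eq_square)
  then have "4000 * (8 / sqrt \<gamma>) ^ 4 * \<beta> = 16384000 * \<beta> / \<gamma>\<^sup>2" by (simp add: power_divide)
  then have "L2_set (\<lambda>i. Zd n \<beta> (\<lambda>i. 1 / d i) A i - tlim n \<beta> (\<lambda>i. 1 / d i)) {..<n} / sqrt n \<le> 16384000 * \<beta> / \<gamma>\<^sup>2 / sqrt n"
    using le by (intro divide_right_mono) auto
  moreover have "norm_L2 (diag_part (mat_diag n d * (matinv (shifted_mat n \<beta> A (mat_diag n d)) ^\<^sub>m 2) * mat_diag n d)
      - (1 / (1 - \<beta>\<^sup>2 * ntr (matinv (mat_diag n d) ^\<^sub>m 2))) \<cdot>\<^sub>m 1\<^sub>m n)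
    = L2_set (\<lambda>i. Zd n \<beta> (\<lambda>i. 1 / d i) A i - tlim n \<beta> (\<lambda>i. 1 / d i)) {..<n} / sqrt n"
    by (rule norm_L2_resolvent_diagonal[OF n A _ N]) (rule d)
  ultimately show ?thesis by (simp add: diag_bound_def)
qed

section \<open>Transfer to the law on matrices and the threshold for the dimension\<close>

lemma (in goe) GOE_event:
  assumes E: "E \<in> sets PG"
  shows "{A \<in> sym_mats n. upper_entries n A \<in> E} \<in> sets (GOE n)"
    and "measure (GOE n) {A \<in> sym_mats n. upper_entries n A \<in> E} = measure PG E"
proof -
  have E': "E \<in> sets (Pi\<^sub>M (upper_idx n) (\<lambda>_. borel))" using E unfolding sets_PiM_N .
  have e: "{A \<in> sym_mats n. upper_entries n A \<in> E} = upper_entries n -` E \<inter> space (GOE n)" by auto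
  show "{A \<in> sym_mats n. upper_entries n A \<in> E} \<in> sets (GOE n)"
    unfolding e by (rule measurable_sets[OF measurable_upper_entries E'])
  have "measure PG E = measure (distr (GOE n) (Pi\<^sub>M (upper_idx n) (\<lambda>_. borel)) (upper_entries n)) E"
    unfolding distr_upper_entries GOE_entry_eq_N ..
  also have "\<dots> = measure (GOE n) (upper_entries n -` E \<inter> space (GOE n))"
    by (rule measure_distr[OF measurable_upper_entries E'])
  finally show "measure (GOE n) {A \<in> sym_mats n. upper_entries n A \<in> E} = measure PG E" unfolding e ..
qed

lemma sym_mat_of_upper_entries:
  assumes "A \<in> sym_mats n"
  shows "sym_mat_of n (upper_entries n A) = A"
proof (rule eq_matI)
  have c: "A \<in> carrier_mat n n" and t: "transpose_mat A = A" using assms by (auto simp: sym_mats_def)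
  fix i j assume "i < dim_row A" "j < dim_col A"
  then have ij: "i < n" "j < n" using c by auto
  have "A $$ (j, i) = A $$ (i, j)" using t ij c by (metis carrier_matD index_transpose_mat(1))
  then show "sym_mat_of n (upper_entries n A) $$ (i, j) = A $$ (i, j)"
    using ij by (auto simp: sym_mat_of_def upper_entries_def upper_idx_def min_def max_def)
qed (use assms in \<open>auto simp: sym_mats_def sym_mat_of_def\<close>)

text \<open>The 192 is 32 times 6: both exponents are then at least 6, and
  \<open>exp (- 6) \<le> 1 / 64\<close>.\<close>

lemma eventually_chaining:
  assumes \<beta>: "0 < \<beta>" "\<beta> < 1" and c: "2 * c = (1 - \<beta>)\<^sup>2" and \<kappa>: "8 / c \<le> \<kappa>"
  obtains n0 where "\<And>n. n0 \<le> n \<Longrightarrow> chaining n \<beta> c \<kappa> \<and> 8 * \<kappa> \<le> sqrt (real n) \<and> 192 \<le> n"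
proof -
  have c0: "0 < c" using c \<beta>(2) by (smt (verit) zero_less_power)
  have c1: "c \<le> 1"
  proof -
    have "2 * c \<le> 1" unfolding c using \<beta> by (simp add: power_le_one)
    then show ?thesis using c0 by linarith
  qed
  obtain n0 :: nat where n0: "192 / c\<^sup>2 + (400 / c ^ 4)\<^sup>2 + (8 * \<kappa>)\<^sup>2 \<le> real n0" using real_arch_simple by blast
  show thesis
  proof (rule that[of n0])
    fix n assume n: "n0 \<le> n"
    then have "real n0 \<le> real n" by simp
    then have "192 / c\<^sup>2 + (400 / c ^ 4)\<^sup>2 + (8 * \<kappa>)\<^sup>2 \<le> real n" using n0 by linarith
    moreover have "0 \<le> 192 / c\<^sup>2" "0 \<le> (400 / c ^ 4)\<^sup>2" "0 \<le> (8 * \<kappa>)\<^sup>2" by simp_all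
    ultimately have le: "192 / c\<^sup>2 \<le> real n" "(400 / c ^ 4)\<^sup>2 \<le> real n" "(8 * \<kappa>)\<^sup>2 \<le> real n" by linarith+
    have "c\<^sup>2 \<le> 1" using c0 c1 by (simp add: power_le_one)
    then have nc: "192 \<le> real n * c\<^sup>2" "real n * c\<^sup>2 \<le> real n * 1" using le(1) c0 mult_left_mono[of "c\<^sup>2" 1 "real n"] by (simp_all add: field_simps)
    have e6: "exp (- y) \<le> 1 / 64" if "6 \<le> y" for y :: real
    proof -
      have "exp (- y) \<le> exp (- real 6)" using that by simp
      also have "\<dots> \<le> (1 / 2) ^ 6" by (rule exp_neg_le_half_power)
      finally show ?thesis by (simp add: power_divide)
    qed
    have "chaining n \<beta> c \<kappa>"
    proof
      show "0 < n" using nc by simp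
      show "exp (- (real n * c\<^sup>2) / 32) \<le> 1 / 64" using e6[of "real n * c\<^sup>2 / 32"] nc by simp
      show "exp (- real n / 32) \<le> 1 / 64" using e6[of "real n / 32"] nc by simp
      show "400 / c ^ 4 \<le> sqrt (real n)" by (rule real_le_rsqrt[OF le(2)])
    qed (use \<beta> c \<kappa> in auto)
    moreover have "192 \<le> n" using nc by linarith
    ultimately show "chaining n \<beta> c \<kappa> \<and> 8 * \<kappa> \<le> sqrt (real n) \<and> 192 \<le> n" using real_le_rsqrt[OF le(3)] by blast
  qed
qed

theorem corollary5p9:
  shows "\<exists>C::real. C > 0 \<and>
    (\<forall>\<beta> \<gamma> :: real. 0 < \<beta> \<longrightarrow> \<beta> < 1 \<longrightarrow> 0 < \<gamma> \<longrightarrow>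
        \<gamma> \<le> (1 - \<beta>) ^ 4 / (4 * (1 + 2 * \<beta>\<^sup>2)\<^sup>2) \<longrightarrow>
      (\<exists>n0::nat. \<forall>n\<ge>n0. \<exists>E \<in> sets (GOE n).
        measure (GOE n) E \<ge> 1 - 4 * exp (- real n / 4) \<and>
        (\<forall>A\<in>E.
          (\<forall>D \<in> diag_mats n {1..}.
             loewner_le n (\<gamma> \<cdot>\<^sub>m 1\<^sub>m n)
               (matinv D * (shifted_mat n \<beta> A D ^\<^sub>m 2) * matinv D) \<longrightarrow>
             diag_bound n C \<beta> \<gamma> A D) \<and>
          (\<forall>c>0. \<gamma> \<le> (1 + (1 + 3 * \<beta>) / c) powi (- 2) \<longrightarrow>
             (\<forall>m \<in> S_set n \<beta> A c. diag_bound n C \<beta> \<gamma> A (D_of m))))))"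
proof (rule exI[of _ 16384000], intro conjI allI impI)
  fix \<beta> \<gamma> :: real
  assume \<beta>: "0 < \<beta>" "\<beta> < 1" and g: "0 < \<gamma>" and g4: "\<gamma> \<le> (1 - \<beta>) ^ 4 / (4 * (1 + 2 * \<beta>\<^sup>2)\<^sup>2)"
  define c where "c = (1 - \<beta>)\<^sup>2 / 2"
  define s where "s = sqrt \<gamma>"
  define \<kappa> where "\<kappa> = 8 / s"
  have s0: "0 < s" using g by (simp add: s_def)
  have s2: "s\<^sup>2 = \<gamma>" using g by (simp add: s_def)
  have c: "2 * c = (1 - \<beta>)\<^sup>2" "0 < c" using \<beta> by (simp_all add: c_def)
  \<comment> \<open>The hypothesis on \<gamma> enters here. It makes the inverses on typical events,
    bounded by \<open>8 / c\<close>, obey the bound \<open>8 / s\<close> too.\<close>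
  have "s \<le> c"
  proof -
    have "\<gamma> \<le> (1 - \<beta>) ^ 4 / 4"
    proof (rule order_trans[OF g4 divide_left_mono])
      have "1 \<le> (1 + 2 * \<beta>\<^sup>2)\<^sup>2" by (rule one_le_power) simp
      then show "4 \<le> 4 * (1 + 2 * \<beta>\<^sup>2)\<^sup>2" "0 < 4 * (1 + 2 * \<beta>\<^sup>2)\<^sup>2 * 4" by linarith+
    qed simp
    also have "(1 - \<beta>) ^ 4 / 4 = c\<^sup>2" by (simp add: c_def power_divide flip: power_mult)
    finally have "s\<^sup>2 \<le> c\<^sup>2" unfolding s2 .
    then show ?thesis by (rule power2_le_imp_le) (use c in simp)
  qed
  then have ck: "8 / c \<le> \<kappa>" unfolding \<kappa>_def using s0 by (intro divide_left_mono) auto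
  have k4: "4 / \<kappa> = s / 2" using s0 by (simp add: \<kappa>_def)
  obtain N0 where N0: "\<And>n. N0 \<le> n \<Longrightarrow> chaining n \<beta> c \<kappa> \<and> 8 * \<kappa> \<le> sqrt (real n) \<and> 192 \<le> n"
    by (rule eventually_chaining[OF \<beta> c(1) ck]) blast
  show "\<exists>n0::nat. \<forall>n\<ge>n0. \<exists>E \<in> sets (GOE n). measure (GOE n) E \<ge> 1 - 4 * exp (- real n / 4) \<and>
      (\<forall>A\<in>E.
        (\<forall>D \<in> diag_mats n {1..}. loewner_le n (\<gamma> \<cdot>\<^sub>m 1\<^sub>m n) (matinv D * (shifted_mat n \<beta> A D ^\<^sub>m 2) * matinv D) \<longrightarrow>
           diag_bound n 16384000 \<beta> \<gamma> A D) \<and>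
        (\<forall>c>0. \<gamma> \<le> (1 + (1 + 3 * \<beta>) / c) powi (- 2) \<longrightarrow>
           (\<forall>m \<in> S_set n \<beta> A c. diag_bound n 16384000 \<beta> \<gamma> A (D_of m))))"
  proof (intro exI[of _ N0] allI impI)
    fix n assume n: "N0 \<le> n"
    interpret chaining n \<beta> c \<kappa> using N0[OF n] by blast
    have big: "8 * \<kappa> \<le> sqrt (real n)" using N0[OF n] by blast
    obtain E0 where E0: "E0 \<in> sets PG" "1 - 8 * exp (- real n) \<le> measure PG E0" "\<And>\<xi>. \<xi> \<in> E0 \<Longrightarrow> op_bound n (amat \<xi>) 6"
      "\<And>\<xi> x. \<xi> \<in> E0 \<Longrightarrow> x \<in> cube \<Longrightarrow> \<forall>v\<in>carrier_vec n. 4 / \<kappa> * vnorm v \<le> vnorm (resm n \<beta> x (amat \<xi>) *\<^sub>v v) \<Longrightarrow>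
        L2_set (\<lambda>i. Zd n \<beta> x (amat \<xi>) i - tlim n \<beta> x) {..<n} \<le> 4000 * \<kappa> ^ 4 * \<beta>"
      by (rule uniform_law[OF big]) blast
    define E where "E = {A \<in> sym_mats n. upper_entries n A \<in> E0}"
    have E: "E \<in> sets (GOE n)" "measure (GOE n) E = measure PG E0" unfolding E_def by (rule GOE_event[OF E0(1)])+
    have prob: "1 - 4 * exp (- real n / 4) \<le> measure (GOE n) E"
    proof -
      \<comment> \<open>For large \<open>n\<close> the gap between the exponents \<open>n\<close>
        and \<open>n / 4\<close> absorbs the factor 2 between 8 and 4.\<close>
      have "2 * exp (- real n) \<le> exp (real n * (3 / 4)) * exp (- real n)"
      proof (rule mult_right_mono)
        have "2 \<le> 1 + real n * (3 / 4)" using N0[OF n] by simp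
        then show "2 \<le> exp (real n * (3 / 4))" using exp_ge_add_one_self[of "real n * (3 / 4)"] by linarith
      qed simp
      also have "\<dots> = exp (- real n / 4)" by (simp add: exp_add[symmetric])
      finally show ?thesis using E0(2) E(2) by linarith
    qed
    \<comment> \<open>Both conclusions reduce to one lower bound for \<open>resm\<close>. The
      Loewner hypothesis gives \<open>s\<close>; the Hessian case gives \<open>s / 2\<close>, which
      explains the value \<open>\<kappa> = 8 / s\<close>.\<close>
    have key: "diag_bound n 16384000 \<beta> \<gamma> A (mat_diag n d)"
      if A: "A \<in> E" and d: "\<And>i. i < n \<Longrightarrow> 1 \<le> d i"
        and low: "\<And>v. v \<in> carrier_vec n \<Longrightarrow> s / 2 * vnorm v \<le> vnorm (resm n \<beta> (\<lambda>i. 1 / d i) A *\<^sub>v v)" for A d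
    proof -
      have A1: "upper_entries n A \<in> E0" "amat (upper_entries n A) = A" using A sym_mat_of_upper_entries by (auto simp: E_def)
      have sA: "symm n A" using amat_symm[of "upper_entries n A"] A1(2) by simp
      have oA: "op_bound n A 6" using E0(3)[OF A1(1)] A1(2) by simp
      have d0: "d i \<noteq> 0" if "i < n" for i using d[OF that] by linarith
      have x: "(\<lambda>i. 1 / d i) \<in> cube" unfolding cube_def
      proof (intro CollectI allI impI)
        fix i assume "i < n"
        then have "1 \<le> d i" by (rule d)
        then show "0 < 1 / d i \<and> 1 / d i \<le> 1" by simp
      qed
      have "s / 2 > 0" using s0 by simp
      then have gd: "good n \<beta> (1 / (s / 2)) (\<lambda>i. 1 / d i) A" by (rule goodI[OF oA _ low]) simp_all
      have "L2_set (\<lambda>i. Zd n \<beta> (\<lambda>i. 1 / d i) A i - tlim n \<beta> (\<lambda>i. 1 / d i)) {..<n} \<le> 4000 * \<kappa> ^ 4 * \<beta>"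
        using E0(4)[OF A1(1) x] low unfolding A1(2) k4 by blast
      then have le: "L2_set (\<lambda>i. Zd n \<beta> (\<lambda>i. 1 / d i) A i - tlim n \<beta> (\<lambda>i. 1 / d i)) {..<n} \<le> 4000 * (8 / sqrt \<gamma>) ^ 4 * \<beta>"
        unfolding \<kappa>_def s_def .
      show ?thesis
        by (rule diag_bound_of_L2_set_le[where d = d, OF n_pos sA d0 _ g le]) (use gd in \<open>simp_all add: good_def\<close>)
    qed
    show "\<exists>E \<in> sets (GOE n). measure (GOE n) E \<ge> 1 - 4 * exp (- real n / 4) \<and>
      (\<forall>A\<in>E.
        (\<forall>D \<in> diag_mats n {1..}. loewner_le n (\<gamma> \<cdot>\<^sub>m 1\<^sub>m n) (matinv D * (shifted_mat n \<beta> A D ^\<^sub>m 2) * matinv D) \<longrightarrow>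
           diag_bound n 16384000 \<beta> \<gamma> A D) \<and>
        (\<forall>c>0. \<gamma> \<le> (1 + (1 + 3 * \<beta>) / c) powi (- 2) \<longrightarrow>
           (\<forall>m \<in> S_set n \<beta> A c. diag_bound n 16384000 \<beta> \<gamma> A (D_of m))))"
    proof (intro bexI[OF _ E(1)] conjI prob ballI allI impI)
      fix A D assume A: "A \<in> E" and D: "D \<in> diag_mats n {1..}"
        and L: "loewner_le n (\<gamma> \<cdot>\<^sub>m 1\<^sub>m n) (matinv D * (shifted_mat n \<beta> A D ^\<^sub>m 2) * matinv D)"
      define d where "d i = D $$ (i, i)" for i
      have De: "D = mat_diag n d" unfolding d_def by (rule diag_mats_eq[OF D])
      have d: "1 \<le> d i" if "i < n" for i using D that by (simp add: diag_mats_def d_def)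
      have d0: "d i \<noteq> 0" if "i < n" for i using d[OF that] by linarith
      have sA: "symm n A" using A amat_symm[of "upper_entries n A"] sym_mat_of_upper_entries[of A n] by (simp add: E_def)
      have low: "s / 2 * vnorm v \<le> vnorm (resm n \<beta> (\<lambda>i. 1 / d i) A *\<^sub>v v)" if v: "v \<in> carrier_vec n" for v
      proof -
        have "s * vnorm v \<le> vnorm (resm n \<beta> (\<lambda>i. 1 / d i) A *\<^sub>v v)"
          unfolding s_def by (rule loewner_imp_lower_bound[OF sA _ _ L[unfolded De] v]) (use d0 g in auto)
        moreover have "0 \<le> s * vnorm v" using s0 vnorm_nonneg[OF v] by simp
        ultimately show ?thesis by linarith
      qed
      show "diag_bound n 16384000 \<beta> \<gamma> A D" unfolding De by (rule key[of A d, OF A]) (erule d, erule low)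
    next
      fix A a m assume A: "A \<in> E" and a: "(0::real) < a" and ga: "\<gamma> \<le> (1 + (1 + 3 * \<beta>) / a) powi (- 2)" and m: "m \<in> S_set n \<beta> A a"
      define d where "d i = 1 / (1 - (m $ i)\<^sup>2)" for i
      have dm: "dim_vec m = n" and mi: "\<And>i. i < n \<Longrightarrow> (m $ i)\<^sup>2 < 1"
        using m by (auto simp: S_set_def open_cube_def abs_square_less_1 abs_less_iff)
      have De: "D_of m = mat_diag n d" by (simp add: D_of_def dm d_def[abs_def])
      have d: "1 \<le> d i" if "i < n" for i using mi[OF that] by (simp add: d_def)
      have xd: "(\<lambda>i. 1 / d i) = (\<lambda>i. 1 - (m $ i)\<^sup>2)" by (simp add: d_def)
      have sA: "symm n A" using A amat_symm[of "upper_entries n A"] sym_mat_of_upper_entries[of A n] by (simp add: E_def)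
      have oA: "op_bound n A 6" using A E0(3)[of "upper_entries n A"] sym_mat_of_upper_entries[of A n] by (simp add: E_def)
      define b where "b = 1 + (1 + 3 * \<beta>) / a"
      have b0: "0 < b" using a \<beta> by (simp add: b_def add_pos_pos)
      have sb: "s * b \<le> 1"
      proof -
        have "\<gamma> \<le> 1 / b\<^sup>2" using ga unfolding b_def[symmetric] by (simp add: power_int_minus inverse_eq_divide)
        then have "(s * b)\<^sup>2 \<le> 1\<^sup>2" using b0 by (simp add: power_mult_distrib s2 pos_le_divide_eq)
        then show ?thesis by (rule power2_le_imp_le) simp
      qed
      have low: "s / 2 * vnorm v \<le> vnorm (resm n \<beta> (\<lambda>i. 1 / d i) A *\<^sub>v v)" if v: "v \<in> carrier_vec n" for v
      proof -
        have r0: "0 \<le> vnorm (resm n \<beta> (\<lambda>i. 1 / d i) A *\<^sub>v v)"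
          by (rule vnorm_nonneg[OF mult_mat_vec_carrier[OF resm_carrier[OF symm_carrier[OF sA]] v]])
        \<comment> \<open>The norm bound 6 for \<open>A\<close> produces 7 where \<open>b\<close>
          has 3; doubling \<open>b\<close> covers this since
          \<open>7 * \<beta> \<le> 2 + 6 * \<beta>\<close>.\<close>
        have "1 + 7 * \<beta> / a \<le> 2 * b"
        proof -
          have "7 * \<beta> / a \<le> (2 + 6 * \<beta>) / a" using a \<beta> by (intro divide_right_mono) auto
          then show ?thesis by (simp add: b_def add_divide_distrib)
        qed
        then have "s / 2 * (1 + 7 * \<beta> / a) \<le> s / 2 * (2 * b)" using s0 by (intro mult_left_mono) auto
        then have f: "s / 2 * (1 + 7 * \<beta> / a) \<le> 1" using sb by simp
        have "vnorm v \<le> (1 + 7 * \<beta> / a) * vnorm (resm n \<beta> (\<lambda>i. 1 / d i) A *\<^sub>v v)"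
          unfolding xd by (rule S_set_imp_lower_bound[OF n_pos sA oA \<beta> a m v])
        then have "s / 2 * vnorm v \<le> s / 2 * ((1 + 7 * \<beta> / a) * vnorm (resm n \<beta> (\<lambda>i. 1 / d i) A *\<^sub>v v))"
          using s0 by (intro mult_left_mono) auto
        also have "\<dots> = (s / 2 * (1 + 7 * \<beta> / a)) * vnorm (resm n \<beta> (\<lambda>i. 1 / d i) A *\<^sub>v v)" by simp
        also have "\<dots> \<le> 1 * vnorm (resm n \<beta> (\<lambda>i. 1 / d i) A *\<^sub>v v)" by (rule mult_right_mono[OF f r0])
        finally show ?thesis by simp
      qed
      show "diag_bound n 16384000 \<beta> \<gamma> A (D_of m)" unfolding De by (rule key[of A d, OF A]) (erule d, erule low)
    qed
  qed
qed simp

end
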